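(* Suppose $V\in\widehat K_M$, $\Phi\in\mathrm{Hom}_K(V,S(\mathfrak s_{\mathbb C}))$ and $f\in C^\infty(\mathfrak s)^K$. Let $\partial(\Phi)f$ denote the map $V\ni v\mapsto\partial(\Phi[v])f\in C^\infty(\mathfrak s)$ and let $\mathscr D(\Gamma_0^V(\Phi))\gamma_0(f)$ denote the map $V^M\ni v\mapsto\mathscr D(\Gamma_0^V(\Phi)[v])\gamma_0(f)\in C^\infty(\mathfrak a)$. (i) We have $\partial(\Phi)f\in\mathrm{Hom}_K(V,C^\infty(\mathfrak s))$ and $\mathscr D(\Gamma_0^V(\Phi))\gamma_0(f)\in\mathrm{Hom}_W(V^M,C^\infty(\mathfrak a))$, and $$\Gamma_0^V(\partial(\Phi)f)[v]=\bigl(\mathscr D(\Gamma_0^V(\Phi))\gamma_0(f)\bigr)[v]\quad\text{for }v\in V^M_{\mathrm{single}}.$$ (ii) If $\Phi\in\mathrm{Hom}_K^{2\to2}(V,S(\mathfrak s_{\mathbb C}))$ then $\partial(\Phi)f\in\mathrm{Hom}_K^{2\to2}(V,C^\infty(\mathfrak s))$. Hence for such $\Phi$ $$\Gamma_0^V(\partial(\Phi)f)=\mathscr D(\Gamma_0^V(\Phi))\gamma_0(f).\qquad( * )$$ (iii) If $V\in\widehat K_{\mathrm{sp}}$ then $( * )$ always holds.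
   Context: Setting. $G$ is a real Lie group with semisimple Lie algebra $\mathfrak g$ and fixed Iwasawa decomposition $\mathfrak g=\mathfrak k+\mathfrak a+\mathfrak n$; assume $\mathrm{Ad}(g)$ is an inner automorphism of $\mathfrak g_{\mathbb C}$ for all $g\in G$ and $K:=N_G(\mathfrak k)$ (normalizer) is compact. $\theta$ is the Cartan involution fixing $\mathfrak k$, $\mathfrak s$ its $-1$-eigenspace in $\mathfrak g$, $B$ the Killing form, $A$ the analytic subgroup of $\mathfrak a$, $M$ the centralizer of $A$ in $K$, $W=N_K(\mathfrak a)/M$ the Weyl group. $\Sigma$ is the restricted root system of $(\mathfrak g,\mathfrak a)$ with root spaces $\mathfrak g_\alpha$, $\Sigma^+$ the positive system corresponding to $\mathfrak n$, $s_\alpha\in W$ the reflections, $H_\mu\in\mathfrak a_{\mathbb C}$ is defined by $\mu(H)=B(H_\mu,H)$. Subscript $\mathbb C$ means complexification. $K$-types. $\widehat K$ is the set of irreducible unitary representations of $K$; $\widehat K_M=\{V\in\widehat K: V^M\neq0\}$. For $V\in\widehat K_M$, $V^M$ is a $W$-module. For $\alpha\in\Sigma$ fix $E_\alpha\in\mathfrak g_\alpha$ with $-B(E_\alpha,\theta E_\alpha)=2/B(H_\alpha,H_\alpha)$ and put $Z_\alpha=E_\alpha+\theta E_\alpha\in\mathfrak k$. Put $V^M_{\mathrm{single}}=\{v\in V^M: Z_\alpha(Z_\alpha^2+4)v=0\ \forall\alpha\in\Sigma\}$ and $V^M_{\mathrm{double}}=V^M\cap\sum_{\alpha\in\Sigma,m\in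 M}mZ_\alpha(Z_\alpha^2+4)V$; these are $W$-submodules and $V^M=V^M_{\mathrm{single}}\oplus V^M_{\mathrm{double}}$. $\widehat K_{\mathrm{sp}}=\{V\in\widehat K_M: V^M_{\mathrm{single}}=V^M\}$ (single-petaled $K$-types). Restriction. $\gamma_0:C^\infty(\mathfrak s)\to C^\infty(\mathfrak a)$ is restriction of functions. Via $B$, $S(\mathfrak s_{\mathbb C})$ and $S(\mathfrak a_{\mathbb C})$ are identified with the algebras of polynomial functions on $\mathfrak s$ and $\mathfrak a$, so restriction also gives $\gamma_0:S(\mathfrak s_{\mathbb C})\to S(\mathfrak a_{\mathbb C})$. For $\mathscr F=C^\infty(\mathfrak s)$ or $S(\mathfrak s_{\mathbb C})$ and $\Phi\in\mathrm{Hom}_K(V,\mathscr F)$ put $\Gamma_0^V(\Phi):=\gamma_0\circ\Phi|_{V^M}$, an element of $\mathrm{Hom}_W(V^M,C^\infty(\mathfrak a))$ resp. $\mathrm{Hom}_W(V^M,S(\mathfrak a_{\mathbb C}))$, and $\mathrm{Hom}_K^{2\to2}(V,\mathscr F)=\{\Phi\in\mathrm{Hom}_K(V,\mathscr F):\Gamma_0^V(\Phi)[V^M_{\mathrm{double}}]=\{0\}\}$. Operators. $\partial:S(\mathfrak s_{\mathbb C})\to\mathrm{End}_{\mathbb C}C^\infty(\mathfrak s)$ is the algebra homomorphism sending $X\in\mathfrak s$ to the $X$-directional derivative; similarly $\partial(\xi)$ on $\mathfrak a$. Let $R=2\Sigma$, $R^+=2\Sigma^+$, $R_1=R\setminus2R$,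 $R_1^+=R_1\cap R^+$, and for $\alpha\in R_1$ put $\mathbf m_0(\alpha)=\frac12\dim\mathfrak g_{\alpha/2}$ if $2\alpha\notin R$, $\mathbf m_0(\alpha)=\frac12(\dim\mathfrak g_{\alpha/2}+\dim\mathfrak g_\alpha)$ if $2\alpha\in R$. The Dunkl operators are $\mathscr D(\xi)=\partial(\xi)+\sum_{\alpha\in R_1^+}\mathbf m_0(\alpha)\frac{\alpha(\xi)}{\alpha}(1-s_\alpha)\in\mathrm{End}_{\mathbb C}C^\infty(\mathfrak a)$ for $\xi\in\mathfrak a$; they commute (Dunkl), so $\mathscr D$ extends to an algebra homomorphism $S(\mathfrak a_{\mathbb C})\to\mathrm{End}_{\mathbb C}C^\infty(\mathfrak a)$. *)

theory Defs
  imports "HOL-Analysis.Analysis" "HOL-Algebra.Coset" "HOL-Algebra.Generated_Groups"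
begin

section \<open>Smooth and polynomial functions on a subspace\<close>

text \<open>\<open>S\<close> is meant to be a relatively open subset of the linear subspace \<open>E\<close>, and only the values
  of \<open>f\<close> on \<open>S\<close> matter.  \<open>f\<close> is of class \<open>C\<^sup>k\<close> iff all iterated derivatives of length at most \<open>k\<close> in
  directions of \<open>E\<close> exist and are continuous on \<open>S\<close>.\<close>

primrec Ck_on :: "nat \<Rightarrow> 'v::real_normed_vector set \<Rightarrow> 'v set \<Rightarrow> ('v \<Rightarrow> 'w::real_normed_vector) \<Rightarrow> bool"
where
  "Ck_on 0 E S f \<longleftrightarrow> continuous_on S f"
| "Ck_on (Suc k) E S f \<longleftrightarrow> continuous_on S f \<and>
     (\<forall>v\<in>E. \<exists>f'. (\<forall>x\<in>S. ((\<lambda>t. f (x + t *\<^sub>R v)) has_vector_derivative f' x) (at 0)) \<and> Ck_on k E S f')"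

definition smooth_on :: "'v::real_normed_vector set \<Rightarrow> 'v set \<Rightarrow> ('v \<Rightarrow> 'w::real_normed_vector) \<Rightarrow> bool"
  where "smooth_on E S f \<longleftrightarrow> (\<forall>k. Ck_on k E S f)"

text \<open>Functions on a subspace \<open>S\<close> are represented by their extension by zero, so that equality of
  representatives is equality on \<open>S\<close> and the pointwise operations are the right ones.\<close>

definition ext0 :: "'v set \<Rightarrow> ('v \<Rightarrow> 'b::zero) \<Rightarrow> 'v \<Rightarrow> 'b"
  where "ext0 S f = (\<lambda>x. if x \<in> S then f x else 0)"

definition C_inf :: "'v::euclidean_space set \<Rightarrow> ('v \<Rightarrow> complex) set"
  where "C_inf S = {f. (\<forall>x. x \<notin> S \<longrightarrow> f x = 0) \<and> smooth_on S S f}"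

definition Pol :: "'v::euclidean_space set \<Rightarrow> ('v \<Rightarrow> complex) set"
  where "Pol S = {ext0 S p |p. polynomial_function p}"

definition dir_deriv :: "'v::euclidean_space set \<Rightarrow> 'v \<Rightarrow> ('v \<Rightarrow> complex) \<Rightarrow> 'v \<Rightarrow> complex"
  where "dir_deriv S X f = ext0 S (\<lambda>x. vector_derivative (\<lambda>t. f (x + t *\<^sub>R X)) (at 0))"

text \<open>\<open>D\<close> is a homomorphism of unital complex algebras from the symmetric algebra of the
  complexification of \<open>S\<close> to the linear endomorphisms of \<open>C_inf S\<close>, with value \<open>T X\<close> at \<open>X \<in> S\<close>.
  The symmetric algebra is \<open>Pol S\<close>, with \<open>X \<in> S\<close> identified with \<open>B X\<close> by the form \<open>B\<close>.\<close>

definition sym_hom ::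
  "'v::euclidean_space set \<Rightarrow> ('v \<Rightarrow> 'v \<Rightarrow> real) \<Rightarrow> ('v \<Rightarrow> ('v \<Rightarrow> complex) \<Rightarrow> 'v \<Rightarrow> complex) \<Rightarrow>
   (('v \<Rightarrow> complex) \<Rightarrow> ('v \<Rightarrow> complex) \<Rightarrow> 'v \<Rightarrow> complex) \<Rightarrow> bool"
where "sym_hom S B T D \<longleftrightarrow>
    (\<forall>p\<in>Pol S. \<forall>f\<in>C_inf S. D p f \<in> C_inf S) \<and>
    (\<forall>p\<in>Pol S. \<forall>f\<in>C_inf S. \<forall>g\<in>C_inf S. D p (\<lambda>x. f x + g x) = (\<lambda>x. D p f x + D p g x)) \<and>
    (\<forall>p\<in>Pol S. \<forall>f\<in>C_inf S. \<forall>c. D p (\<lambda>x. c * f x) = (\<lambda>x. c * D p f x)) \<and>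
    (\<forall>p\<in>Pol S. \<forall>q\<in>Pol S. \<forall>f\<in>C_inf S. D (\<lambda>x. p x + q x) f = (\<lambda>x. D p f x + D q f x)) \<and>
    (\<forall>p\<in>Pol S. \<forall>f\<in>C_inf S. \<forall>c. D (\<lambda>x. c * p x) f = (\<lambda>x. c * D p f x)) \<and>
    (\<forall>p\<in>Pol S. \<forall>q\<in>Pol S. \<forall>f\<in>C_inf S. D (\<lambda>x. p x * q x) f = D p (D q f)) \<and>
    (\<forall>f\<in>C_inf S. D (ext0 S (\<lambda>_. 1)) f = f) \<and>
    (\<forall>X\<in>S. \<forall>f\<in>C_inf S. D (ext0 S (\<lambda>x. of_real (B X x))) f = T X f)"

text \<open>For nondegenerate \<open>B\<close> such a \<open>D\<close> is unique on \<open>Pol S\<close> and \<open>C_inf S\<close>, as \<open>S\<close> generates the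
  symmetric algebra, and it exists iff the \<open>T X\<close> are commuting linear operators on \<open>C_inf S\<close> that
  depend linearly on \<open>X\<close>.\<close>

definition sym_ext ::
  "'v::euclidean_space set \<Rightarrow> ('v \<Rightarrow> 'v \<Rightarrow> real) \<Rightarrow> ('v \<Rightarrow> ('v \<Rightarrow> complex) \<Rightarrow> 'v \<Rightarrow> complex) \<Rightarrow>
   ('v \<Rightarrow> complex) \<Rightarrow> ('v \<Rightarrow> complex) \<Rightarrow> 'v \<Rightarrow> complex"
where "sym_ext S B T = (SOME D. sym_hom S B T D)"

section \<open>Lie groups\<close>

text \<open>The underlying set of the group is a topological type.  \<open>lie_alg\<close> is the Lie algebra, a linear
  subspace of a Euclidean space (so that dimension \<open>0\<close> is included); it also serves as the model
  space of the manifold.  A chart is a pair of its domain and its coordinate map.  The map \<open>tangent\<close>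
  identifies \<open>lie_alg\<close> with the tangent space at the identity, regarded as the space of point
  derivations of the algebra of smooth functions.  The inner product of the Euclidean space plays
  no role beyond providing the topology.\<close>

record ('a, 'v) lie_group = "'a monoid" +
  charts :: "('a set \<times> ('a \<Rightarrow> 'v)) set"
  lie_alg :: "'v set"
  tangent :: "'v \<Rightarrow> ('a \<Rightarrow> real) \<Rightarrow> real"

definition smooth_manifold :: "('a::{t2_space,second_countable_topology}, 'v::euclidean_space, 'z) lie_group_scheme \<Rightarrow> bool"
where "smooth_manifold G \<longleftrightarrow>
    subspace (lie_alg G) \<and>
    (\<Union>(U, \<phi>)\<in>charts G. U) = UNIV \<and>
    (\<forall>(U, \<phi>)\<in>charts G. open U \<and> openin (top_of_set (lie_alg G)) (\<phi> ` U) \<and>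
        homeomorphism U (\<phi> ` U) \<phi> (inv_into U \<phi>)) \<and>
    (\<forall>(U, \<phi>)\<in>charts G. \<forall>(U', \<phi>')\<in>charts G.
        smooth_on (lie_alg G) (\<phi> ` (U \<inter> U')) (\<phi>' \<circ> inv_into U \<phi>))"

definition smooth_mult :: "('a::{t2_space,second_countable_topology}, 'v::euclidean_space, 'z) lie_group_scheme \<Rightarrow> bool"
where "smooth_mult G \<longleftrightarrow>
    continuous_on UNIV (\<lambda>(x, y). x \<otimes>\<^bsub>G\<^esub> y) \<and>
    (\<forall>(U, \<phi>)\<in>charts G. \<forall>(U', \<phi>')\<in>charts G. \<forall>(U'', \<phi>'')\<in>charts G.
        smooth_on (lie_alg G \<times> lie_alg G)
          {(\<phi> x, \<phi>' y) |x y. x \<in> U \<and> y \<in> U' \<and> x \<otimes>\<^bsub>G\<^esub> y \<in> U''}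
          (\<lambda>(u, v). \<phi>'' (inv_into U \<phi> u \<otimes>\<^bsub>G\<^esub> inv_into U' \<phi>' v)))"

definition smooth_inv :: "('a::{t2_space,second_countable_topology}, 'v::euclidean_space, 'z) lie_group_scheme \<Rightarrow> bool"
where "smooth_inv G \<longleftrightarrow>
    continuous_on UNIV (\<lambda>x. inv\<^bsub>G\<^esub> x) \<and>
    (\<forall>(U, \<phi>)\<in>charts G. \<forall>(U', \<phi>')\<in>charts G.
        smooth_on (lie_alg G) {\<phi> x |x. x \<in> U \<and> inv\<^bsub>G\<^esub> x \<in> U'}
          (\<lambda>u. \<phi>' (inv\<^bsub>G\<^esub> (inv_into U \<phi> u))))"

definition C_inf_group :: "('a::{t2_space,second_countable_topology}, 'v::euclidean_space, 'z) lie_group_scheme \<Rightarrow> ('a \<Rightarrow> real) set"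
where "C_inf_group G = {f. \<forall>(U, \<phi>)\<in>charts G. smooth_on (lie_alg G) (\<phi> ` U) (f \<circ> inv_into U \<phi>)}"

definition point_derivation ::
  "('a::{t2_space,second_countable_topology}, 'v::euclidean_space, 'z) lie_group_scheme \<Rightarrow> (('a \<Rightarrow> real) \<Rightarrow> real) \<Rightarrow> bool"
where "point_derivation G D \<longleftrightarrow>
    (\<forall>f\<in>C_inf_group G. \<forall>g\<in>C_inf_group G. D (\<lambda>x. f x + g x) = D f + D g) \<and>
    (\<forall>f\<in>C_inf_group G. \<forall>c. D (\<lambda>x. c * f x) = c * D f) \<and>
    (\<forall>f\<in>C_inf_group G. \<forall>g\<in>C_inf_group G.
        D (\<lambda>x. f x * g x) = f \<one>\<^bsub>G\<^esub> * D g + g \<one>\<^bsub>G\<^esub> * D f)"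

definition is_lie_group :: "('a::{t2_space,second_countable_topology}, 'v::euclidean_space, 'z) lie_group_scheme \<Rightarrow> bool"
where "is_lie_group G \<longleftrightarrow>
    Group.group G \<and> carrier G = UNIV \<and> smooth_manifold G \<and> smooth_mult G \<and> smooth_inv G \<and>
    (\<forall>X\<in>lie_alg G. point_derivation G (tangent G X)) \<and>
    (\<forall>X\<in>lie_alg G. \<forall>Y\<in>lie_alg G. \<forall>f\<in>C_inf_group G.
        tangent G (X + Y) f = tangent G X f + tangent G Y f) \<and>
    (\<forall>X\<in>lie_alg G. \<forall>c. \<forall>f\<in>C_inf_group G. tangent G (c *\<^sub>R X) f = c * tangent G X f) \<and>
    (\<forall>D. point_derivation G D \<longrightarrow>
        (\<exists>!X. X \<in> lie_alg G \<and> (\<forall>f\<in>C_inf_group G. tangent G X f = D f)))"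

text \<open>The left invariant vector field of \<open>X\<close> is \<open>f \<mapsto> (x \<mapsto> tangent G X (\<lambda>y. f (x y)))\<close>; the bracket is
  the commutator of left invariant vector fields, evaluated at the identity.\<close>

definition left_field ::
  "('a::{t2_space,second_countable_topology}, 'v::euclidean_space, 'z) lie_group_scheme \<Rightarrow> 'v \<Rightarrow> ('a \<Rightarrow> real) \<Rightarrow> 'a \<Rightarrow> real"
where "left_field G X f = (\<lambda>x. tangent G X (\<lambda>y. f (x \<otimes>\<^bsub>G\<^esub> y)))"

definition bracket ::
  "('a::{t2_space,second_countable_topology}, 'v::euclidean_space, 'z) lie_group_scheme \<Rightarrow> 'v \<Rightarrow> 'v \<Rightarrow> 'v"
where "bracket G X Y = (THE Z. Z \<in> lie_alg G \<and> (\<forall>f\<in>C_inf_group G.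
    tangent G Z f = tangent G X (left_field G Y f) - tangent G Y (left_field G X f)))"

text \<open>The differential at the identity of the conjugation by \<open>g\<close>.\<close>

definition Ad ::
  "('a::{t2_space,second_countable_topology}, 'v::euclidean_space, 'z) lie_group_scheme \<Rightarrow> 'a \<Rightarrow> 'v \<Rightarrow> 'v"
where "Ad G g X = (THE Y. Y \<in> lie_alg G \<and> (\<forall>f\<in>C_inf_group G.
    tangent G Y f = tangent G X (\<lambda>x. f (g \<otimes>\<^bsub>G\<^esub> x \<otimes>\<^bsub>G\<^esub> inv\<^bsub>G\<^esub> g))))"

definition one_param ::
  "('a::{t2_space,second_countable_topology}, 'v::euclidean_space, 'z) lie_group_scheme \<Rightarrow> 'v \<Rightarrow> (real \<Rightarrow> 'a) \<Rightarrow> bool"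
where "one_param G X \<gamma> \<longleftrightarrow>
    continuous_on UNIV \<gamma> \<and> (\<forall>s t. \<gamma> (s + t) = \<gamma> s \<otimes>\<^bsub>G\<^esub> \<gamma> t) \<and>
    (\<forall>f\<in>C_inf_group G. ((\<lambda>t. f (\<gamma> t)) has_real_derivative tangent G X f) (at 0))"

definition lie_exp ::
  "('a::{t2_space,second_countable_topology}, 'v::euclidean_space, 'z) lie_group_scheme \<Rightarrow> 'v \<Rightarrow> 'a"
where "lie_exp G X = (THE x. \<exists>\<gamma>. one_param G X \<gamma> \<and> x = \<gamma> 1)"

section \<open>Semisimplicity, Killing form, inner automorphisms\<close>

definition lie_ideal ::
  "('a::{t2_space,second_countable_topology}, 'v::euclidean_space, 'z) lie_group_scheme \<Rightarrow> 'v set \<Rightarrow> bool"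
where "lie_ideal G I \<longleftrightarrow>
    subspace I \<and> I \<subseteq> lie_alg G \<and> (\<forall>X\<in>lie_alg G. \<forall>Y\<in>I. bracket G X Y \<in> I)"

definition lie_solvable ::
  "('a::{t2_space,second_countable_topology}, 'v::euclidean_space, 'z) lie_group_scheme \<Rightarrow> 'v set \<Rightarrow> bool"
where "lie_solvable G I \<longleftrightarrow>
    (\<exists>n. ((\<lambda>J. span {bracket G X Y |X Y. X \<in> J \<and> Y \<in> J}) ^^ n) I = {0})"

definition semisimple ::
  "('a::{t2_space,second_countable_topology}, 'v::euclidean_space, 'z) lie_group_scheme \<Rightarrow> bool"
where "semisimple G \<longleftrightarrow> (\<forall>I. lie_ideal G I \<and> lie_solvable G I \<longrightarrow> I = {0})"

definition trace_on :: "'v::euclidean_space set \<Rightarrow> ('v \<Rightarrow> 'v) \<Rightarrow> real"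
where "trace_on E f =
    (let b = (SOME b. b \<subseteq> E \<and> independent b \<and> span b = E) in \<Sum>v\<in>b. representation b (f v) v)"

definition killing ::
  "('a::{t2_space,second_countable_topology}, 'v::euclidean_space, 'z) lie_group_scheme \<Rightarrow> 'v \<Rightarrow> 'v \<Rightarrow> real"
where "killing G X Y = trace_on (lie_alg G) (\<lambda>Z. bracket G X (bracket G Y Z))"

text \<open>The pair \<open>(X, Y)\<close> stands for \<open>X + i Y\<close> in the complexified Lie algebra \<open>lie_alg G \<times> lie_alg G\<close>.\<close>

definition bracketC ::
  "('a::{t2_space,second_countable_topology}, 'v::euclidean_space, 'z) lie_group_scheme \<Rightarrow> 'v \<times> 'v \<Rightarrow> 'v \<times> 'v \<Rightarrow> 'v \<times> 'v"
where "bracketC G = (\<lambda>(X, Y) (X', Y').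
    (bracket G X X' - bracket G Y Y', bracket G X Y' + bracket G Y X'))"

definition exp_adC ::
  "('a::{t2_space,second_countable_topology}, 'v::euclidean_space, 'z) lie_group_scheme \<Rightarrow> 'v \<times> 'v \<Rightarrow> 'v \<times> 'v \<Rightarrow> 'v \<times> 'v"
where "exp_adC G Z W = (\<Sum>n. ((bracketC G Z) ^^ n) W /\<^sub>R fact n)"

inductive_set inner_autC ::
  "('a::{t2_space,second_countable_topology}, 'v::euclidean_space, 'z) lie_group_scheme \<Rightarrow> ('v \<times> 'v \<Rightarrow> 'v \<times> 'v) set"
  for G
where
  id: "(\<lambda>W. W) \<in> inner_autC G"
| comp: "\<psi> \<in> inner_autC G \<Longrightarrow> Z \<in> lie_alg G \<times> lie_alg G \<Longrightarrow> (\<lambda>W. exp_adC G Z (\<psi> W)) \<in> inner_autC G"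

definition Ad_inner ::
  "('a::{t2_space,second_countable_topology}, 'v::euclidean_space, 'z) lie_group_scheme \<Rightarrow> bool"
where "Ad_inner G \<longleftrightarrow> (\<forall>g. \<exists>\<psi>\<in>inner_autC G. \<forall>X\<in>lie_alg G. \<forall>Y\<in>lie_alg G. \<psi> (X, Y) = (Ad G g X, Ad G g Y))"

section \<open>Iwasawa data and restricted roots\<close>

text \<open>An Iwasawa decomposition is given by a Cartan involution \<open>theta\<close> (with fixed point algebra
  \<open>kk\<close>), a maximal abelian subspace \<open>aa\<close> of its \<open>-1\<close>-eigenspace \<open>ss\<close>, and the sum \<open>nn\<close> of
  the root spaces of a positive system; \<open>rvec \<alpha>\<close> is the normalised root vector chosen for \<open>\<alpha>\<close>.\<close>

record ('a, 'v) iwasawa_group = "('a, 'v) lie_group" +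
  theta :: "'v \<Rightarrow> 'v"
  aa :: "'v set"
  nn :: "'v set"
  rvec :: "('v \<Rightarrow> real) \<Rightarrow> 'v"

definition kk :: "('a::{t2_space,second_countable_topology}, 'v::euclidean_space, 'z) iwasawa_group_scheme \<Rightarrow> 'v set"
  where "kk G = {X \<in> lie_alg G. theta G X = X}"

definition ss :: "('a::{t2_space,second_countable_topology}, 'v::euclidean_space, 'z) iwasawa_group_scheme \<Rightarrow> 'v set"
  where "ss G = {X \<in> lie_alg G. theta G X = - X}"

definition cartan_involution :: "('a::{t2_space,second_countable_topology}, 'v::euclidean_space, 'z) iwasawa_group_scheme \<Rightarrow> bool"
where "cartan_involution G \<longleftrightarrow>
    (\<forall>X\<in>lie_alg G. theta G X \<in> lie_alg G \<and> theta G (theta G X) = X) \<and>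
    (\<forall>X\<in>lie_alg G. \<forall>Y\<in>lie_alg G. theta G (X + Y) = theta G X + theta G Y) \<and>
    (\<forall>X\<in>lie_alg G. \<forall>c. theta G (c *\<^sub>R X) = c *\<^sub>R theta G X) \<and>
    (\<forall>X\<in>lie_alg G. \<forall>Y\<in>lie_alg G. theta G (bracket G X Y) = bracket G (theta G X) (theta G Y)) \<and>
    (\<forall>X\<in>lie_alg G. X \<noteq> 0 \<longrightarrow> - killing G X (theta G X) > 0)"

definition abelian_subspace :: "('a::{t2_space,second_countable_topology}, 'v::euclidean_space, 'z) lie_group_scheme \<Rightarrow> 'v set \<Rightarrow> bool"
  where "abelian_subspace G b \<longleftrightarrow> subspace b \<and> b \<subseteq> lie_alg G \<and> (\<forall>X\<in>b. \<forall>Y\<in>b. bracket G X Y = 0)"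

definition root_space :: "('a::{t2_space,second_countable_topology}, 'v::euclidean_space, 'z) iwasawa_group_scheme \<Rightarrow> ('v \<Rightarrow> real) \<Rightarrow> 'v set"
  where "root_space G \<alpha> = {X \<in> lie_alg G. \<forall>H\<in>aa G. bracket G H X = \<alpha> H *\<^sub>R X}"

text \<open>Linear functionals on \<open>aa\<close> are also represented by their extension by zero.\<close>

definition dual_aa :: "('a::{t2_space,second_countable_topology}, 'v::euclidean_space, 'z) iwasawa_group_scheme \<Rightarrow> ('v \<Rightarrow> real) set"
  where "dual_aa G = {ext0 (aa G) \<phi> |\<phi>. linear \<phi>}"

definition roots :: "('a::{t2_space,second_countable_topology}, 'v::euclidean_space, 'z) iwasawa_group_scheme \<Rightarrow> ('v \<Rightarrow> real) set"
  where "roots G = {\<alpha> \<in> dual_aa G. \<alpha> \<noteq> (\<lambda>_. 0) \<and> root_space G \<alpha> \<noteq> {0}}"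

definition iwasawa :: "('a::{t2_space,second_countable_topology}, 'v::euclidean_space, 'z) iwasawa_group_scheme \<Rightarrow> bool"
where "iwasawa G \<longleftrightarrow>
    cartan_involution G \<and>
    abelian_subspace G (aa G) \<and> aa G \<subseteq> ss G \<and>
    (\<forall>b. abelian_subspace G b \<and> aa G \<subseteq> b \<and> b \<subseteq> ss G \<longrightarrow> b = aa G) \<and>
    (\<exists>H\<in>aa G. (\<forall>\<alpha>\<in>roots G. \<alpha> H \<noteq> 0) \<and>
        nn G = span (\<Union>\<alpha>\<in>{\<alpha> \<in> roots G. \<alpha> H > 0}. root_space G \<alpha>))"

definition pos_roots :: "('a::{t2_space,second_countable_topology}, 'v::euclidean_space, 'z) iwasawa_group_scheme \<Rightarrow> ('v \<Rightarrow> real) set"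
  where "pos_roots G = {\<alpha> \<in> roots G. root_space G \<alpha> \<subseteq> nn G}"

definition Hvec :: "('a::{t2_space,second_countable_topology}, 'v::euclidean_space, 'z) iwasawa_group_scheme \<Rightarrow> ('v \<Rightarrow> real) \<Rightarrow> 'v"
  where "Hvec G \<mu> = (THE X. X \<in> aa G \<and> (\<forall>H\<in>aa G. \<mu> H = killing G X H))"

definition root_refl :: "('a::{t2_space,second_countable_topology}, 'v::euclidean_space, 'z) iwasawa_group_scheme \<Rightarrow> ('v \<Rightarrow> real) \<Rightarrow> 'v \<Rightarrow> 'v"
  where "root_refl G \<alpha> H = H - (2 * \<alpha> H / killing G (Hvec G \<alpha>) (Hvec G \<alpha>)) *\<^sub>R Hvec G \<alpha>"

definition root_vectors :: "('a::{t2_space,second_countable_topology}, 'v::euclidean_space, 'z) iwasawa_group_scheme \<Rightarrow> bool"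
where "root_vectors G \<longleftrightarrow> (\<forall>\<alpha>\<in>roots G. rvec G \<alpha> \<in> root_space G \<alpha> \<and>
    - killing G (rvec G \<alpha>) (theta G (rvec G \<alpha>)) = 2 / killing G (Hvec G \<alpha>) (Hvec G \<alpha>))"

definition Zvec :: "('a::{t2_space,second_countable_topology}, 'v::euclidean_space, 'z) iwasawa_group_scheme \<Rightarrow> ('v \<Rightarrow> real) \<Rightarrow> 'v"
  where "Zvec G \<alpha> = rvec G \<alpha> + theta G (rvec G \<alpha>)"

section \<open>The groups K, A, M and W\<close>

definition Kgrp :: "('a::{t2_space,second_countable_topology}, 'v::euclidean_space, 'z) iwasawa_group_scheme \<Rightarrow> 'a set"
  where "Kgrp G = {g \<in> carrier G. Ad G g ` kk G = kk G}"

definition Agrp :: "('a::{t2_space,second_countable_topology}, 'v::euclidean_space, 'z) iwasawa_group_scheme \<Rightarrow> 'a set"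
  where "Agrp G = generate G (lie_exp G ` aa G)"

definition Mgrp :: "('a::{t2_space,second_countable_topology}, 'v::euclidean_space, 'z) iwasawa_group_scheme \<Rightarrow> 'a set"
  where "Mgrp G = {k \<in> Kgrp G. \<forall>x\<in>Agrp G. k \<otimes>\<^bsub>G\<^esub> x = x \<otimes>\<^bsub>G\<^esub> k}"

definition weyl :: "('a::{t2_space,second_countable_topology}, 'v::euclidean_space, 'z) iwasawa_group_scheme \<Rightarrow> 'a set monoid"
  where "weyl G = (G\<lparr>carrier := {k \<in> Kgrp G. Ad G k ` aa G = aa G}\<rparr>) Mod (Mgrp G)"

section \<open>K-types\<close>

text \<open>Irreducible unitary representations of the compact group \<open>K\<close> are finite dimensional; an
  orthonormal basis identifies the representation space with a space \<open>complex ^ 'n\<close>.  Only the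
  values of \<open>\<pi>\<close> on \<open>K\<close> matter.\<close>

definition unitary_irrep ::
  "('a::{t2_space,second_countable_topology}, 'v::euclidean_space, 'z) iwasawa_group_scheme \<Rightarrow>
   ('a \<Rightarrow> complex ^ 'n::finite \<Rightarrow> complex ^ 'n) \<Rightarrow> bool"
where "unitary_irrep G \<pi> \<longleftrightarrow>
    (\<forall>k\<in>Kgrp G. Vector_Spaces.linear (*s) (*s) (\<pi> k)) \<and>
    (\<forall>v. \<pi> \<one>\<^bsub>G\<^esub> v = v) \<and>
    (\<forall>k\<in>Kgrp G. \<forall>l\<in>Kgrp G. \<forall>v. \<pi> (k \<otimes>\<^bsub>G\<^esub> l) v = \<pi> k (\<pi> l v)) \<and>
    (\<forall>k\<in>Kgrp G. \<forall>v w. (\<Sum>i\<in>UNIV. \<pi> k v $ i * cnj (\<pi> k w $ i)) = (\<Sum>i\<in>UNIV. v $ i * cnj (w $ i))) \<and>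
    (\<forall>v. continuous_on (Kgrp G) (\<lambda>k. \<pi> k v)) \<and>
    (\<forall>U. vec.subspace U \<and> (\<forall>k\<in>Kgrp G. \<pi> k ` U \<subseteq> U) \<longrightarrow> U = {0} \<or> U = UNIV)"

definition VM ::
  "('a::{t2_space,second_countable_topology}, 'v::euclidean_space, 'z) iwasawa_group_scheme \<Rightarrow>
   ('a \<Rightarrow> complex ^ 'n::finite \<Rightarrow> complex ^ 'n) \<Rightarrow> (complex ^ 'n) set"
  where "VM G \<pi> = {v. \<forall>m\<in>Mgrp G. \<pi> m v = v}"

text \<open>The differentiated action of \<open>kk\<close>.\<close>

definition dpi ::
  "('a::{t2_space,second_countable_topology}, 'v::euclidean_space, 'z) iwasawa_group_scheme \<Rightarrow>
   ('a \<Rightarrow> complex ^ 'n::finite \<Rightarrow> complex ^ 'n) \<Rightarrow> 'v \<Rightarrow> complex ^ 'n \<Rightarrow> complex ^ 'n"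
  where "dpi G \<pi> Z v = vector_derivative (\<lambda>t. \<pi> (lie_exp G (t *\<^sub>R Z)) v) (at 0)"

text \<open>The action of \<open>Z (Z\<^sup>2 + 4)\<close> for \<open>Z = Zvec G \<alpha>\<close>.\<close>

definition Zcubic ::
  "('a::{t2_space,second_countable_topology}, 'v::euclidean_space, 'z) iwasawa_group_scheme \<Rightarrow>
   ('a \<Rightarrow> complex ^ 'n::finite \<Rightarrow> complex ^ 'n) \<Rightarrow> ('v \<Rightarrow> real) \<Rightarrow> complex ^ 'n \<Rightarrow> complex ^ 'n"
  where "Zcubic G \<pi> \<alpha> v =
    (let Z = dpi G \<pi> (Zvec G \<alpha>) in Z (Z (Z v) + 4 *s v))"

definition V_single ::
  "('a::{t2_space,second_countable_topology}, 'v::euclidean_space, 'z) iwasawa_group_scheme \<Rightarrow>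
   ('a \<Rightarrow> complex ^ 'n::finite \<Rightarrow> complex ^ 'n) \<Rightarrow> (complex ^ 'n) set"
  where "V_single G \<pi> = {v \<in> VM G \<pi>. \<forall>\<alpha>\<in>roots G. Zcubic G \<pi> \<alpha> v = 0}"

definition V_double ::
  "('a::{t2_space,second_countable_topology}, 'v::euclidean_space, 'z) iwasawa_group_scheme \<Rightarrow>
   ('a \<Rightarrow> complex ^ 'n::finite \<Rightarrow> complex ^ 'n) \<Rightarrow> (complex ^ 'n) set"
  where "V_double G \<pi> =
    VM G \<pi> \<inter> vec.span {\<pi> m (Zcubic G \<pi> \<alpha> v) |\<alpha> m v. \<alpha> \<in> roots G \<and> m \<in> Mgrp G}"

definition K_M_type ::
  "('a::{t2_space,second_countable_topology}, 'v::euclidean_space, 'z) iwasawa_group_scheme \<Rightarrow>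
   ('a \<Rightarrow> complex ^ 'n::finite \<Rightarrow> complex ^ 'n) \<Rightarrow> bool"
  where "K_M_type G \<pi> \<longleftrightarrow> unitary_irrep G \<pi> \<and> VM G \<pi> \<noteq> {0}"

definition single_petaled ::
  "('a::{t2_space,second_countable_topology}, 'v::euclidean_space, 'z) iwasawa_group_scheme \<Rightarrow>
   ('a \<Rightarrow> complex ^ 'n::finite \<Rightarrow> complex ^ 'n) \<Rightarrow> bool"
  where "single_petaled G \<pi> \<longleftrightarrow> K_M_type G \<pi> \<and> V_single G \<pi> = VM G \<pi>"

section \<open>Equivariant maps and restriction\<close>

definition C_inf_K ::
  "('a::{t2_space,second_countable_topology}, 'v::euclidean_space, 'z) iwasawa_group_scheme \<Rightarrow> ('v \<Rightarrow> complex) set"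
  where "C_inf_K G = {f \<in> C_inf (ss G). \<forall>k\<in>Kgrp G. \<forall>x\<in>ss G. f (Ad G k x) = f x}"

definition Hom_K ::
  "('a::{t2_space,second_countable_topology}, 'v::euclidean_space, 'z) iwasawa_group_scheme \<Rightarrow>
   ('a \<Rightarrow> complex ^ 'n::finite \<Rightarrow> complex ^ 'n) \<Rightarrow> ('v \<Rightarrow> complex) set \<Rightarrow> (complex ^ 'n \<Rightarrow> 'v \<Rightarrow> complex) set"
where "Hom_K G \<pi> F = {\<Phi>.
    (\<forall>v. \<Phi> v \<in> F) \<and>
    (\<forall>u v. \<Phi> (u + v) = (\<lambda>x. \<Phi> u x + \<Phi> v x)) \<and>
    (\<forall>c v. \<Phi> (c *s v) = (\<lambda>x. c * \<Phi> v x)) \<and>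
    (\<forall>k\<in>Kgrp G. \<forall>v. \<forall>x\<in>ss G. \<Phi> (\<pi> k v) x = \<Phi> v (Ad G (inv\<^bsub>G\<^esub> k) x))}"

text \<open>Maps with domain \<open>VM\<close> are extensional.  An element of the Weyl group is a coset, and acts on
  \<open>VM\<close> and on \<open>aa\<close> through any representative.\<close>

definition Hom_W ::
  "('a::{t2_space,second_countable_topology}, 'v::euclidean_space, 'z) iwasawa_group_scheme \<Rightarrow>
   ('a \<Rightarrow> complex ^ 'n::finite \<Rightarrow> complex ^ 'n) \<Rightarrow> ('v \<Rightarrow> complex) set \<Rightarrow> (complex ^ 'n \<Rightarrow> 'v \<Rightarrow> complex) set"
where "Hom_W G \<pi> F = {\<Psi> \<in> extensional (VM G \<pi>).
    (\<forall>v\<in>VM G \<pi>. \<Psi> v \<in> F) \<and>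
    (\<forall>u\<in>VM G \<pi>. \<forall>v\<in>VM G \<pi>. \<Psi> (u + v) = (\<lambda>x. \<Psi> u x + \<Psi> v x)) \<and>
    (\<forall>c. \<forall>v\<in>VM G \<pi>. \<Psi> (c *s v) = (\<lambda>x. c * \<Psi> v x)) \<and>
    (\<forall>w\<in>carrier (weyl G). \<forall>k\<in>w. \<forall>v\<in>VM G \<pi>. \<forall>x\<in>aa G. \<Psi> (\<pi> k v) x = \<Psi> v (Ad G (inv\<^bsub>G\<^esub> k) x))}"

definition gamma0 ::
  "('a::{t2_space,second_countable_topology}, 'v::euclidean_space, 'z) iwasawa_group_scheme \<Rightarrow>
   ('v \<Rightarrow> complex) \<Rightarrow> 'v \<Rightarrow> complex"
  where "gamma0 G f = ext0 (aa G) f"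

definition Gamma0 ::
  "('a::{t2_space,second_countable_topology}, 'v::euclidean_space, 'z) iwasawa_group_scheme \<Rightarrow>
   ('a \<Rightarrow> complex ^ 'n::finite \<Rightarrow> complex ^ 'n) \<Rightarrow> (complex ^ 'n \<Rightarrow> 'v \<Rightarrow> complex) \<Rightarrow> complex ^ 'n \<Rightarrow> 'v \<Rightarrow> complex"
  where "Gamma0 G \<pi> \<Phi> = (\<lambda>v\<in>VM G \<pi>. gamma0 G (\<Phi> v))"

definition Hom_K_22 ::
  "('a::{t2_space,second_countable_topology}, 'v::euclidean_space, 'z) iwasawa_group_scheme \<Rightarrow>
   ('a \<Rightarrow> complex ^ 'n::finite \<Rightarrow> complex ^ 'n) \<Rightarrow> ('v \<Rightarrow> complex) set \<Rightarrow> (complex ^ 'n \<Rightarrow> 'v \<Rightarrow> complex) set"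
  where "Hom_K_22 G \<pi> F = {\<Phi> \<in> Hom_K G \<pi> F. \<forall>v\<in>V_double G \<pi>. Gamma0 G \<pi> \<Phi> v = (\<lambda>_. 0)}"

section \<open>Differential operators and Dunkl operators\<close>

definition diff_op ::
  "('a::{t2_space,second_countable_topology}, 'v::euclidean_space, 'z) iwasawa_group_scheme \<Rightarrow>
   ('v \<Rightarrow> complex) \<Rightarrow> ('v \<Rightarrow> complex) \<Rightarrow> 'v \<Rightarrow> complex"
  where "diff_op G = sym_ext (ss G) (killing G) (dir_deriv (ss G))"

definition RR :: "('a::{t2_space,second_countable_topology}, 'v::euclidean_space, 'z) iwasawa_group_scheme \<Rightarrow> ('v \<Rightarrow> real) set"
  where "RR G = (\<lambda>\<alpha> H. 2 * \<alpha> H) ` roots G"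

definition R1 :: "('a::{t2_space,second_countable_topology}, 'v::euclidean_space, 'z) iwasawa_group_scheme \<Rightarrow> ('v \<Rightarrow> real) set"
  where "R1 G = RR G - (\<lambda>\<alpha> H. 2 * \<alpha> H) ` RR G"

definition R1_pos :: "('a::{t2_space,second_countable_topology}, 'v::euclidean_space, 'z) iwasawa_group_scheme \<Rightarrow> ('v \<Rightarrow> real) set"
  where "R1_pos G = R1 G \<inter> (\<lambda>\<alpha> H. 2 * \<alpha> H) ` pos_roots G"

definition m0 :: "('a::{t2_space,second_countable_topology}, 'v::euclidean_space, 'z) iwasawa_group_scheme \<Rightarrow> ('v \<Rightarrow> real) \<Rightarrow> real"
where "m0 G \<alpha> =
    (if (\<lambda>H. 2 * \<alpha> H) \<in> RR G
     then real (dim (root_space G (\<lambda>H. \<alpha> H / 2)) + dim (root_space G \<alpha>)) / 2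
     else real (dim (root_space G (\<lambda>H. \<alpha> H / 2))) / 2)"

text \<open>The function \<open>(1 - s\<^sub>\<alpha>) f / \<alpha>\<close>, which extends smoothly across the hyperplane \<open>\<alpha> = 0\<close>.\<close>

definition dunkl_quot ::
  "('a::{t2_space,second_countable_topology}, 'v::euclidean_space, 'z) iwasawa_group_scheme \<Rightarrow>
   ('v \<Rightarrow> real) \<Rightarrow> ('v \<Rightarrow> complex) \<Rightarrow> 'v \<Rightarrow> complex"
where "dunkl_quot G \<alpha> f =
    (THE g. g \<in> C_inf (aa G) \<and> (\<forall>x\<in>aa G. of_real (\<alpha> x) * g x = f x - f (root_refl G \<alpha> x)))"

definition dunkl_vec ::
  "('a::{t2_space,second_countable_topology}, 'v::euclidean_space, 'z) iwasawa_group_scheme \<Rightarrow>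
   'v \<Rightarrow> ('v \<Rightarrow> complex) \<Rightarrow> 'v \<Rightarrow> complex"
where "dunkl_vec G \<xi> f = (\<lambda>x. dir_deriv (aa G) \<xi> f x +
    (\<Sum>\<alpha>\<in>R1_pos G. of_real (m0 G \<alpha> * \<alpha> \<xi>) * dunkl_quot G \<alpha> f x))"

definition dunkl ::
  "('a::{t2_space,second_countable_topology}, 'v::euclidean_space, 'z) iwasawa_group_scheme \<Rightarrow>
   ('v \<Rightarrow> complex) \<Rightarrow> ('v \<Rightarrow> complex) \<Rightarrow> 'v \<Rightarrow> complex"
  where "dunkl G = sym_ext (aa G) (killing G) (dunkl_vec G)"

definition diff_Hom ::
  "('a::{t2_space,second_countable_topology}, 'v::euclidean_space, 'z) iwasawa_group_scheme \<Rightarrow>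
   (complex ^ 'n::finite \<Rightarrow> 'v \<Rightarrow> complex) \<Rightarrow> ('v \<Rightarrow> complex) \<Rightarrow> complex ^ 'n \<Rightarrow> 'v \<Rightarrow> complex"
  where "diff_Hom G \<Phi> f = (\<lambda>v. diff_op G (\<Phi> v) f)"

definition dunkl_Hom ::
  "('a::{t2_space,second_countable_topology}, 'v::euclidean_space, 'z) iwasawa_group_scheme \<Rightarrow>
   ('a \<Rightarrow> complex ^ 'n::finite \<Rightarrow> complex ^ 'n) \<Rightarrow>
   (complex ^ 'n \<Rightarrow> 'v \<Rightarrow> complex) \<Rightarrow> ('v \<Rightarrow> complex) \<Rightarrow> complex ^ 'n \<Rightarrow> 'v \<Rightarrow> complex"
  where "dunkl_Hom G \<pi> \<Psi> h = (\<lambda>v\<in>VM G \<pi>. dunkl G (\<Psi> v) h)"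

end

theory Submission
  imports Defs "HOL-Analysis.Bounded_Continuous_Function"
begin

text \<open>Let \<open>L\<close> be the Laplacian of \<open>ss\<close> and \<open>L\<^sub>D\<close> the sum of the squares of the Dunkl operators over an
orthonormal frame of \<open>aa\<close>. If \<open>p\<close> is homogeneous of degree \<open>d\<close>, then the \<open>d\<close>-fold commutator of \<open>L\<close> with
multiplication by \<open>p\<close> is \<open>2^d d!\<close> times the differential operator of \<open>p\<close>, and the same holds for \<open>L\<^sub>D\<close>.
This yields the symmetric algebra homomorphisms of both sides, and it reduces the theorem to two facts about
\<open>\<Phi>\<close> in \<open>Hom_K G \<pi> (C_inf (ss G))\<close>: restriction to \<open>aa\<close> intertwines \<open>L\<close> and \<open>L\<^sub>D\<close> on \<open>\<Phi> v\<close> for \<open>v\<close> in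
\<open>V_single\<close>, and \<open>L\<close> preserves the vanishing of \<open>\<Phi>\<close> on \<open>V_double\<close>.

Both follow from the radial part of \<open>L\<close>, in which a root \<open>\<alpha>\<close> contributes \<open>\<Phi> (omega \<alpha> v)\<close>, where \<open>omega \<alpha>\<close>
is the sum of the \<open>Z\<^sup>2\<close> for \<open>Z = X + theta X\<close> and \<open>X\<close> in an orthonormal frame of the root space. The equation
\<open>Z (Z\<^sup>2 + 4) v = 0\<close> at the chosen root vector spreads over the whole sphere of the root space by the action of M,
and it gives \<open>exp (\<pi>/2 Z) v = v + Z\<^sup>2 v / 2\<close>; as \<open>exp (\<pi>/2 Z)\<close> acts on \<open>aa\<close> by the reflection, \<open>Z\<^sup>2\<close> becomes
the difference term of \<open>L\<^sub>D\<close>. For double vectors one uses that \<open>omega \<alpha>\<close> is symmetric and preserves \<open>V_single\<close>,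
the orthogonal complement of \<open>V_double\<close> in \<open>VM\<close>.

Identities between operators on smooth functions (commuting Dunkl operators, the formula for \<open>L\<^sub>D\<close>) are
proved by checking constants and commutators with linear functions, which suffices by Hadamard's lemma.\<close>

text \<open>Differential operators of high order have no tractable restriction to \<open>aa\<close>,
  whereas the single second order operator \<open>L\<close> has. For a K-invariant \<open>f\<close>,
  the iterated commutators with \<open>\<Phi> v\<close>, applied to \<open>f\<close>, depend again
  equivariantly on \<open>v\<close>, so the two facts about \<open>L\<close> can be applied anew
  after each commutator. The effect of \<open>L\<close> on \<open>f\<close> itself is the same
  statement for the trivial representation.

  One obstacle is that \<pi> is only assumed continuous, while \<open>V_single\<close>
  differentiates it. A nonzero equivariant map into smooth functions embeds the representation
  space, by irreducibility, and transfers differentiability from \<open>Ad\<close> to \<pi>; so the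
  case \<Phi> = 0 is split off at the end. Another is the bookkeeping of multiplicities: the radial
  part of \<open>L\<close> sums over all positive roots with the dimensions of the root spaces, the
  Dunkl operators over \<open>R1_pos\<close> with \<open>m0\<close>. The two match because each term
  is homogeneous of degree 0 in the root, so \<alpha> and 2\<alpha> can be merged.

  The group is known only through charts and point derivations; bracket, \<open>Ad\<close> and
  one-parameter groups are developed from these.\<close>

notation has_vector_derivative (infix "hvd" 50)
notation scaleR (infixr "*R" 75)

section \<open>Calculus on relatively open subsets of a subspace\<close>

text \<open>The spaces that carry functions here (\<open>lie_alg\<close>, \<open>ss\<close>,
  \<open>aa\<close>) are subspaces of a larger Euclidean type, so openness and derivatives are taken
  relative to a subspace \<open>E\<close>.\<close>

definition relopen :: "'v::euclidean_space set => 'v set => bool"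
 where "relopen E S \<longleftrightarrow> subspace E \<and> openin (top_of_set E) S"

text \<open>A canonical choice for the derivative that \<open>Ck_on\<close> only asserts to exist,
  so that iterated derivatives become functions that can be named.\<close>

definition dirder :: "('v::real_normed_vector => 'w::real_normed_vector) => 'v => 'v => 'w"
 where "dirder f v x = vector_derivative (%t. f (x + t *R v)) (at 0)"

lemma line_vderiv: "((%t. x + t *R v) hvd v) (at s within A)"
proof -
 have "((%t. x + t *R v) has_derivative (%t. 0 + t *R v)) (at s within A)"
  by (intro has_derivative_add has_derivative_const has_derivative_scaleR_left has_derivative_ident)
 then show ?thesis by (simp add: has_vector_derivative_def)
qed

lemma relopen_subset: "relopen E S ==> S \<subseteq> E"
 by (auto simp: relopen_def dest: openin_imp_subset)

lemma relopen_self: "subspace E ==> relopen E E"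
 by (simp add: relopen_def)

lemma relopen_Times: "relopen E S ==> relopen E' S' ==> relopen (E \<times> E') (S \<times> S')"
 by (auto simp: relopen_def subspace_Times openin_Times)

lemma relopen_Int: "relopen E S ==> relopen E T ==> relopen E (S \<inter> T)"
 by (auto simp: relopen_def)

lemma relopen_ball:
 assumes "relopen E S" "x : S"
 obtains e where "e > 0" "\<And>y. y : E ==> dist y x < e ==> y : S"
 using assms unfolding relopen_def openin_euclidean_subtopology_iff by metis

lemma relopen_line:
 assumes "relopen E S" "x : S" "v : E"
 obtains d where "d > 0" "\<And>t. \<bar>t\<bar> < d ==> x + t *R v : S"
proof -
 obtain e where e: "e > 0" "\<And>y. y : E ==> dist y x < e ==> y : S"
  using relopen_ball[OF assms(1,2)] by blast
 have E: "subspace E" "x : E" using assms relopen_subset by (auto simp: relopen_def)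
 show ?thesis
 proof (rule that[of "e / (norm v + 1)"])
  show "0 < e / (norm v + 1)" using e by (simp add: add_nonneg_pos)
  fix t :: real assume t: "\<bar>t\<bar> < e / (norm v + 1)"
  have "\<bar>t\<bar> * norm v \<le> \<bar>t\<bar> * (norm v + 1)" by (simp add: mult_left_mono)
  also have "\<dots> < e" using t by (simp add: pos_less_divide_eq add_nonneg_pos)
  finally have "dist (x + t *R v) x < e" by (simp add: dist_norm)
  moreover have "x + t *R v : E"
   using E assms(3) by (simp add: subspace_add subspace_scale)
  ultimately show "x + t *R v : S" using e(2) by blast
 qed
qed

text \<open>Only the germ along the line matters: for \<open>v\<close> in \<open>E\<close> a short
  segment through \<open>x\<close> stays in \<open>S\<close>.\<close>

lemma vderiv_line_cong:
 assumes "relopen E S" "x : S" "v : E" "\<And>y. y : S ==> f y = g y"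
  and "((%t. f (x + t *R v)) hvd D) (at 0)"
 shows "((%t. g (x + t *R v)) hvd D) (at 0)"
proof -
 obtain d where d: "d > 0" "\<And>t. \<bar>t\<bar> < d ==> x + t *R v : S"
  using relopen_line[OF assms(1-3)] by blast
 show ?thesis
  by (rule has_vector_derivative_transform_within[OF assms(5) d(1)]) (auto simp: d(2) assms(4))
qed

lemma dirder_cong:
 assumes "relopen E S" "x : S" "v : E" "\<And>y. y : S ==> f y = g y"
 shows "dirder f v x = dirder g v x"
proof -
 have "((%t. f (x + t *R v)) hvd D) (at 0) \<longleftrightarrow>
    ((%t. g (x + t *R v)) hvd D) (at 0)" for D
  using vderiv_line_cong[OF assms(1-3), of f g D] vderiv_line_cong[OF assms(1-3), of g f D] assms(4)
  by metis
 then show ?thesis by (simp add: dirder_def vector_derivative_def)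
qed

lemma Ck_SucE:
 assumes "Ck_on (Suc k) E S f" "v : E"
 obtains f' where "\<And>x. x : S ==> ((%t. f (x + t *R v)) hvd f' x) (at 0)"
  "Ck_on k E S f'"
 using assms unfolding Ck_on.simps by blast

lemma Ck_cong:
 assumes "relopen E S" "\<And>y. y : S ==> f y = g y" "Ck_on k E S f"
 shows "Ck_on k E S g"
proof (cases k)
 case 0
 then show ?thesis using assms by (simp cong: continuous_on_cong)
next
 case (Suc k')
 have "continuous_on S g" using assms Suc by (simp cong: continuous_on_cong)
 moreover have "\<exists>f'. (\<forall>x\<in>S. ((%t. g (x + t *R v)) hvd f' x) (at 0)) \<and> Ck_on k' E S f'"
  if v: "v : E" for v
 proof -
  obtain f' where "\<And>x. x : S ==> ((%t. f (x + t *R v)) hvd f' x) (at 0)"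
   "Ck_on k' E S f'" using assms(3) v unfolding Suc Ck_on.simps by blast
  then show ?thesis using vderiv_line_cong[OF assms(1) _ v, of _ f g] assms(2) by metis
 qed
 ultimately show ?thesis by (simp add: Suc)
qed

text \<open>Uniqueness of vector derivatives turns the existential quantifier of
  \<open>Ck_on\<close> into a statement about \<open>dirder\<close>, which can be iterated.\<close>

lemma Ck_Suc_iff:
 assumes "relopen E S"
 shows "Ck_on (Suc k) E S f \<longleftrightarrow> continuous_on S f \<and>
  (\<forall>v\<in>E. (\<forall>x\<in>S. ((%t. f (x + t *R v)) hvd dirder f v x) (at 0)) \<and>
    Ck_on k E S (dirder f v))" (is "?L \<longleftrightarrow> ?R")
proof
 assume L: ?L
 have "(\<forall>x\<in>S. ((%t. f (x + t *R v)) hvd dirder f v x) (at 0)) \<and>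
    Ck_on k E S (dirder f v)" if v: "v : E" for v
 proof -
  obtain f' where f': "\<And>x. x : S ==> ((%t. f (x + t *R v)) hvd f' x) (at 0)"
   "Ck_on k E S f'" using Ck_SucE[OF L v] by blast
  have "dirder f v x = f' x" if "x : S" for x
   using vector_derivative_at[OF f'(1)[OF that]] by (simp add: dirder_def)
  then show ?thesis using f' Ck_cong[OF assms, of f' "dirder f v" k] by simp
 qed
 then show ?R using L by simp
next
 assume ?R then show ?L by auto
qed

lemma Ck_SucI:
 assumes "continuous_on S f"
  "\<And>v x. v : E ==> x : S ==> ((%t. f (x + t *R v)) hvd f' v x) (at 0)"
  "\<And>v. v : E ==> Ck_on k E S (f' v)"
 shows "Ck_on (Suc k) E S f"
 using assms by (auto intro!: exI[of _ "f' _"])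

lemma Ck_Suc_dest:
 assumes "relopen E S" "Ck_on (Suc k) E S f" "v : E"
 shows "x : S ==> ((%t. f (x + t *R v)) hvd dirder f v x) (at 0)"
  "Ck_on k E S (dirder f v)" "continuous_on S f"
 using assms by (auto simp: Ck_Suc_iff simp del: Ck_on.simps(2))

lemma Ck_continuous: "Ck_on k E S f ==> continuous_on S f"
 by (cases k) auto

lemma Ck_Suc_imp: "Ck_on (Suc k) E S f ==> Ck_on k E S f"
proof (induction k arbitrary: f)
 case (Suc k)
 have "\<exists>f'. (\<forall>x\<in>S. ((%t. f (x + t *R v)) hvd f' x) (at 0)) \<and> Ck_on k E S f'"
  if v: "v : E" for v
 proof -
  obtain f' where "\<And>x. x : S ==> ((%t. f (x + t *R v)) hvd f' x) (at 0)" "Ck_on (Suc k) E S f'"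
   using Ck_SucE[OF Suc.prems v] by blast
  then show ?thesis by (intro exI[of _ f'] conjI ballI Suc.IH) auto
 qed
 moreover have "continuous_on S f" using Suc.prems Ck_continuous by blast
 ultimately show ?case by simp
qed simp

lemma Ck_mono: "Ck_on m E S f ==> k \<le> m ==> Ck_on k E S f"
 by (induction m) (auto simp del: Ck_on.simps simp: le_Suc_eq dest: Ck_Suc_imp)

lemma Ck_subset: "Ck_on k E S f ==> T \<subseteq> S ==> Ck_on k E T f"
proof (induction k arbitrary: f)
 case 0 then show ?case by (simp add: continuous_on_subset)
next
 case (Suc k)
 have "\<exists>f'. (\<forall>x\<in>T. ((%t. f (x + t *R v)) hvd f' x) (at 0)) \<and> Ck_on k E T f'"
  if v: "v : E" for v
 proof -
  obtain f' where "\<And>x. x : S ==> ((%t. f (x + t *R v)) hvd f' x) (at 0)" "Ck_on k E S f'"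
   using Ck_SucE[OF Suc.prems(1) v] by blast
  then show ?thesis using Suc.prems(2) by (intro exI[of _ f'] conjI ballI Suc.IH) auto
 qed
 moreover have "continuous_on T f" using Suc.prems Ck_continuous continuous_on_subset by blast
 ultimately show ?case by simp
qed

lemma Ck_const: "Ck_on k E S (%_. c)"
proof (induction k arbitrary: c)
 case (Suc k)
 show ?case by (rule Ck_SucI[where f'="%_ _. 0"]) (auto intro: Suc has_vector_derivative_const)
qed simp

lemma Ck_bounded_linear:
 assumes "bounded_linear h"
 shows "Ck_on k E S f ==> Ck_on k E S (%x. h (f x))"
proof (induction k arbitrary: f)
 case 0
 then show ?case by (simp add: bounded_linear.continuous_on[OF assms])
next
 case (Suc k)
 have "\<exists>f'. (\<forall>x\<in>S. ((%t. h (f (x + t *R v))) hvd f' x) (at 0)) \<and> Ck_on k E S f'"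
  if v: "v : E" for v
 proof -
  obtain f' where "\<And>x. x : S ==> ((%t. f (x + t *R v)) hvd f' x) (at 0)" "Ck_on k E S f'"
   using Ck_SucE[OF Suc.prems(1) v] by blast
  then show ?thesis
   by (intro exI[of _ "%x. h (f' x)"] conjI ballI Suc.IH bounded_linear.has_vector_derivative[OF assms])
 qed
 moreover have "continuous_on S (%x. h (f x))"
  using Suc.prems Ck_continuous bounded_linear.continuous_on[OF assms] by blast
 ultimately show ?case by simp
qed

lemma Ck_linear_id:
 assumes "bounded_linear h"
 shows "Ck_on k E S h"
proof (cases k)
 case 0
 then show ?thesis by (simp add: assms linear_continuous_on)
next
 case (Suc m)
 have lin: "linear h" using assms bounded_linear.linear by blast
 have "((%t. h (x + t *R v)) hvd h v) (at 0)" for x v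
  by (rule bounded_linear.has_vector_derivative[OF assms line_vderiv])
 then show ?thesis unfolding Suc
  by (intro Ck_SucI[where f'="%v x. h v"]) (auto simp: Ck_const assms linear_continuous_on)
qed

lemma Ck_add: "Ck_on k E S f ==> Ck_on k E S g ==> Ck_on k E S (%x. f x + g x)"
proof (induction k arbitrary: f g)
 case 0 then show ?case by (simp add: continuous_on_add)
next
 case (Suc k)
 show ?case unfolding Ck_on.simps
 proof (intro conjI ballI)
  show "continuous_on S (%x. f x + g x)" using Suc.prems by (auto intro: continuous_on_add)
  fix v assume v: "v : E"
  obtain f' where f': "\<And>x. x : S ==> ((%t. f (x + t *R v)) hvd f' x) (at 0)"
   "Ck_on k E S f'" using Ck_SucE[OF Suc.prems(1) v] by blast
  obtain g' where g': "\<And>x. x : S ==> ((%t. g (x + t *R v)) hvd g' x) (at 0)"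
   "Ck_on k E S g'" using Ck_SucE[OF Suc.prems(2) v] by blast
  show "\<exists>h. (\<forall>x\<in>S. ((%t. f (x + t *R v) + g (x + t *R v)) hvd h x) (at 0)) \<and> Ck_on k E S h"
   using f' g' Suc.IH by (intro exI[of _ "%x. f' x + g' x"]) (auto intro!: has_vector_derivative_add)
 qed
qed

lemma Ck_bilinear:
 assumes "bounded_bilinear pr"
 shows "Ck_on k E S f ==> Ck_on k E S g ==> Ck_on k E S (%x. pr (f x) (g x))"
proof (induction k arbitrary: f g)
 case 0 then show ?case by (simp add: bounded_bilinear.continuous_on[OF assms])
next
 case (Suc k)
 show ?case unfolding Ck_on.simps
 proof (intro conjI ballI)
  show "continuous_on S (%x. pr (f x) (g x))" using Suc.prems
   by (auto intro: bounded_bilinear.continuous_on[OF assms])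
  fix v assume v: "v : E"
  obtain f' where f': "\<And>x. x : S ==> ((%t. f (x + t *R v)) hvd f' x) (at 0)"
   "Ck_on k E S f'" using Ck_SucE[OF Suc.prems(1) v] by blast
  obtain g' where g': "\<And>x. x : S ==> ((%t. g (x + t *R v)) hvd g' x) (at 0)"
   "Ck_on k E S g'" using Ck_SucE[OF Suc.prems(2) v] by blast
  have "((%t. pr (f (x + t *R v)) (g (x + t *R v))) hvd
    pr (f x) (g' x) + pr (f' x) (g x)) (at 0)" if "x : S" for x
   using bounded_bilinear.has_vector_derivative[OF assms f'(1)[OF that] g'(1)[OF that]] by simp
  moreover have "Ck_on k E S (%x. pr (f x) (g' x) + pr (f' x) (g x))"
   using Suc.prems f' g' by (intro Ck_add Suc.IH) (auto simp del: Ck_on.simps intro: Ck_Suc_imp)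
  ultimately show "\<exists>h. (\<forall>x\<in>S. ((%t. pr (f (x + t *R v)) (g (x + t *R v))) hvd h x) (at 0)) \<and> Ck_on k E S h"
   by (intro exI[of _ "%x. pr (f x) (g' x) + pr (f' x) (g x)"]) blast
 qed
qed

lemma Ck_sum: "(\<And>i. i : I ==> Ck_on k E S (f i)) ==> Ck_on k E S (%x. \<Sum>i\<in>I. f i x)"
 by (induction I rule: infinite_finite_induct) (auto simp: Ck_const Ck_add)

lemma Ck_local_cont:
 assumes "relopen E S" "\<And>x. x : S ==> \<exists>T. x : T \<and> T \<subseteq> S \<and> relopen E T \<and> continuous_on T f"
 shows "continuous_on S f"
 unfolding continuous_on_eq_continuous_within
proof
 fix x assume x: "x : S"
 then obtain T where T: "x : T" "T \<subseteq> S" "relopen E T" "continuous_on T f" using assms(2) by metis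
 obtain e where e: "e > 0" "\<And>y. y : E ==> dist y x < e ==> y : T"
  using relopen_ball[OF T(3,1)] by blast
 have "at x within S = at x within T"
 proof (rule at_within_nhd[of x "ball x e"])
  show "S \<inter> ball x e - {x} = T \<inter> ball x e - {x}"
   using T(2) e(2) relopen_subset[OF assms(1)] by (auto simp: dist_commute)
 qed (use e in auto)
 then show "continuous (at x within S) f"
  using T by (simp add: continuous_on_eq_continuous_within)
qed

lemma Ck_local:
 assumes "relopen E S" "\<And>x. x : S ==> \<exists>T. x : T \<and> T \<subseteq> S \<and> relopen E T \<and> Ck_on k E T f"
 shows "Ck_on k E S f"
 using assms(2)
proof (induction k arbitrary: f)
 case 0
 then show ?case using Ck_local_cont[OF assms(1), of f] by simp
next
 case (Suc k)
 have T: thesis if "x : S" "\<And>T. x : T ==> T \<subseteq> S ==> relopen E T ==> Ck_on (Suc k) E T f ==> thesis" for x thesis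
  using Suc.prems[OF that(1)] that(2) by (elim exE conjE)
 show ?case
 proof (rule Ck_SucI[where f'="dirder f"])
  show "continuous_on S f"
  proof (rule Ck_local_cont[OF assms(1)])
   fix x assume "x : S"
   then show "\<exists>T. x : T \<and> T \<subseteq> S \<and> relopen E T \<and> continuous_on T f"
    by (rule T) (metis Ck_continuous)
  qed
  fix v assume v: "v : E"
  show "((%t. f (x + t *R v)) hvd dirder f v x) (at 0)" if "x : S" for x
   using that by (rule T) (metis Ck_Suc_dest(1) v)
  show "Ck_on k E S (dirder f v)"
  proof (rule Suc.IH)
   fix x assume "x : S"
   then show "\<exists>T. x : T \<and> T \<subseteq> S \<and> relopen E T \<and> Ck_on k E T (dirder f v)"
    by (rule T) (metis Ck_Suc_dest(2) v)
  qed
 qed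
qed

section \<open>Coordinates on a subspace: total differentiability and the chain rule\<close>

definition onb :: "'v::euclidean_space set => 'v set" where
 "onb E = (SOME B. B \<subseteq> E \<and> pairwise orthogonal B \<and> (\<forall>x\<in>B. norm x = 1) \<and> independent B \<and> span B = E)"

lemma onb:
 assumes "subspace E"
 shows "onb E \<subseteq> E" "pairwise orthogonal (onb E)" "\<And>x. x : onb E ==> norm x = 1"
  "independent (onb E)" "span (onb E) = E" "finite (onb E)"
proof -
 have "\<exists>B. B \<subseteq> E \<and> pairwise orthogonal B \<and> (\<forall>x\<in>B. norm x = 1) \<and> independent B \<and> span B = E"
  using orthonormal_basis_subspace[OF assms] by metis
 from someI_ex[OF this]
 show "onb E \<subseteq> E" "pairwise orthogonal (onb E)" "\<And>x. x : onb E ==> norm x = 1"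
  "independent (onb E)" "span (onb E) = E" unfolding onb_def by auto
 then show "finite (onb E)" using independent_imp_finite by blast
qed

text \<open>Composition with this projection extends a function from \<open>E\<close> to the whole
  type, where total derivatives and bounded linear maps are available.\<close>

definition prj :: "'v::euclidean_space set => 'v => 'v"
 where "prj E y = (\<Sum>b\<in>onb E. (y \<bullet> b) *R b)"

lemma prj_in: "subspace E ==> prj E y : E"
 unfolding prj_def by (intro subspace_sum subspace_scale) (use onb in auto)

lemma prj_id: "subspace E ==> y : E ==> prj E y = y"
 unfolding prj_def using orthonormal_basis_expand[of "onb E" y] onb[of E] by auto

lemma prj_bounded_linear: "bounded_linear (prj E)"
 unfolding prj_def by (intro bounded_linear_sum bounded_linear_scaleR_const bounded_linear_inner_left)

lemma prj_linear: "linear (prj E)"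
 using prj_bounded_linear bounded_linear.linear by blast

lemma line_shift:
 fixes f :: "'v::real_normed_vector => 'w::real_normed_vector"
 assumes "((%t. f (x + s *R v + t *R v)) hvd D) (at 0)"
 shows "((%t. f (x + t *R v)) hvd D) (at s)"
proof -
 have a: "((%t. t - s) hvd 1) (at s)"
  by (auto intro!: derivative_eq_intros)
 have "(((%t. f (x + s *R v + t *R v)) \<circ> (%t. t - s)) hvd 1 *R D) (at s)"
  by (rule vector_diff_chain_at[OF a]) (use assms in simp)
 moreover have "x + s *R v + (t - s) *R v = x + t *R v" for t
  by (simp add: scaleR_left_diff_distrib)
 ultimately show ?thesis by (simp add: o_def)
qed

lemma seg_bound:
 fixes g :: "real => 'w::real_normed_vector"
 assumes "\<And>s. \<bar>s\<bar> \<le> \<bar>c\<bar> ==> (g hvd g' s) (at s)"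
  and "\<And>s. \<bar>s\<bar> \<le> \<bar>c\<bar> ==> norm (g' s - D) \<le> ep"
 shows "norm (g c - g 0 - c *R D) \<le> ep * \<bar>c\<bar>"
proof -
 let ?S = "{-\<bar>c\<bar>..\<bar>c\<bar>}"
 have "norm ((g c - c *R D) - (g 0 - 0 *R D)) \<le> ep * norm (c - 0)"
 proof (rule differentiable_bound[of ?S _ "%s t. t *R (g' s - D)"])
  fix s assume s: "s : ?S"
  have "((%s. g s - s *R D) hvd (g' s - D)) (at s)"
   using s by (auto intro!: derivative_eq_intros assms(1))
  then show "((%s. g s - s *R D) has_derivative (%t. t *R (g' s - D))) (at s within ?S)"
   using has_derivative_at_withinI by (auto simp: has_vector_derivative_def)
  show "onorm (%t. t *R (g' s - D)) \<le> ep"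
   using assms(2)[of s] s by (intro onorm_le) (auto simp: mult.commute[of ep] mult_left_mono)
 qed auto
 then show ?thesis by (simp add: algebra_simps)
qed

text \<open>The classical argument that continuous partial derivatives give total differentiability:
  coordinates are changed one at a time, each change is estimated by the mean value inequality, and
  continuity of \<open>dirder f a\<close> at \<open>x\<close> makes the error at most
  \<open>ep\<close>.\<close>

lemma C1_estimate:
 assumes R: "relopen E S" and f: "Ck_on (Suc 0) E S f" and x: "x : S" and "finite A" "A \<subseteq> E" "ep > 0"
 shows "\<exists>de>0. \<forall>c. (\<forall>a\<in>A. \<bar>c a\<bar> < de) \<longrightarrow>
  norm (f (x + (\<Sum>a\<in>A. c a *R a)) - f x - (\<Sum>a\<in>A. c a *R dirder f a x)) \<le> ep * (\<Sum>a\<in>A. \<bar>c a\<bar>)"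
 using \<open>finite A\<close> \<open>A \<subseteq> E\<close>
proof (induction A rule: finite_induct)
 case empty
 then show ?case by (auto intro: exI[of _ 1])
next
 case (insert a A)
 have E: "subspace E" and xE: "x : E" using R x relopen_subset by (auto simp: relopen_def)
 have aE: "a : E" "A \<subseteq> E" using insert.prems by auto
 obtain de1 where d1: "de1 > 0" and d1': "\<forall>c. (\<forall>a\<in>A. \<bar>c a\<bar> < de1) \<longrightarrow>
  norm (f (x + (\<Sum>a\<in>A. c a *R a)) - f x - (\<Sum>a\<in>A. c a *R dirder f a x)) \<le> ep * (\<Sum>a\<in>A. \<bar>c a\<bar>)"
  using insert.IH[OF aE(2)] by (elim exE conjE)
 obtain e where e: "e > 0" "\<And>y. y : E ==> dist y x < e ==> y : S" using relopen_ball[OF R x] by blast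
 have "continuous_on S (dirder f a)" using Ck_Suc_dest(2)[OF R f aE(1)] by simp
 then obtain \<eta> where eta: "\<eta> > 0" "\<And>y. y : S ==> dist y x < \<eta> ==> dist (dirder f a y) (dirder f a x) < ep"
  using x \<open>ep > 0\<close> unfolding continuous_on_iff by metis
 \<comment> \<open>All points visited lie within \<open>de * M\<close> of \<open>x\<close>; the
   summand 1 makes \<open>M\<close> positive and the bound strict.\<close>
 define M where "M = (\<Sum>b\<in>insert a A. norm b) + 1"
 have M: "M > 0" unfolding M_def by (simp add: add_nonneg_pos sum_nonneg)
 define de where "de = min de1 (min e \<eta> / M)"
 have d: "de > 0" "de \<le> de1" "de * M \<le> min e \<eta>"
  using d1 e eta M by (auto simp: de_def min_def field_simps)
 show ?case
 proof (intro exI[of _ de] conjI allI impI d(1))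
  fix c assume c: "\<forall>b\<in>insert a A. \<bar>c b\<bar> < de"
  define y where "y = x + (\<Sum>b\<in>A. c b *R b)"
  have yE: "y : E" unfolding y_def using E xE aE by (intro subspace_add subspace_sum subspace_scale) auto
  have near: "y + s *R a : S \<and> dist (y + s *R a) x < \<eta>" if s: "\<bar>s\<bar> \<le> \<bar>c a\<bar>" for s
  proof -
   have "norm ((\<Sum>b\<in>A. c b *R b) + s *R a) \<le> (\<Sum>b\<in>A. norm (c b *R b)) + norm (s *R a)"
    using norm_triangle_ineq[of "\<Sum>b\<in>A. c b *R b" "s *R a"] norm_sum[of "%b. c b *R b" A] by linarith
   also have "\<dots> \<le> (\<Sum>b\<in>A. de * norm b) + de * norm a"
    using c s by (intro add_mono sum_mono) (auto intro!: mult_right_mono)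
   also have "\<dots> = de * (M - 1)" using insert.hyps by (simp add: M_def sum_distrib_left algebra_simps)
   also have "\<dots> < de * M" using d by simp
   also have "\<dots> \<le> min e \<eta>" by (rule d)
   finally have "dist (y + s *R a) x < min e \<eta>"
    by (simp add: y_def dist_norm algebra_simps)
   moreover have "y + s *R a : E" using yE aE E by (intro subspace_add subspace_scale)
   ultimately show ?thesis using e(2)[of "y + s *R a"] by simp
  qed
  have h1: "norm (f (y + c a *R a) - f (y + 0 *R a) - c a *R dirder f a x) \<le> ep * \<bar>c a\<bar>"
  proof (rule seg_bound[of "c a" "%s. f (y + s *R a)" "%s. dirder f a (y + s *R a)"])
   fix s assume s: "\<bar>s\<bar> \<le> \<bar>c a\<bar>"
   show "((%s. f (y + s *R a)) hvd dirder f a (y + s *R a)) (at s)"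
    by (rule line_shift, rule Ck_Suc_dest(1)[OF R f aE(1)]) (use near[OF s] in blast)
   show "norm (dirder f a (y + s *R a) - dirder f a x) \<le> ep"
    using eta(2)[of "y + s *R a"] near[OF s] by (simp add: dist_norm)
  qed
  have h2: "norm (f y - f x - (\<Sum>a\<in>A. c a *R dirder f a x)) \<le> ep * (\<Sum>a\<in>A. \<bar>c a\<bar>)"
   unfolding y_def by (rule d1'[rule_format]) (use c d in auto)
  have h3: "f (x + (\<Sum>a\<in>insert a A. c a *R a)) - f x - (\<Sum>a\<in>insert a A. c a *R dirder f a x)
    = (f (y + c a *R a) - f (y + 0 *R a) - c a *R dirder f a x) +
     (f y - f x - (\<Sum>a\<in>A. c a *R dirder f a x))" (is "?l = ?p + ?q")
   using insert.hyps by (simp add: y_def algebra_simps)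
  have "norm ?l \<le> ep * \<bar>c a\<bar> + ep * (\<Sum>a\<in>A. \<bar>c a\<bar>)"
   unfolding h3 by (rule order_trans[OF norm_triangle_ineq add_mono[OF h1 h2]])
  then show "norm ?l \<le> ep * (\<Sum>a\<in>insert a A. \<bar>c a\<bar>)"
   using insert.hyps by (simp add: distrib_left)
 qed
qed

lemma C1_has_derivative:
 assumes R: "relopen E S" and f: "Ck_on (Suc 0) E S f" and x: "x : S"
 shows "((%y. f (prj E y)) has_derivative (%v. \<Sum>b\<in>onb E. (v \<bullet> b) *R dirder f b x)) (at x)"
proof -
 have E: "subspace E" and xE: "x : E" using R x relopen_subset by (auto simp: relopen_def)
 have fin: "finite (onb E)" using onb[OF E] by blast
 let ?D = "%v. \<Sum>b\<in>onb E. (v \<bullet> b) *R dirder f b x"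
 show ?thesis unfolding has_derivative_at_alt
 proof (intro conjI allI impI)
  show "bounded_linear ?D"
   by (intro bounded_linear_sum bounded_linear_scaleR_const bounded_linear_inner_left)
  fix e :: real assume e: "e > 0"
  define ep where "ep = e / (real (card (onb E)) + 1)"
  have eps: "ep > 0" "ep * real (card (onb E)) \<le> e" using e by (auto simp: ep_def field_simps)
  obtain de where d: "de > 0" and d': "\<forall>c. (\<forall>a\<in>onb E. \<bar>c a\<bar> < de) \<longrightarrow>
   norm (f (x + (\<Sum>a\<in>onb E. c a *R a)) - f x - (\<Sum>a\<in>onb E. c a *R dirder f a x)) \<le> ep * (\<Sum>a\<in>onb E. \<bar>c a\<bar>)"
   using C1_estimate[OF R f x fin onb(1)[OF E] eps(1)] by (elim exE conjE)
  show "\<exists>d>0. \<forall>y. norm (y - x) < d \<longrightarrow>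
    norm (f (prj E y) - f (prj E x) - ?D (y - x)) \<le> e * norm (y - x)"
  proof (intro exI[of _ de] conjI allI impI d(1))
   fix y assume y: "norm (y - x) < de"
   have b: "\<bar>(y - x) \<bullet> b\<bar> \<le> norm (y - x)" if "b : onb E" for b
    using Cauchy_Schwarz_ineq2[of "y - x" b] onb(3)[OF E that] by simp
   have eq: "x + (\<Sum>a\<in>onb E. ((y - x) \<bullet> a) *R a) = prj E y"
    using prj_id[OF E xE] linear_diff[OF prj_linear, of E y x] by (simp add: prj_def[symmetric])
   have "norm (f (prj E y) - f x - ?D (y - x)) \<le> ep * (\<Sum>a\<in>onb E. \<bar>(y - x) \<bullet> a\<bar>)"
    using d'[rule_format, of "%a. (y - x) \<bullet> a"] b y unfolding eq by (meson le_less_trans)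
   also have "\<dots> \<le> ep * (\<Sum>a\<in>onb E. norm (y - x))"
    using eps b by (intro mult_left_mono sum_mono) auto
   also have "\<dots> = (ep * real (card (onb E))) * norm (y - x)" by simp
   also have "\<dots> \<le> e * norm (y - x)" using eps by (intro mult_right_mono) auto
   finally show "norm (f (prj E y) - f (prj E x) - ?D (y - x)) \<le> e * norm (y - x)"
    by (simp add: prj_id[OF E xE])
  qed
 qed
qed

text \<open>The total derivative is that of \<open>f\<close> composed with \<open>prj E\<close>; the
  curve has to stay in \<open>E\<close> near \<open>t0\<close>, since only there does this
  composition agree with \<open>f\<close>.\<close>

lemma chain_curve_onb:
 assumes R: "relopen E S" and f: "Ck_on (Suc 0) E S f" and x: "c t0 : S"
  and c: "(c hvd w) (at t0)" and ev: "eventually (%t. c t : E) (at t0)"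
 shows "((%t. f (c t)) hvd (\<Sum>b\<in>onb E. (w \<bullet> b) *R dirder f b (c t0))) (at t0)"
proof -
 have E: "subspace E" and xE: "c t0 : E" using R x relopen_subset by (auto simp: relopen_def)
 have "(((%y. f (prj E y)) \<circ> c) hvd (\<Sum>b\<in>onb E. (w \<bullet> b) *R dirder f b (c t0))) (at t0)"
  using has_derivative_at_withinI[OF C1_has_derivative[OF R f x]] c
  by (intro vector_derivative_diff_chain_within) auto
 then show ?thesis
  unfolding has_vector_derivative_def o_def
 proof (rule has_derivative_transform_eventually)
  show "\<forall>\<^sub>F t in at t0. f (prj E (c t)) = f (c t)"
   using ev by eventually_elim (simp add: prj_id[OF E])
 qed (simp_all add: prj_id[OF E xE])
qed

lemma dirder_onb:
 assumes R: "relopen E S" and f: "Ck_on (Suc 0) E S f" and x: "x : S" and v: "v : E"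
 shows "dirder f v x = (\<Sum>b\<in>onb E. (v \<bullet> b) *R dirder f b x)"
proof -
 have E: "subspace E" and xE: "x : E" using R x relopen_subset by (auto simp: relopen_def)
 have "((%t. f (x + t *R v)) hvd (\<Sum>b\<in>onb E. (v \<bullet> b) *R dirder f b (x + 0 *R v))) (at 0)"
 proof (rule chain_curve_onb[OF R f])
  show "((%t. x + t *R v) hvd v) (at 0)" by (auto intro!: derivative_eq_intros)
  show "\<forall>\<^sub>F t in at 0. x + t *R v : E"
   using E xE v by (intro always_eventually allI) (simp add: subspace_add subspace_scale)
 qed (use x in simp)
 then show ?thesis using vector_derivative_at unfolding dirder_def by fastforce
qed

lemma dirder_linear:
 assumes R: "relopen E S" and f: "Ck_on (Suc 0) E S f" and x: "x : S"
 shows "v : E ==> w : E ==> dirder f (v + w) x = dirder f v x + dirder f w x"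
  and "v : E ==> dirder f (r *R v) x = r *R dirder f v x"
  and "v : E ==> w : E ==> dirder f (v - w) x = dirder f v x - dirder f w x"
  and "v : E ==> dirder f (- v) x = - dirder f v x"
  and "dirder f 0 x = 0"
proof -
 have E: "subspace E" using R by (auto simp: relopen_def)
 note d = dirder_onb[OF R f x]
 show "v : E ==> w : E ==> dirder f (v + w) x = dirder f v x + dirder f w x"
  using d[of v] d[of w] d[of "v + w"] E
  by (simp add: subspace_add inner_left_distrib scaleR_left_distrib sum.distrib)
 show "v : E ==> w : E ==> dirder f (v - w) x = dirder f v x - dirder f w x"
  using d[of v] d[of w] d[of "v - w"] E
  by (simp add: subspace_diff inner_diff_left scaleR_left_diff_distrib sum_subtractf)
 show "v : E ==> dirder f (r *R v) x = r *R dirder f v x"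
  using d[of v] d[of "r *R v"] E
  by (simp add: subspace_scale scaleR_sum_right)
 show "v : E ==> dirder f (- v) x = - dirder f v x"
  using d[of v] d[of "- v"] E by (simp add: subspace_neg sum_negf)
 show "dirder f 0 x = 0" by (simp add: dirder_def)
qed

lemma dirder_sum:
 assumes R: "relopen E S" and f: "Ck_on (Suc 0) E S f" and x: "x : S" and "\<And>i. i : I ==> v i : E"
 shows "dirder f (\<Sum>i\<in>I. c i *R v i) x = (\<Sum>i\<in>I. c i *R dirder f (v i) x)"
proof -
 have E: "subspace E" using R by (auto simp: relopen_def)
 show ?thesis using assms(4)
 proof (induction I rule: infinite_finite_induct)
  case (insert i I)
  then show ?case
   by (simp add: dirder_linear[OF R f x] subspace_scale[OF E] subspace_sum[OF E])
 qed (simp_all add: dirder_linear(5)[OF R f x])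
qed

lemma chain_curve:
 assumes R: "relopen E S" and f: "Ck_on (Suc 0) E S f" and x: "c t0 : S"
  and c: "(c hvd w) (at t0)" and ev: "eventually (%t. c t : E) (at t0)" and w: "w : E"
 shows "((%t. f (c t)) hvd dirder f w (c t0)) (at t0)"
 using chain_curve_onb[OF assms(1-5)] dirder_onb[OF R f x w] by simp

text \<open>Induction on the order: the derivative of the composite is a finite sum of products of a
  component of \<open>dirder f v\<close> with some \<open>dirder g b\<close> composed with
  \<open>f\<close>, and these factors are one order less regular.\<close>

lemma Ck_compose:
 fixes f :: "'v::euclidean_space => 'u::euclidean_space"
 assumes "relopen E S" "relopen E' S'"
 shows "Ck_on k E S f ==> f ` S \<subseteq> S' ==> Ck_on k E' S' g ==> Ck_on k E S (%x. g (f x))"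
proof (induction k arbitrary: f g)
 case 0
 then show ?case by (auto intro: continuous_on_compose2)
next
 case (Suc k)
 have f: "Ck_on (Suc k) E S f" and g: "Ck_on (Suc k) E' S' g" and im: "f ` S \<subseteq> S'" by fact+
 have g1: "Ck_on (Suc 0) E' S' g" by (rule Ck_mono[OF g]) simp
 have E': "subspace E'" using assms by (simp add: relopen_def)
 let ?f' = "%v x. \<Sum>b\<in>onb E'. (dirder f v x \<bullet> b) *R dirder g b (f x)"
 show ?case
 proof (rule Ck_SucI[where f'="?f'"])
  show "continuous_on S (%x. g (f x))"
   using Ck_continuous[OF f] Ck_continuous[OF g] im by (auto intro: continuous_on_compose2)
  fix v assume v: "v : E"
  show "((%t. g (f (x + t *R v))) hvd ?f' v x) (at 0)" if x: "x : S" for x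
  proof -
   obtain d where d: "d > 0" "\<And>t. \<bar>t\<bar> < d ==> x + t *R v : S"
    using relopen_line[OF assms(1) x v] by blast
   have "\<forall>\<^sub>F t in at 0. f (x + t *R v) : E'"
    unfolding eventually_at using d im relopen_subset[OF assms(2)] by (intro exI[of _ d]) auto
   then have "((%t. g (f (x + t *R v))) hvd 
     (\<Sum>b\<in>onb E'. (dirder f v x \<bullet> b) *R dirder g b (f (x + 0 *R v)))) (at 0)"
    using x im Ck_Suc_dest(1)[OF assms(1) f v x]
    by (intro chain_curve_onb[OF assms(2) g1, of "%t. f (x + t *R v)"]) auto
   then show ?thesis by simp
  qed
  show "Ck_on k E S (?f' v)"
  proof (intro Ck_sum Ck_bilinear[OF bounded_bilinear_scaleR] Suc.IH)
   fix b assume b: "b : onb E'"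
   show "Ck_on k E S (%x. dirder f v x \<bullet> b)"
    using Ck_Suc_dest(2)[OF assms(1) f v] by (rule Ck_bounded_linear[OF bounded_linear_inner_left])
   show "Ck_on k E' S' (dirder g b)" using Ck_Suc_dest(2)[OF assms(2) g] b onb(1)[OF E'] by auto
   show "Ck_on k E S f" using f by (rule Ck_Suc_imp)
   show "f ` S \<subseteq> S'" by (rule im)
  qed
 qed
qed

section \<open>Integrals along segments, symmetry of second derivatives, parameter integrals\<close>

lemma line_integral:
 fixes f :: "'v::euclidean_space => 'w::banach"
 assumes R: "relopen E S" and f: "Ck_on (Suc 0) E S f" and v: "v : E"
  and ab: "a \<le> b" and S: "\<And>t. t : {a..b} ==> x + t *R v : S"
 shows "((%t. dirder f v (x + t *R v)) has_integral f (x + b *R v) - f (x + a *R v)) {a..b}"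
proof (rule fundamental_theorem_of_calculus[OF ab])
 fix t assume t: "t : {a..b}"
 show "((%t. f (x + t *R v)) hvd dirder f v (x + t *R v)) (at t within {a..b})"
  by (rule has_vector_derivative_at_within, rule line_shift, rule Ck_Suc_dest(1)[OF R f v S[OF t]])
qed

text \<open>The increment of \<open>f\<close> in direction \<open>w\<close> is an integral of
  \<open>dirder f w\<close>; differentiating it in direction \<open>v\<close> under the integral
  sign, and then with respect to its length at 0, interchanges the two derivatives.\<close>

lemma dirder_commute:
 fixes f :: "'v::euclidean_space => 'w::banach"
 assumes R: "relopen E S" and f: "Ck_on (Suc (Suc 0)) E S f" and v: "v : E" and w: "w : E" and x: "x : S"
 shows "dirder (dirder f v) w x = dirder (dirder f w) v x"
proof -
 have E: "subspace E" and xE: "x : E" using R x relopen_subset by (auto simp: relopen_def)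
 have f1: "Ck_on (Suc 0) E S f" using f by (rule Ck_Suc_imp)
 note fv = Ck_Suc_dest(2)[OF R f v] and fw = Ck_Suc_dest(2)[OF R f w]
 obtain d where d: "d > 0" "\<And>y. y : E ==> dist y x < d ==> y : S" using relopen_ball[OF R x] by blast
 define e where "e = d / (2 * (norm v + norm w + 1))"
 have pos: "norm v + norm w + 1 > 0" by (smt (verit) norm_ge_zero)
 have e: "e > 0" using d pos by (simp add: e_def)
 have inS: "x + t *R w + s *R v : S" if "\<bar>s\<bar> \<le> e" "\<bar>t\<bar> \<le> e" for s t
 proof -
  have "norm (t *R w + s *R v) \<le> \<bar>t\<bar> * norm w + \<bar>s\<bar> * norm v"
   using norm_triangle_ineq[of "t *R w" "s *R v"] by simp
  also have "\<dots> \<le> e * norm w + e * norm v" using that by (intro add_mono mult_right_mono) auto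
  also have "\<dots> \<le> e * (norm v + norm w + 1)" using e by (simp add: algebra_simps)
  also have "\<dots> = d / 2" using pos by (simp add: e_def field_simps)
  also have "\<dots> < d" using d by simp
  finally have "dist (x + t *R w + s *R v) x < d" by (simp add: dist_norm algebra_simps)
  moreover have "x + t *R w + s *R v : E" using E xE v w by (intro subspace_add subspace_scale)
  ultimately show ?thesis using d(2) by simp
 qed
 have x1: "x + t *R w : S" if "\<bar>t\<bar> \<le> e" for t
  using inS[of 0 t] that e by simp
 let ?U = "{-e..e}"
 have A: "dirder f v (x + t *R w) = dirder f v x + integral {0..t} (%\<tau>. dirder (dirder f w) v (x + \<tau> *R w))"
  if t: "t : {0..e}" for t
 proof -
  let ?I = "%s. integral {0..t} (%\<tau>. dirder f w (x + s *R v + \<tau> *R w))"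
  have st: "x + s *R v + \<tau> *R w : S" if "s : ?U" "\<tau> : {0..t}" for s \<tau>
   using inS[of s \<tau>] that t by (auto simp: algebra_simps)
  have I: "f (x + s *R v + t *R w) - f (x + s *R v) = ?I s" if s: "s : ?U" for s
   using line_integral[OF R f1 w, of 0 t "x + s *R v"] st[OF s] t by (simp add: integral_unique)
  have "((%s. integral (cbox 0 t) (%\<tau>. dirder f w (x + s *R v + \<tau> *R w))) hvd
    integral (cbox 0 t) (%\<tau>. dirder (dirder f w) v (x + 0 *R v + \<tau> *R w))) (at 0 within ?U)"
  proof (rule leibniz_rule_vector_derivative)
   fix s \<tau> assume s: "s : ?U" "\<tau> : cbox 0 t"
   have "((%s. dirder f w (x + \<tau> *R w + s *R v)) hvd
     dirder (dirder f w) v (x + s *R v + \<tau> *R w)) (at s within ?U)"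
   proof (rule has_vector_derivative_at_within, rule line_shift)
    have eq: "x + \<tau> *R w + s *R v = x + s *R v + \<tau> *R w" by (simp add: algebra_simps)
    show "((%t. dirder f w (x + \<tau> *R w + s *R v + t *R v)) hvd
      dirder (dirder f w) v (x + s *R v + \<tau> *R w)) (at 0)"
     unfolding eq by (rule Ck_Suc_dest(1)[OF R fw v]) (use st s in auto)
   qed
   then show "((%s. dirder f w (x + s *R v + \<tau> *R w)) hvd
     dirder (dirder f w) v (x + s *R v + \<tau> *R w)) (at s within ?U)"
    by (simp add: add.assoc add.commute[of "\<tau> *R w"])
  next
   fix s assume s: "s : ?U"
   show "(%\<tau>. dirder f w (x + s *R v + \<tau> *R w)) integrable_on cbox 0 t"
   proof (rule integrable_continuous)
    show "continuous_on (cbox 0 t) (%\<tau>. dirder f w (x + s *R v + \<tau> *R w))"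
     by (rule continuous_on_compose2[OF Ck_continuous[OF fw]])
       (use st s in \<open>auto intro!: continuous_intros\<close>)
   qed
  next
   show "continuous_on (?U \<times> cbox 0 t) (%(s, \<tau>). dirder (dirder f w) v (x + s *R v + \<tau> *R w))"
    unfolding split_beta
    by (rule continuous_on_compose2[OF Ck_continuous[OF Ck_Suc_dest(2)[OF R fw v]]])
      (use st in \<open>auto intro!: continuous_intros\<close>)
  qed (use e in auto)
  then have 1: "(?I hvd integral {0..t} (%\<tau>. dirder (dirder f w) v (x + \<tau> *R w))) (at 0 within ?U)"
   by simp
  have "((%s. f (x + t *R w + s *R v) - f (x + s *R v)) hvd
    dirder f v (x + t *R w) - dirder f v x) (at 0)"
   using Ck_Suc_dest(1)[OF R f1 v] x x1[of t] t by (intro has_vector_derivative_diff) auto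
  then have "((%s. f (x + t *R w + s *R v) - f (x + s *R v)) hvd
    dirder f v (x + t *R w) - dirder f v x) (at 0 within ?U)"
   by (rule has_vector_derivative_at_within)
  then have 2: "(?I hvd dirder f v (x + t *R w) - dirder f v x) (at 0 within ?U)"
  proof (rule has_vector_derivative_transform_within[OF _ zero_less_one])
   fix s assume "s : ?U"
   then show "f (x + t *R w + s *R v) - f (x + s *R v) = ?I s"
    using I[of s] by (simp add: algebra_simps)
  qed (use e in auto)
  have "dirder f v (x + t *R w) - dirder f v x = integral {0..t} (%\<tau>. dirder (dirder f w) v (x + \<tau> *R w))"
   using vector_derivative_unique_within_closed_interval[of "-e" e 0 ?I, unfolded cbox_interval, OF _ _ 2 1] e by simp
  then show ?thesis by (simp add: algebra_simps)
 qed
 have "((%t. integral {0..t} (%\<tau>. dirder (dirder f w) v (x + \<tau> *R w))) hvd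
   dirder (dirder f w) v (x + 0 *R w)) (at 0 within {0..e})"
 proof (rule integral_has_vector_derivative)
  show "continuous_on {0..e} (%\<tau>. dirder (dirder f w) v (x + \<tau> *R w))"
   by (rule continuous_on_compose2[OF Ck_continuous[OF Ck_Suc_dest(2)[OF R fw v]]])
      (use x1 in \<open>auto intro!: continuous_intros\<close>)
 qed (use e in auto)
 then have "((%t. dirder f v x + integral {0..t} (%\<tau>. dirder (dirder f w) v (x + \<tau> *R w))) hvd
   dirder (dirder f w) v x) (at 0 within {0..e})"
  by (auto intro!: derivative_eq_intros)
 then have 3: "((%t. dirder f v (x + t *R w)) hvd dirder (dirder f w) v x) (at 0 within {0..e})"
  by (rule has_vector_derivative_transform_within[OF _ zero_less_one]) (use e A in auto)
 have 4: "((%t. dirder f v (x + t *R w)) hvd dirder (dirder f v) w x) (at 0 within {0..e})"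
  by (rule has_vector_derivative_at_within, rule Ck_Suc_dest(1)[OF R fv w x])
 show ?thesis
  using vector_derivative_unique_within_closed_interval[of 0 e 0 "%t. dirder f v (x + t *R w)", unfolded cbox_interval, OF _ _ 4 3] e by simp
qed

text \<open>The power of \<open>t\<close> is there for the induction: moving \<open>x\<close> in
  direction \<open>v\<close> moves the evaluation point in direction \<open>v + t *R A v\<close>,
  and the second part carries an extra factor \<open>t\<close>. It is used with \<open>A\<close> the
  negative of the identity, for Hadamard's lemma, and with \<open>A\<close> along a single vector,
  for the difference quotients of Dunkl operators.\<close>

lemma Ck_integral:
 fixes f :: "'v::euclidean_space => 'w::banach"
 assumes E: "subspace E" and A: "bounded_linear A" "\<And>x. x : E ==> A x : E" and a: "a : E"
 shows "Ck_on k E E f ==> Ck_on k E E (%x. integral {0..1} (%t. t ^ j *R f (x + t *R (A x + a))))"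
proof (induction k arbitrary: f j)
 have inE: "x + t *R (A x + a) : E" if "x : E" for x t
  using that E A a by (intro subspace_add subspace_scale) auto
 have contf: "continuous_on (D \<times> cbox 0 1) (%(x, t). t ^ j *R f (h x + t *R (A (h x) + a)))"
  if "continuous_on E f" "continuous_on D h" "h ` D \<subseteq> E" for D and h :: "'d::topological_space => 'v" and f :: "'v => 'w" and j
  unfolding split_beta
  apply (intro continuous_intros)
  apply (rule continuous_on_compose2[OF that(1)])
  apply (intro continuous_intros bounded_linear.continuous_on[OF A(1)] continuous_on_compose2[OF that(2)])
  using that(3) inE by auto
 {
  case 0
  then have c: "continuous_on E f" by simp
  have "continuous_on E (%x. integral (cbox 0 1) (%t. t ^ j *R f (x + t *R (A x + a))))"
   by (rule integral_continuous_on_param) (use contf[OF c, of E "%x. x"] in simp)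
  then show ?case by simp
 next
  case (Suc k)
  have R: "relopen E E" using E by (rule relopen_self)
  have f1: "Ck_on (Suc 0) E E f" by (rule Ck_mono[OF Suc.prems]) simp
  have fc: "continuous_on E f" using Suc.prems Ck_continuous by blast
  let ?f' = "%v x. integral {0..1} (%t. t ^ j *R dirder f v (x + t *R (A x + a))) +
         integral {0..1} (%t. t ^ Suc j *R dirder f (A v) (x + t *R (A x + a)))"
  show ?case
  proof (rule Ck_SucI[where f'="?f'"])
   have "continuous_on E (%x. integral (cbox 0 1) (%t. t ^ j *R f (x + t *R (A x + a))))"
    by (rule integral_continuous_on_param) (use contf[OF fc, of E "%x. x"] in simp)
   then show "continuous_on E (%x. integral {0..1} (%t. t ^ j *R f (x + t *R (A x + a))))" by simp
   fix v assume v: "v : E"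
   then have Av: "A v : E" by (rule A(2))
   note dv = Ck_Suc_dest(2)[OF R Suc.prems v] and dAv = Ck_Suc_dest(2)[OF R Suc.prems Av]
   show "Ck_on k E E (?f' v)" by (intro Ck_add Suc.IH dv dAv)
   fix x assume x: "x : E"
   let ?h = "%s. x + s *R v"
   let ?p = "%s t. ?h s + t *R (A (?h s) + a)"
   have hE: "?h s : E" for s using x v E by (intro subspace_add subspace_scale)
   have hc: "continuous_on UNIV ?h" by (intro continuous_intros)
   have c1: "continuous_on (UNIV \<times> cbox 0 1) (%(s, t). t ^ j *R dirder f v (?p s t))"
    by (rule contf[OF Ck_continuous[OF dv] hc]) (use hE in auto)
   have c2: "continuous_on (UNIV \<times> cbox 0 1) (%(s, t). t ^ Suc j *R dirder f (A v) (?p s t))"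
    by (rule contf[OF Ck_continuous[OF dAv] hc]) (use hE in auto)
   have c3: "continuous_on (UNIV \<times> cbox 0 1) (%(s, t). t ^ j *R f (?p s t))"
    by (rule contf[OF fc hc]) (use hE in auto)
   have slice: "(%t. G s t) integrable_on cbox 0 1" 
    if "continuous_on (UNIV \<times> cbox 0 1) (%(s, t). G s t)" for G :: "real => real => 'w" and s
    by (rule integrable_continuous, rule continuous_on_compose2[OF that, of _ "%t. (s, t)", simplified])
      (auto intro!: continuous_intros)
   have "((%s. integral (cbox 0 1) (%t. t ^ j *R f (?p s t))) hvd
     integral (cbox 0 1) (%t. t ^ j *R dirder f v (?p 0 t) + t ^ Suc j *R dirder f (A v) (?p 0 t))) (at 0 within UNIV)"
   proof (rule leibniz_rule_vector_derivative)
    fix s t :: real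
    have eq: "?p s' t = x + t *R (A x + a) + s' *R (v + t *R A v)" for s'
     using bounded_linear.linear[OF A(1)] by (simp add: linear_add linear_cmul algebra_simps)
    have vE: "v + t *R A v : E" using v Av E by (intro subspace_add subspace_scale)
    have pE: "?p s t : E" using inE[OF hE] .
    have "((%s. f (x + t *R (A x + a) + s *R (v + t *R A v))) hvd dirder f (v + t *R A v) (?p s t)) (at s)"
     by (rule line_shift) (use Ck_Suc_dest(1)[OF R f1 vE pE] in \<open>simp only: eq\<close>)
    then have "((%s. f (?p s t)) hvd dirder f (v + t *R A v) (?p s t)) (at s)"
     by (simp only: eq)
    moreover have "dirder f (v + t *R A v) (?p s t) = dirder f v (?p s t) + t *R dirder f (A v) (?p s t)"
     using dirder_linear(1)[OF R f1 pE v, of "t *R A v"] dirder_linear(2)[OF R f1 pE Av, of t] Av E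
     by (simp add: subspace_scale)
    ultimately have "((%s. f (?p s t)) hvd
      dirder f v (?p s t) + t *R dirder f (A v) (?p s t)) (at s)" by (simp only:)
    then have "((%s. t ^ j *R f (?p s t)) hvd
      t ^ j *R (dirder f v (?p s t) + t *R dirder f (A v) (?p s t))) (at s)"
     by (rule bounded_linear.has_vector_derivative[OF bounded_linear_scaleR_right])
    then show "((%s. t ^ j *R f (?p s t)) hvd
      t ^ j *R dirder f v (?p s t) + t ^ Suc j *R dirder f (A v) (?p s t)) (at s within UNIV)"
     by (simp add: scaleR_add_right mult.commute)
   next
    show "(%t. t ^ j *R f (?p s t)) integrable_on cbox 0 1" for s
     by (rule slice[OF c3])
    show "continuous_on (UNIV \<times> cbox 0 1) (%(s, t). t ^ j *R dirder f v (?p s t) + t ^ Suc j *R dirder f (A v) (?p s t))"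
     using continuous_on_add[OF c1 c2] by (simp add: split_beta)
   qed auto
   then show "((%s. integral {0..1} (%t. t ^ j *R f (x + s *R v + t *R (A (x + s *R v) + a))))
      hvd ?f' v x) (at 0)"
    using integral_add[OF slice[OF c1, of 0] slice[OF c2, of 0]] by simp
  qed
 }
qed

section \<open>Smooth functions and their closure properties\<close>

lemma smooth_on_dirder: "relopen E S ==> smooth_on E S f ==> v : E ==> smooth_on E S (dirder f v)"
 unfolding smooth_on_def using Ck_Suc_dest(2) by blast

lemma smooth_on_Ck: "smooth_on E S f ==> Ck_on k E S f"
 by (simp add: smooth_on_def)

lemma smooth_on_deriv:
 "relopen E S ==> smooth_on E S f ==> v : E ==> x : S ==>
  ((%t. f (x + t *R v)) hvd dirder f v x) (at 0)"
 by (rule Ck_Suc_dest(1)[OF _ smooth_on_Ck])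

lemma smooth_on_cong: "relopen E S ==> (\<And>y. y : S ==> f y = g y) ==> smooth_on E S f ==> smooth_on E S g"
 unfolding smooth_on_def using Ck_cong by blast

lemma smooth_on_subset: "smooth_on E S f ==> T \<subseteq> S ==> smooth_on E T f"
 unfolding smooth_on_def using Ck_subset by blast

lemma smooth_on_const: "smooth_on E S (%_. c)"
 by (simp add: smooth_on_def Ck_const)

lemma smooth_on_add: "smooth_on E S f ==> smooth_on E S g ==> smooth_on E S (%x. f x + g x)"
 by (simp add: smooth_on_def Ck_add)

lemma smooth_on_sum: "(\<And>i. i : I ==> smooth_on E S (f i)) ==> smooth_on E S (%x. \<Sum>i\<in>I. f i x)"
 by (simp add: smooth_on_def Ck_sum)

lemma smooth_on_bilinear:
 "bounded_bilinear pr ==> smooth_on E S f ==> smooth_on E S g ==> smooth_on E S (%x. pr (f x) (g x))"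
 by (simp add: smooth_on_def Ck_bilinear)

lemmas smooth_on_scaleR = smooth_on_bilinear[OF bounded_bilinear_scaleR]
lemmas smooth_on_mult = smooth_on_bilinear[OF bounded_bilinear_mult]

lemma smooth_on_linear: "bounded_linear h ==> smooth_on E S f ==> smooth_on E S (%x. h (f x))"
 by (simp add: smooth_on_def Ck_bounded_linear)

lemma smooth_on_id_linear: "bounded_linear h ==> smooth_on E S h"
 by (simp add: smooth_on_def Ck_linear_id)

lemma smooth_on_minus: "smooth_on E S f ==> smooth_on E S (%x. - f x)"
 by (rule smooth_on_linear[OF bounded_linear_minus[OF bounded_linear_ident]])

lemma smooth_on_diff: "smooth_on E S f ==> smooth_on E S g ==> smooth_on E S (%x. f x - g x)"
 using smooth_on_add[of E S f "%x. - g x"] smooth_on_minus[of E S g] by simp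

lemma smooth_on_compose:
 fixes f :: "'v::euclidean_space => 'u::euclidean_space"
 assumes "relopen E S" "relopen E' S'" "smooth_on E S f" "f ` S \<subseteq> S'" "smooth_on E' S' g"
 shows "smooth_on E S (%x. g (f x))"
 unfolding smooth_on_def
 by (rule allI, rule Ck_compose[OF assms(1,2) smooth_on_Ck[OF assms(3)] assms(4) smooth_on_Ck[OF assms(5)]])

lemma smooth_on_local:
 assumes "relopen E S" "\<And>x. x : S ==> \<exists>T. x : T \<and> T \<subseteq> S \<and> relopen E T \<and> smooth_on E T f"
 shows "smooth_on E S f"
 unfolding smooth_on_def
proof
 fix k show "Ck_on k E S f"
 proof (rule Ck_local[OF assms(1)])
  fix x assume "x : S"
  from assms(2)[OF this] show "\<exists>T. x : T \<and> T \<subseteq> S \<and> relopen E T \<and> Ck_on k E T f"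
   by (elim exE conjE) (intro exI conjI smooth_on_Ck)
 qed
qed

lemma smooth_on_continuous: "smooth_on E S f ==> continuous_on S f"
 using Ck_continuous[OF smooth_on_Ck] .

lemma smooth_on_real_polynomial: "real_polynomial_function p ==> smooth_on E S p"
 by (induction rule: real_polynomial_function.induct)
   (auto intro: smooth_on_id_linear smooth_on_const smooth_on_add smooth_on_mult)

lemma smooth_on_polynomial:
 fixes p :: "'v::euclidean_space => 'w::euclidean_space"
 assumes "polynomial_function p"
 shows "smooth_on E S p"
proof -
 have "smooth_on E S (%x. \<Sum>b\<in>Basis. (p x \<bullet> b) *R b)"
 proof (intro smooth_on_sum smooth_on_scaleR smooth_on_const smooth_on_real_polynomial)
  fix b :: 'w
  have "bounded_linear (%x::'w. x \<bullet> b)" by (rule bounded_linear_inner_left)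
  then show "real_polynomial_function (%x. p x \<bullet> b)"
   using assms unfolding polynomial_function_def o_def by blast
 qed
 then show ?thesis by (simp add: euclidean_representation)
qed

section \<open>Bump functions\<close>

text \<open>The derivative of a member of this family is a linear combination of two others, so
  smoothness is a single induction over the order, for all \<open>n\<close> at once.\<close>

definition flat :: "nat => real => real"
 where "flat n t = (if t > 0 then exp (- (1 / t)) / t ^ n else 0)"

lemma flat_tendsto: "(flat n \<longlongrightarrow> 0) (at 0)"
proof -
 have "((%x::real. x ^ n / exp x) \<longlongrightarrow> 0) at_top" by (rule tendsto_power_div_exp_0)
 then have "((%t::real. inverse t ^ n / exp (inverse t)) \<longlongrightarrow> 0) (at_right 0)"
  using filterlim_compose filterlim_inverse_at_top_right by blast
 moreover have "\<forall>\<^sub>F t in at_right 0. inverse t ^ n / exp (inverse t) = flat n t"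
  by (auto simp: eventually_at_right_less flat_def eventually_at_filter exp_minus field_simps)
 ultimately have "(flat n \<longlongrightarrow> 0) (at_right 0)" by (rule Lim_transform_eventually)
 moreover have "(flat n \<longlongrightarrow> 0) (at_left 0)"
 proof (rule Lim_transform_eventually[OF tendsto_const])
  show "\<forall>\<^sub>F x in at_left 0. 0 = flat n x" by (auto simp: flat_def eventually_at_filter)
 qed
 ultimately show ?thesis by (simp add: filterlim_split_at_real)
qed

lemma flat_deriv: "(flat n has_real_derivative flat (n + 2) t - real n * flat (n + 1) t) (at t)"
proof (cases "t > 0")
 case True
 have "((%t. exp (- (1 / t)) / t ^ n) has_real_derivative flat (n + 2) t - real n * flat (n + 1) t) (at t)"
  using True
  by (auto intro!: derivative_eq_intros simp: flat_def field_simps power_add power2_eq_square)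
    (cases n, auto simp: field_simps)
 then show ?thesis
  by (rule has_field_derivative_transform_within_open[where S="{0<..}"]) (use True in \<open>auto simp: flat_def\<close>)
next
 case False
 show ?thesis
 proof (cases "t = 0")
  case True
  have "((%h. (flat n (0 + h) - flat n 0) / h) \<longlongrightarrow> 0) (at 0)"
   by (rule Lim_transform_eventually[OF flat_tendsto[of "Suc n"]])
     (auto simp: flat_def eventually_at_filter field_simps)
  then show ?thesis using True by (simp add: DERIV_def) (simp add: flat_def)
 next
  case False
  have "((%t. 0) has_real_derivative flat (n + 2) t - real n * flat (n + 1) t) (at t)"
   using \<open>\<not> t > 0\<close> by (simp add: flat_def)
  then show ?thesis
   by (rule has_field_derivative_transform_within_open[where S="{..<0}"]) (use False \<open>\<not> t > 0\<close> in \<open>auto simp: flat_def\<close>)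
 qed
qed

lemma smooth_on_flat: "smooth_on UNIV S (flat n)"
 unfolding smooth_on_def
proof
 fix k show "Ck_on k UNIV S (flat n)"
 proof (induction k arbitrary: n)
  case 0
  show ?case by (auto intro!: continuous_at_imp_continuous_on DERIV_isCont[OF flat_deriv])
 next
  case (Suc k)
  show ?case
  proof (rule Ck_SucI[where f'="%v t. v *R (flat (n + 2) t + (- real n) *R flat (n + 1) t)"])
   show "continuous_on S (flat n)"
    by (auto intro!: continuous_at_imp_continuous_on DERIV_isCont[OF flat_deriv])
   fix v :: real
   show "Ck_on k UNIV S (%t. v *R (flat (n + 2) t + (- real n) *R flat (n + 1) t))"
    by (intro Ck_bounded_linear[OF bounded_linear_scaleR_right] Ck_add Suc.IH)
   fix x :: real
   have "(((flat n) \<circ> (%t. x + t *R v)) hvd v *R (flat (n + 2) x - real n * flat (n + 1) x)) (at 0)"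
   proof (rule vector_diff_chain_at)
    show "((%t. x + t *R v) hvd v) (at 0)" by (rule line_vderiv)
    show "(flat n hvd (flat (n + 2) x - real n * flat (n + 1) x)) (at (x + 0 *R v))"
     using flat_deriv[of n x] by (simp add: has_real_derivative_iff_has_vector_derivative)
   qed
   then show "((%t. flat n (x + t *R v)) hvd v *R (flat (n + 2) x + (- real n) *R flat (n + 1) x)) (at 0)"
    by (simp add: o_def)
  qed
 qed
qed

text \<open>The value at the centre is exp (-1/r^2) rather than 1; a division normalises it where
  this matters.\<close>

definition bump :: "'v::euclidean_space => real => 'v => real"
 where "bump a r x = flat 0 (r\<^sup>2 - (x - a) \<bullet> (x - a))"

lemma smooth_on_bump:
 assumes "relopen E S"
 shows "smooth_on E S (bump a r)"
 unfolding bump_def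
proof (rule smooth_on_compose[OF assms relopen_self[OF subspace_UNIV], where f="%x. r\<^sup>2 - (x - a) \<bullet> (x - a)" and g="flat 0"])
 have "smooth_on E S (%x. x - a)"
  by (intro smooth_on_diff smooth_on_const smooth_on_id_linear bounded_linear_ident)
 from smooth_on_bilinear[OF bounded_bilinear_inner this this]
 show "smooth_on E S (%x. r\<^sup>2 - (x - a) \<bullet> (x - a))"
  by (intro smooth_on_diff smooth_on_const)
qed (auto intro: smooth_on_flat)

lemma bump_outside:
 assumes "r > 0" "dist x a \<ge> r"
 shows "bump a r x = 0"
proof -
 have "r\<^sup>2 \<le> (norm (x - a))\<^sup>2" using assms by (intro power_mono) (auto simp: dist_norm)
 then show ?thesis by (simp add: bump_def flat_def power2_norm_eq_inner)
qed

lemma bump_center: "r > 0 ==> bump a r a > 0"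
 by (auto simp: bump_def flat_def)

lemma smooth_on_Pair:
 fixes f :: "'u::euclidean_space => 'v::euclidean_space" and g :: "'u => 'w::euclidean_space"
 assumes "smooth_on E S f" "smooth_on E S g"
 shows "smooth_on E S (%x. (f x, g x))"
proof -
 have "smooth_on E S (%x. (f x, 0) + (0, g x))"
  by (intro smooth_on_add smooth_on_linear[OF _ assms(1)] smooth_on_linear[OF _ assms(2)]
     bounded_linear_Pair bounded_linear_ident bounded_linear_zero)
 then show ?thesis by simp
qed

lemma smooth_on_ident: "smooth_on E S (%x. x)"
 by (rule smooth_on_id_linear[OF bounded_linear_ident])

lemma smooth_on_slice2:
 assumes "relopen E S" "relopen E' S'" "smooth_on (E \<times> E') (S \<times> S') F" "u : S"
 shows "smooth_on E' S' (%v. F (u, v))"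
 by (rule smooth_on_compose[OF assms(2) relopen_Times[OF assms(1,2)] _ _ assms(3)])
   (use assms(4) in \<open>auto intro!: smooth_on_Pair smooth_on_const smooth_on_ident\<close>)

lemma smooth_on_slice1:
 assumes "relopen E S" "relopen E' S'" "smooth_on (E \<times> E') (S \<times> S') F" "v : S'"
 shows "smooth_on E S (%u. F (u, v))"
 by (rule smooth_on_compose[OF assms(1) relopen_Times[OF assms(1,2)] _ _ assms(3)])
   (use assms(4) in \<open>auto intro!: smooth_on_Pair smooth_on_const smooth_on_ident\<close>)

lemma relopen_preimage:
 assumes "relopen E S" "continuous_on S f" "open W"
 shows "relopen E {u : S. f u : W}"
proof -
 have "openin (top_of_set S) (S \<inter> f -` W)" by (rule continuous_openin_preimage_gen[OF assms(2,3)])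
 moreover have "S \<inter> f -` W = {u : S. f u : W}" by auto
 ultimately show ?thesis using assms(1) openin_trans by (metis relopen_def)
qed

section \<open>Lie groups in charts\<close>

locale lie_grp =
 fixes G :: "('a::{t2_space,second_countable_topology}, 'v::euclidean_space, 'z) lie_group_scheme"
 assumes lie: "is_lie_group G"
begin

abbreviation E where "E \<equiv> lie_alg G"
abbreviation mul (infixl "\<cdot>" 70) where "x \<cdot> y \<equiv> x \<otimes>\<^bsub>G\<^esub> y"
abbreviation one_G ("\<e>") where "\<e> \<equiv> \<one>\<^bsub>G\<^esub>"
abbreviation iv where "iv \<equiv> m_inv G"
abbreviation CG where "CG \<equiv> C_inf_group G"

lemma carrier_UNIV [simp]: "carrier G = UNIV"
 using lie by (simp add: is_lie_group_def)

sublocale group G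
 using lie by (simp add: is_lie_group_def)

lemma E_sub: "subspace E"
 using lie by (simp add: is_lie_group_def smooth_manifold_def)

lemma chart_facts:
 assumes "(U, ph) : charts G"
 shows "open U" "relopen E (ph ` U)" "homeomorphism U (ph ` U) ph (inv_into U ph)"
  "inj_on ph U" "continuous_on (ph ` U) (inv_into U ph)" "continuous_on U ph"
proof -
 show "open U" "relopen E (ph ` U)" and h: "homeomorphism U (ph ` U) ph (inv_into U ph)"
  using lie assms E_sub by (auto simp: is_lie_group_def smooth_manifold_def relopen_def)
 then show "inj_on ph U" "continuous_on (ph ` U) (inv_into U ph)" "continuous_on U ph"
  by (auto simp: homeomorphism_def intro: inj_on_inverseI)
qed

lemma chart_transition:
 "(U, ph) : charts G ==> (U', ph') : charts G ==> smooth_on E (ph ` (U \<inter> U')) (ph' \<circ> inv_into U ph)"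
 using lie by (auto simp: is_lie_group_def smooth_manifold_def)

lemma chart_exists: obtains U ph where "(U, ph) : charts G" "x : U"
proof -
 have "x : (\<Union>(U, ph)\<in>charts G. U)" using lie by (simp add: is_lie_group_def smooth_manifold_def)
 then show ?thesis using that by auto
qed

lemma chart_relopen:
 assumes "(U, ph) : charts G" "open W"
 shows "relopen E (ph ` (U \<inter> W))"
proof -
 note c = chart_facts[OF assms(1)]
 have "relopen E {u : ph ` U. inv_into U ph u : W}"
  by (rule relopen_preimage[OF c(2,5) assms(2)])
 moreover have "{u : ph ` U. inv_into U ph u : W} = ph ` (U \<inter> W)"
  using c(4) by auto
 ultimately show ?thesis by simp
qed

lemma CG_chart: "f : CG ==> (U, ph) : charts G ==> smooth_on E (ph ` U) (f \<circ> inv_into U ph)"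
 by (auto simp: C_inf_group_def)

lemma CG_localI:
 assumes "\<And>x. \<exists>U ph W. (U, ph) : charts G \<and> open W \<and> x : W \<and> W \<subseteq> U \<and> smooth_on E (ph ` W) (f \<circ> inv_into U ph)"
 shows "f : CG"
 unfolding C_inf_group_def
proof (clarify)
 fix U' ph' assume c': "(U', ph') : charts G"
 note f' = chart_facts[OF c']
 show "smooth_on E (ph' ` U') (f \<circ> inv_into U' ph')"
 proof (rule smooth_on_local[OF f'(2)])
  fix u assume "u : ph' ` U'"
  then obtain x where x: "x : U'" "u = ph' x" by auto
  obtain U ph W where c: "(U, ph) : charts G" "open W" "x : W" "W \<subseteq> U" "smooth_on E (ph ` W) (f \<circ> inv_into U ph)"
   using assms[of x] by (elim exE conjE)
  note f = chart_facts[OF c(1)]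
  let ?T = "ph' ` (U' \<inter> W)"
  have T: "relopen E ?T" by (rule chart_relopen[OF c'(1) c(2)])
  have W: "relopen E (ph ` W)" using chart_relopen[OF c(1,2)] c(4) by (simp add: Int_absorb1)
  have "smooth_on E ?T (%u. (f \<circ> inv_into U ph) ((ph \<circ> inv_into U' ph') u))"
  proof (rule smooth_on_compose[OF T W _ _ c(5)])
   show "smooth_on E ?T (ph \<circ> inv_into U' ph')"
    by (rule smooth_on_subset[OF chart_transition[OF c' c(1)]]) (use c(4) in auto)
   show "(ph \<circ> inv_into U' ph') ` ?T \<subseteq> ph ` W" using f'(4) by auto
  qed
  then have "smooth_on E ?T (f \<circ> inv_into U' ph')"
  proof (rule smooth_on_cong[OF T, rotated])
   fix y assume "y : ?T"
   then show "(f \<circ> inv_into U ph) ((ph \<circ> inv_into U' ph') y) = (f \<circ> inv_into U' ph') y"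
    using f(4) f'(4) c(4) by auto
  qed
  then show "\<exists>T. u : T \<and> T \<subseteq> ph' ` U' \<and> relopen E T \<and> smooth_on E T (f \<circ> inv_into U' ph')"
   using T x c(3) by (intro exI[of _ ?T]) auto
 qed
qed

lemma CG_const: "(%_. c) : CG"
 by (auto simp: C_inf_group_def o_def smooth_on_const)

lemma CG_add: "f : CG ==> g : CG ==> (%x. f x + g x) : CG"
 using smooth_on_add by (fastforce simp: C_inf_group_def o_def)

lemma CG_mult: "f : CG ==> g : CG ==> (%x. f x * g x) : CG"
 using smooth_on_mult by (fastforce simp: C_inf_group_def o_def)

lemma CG_scale: "f : CG ==> (%x. c * f x) : CG"
 by (rule CG_mult[OF CG_const])

lemma mult_continuous: "continuous_on UNIV (%(x, y). x \<cdot> y)"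
 using lie by (simp add: is_lie_group_def smooth_mult_def)

lemma mult_continuous_on:
 "continuous_on A f ==> continuous_on A g ==> continuous_on A (%x. f x \<cdot> g x)"
 using continuous_on_compose2[OF mult_continuous, of A "%x. (f x, g x)"]
 by (simp add: continuous_on_Pair)

text \<open>Rewrites the domain in \<open>smooth_mult\<close> as a preimage under the continuous
  multiplication; this shows that it is relatively open, as compositions require.\<close>

lemma mult_chart_smooth:
 assumes c: "(U, ph) : charts G" and c': "(U', ph') : charts G" and c'': "(U'', ph'') : charts G"
 defines "T \<equiv> {p : ph ` U \<times> ph' ` U'. inv_into U ph (fst p) \<cdot> inv_into U' ph' (snd p) : U''}"
 shows "relopen (E \<times> E) T"
  "smooth_on (E \<times> E) T (%p. ph'' (inv_into U ph (fst p) \<cdot> inv_into U' ph' (snd p)))"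
proof -
 note f = chart_facts[OF c] and f' = chart_facts[OF c'] and f'' = chart_facts[OF c'']
 show "relopen (E \<times> E) T" unfolding T_def
 proof (rule relopen_preimage[OF relopen_Times[OF f(2) f'(2)] _ f''(1)])
  show "continuous_on (ph ` U \<times> ph' ` U') (%p. inv_into U ph (fst p) \<cdot> inv_into U' ph' (snd p))"
   by (intro mult_continuous_on continuous_on_compose2[OF f(5)] continuous_on_compose2[OF f'(5)] continuous_intros) auto
 qed
 have "T = {(ph x, ph' y) |x y. x : U \<and> y : U' \<and> x \<cdot> y : U''}"
  unfolding T_def using f(4) f'(4) by fastforce
 moreover have "smooth_on (E \<times> E) {(ph x, ph' y) |x y. x : U \<and> y : U' \<and> x \<cdot> y : U''}
     (%(u, v). ph'' (inv_into U ph u \<cdot> inv_into U' ph' v))"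
 proof -
  have "smooth_mult G" using lie by (simp add: is_lie_group_def)
  note sm = conjunct2[OF this[unfolded smooth_mult_def]]
  show ?thesis by (rule bspec[OF bspec[OF bspec[OF sm c, unfolded prod.case] c', unfolded prod.case] c'', unfolded prod.case])
 qed
 ultimately show "smooth_on (E \<times> E) T (%p. ph'' (inv_into U ph (fst p) \<cdot> inv_into U' ph' (snd p)))"
 by (simp add: case_prod_unfold)
qed

lemma mult_smooth:
 assumes c: "(U, ph) : charts G" and c': "(U', ph') : charts G" and f: "f : CG"
 shows "smooth_on (E \<times> E) (ph ` U \<times> ph' ` U') (%p. f (inv_into U ph (fst p) \<cdot> inv_into U' ph' (snd p)))"
proof (rule smooth_on_local[OF relopen_Times[OF chart_facts(2)[OF c] chart_facts(2)[OF c']]])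
 fix p assume p: "p : ph ` U \<times> ph' ` U'"
 let ?m = "%p. inv_into U ph (fst p) \<cdot> inv_into U' ph' (snd p)"
 obtain U'' ph'' where c'': "(U'', ph'') : charts G" "?m p : U''" by (rule chart_exists)
 let ?T = "{p : ph ` U \<times> ph' ` U'. ?m p : U''}"
 note T = mult_chart_smooth[OF c c' c''(1)] and f'' = chart_facts[OF c''(1)]
 have "smooth_on (E \<times> E) ?T (%p. (f \<circ> inv_into U'' ph'') (ph'' (?m p)))"
  by (rule smooth_on_compose[OF T(1) f''(2) T(2) _ CG_chart[OF f c''(1)]]) auto
 then have "smooth_on (E \<times> E) ?T (%p. f (?m p))"
  by (rule smooth_on_cong[OF T(1), rotated]) (use f''(4) in auto)
 then show "\<exists>T. p : T \<and> T \<subseteq> ph ` U \<times> ph' ` U' \<and> relopen (E \<times> E) T \<and> smooth_on (E \<times> E) T (%p. f (?m p))"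
  using T(1) p c''(2) by (intro exI[of _ ?T]) auto
qed

text \<open>The product of the first two factors is read in a chart around it, which reduces the
  claim to \<open>mult_smooth\<close>. Three factors occur when conjugations are differentiated,
  where both outer factors vary.\<close>

lemma mult3_smooth:
 assumes c: "(U, ph) : charts G" and c': "(U', ph') : charts G" and c3: "(U3, ph3) : charts G" and f: "f : CG"
 shows "smooth_on ((E \<times> E) \<times> E) ((ph ` U \<times> ph' ` U') \<times> ph3 ` U3)
  (%q. f (inv_into U ph (fst (fst q)) \<cdot> inv_into U' ph' (snd (fst q)) \<cdot> inv_into U3 ph3 (snd q)))"
proof (rule smooth_on_local[OF relopen_Times[OF relopen_Times[OF chart_facts(2)[OF c] chart_facts(2)[OF c']] chart_facts(2)[OF c3]]])
 fix q assume q: "q : (ph ` U \<times> ph' ` U') \<times> ph3 ` U3"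
 let ?m = "%p. inv_into U ph (fst p) \<cdot> inv_into U' ph' (snd p)"
 let ?F = "%q. f (?m (fst q) \<cdot> inv_into U3 ph3 (snd q))"
 obtain U'' ph'' where c'': "(U'', ph'') : charts G" "?m (fst q) : U''" by (rule chart_exists)
 let ?T = "{p : ph ` U \<times> ph' ` U'. ?m p : U''}"
 note T = mult_chart_smooth[OF c c' c''(1)] and f'' = chart_facts[OF c''(1)] and f3 = chart_facts[OF c3]
 have T2: "relopen ((E \<times> E) \<times> E) (?T \<times> ph3 ` U3)" by (rule relopen_Times[OF T(1) f3(2)])
 have "smooth_on ((E \<times> E) \<times> E) (?T \<times> ph3 ` U3)
  (%q. f (inv_into U'' ph'' (fst (ph'' (?m (fst q)), snd q)) \<cdot> inv_into U3 ph3 (snd (ph'' (?m (fst q)), snd q))))"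
 proof (rule smooth_on_compose[OF T2 relopen_Times[OF f''(2) f3(2)] _ _ mult_smooth[OF c''(1) c3 f]])
  have "smooth_on ((E \<times> E) \<times> E) (?T \<times> ph3 ` U3) (%q. ph'' (?m (fst q)))"
   by (rule smooth_on_compose[OF T2 T(1) _ _ T(2)]) (auto intro: smooth_on_id_linear bounded_linear_fst)
  then show "smooth_on ((E \<times> E) \<times> E) (?T \<times> ph3 ` U3) (%q. (ph'' (?m (fst q)), snd q))"
   by (rule smooth_on_Pair) (rule smooth_on_id_linear[OF bounded_linear_snd])
 qed auto
 then have "smooth_on ((E \<times> E) \<times> E) (?T \<times> ph3 ` U3) ?F"
  by (rule smooth_on_cong[OF T2, rotated]) (use f''(4) in auto)
 then show "\<exists>T. q : T \<and> T \<subseteq> (ph ` U \<times> ph' ` U') \<times> ph3 ` U3 \<and> relopen ((E \<times> E) \<times> E) T \<and> smooth_on ((E \<times> E) \<times> E) T ?F"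
  using T2 q c''(2) by (intro exI[of _ "?T \<times> ph3 ` U3"]) auto
qed

lemma CG_left: assumes "f : CG" shows "(%y. f (x \<cdot> y)) : CG"
 unfolding C_inf_group_def
proof (clarify)
 fix U' ph' assume c': "(U', ph') : charts G"
 obtain U ph where c: "(U, ph) : charts G" "x : U" by (rule chart_exists)
 have "smooth_on E (ph' ` U') (%v. f (inv_into U ph (fst (ph x, v)) \<cdot> inv_into U' ph' (snd (ph x, v))))"
  by (rule smooth_on_slice2[OF chart_facts(2)[OF c(1)] chart_facts(2)[OF c'] mult_smooth[OF c(1) c' assms]]) (use c in auto)
 then show "smooth_on E (ph' ` U') ((%y. f (x \<cdot> y)) \<circ> inv_into U' ph')"
  using c chart_facts(4)[OF c(1)] by (simp add: o_def)
qed

lemma CG_right: assumes "f : CG" shows "(%y. f (y \<cdot> x)) : CG"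
 unfolding C_inf_group_def
proof (clarify)
 fix U' ph' assume c': "(U', ph') : charts G"
 obtain U ph where c: "(U, ph) : charts G" "x : U" by (rule chart_exists)
 have "smooth_on E (ph' ` U') (%v. f (inv_into U' ph' (fst (v, ph x)) \<cdot> inv_into U ph (snd (v, ph x))))"
  by (rule smooth_on_slice1[OF chart_facts(2)[OF c'] chart_facts(2)[OF c(1)] mult_smooth[OF c' c(1) assms]]) (use c in auto)
 then show "smooth_on E (ph' ` U') ((%y. f (y \<cdot> x)) \<circ> inv_into U' ph')"
  using c chart_facts(4)[OF c(1)] by (simp add: o_def)
qed

lemma CG_conj: assumes "f : CG" shows "(%y. f (g \<cdot> y \<cdot> h)) : CG"
 using CG_left[OF CG_right[OF assms, of h], of g] .

section \<open>The chart at the identity and global test functions\<close>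

definition chart1 where "chart1 = (SOME c. c : charts G \<and> \<e> : fst c)"
definition U1 where "U1 = fst chart1"
definition ph1 where "ph1 = snd chart1"
definition ps1 where "ps1 = inv_into U1 ph1"
definition e1 where "e1 = ph1 \<e>"
definition S1 where "S1 = ph1 ` U1"

lemma chart1: "(U1, ph1) : charts G" "\<e> : U1"
proof -
 obtain U ph where "(U, ph) : charts G" "\<e> : U" by (rule chart_exists)
 then have "\<exists>c. c : charts G \<and> \<e> : fst c" by force
 from someI_ex[OF this] show "(U1, ph1) : charts G" "\<e> : U1"
  by (auto simp: U1_def ph1_def chart1_def)
qed

lemma chart1_facts:
 "open U1" "relopen E S1" "continuous_on S1 ps1" "continuous_on U1 ph1" "e1 : S1" "e1 : E" "ps1 e1 = \<e>"
 "x : U1 ==> ps1 (ph1 x) = x" "u : S1 ==> ph1 (ps1 u) = u" "u : S1 ==> ps1 u : U1" "x : U1 ==> ph1 x : S1"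
proof -
 note f = chart_facts[OF chart1(1)]
 show "open U1" "relopen E S1" "continuous_on S1 ps1" "continuous_on U1 ph1" and "e1 : S1"
   and "x : U1 ==> ps1 (ph1 x) = x" and "u : S1 ==> ph1 (ps1 u) = u" "u : S1 ==> ps1 u : U1"
   and "x : U1 ==> ph1 x : S1" and "ps1 e1 = \<e>"
  using f chart1(2) by (auto simp: S1_def ps1_def e1_def f_inv_into_f inv_into_into)
 then show "e1 : E" using relopen_subset by blast
qed

lemma CG_chart1: "f : CG ==> smooth_on E S1 (%u. f (ps1 u))"
 using CG_chart[OF _ chart1(1)] by (simp add: S1_def ps1_def o_def)

lemma small_radius:
 obtains r where "r > 0" "E \<inter> cball e1 r \<subseteq> S1"
proof -
 obtain e where e: "e > 0" "\<And>y. y : E ==> dist y e1 < e ==> y : S1"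
  using relopen_ball[OF chart1_facts(2,5)] by blast
 show ?thesis by (rule that[of "e/2"]) (use e in \<open>auto simp: dist_commute\<close>)
qed

text \<open>The delicate points are those outside \<open>U1\<close>: near them the function
  vanishes, because the image of the closed ball is compact, hence closed in the Hausdorff
  group.\<close>

lemma CG_extend:
 fixes u :: "'v => real"
 assumes r: "r > 0" "E \<inter> cball e1 r \<subseteq> S1" and u: "smooth_on E E u" "\<And>x. x : E ==> dist x e1 \<ge> r ==> u x = 0"
 shows "(%x. if x : U1 then u (ph1 x) else 0) : CG"
proof (rule CG_localI)
 fix x
 let ?f = "%x. if x : U1 then u (ph1 x) else 0"
 let ?C = "ps1 ` (E \<inter> cball e1 r)"
 have "compact ?C"
  by (rule compact_continuous_image) (use continuous_on_subset[OF chart1_facts(3) r(2)] closed_subspace[OF E_sub] in auto)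
 then have C: "closed ?C" by (rule compact_imp_closed)
 show "\<exists>U ph W. (U, ph) : charts G \<and> open W \<and> x : W \<and> W \<subseteq> U \<and> smooth_on E (ph ` W) (?f \<circ> inv_into U ph)"
 proof (cases "x : U1")
  case True
  have "smooth_on E S1 u" by (rule smooth_on_subset[OF u(1)]) (use relopen_subset chart1_facts(2) in blast)
  then have "smooth_on E S1 (?f \<circ> ps1)"
   by (rule smooth_on_cong[OF chart1_facts(2), rotated]) (auto simp: chart1_facts)
  then show ?thesis using chart1 chart1_facts(1) True
   by (intro exI[of _ U1] exI[of _ ph1]) (auto simp: S1_def ps1_def)
 next
  case False
  obtain U ph where c: "(U, ph) : charts G" "x : U" by (rule chart_exists)
  note f = chart_facts[OF c(1)]
  let ?W = "U \<inter> - ?C"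
  have "x \<notin> ?C" using False chart1_facts(10) r(2) by auto
  have f0: "?f y = 0" if "y \<notin> ?C" for y
  proof (cases "y : U1")
   case True
   have "ph1 y : E" using chart1_facts(2,11) True relopen_subset by blast
   moreover have "ph1 y \<notin> cball e1 r"
    using that chart1_facts(8)[OF True] \<open>ph1 y : E\<close> by (metis IntI imageI)
   ultimately show ?thesis using u(2)[of "ph1 y"] by (auto simp: dist_commute)
  qed simp
  have "relopen E (ph ` ?W)" by (rule chart_relopen[OF c(1)]) (use C in auto)
  then have "smooth_on E (ph ` ?W) (?f \<circ> inv_into U ph)"
  proof (rule smooth_on_cong[OF _ _ smooth_on_const[of _ _ 0]])
   fix y assume "y : ph ` ?W"
   then obtain z where "z : ?W" "y = ph z" by blast
   then have inv: "inv_into U ph y = z" using f(4) by auto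
   have "?f z = 0" by (rule f0) (use \<open>z : ?W\<close> in blast)
   then show "0 = (?f \<circ> inv_into U ph) y" by (simp only: o_def inv)
  qed
  then show ?thesis using c f(1) C \<open>x \<notin> ?C\<close> by (intro exI[of _ U] exI[of _ ph] exI[of _ ?W]) auto
 qed
qed

text \<open>A linear chart coordinate, cut off by a normalised bump. The factorisation through
  \<open>h\<close> is recorded because division by \<open>h\<close> recovers the bare coordinate
  near the identity.\<close>

lemma coordinate_function:
 "\<exists>f h. f : CG \<and> f \<e> = 0 \<and> (\<forall>v\<in>E. dirder (%u. f (ps1 u)) v e1 = v \<bullet> w) \<and>
  (\<forall>x\<in>U1. f x = ((ph1 x - e1) \<bullet> w) * h (ph1 x)) \<and> continuous_on UNIV h \<and> h e1 = (1::real)"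
proof -
 obtain r where r: "r > 0" "E \<inter> cball e1 r \<subseteq> S1" by (rule small_radius)
 let ?h = "%x. bump e1 r x / bump e1 r e1"
 let ?u = "%x. ((x - e1) \<bullet> w) * ?h x"
 let ?f = "%x. if x : U1 then ?u (ph1 x) else 0"
 have b: "bump e1 r e1 > 0" using r(1) by (rule bump_center)
 have hs: "smooth_on F T ?h" if "relopen F T" for F T
  using smooth_on_linear[OF bounded_linear_mult_left smooth_on_bump[OF that]] by (simp add: divide_inverse)
 have us: "smooth_on E E ?u"
  by (intro smooth_on_mult hs relopen_self[OF E_sub] smooth_on_linear[OF bounded_linear_inner_left] smooth_on_diff smooth_on_const smooth_on_ident)
 have fC: "?f : CG" by (rule CG_extend[OF r us]) (simp add: bump_outside r)
 show ?thesis
 proof (intro exI[of _ ?f] exI[of _ ?h] conjI ballI fC)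
  show "?f \<e> = 0" by (simp add: e1_def)
  show "continuous_on UNIV ?h" using smooth_on_continuous[OF hs[OF relopen_self[OF subspace_UNIV]]] .
  show "?h e1 = 1" using b by simp
  fix v assume v: "v : E"
  have "dirder (%u. ?f (ps1 u)) v e1 = dirder ?u v e1"
   by (rule dirder_cong[OF chart1_facts(2,5) v]) (simp add: chart1_facts)
  also have "\<dots> = v \<bullet> w"
  proof -
   have d1: "((%t. (e1 + t *R v - e1) \<bullet> w) hvd v \<bullet> w) (at 0)"
    by (rule bounded_linear.has_vector_derivative[OF bounded_linear_inner_left])
      (use line_vderiv[of 0 v] in simp)
   have d2: "((%t. ?h (e1 + t *R v)) hvd dirder ?h v e1) (at 0)"
    by (rule smooth_on_deriv[OF relopen_self[OF E_sub] hs[OF relopen_self[OF E_sub]] v chart1_facts(6)])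
   have "((%t. ?u (e1 + t *R v)) hvd ((e1 + 0 *R v - e1) \<bullet> w) * dirder ?h v e1 + (v \<bullet> w) * ?h (e1 + 0 *R v)) (at 0)"
    by (rule has_vector_derivative_mult[OF d1 d2])
   then have "((%t. ?u (e1 + t *R v)) hvd v \<bullet> w) (at 0)" using b by simp
   then show ?thesis unfolding dirder_def by (rule vector_derivative_at)
  qed
  finally show "dirder (%u. ?f (ps1 u)) v e1 = v \<bullet> w" .
 qed auto
qed

lemma CG_separates:
 assumes "\<And>f. f : CG ==> f x = f y"
 shows "x = y"
proof (rule ccontr)
 assume ne: "x \<noteq> y"
 define c where "c = iv x \<cdot> y"
 have ce: "c \<noteq> \<e>"
  using ne by (metis UNIV_I c_def carrier_UNIV inv_solve_left r_one)
 obtain r0 where r0: "r0 > 0" "E \<inter> cball e1 r0 \<subseteq> S1" by (rule small_radius)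
 \<comment> \<open>If \<open>c\<close> lies in the chart, the radius is at most its distance from
   \<open>e1\<close> there, so the bump at the identity vanishes at \<open>c\<close>.\<close>
 define r where "r = (if c : U1 then min r0 (dist (ph1 c) e1) else r0)"
 have "ph1 c \<noteq> e1" if "c : U1" using that ce chart1_facts(7,8) by metis
 then have r: "r > 0" "E \<inter> cball e1 r \<subseteq> S1" using r0 by (auto simp: r_def)
 let ?f = "%x. if x : U1 then bump e1 r (ph1 x) else 0"
 have "?f : CG"
  by (rule CG_extend[OF r smooth_on_bump[OF relopen_self[OF E_sub]]]) (simp add: bump_outside r)
 from assms[OF CG_left[OF this, of "iv x"]]
 have "?f (iv x \<cdot> x) = ?f c" by (simp add: c_def)
 moreover have "?f (iv x \<cdot> x) > 0" using bump_center[OF r(1)] chart1(2) by (simp add: e1_def)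
 moreover have "?f c = 0"
  by (auto simp: r_def intro!: bump_outside) (use r in \<open>auto simp: r_def\<close>)
 ultimately show False by simp
qed

end

context lie_grp
begin

section \<open>Tangent vectors as chart derivatives at the identity\<close>

definition Dl :: "'v => ('a => real) => real" where "Dl v f = dirder (%u. f (ps1 u)) v e1"

lemma Dl_deriv:
 assumes "f : CG" "v : E"
 shows "((%t. f (ps1 (e1 + t *R v))) hvd Dl v f) (at 0)"
 unfolding Dl_def by (rule smooth_on_deriv[OF chart1_facts(2) CG_chart1[OF assms(1)] assms(2) chart1_facts(5)])

lemma Dl_eqI:
 assumes "((%t. f (ps1 (e1 + t *R v))) hvd d) (at 0)"
 shows "Dl v f = d"
 unfolding Dl_def dirder_def using assms by (rule vector_derivative_at)

lemma Dl_derivation: assumes v: "v : E" shows "point_derivation G (Dl v)"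
 unfolding point_derivation_def
proof (intro conjI ballI allI)
 fix f g assume f: "f : CG" and g: "g : CG"
 show "Dl v (%x. f x + g x) = Dl v f + Dl v g"
  by (rule Dl_eqI, rule has_vector_derivative_add[OF Dl_deriv[OF f v] Dl_deriv[OF g v]])
 have "((%t. f (ps1 (e1 + t *R v)) * g (ps1 (e1 + t *R v))) hvd
   f (ps1 (e1 + 0 *R v)) * Dl v g + Dl v f * g (ps1 (e1 + 0 *R v))) (at 0)"
  by (rule has_vector_derivative_mult[OF Dl_deriv[OF f v] Dl_deriv[OF g v]])
 from Dl_eqI[OF this] show "Dl v (%x. f x * g x) = f \<e> * Dl v g + g \<e> * Dl v f"
  by (simp add: chart1_facts)
next
 fix f c assume f: "f : CG"
 show "Dl v (%x. c * f x) = c * Dl v f"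
  by (rule Dl_eqI, rule bounded_linear.has_vector_derivative[OF bounded_linear_mult_right Dl_deriv[OF f v]])
qed

lemma Dl_add: "v : E ==> w : E ==> f : CG ==> Dl (v + w) f = Dl v f + Dl w f"
 unfolding Dl_def by (rule dirder_linear(1)[OF chart1_facts(2) smooth_on_Ck[OF CG_chart1] chart1_facts(5)])

lemma Dl_scale: "v : E ==> f : CG ==> Dl (c *R v) f = c * Dl v f"
 unfolding Dl_def using dirder_linear(2)[OF chart1_facts(2) smooth_on_Ck[OF CG_chart1] chart1_facts(5)] by simp

lemma Dl_sep: assumes "v : E" "\<And>f. f : CG ==> Dl v f = 0" shows "v = 0"
proof -
 obtain f h where f: "f : CG" "\<forall>v'\<in>E. dirder (%u. f (ps1 u)) v' e1 = v' \<bullet> v"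
  using coordinate_function[of v] by (elim exE conjE)
 have "v \<bullet> v = 0" using bspec[OF f(2) assms(1)] assms(2)[OF f(1)] by (simp add: Dl_def)
 then show ?thesis by simp
qed

lemma tangent_derivation: "X : E ==> point_derivation G (tangent G X)"
 using lie by (simp add: is_lie_group_def)

lemma tan_add: "X : E ==> f : CG ==> g : CG ==> tangent G X (%x. f x + g x) = tangent G X f + tangent G X g"
 using tangent_derivation by (simp add: point_derivation_def)

lemma tan_scale: "X : E ==> f : CG ==> tangent G X (%x. c * f x) = c * tangent G X f"
 using tangent_derivation by (simp add: point_derivation_def)

lemma tan_mult: "X : E ==> f : CG ==> g : CG ==>
  tangent G X (%x. f x * g x) = f \<e> * tangent G X g + g \<e> * tangent G X f"
 using tangent_derivation by (simp add: point_derivation_def)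

lemma tan_diff: "X : E ==> f : CG ==> g : CG ==> tangent G X (%x. f x - g x) = tangent G X f - tangent G X g"
 using tan_add[of X f "%x. - 1 * g x"] tan_scale[of X g "-1"] CG_scale[of g "-1"] by simp

lemma tangent_add: "X : E ==> Y : E ==> f : CG ==> tangent G (X + Y) f = tangent G X f + tangent G Y f"
 using lie by (simp add: is_lie_group_def)

lemma tangent_scale: "X : E ==> f : CG ==> tangent G (c *R X) f = c * tangent G X f"
 using lie by (simp add: is_lie_group_def)

lemma tangent_ex1: "point_derivation G D ==> \<exists>!X. X : E \<and> (\<forall>f\<in>CG. tangent G X f = D f)"
 using lie by (simp add: is_lie_group_def)

lemma tangent_ext:
 assumes "X : E" "Y : E" "\<And>f. f : CG ==> tangent G X f = tangent G Y f"
 shows "X = Y"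
proof -
 have "\<exists>!Z. Z : E \<and> (\<forall>f\<in>CG. tangent G Z f = tangent G X f)"
  by (rule tangent_ex1[OF tangent_derivation[OF assms(1)]])
 then show ?thesis using assms by metis
qed

lemma tangent_neg: "X : E ==> f : CG ==> tangent G (- X) f = - tangent G X f"
 using tangent_scale[of X f "-1"] by simp

lemma tangent_zero: "f : CG ==> tangent G 0 f = 0"
 using tangent_scale[of 0 f 0] subspace_0[OF E_sub] by simp

text \<open>Chart derivatives at the identity are point derivations, so each belongs to a unique
  element of the Lie algebra.\<close>

definition kap :: "'v => 'v" where "kap v = (THE X. X : E \<and> (\<forall>f\<in>CG. tangent G X f = Dl v f))"

lemma kap: assumes "v : E" shows "kap v : E" "f : CG ==> tangent G (kap v) f = Dl v f"
 using theI'[OF tangent_ex1[OF Dl_derivation[OF assms]]] by (auto simp: kap_def)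

lemma kap_linear: "linear (%v. kap (prj E v))"
proof (rule linearI)
 fix v w
 have p: "prj E v : E" "prj E w : E" by (auto intro: prj_in E_sub)
 note kp = kap[OF p(1)] kap[OF p(2)]
 have "kap (prj E v + prj E w) = kap (prj E v) + kap (prj E w)"
  using p kp subspace_add[OF E_sub] kap[OF subspace_add[OF E_sub p]]
  by (intro tangent_ext) (auto simp: tangent_add Dl_add)
 then show "kap (prj E (v + w)) = kap (prj E v) + kap (prj E w)" by (simp add: linear_add[OF prj_linear])
 fix c
 have "kap (c *R prj E v) = c *R kap (prj E v)"
  using p kp subspace_scale[OF E_sub] kap[OF subspace_scale[OF E_sub p(1), of c]]
  by (intro tangent_ext) (auto simp: tangent_scale Dl_scale)
 then show "kap (prj E (c *R v)) = c *R kap (prj E v)" by (simp add: linear_cmul[OF prj_linear])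
qed

text \<open>\<open>E\<close> is both the model space and the Lie algebra, so the injective linear
  map \<open>kap\<close> is onto by dimension. Hence every tangent vector is a chart
  derivative.\<close>

lemma kap_surj: assumes "X : E" obtains v where "v : E" "kap v = X"
proof -
 let ?k = "%v. kap (prj E v)"
 note lin = kap_linear
 have "inj_on ?k E"
 proof (rule inj_onI)
  fix v w assume vw: "v : E" "w : E" "?k v = ?k w"
  have "?k (v - w) = 0" using linear_diff[OF lin, of v w] vw(3) by simp
  moreover have d: "v - w : E" using vw E_sub by (simp add: subspace_diff)
  ultimately have "kap (v - w) = 0" by (simp add: prj_id[OF E_sub])
  then have "v - w = 0" using Dl_sep[OF d] kap(2)[OF d] tangent_zero by metis
  then show "v = w" by simp
 qed
 then have "dim (?k ` E) = dim E"
  using dim_image_eq[OF lin, of E] by (simp only: span_eq_iff[THEN iffD2, OF E_sub])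
 moreover have "?k ` E \<subseteq> E" using kap(1) prj_in[OF E_sub] by auto
 ultimately have "?k ` E = E"
  using subspace_dim_equal[OF linear_subspace_image[OF lin E_sub] E_sub] by simp
 then obtain v where "v : E" "X = ?k v" using assms by auto
 then show ?thesis using that by (simp add: prj_id[OF E_sub])
qed

text \<open>The inverse of \<open>kap\<close>: the coordinates of a Lie algebra element in the chart
  at the identity.\<close>

definition xi :: "'v => 'v" where "xi X = (SOME v. v : E \<and> kap v = X)"

lemma xi: assumes "X : E" shows "xi X : E" "kap (xi X) = X" "f : CG ==> tangent G X f = Dl (xi X) f"
proof -
 obtain v where "v : E \<and> kap v = X" using kap_surj[OF assms] by metis
 then have "xi X : E \<and> kap (xi X) = X" unfolding xi_def by (rule someI)
 then show "xi X : E" "kap (xi X) = X" "f : CG ==> tangent G X f = Dl (xi X) f"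
  using kap(2)[of "xi X" f] by auto
qed

section \<open>Invariant vector fields and the bracket\<close>

lemma left_field_at_one: "left_field G X f \<e> = tangent G X f"
 by (simp add: left_field_def)

lemma left_field_translate: "left_field G Y (%z. f (x \<cdot> z)) z = left_field G Y f (x \<cdot> z)"
 by (simp add: left_field_def m_assoc)

text \<open>A partial derivative of a smooth function of three factors, hence smooth in the outer
  two. With one outer factor trivial it covers left and right invariant fields, with both varying it
  covers \<open>Ad\<close>.\<close>

lemma field3_smooth:
 assumes Y: "Y : E" and f: "f : CG" and c: "(U, ph) : charts G" and c': "(U', ph') : charts G"
 shows "smooth_on (E \<times> E) (ph ` U \<times> ph' ` U')
  (%p. tangent G Y (%z. f (inv_into U ph (fst p) \<cdot> z \<cdot> inv_into U' ph' (snd p))))"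
proof -
 let ?F = "%q. f (inv_into U ph (fst (fst q)) \<cdot> inv_into U1 ph1 (snd (fst q)) \<cdot> inv_into U' ph' (snd q))"
 note f1 = chart_facts(2)[OF c] chart_facts(2)[OF c'] chart_facts(2)[OF chart1(1)]
 have R: "relopen ((E \<times> E) \<times> E) ((ph ` U \<times> ph1 ` U1) \<times> ph' ` U')" by (intro relopen_Times f1)
 have z: "0 : E" by (rule subspace_0[OF E_sub])
 have "smooth_on ((E \<times> E) \<times> E) ((ph ` U \<times> ph1 ` U1) \<times> ph' ` U') (dirder ?F ((0, xi Y), 0))"
  by (rule smooth_on_dirder[OF R mult3_smooth[OF c chart1(1) c' f]]) (use xi[OF Y] z in auto)
 then have "smooth_on (E \<times> E) (ph ` U \<times> ph' ` U') (%p. dirder ?F ((0, xi Y), 0) ((fst p, e1), snd p))"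
  by (rule smooth_on_compose[OF relopen_Times[OF f1(1,2)] R, rotated 2])
    (use chart1_facts(5) in \<open>auto simp: S1_def intro!: smooth_on_Pair smooth_on_const smooth_on_id_linear[OF bounded_linear_fst] smooth_on_id_linear[OF bounded_linear_snd]\<close>)
 moreover have "dirder ?F ((0, xi Y), 0) ((fst p, e1), snd p) =
   tangent G Y (%z. f (inv_into U ph (fst p) \<cdot> z \<cdot> inv_into U' ph' (snd p)))" for p
  unfolding xi(3)[OF Y CG_conj[OF f]] Dl_def dirder_def by (simp add: ps1_def)
 ultimately show ?thesis by simp
qed

lemma left_field_CG: assumes Y: "Y : E" and f: "f : CG" shows "left_field G Y f : CG"
 unfolding C_inf_group_def
proof (clarify)
 fix U ph assume c: "(U, ph) : charts G"
 have "smooth_on E (ph ` U) (%u. tangent G Y (%z. f (inv_into U ph (fst (u, e1)) \<cdot> z \<cdot> inv_into U1 ph1 (snd (u, e1)))))"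
  by (rule smooth_on_slice1[OF chart_facts(2)[OF c] chart_facts(2)[OF chart1(1)] field3_smooth[OF Y f c chart1(1)]])
   (use chart1_facts(5) in \<open>simp add: S1_def\<close>)
 then show "smooth_on E (ph ` U) (left_field G Y f \<circ> inv_into U ph)"
  using chart1_facts(7) by (simp add: left_field_def o_def ps1_def)
qed

lemma right_field_CG: assumes Y: "Y : E" and f: "f : CG" shows "(%x. tangent G Y (%z. f (z \<cdot> x))) : CG"
 unfolding C_inf_group_def
proof (clarify)
 fix U ph assume c: "(U, ph) : charts G"
 have "smooth_on E (ph ` U) (%u. tangent G Y (%z. f (inv_into U1 ph1 (fst (e1, u)) \<cdot> z \<cdot> inv_into U ph (snd (e1, u)))))"
  by (rule smooth_on_slice2[OF chart_facts(2)[OF chart1(1)] chart_facts(2)[OF c] field3_smooth[OF Y f chart1(1) c]])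
   (use chart1_facts(5) in \<open>simp add: S1_def\<close>)
 then show "smooth_on E (ph ` U) ((%x. tangent G Y (%z. f (z \<cdot> x))) \<circ> inv_into U ph)"
  using chart1_facts(7) by (simp add: o_def ps1_def)
qed

text \<open>Symmetry of second derivatives, applied to the two factors of
  \<open>f (z \<cdot> y)\<close>. It lets the right invariant field in the derivative of
  \<open>Ad\<close> be traded for a left invariant one.\<close>

lemma tangent_commute:
 assumes X: "X : E" and Y: "Y : E" and f: "f : CG"
 shows "tangent G X (%z. tangent G Y (%y. f (z \<cdot> y))) = tangent G Y (%y. tangent G X (%z. f (z \<cdot> y)))"
proof -
 let ?F = "%p. f (ps1 (fst p) \<cdot> ps1 (snd p))"
 let ?v = "(xi X, 0::'v)" and ?w = "(0::'v, xi Y)"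
 have R: "relopen (E \<times> E) (S1 \<times> S1)" by (intro relopen_Times chart1_facts)
 have F: "smooth_on (E \<times> E) (S1 \<times> S1) ?F"
  using mult_smooth[OF chart1(1) chart1(1) f] by (simp add: S1_def ps1_def)
 have z: "0 : E" by (rule subspace_0[OF E_sub])
 have lf: "(%z. tangent G Y (%y. f (z \<cdot> y))) : CG" using left_field_CG[OF Y f] by (simp add: left_field_def)
 have "dirder (dirder ?F ?w) ?v (e1, e1) = dirder (dirder ?F ?v) ?w (e1, e1)"
  by (rule dirder_commute[OF R smooth_on_Ck[OF F]]) (use xi X Y z chart1_facts in auto)
 moreover have "dirder (dirder ?F ?w) ?v (e1, e1) = tangent G X (%z. tangent G Y (%y. f (z \<cdot> y)))"
  by (simp only: xi(3)[OF X lf]) (simp add: xi(3)[OF Y CG_left[OF f]] Dl_def dirder_def)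
 moreover have "dirder (dirder ?F ?v) ?w (e1, e1) = tangent G Y (%y. tangent G X (%z. f (z \<cdot> y)))"
  by (simp only: xi(3)[OF Y right_field_CG[OF X f]]) (simp add: xi(3)[OF X CG_right[OF f]] Dl_def dirder_def)
 ultimately show ?thesis by simp
qed

lemma left_field_add: "Y : E ==> f : CG ==> g : CG ==>
  left_field G Y (%x. f x + g x) = (%x. left_field G Y f x + left_field G Y g x)"
 by (simp add: left_field_def tan_add CG_left)

lemma left_field_scale: "Y : E ==> f : CG ==> left_field G Y (%x. c * f x) = (%x. c * left_field G Y f x)"
 by (simp add: left_field_def tan_scale CG_left)

lemma left_field_mult: "Y : E ==> f : CG ==> g : CG ==>
  left_field G Y (%x. f x * g x) = (%x. f x * left_field G Y g x + g x * left_field G Y f x)"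
 by (simp add: left_field_def tan_mult CG_left)

text \<open>Each of the two second order terms violates the Leibniz rule by cross terms that are
  symmetric in \<open>X\<close> and \<open>Y\<close>; these cancel in the difference.\<close>

lemma bracket_ex1:
 assumes X: "X : E" and Y: "Y : E"
 shows "\<exists>!Z. Z : E \<and> (\<forall>f\<in>CG. tangent G Z f = tangent G X (left_field G Y f) - tangent G Y (left_field G X f))"
proof (rule tangent_ex1)
 show "point_derivation G (%f. tangent G X (left_field G Y f) - tangent G Y (left_field G X f))"
  unfolding point_derivation_def
  by (auto simp: X Y left_field_add left_field_scale left_field_mult tan_add tan_scale tan_mult left_field_CG
     CG_mult CG_scale left_field_at_one algebra_simps)
qed

lemma bracket_in: "X : E ==> Y : E ==> bracket G X Y : E"
 and bracket_tangent: "X : E ==> Y : E ==> f : CG ==>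
  tangent G (bracket G X Y) f = tangent G X (left_field G Y f) - tangent G Y (left_field G X f)"
 using theI'[OF bracket_ex1] by (auto simp: bracket_def)

lemma bracket_left_field:
 assumes "X : E" "Y : E" "f : CG"
 shows "left_field G (bracket G X Y) f =
  (%x. left_field G X (left_field G Y f) x - left_field G Y (left_field G X f) x)"
proof
 fix x
 have 1: "left_field G Z (%y. f (x \<cdot> y)) = (%y. left_field G Z f (x \<cdot> y))" for Z
  by (rule ext) (rule left_field_translate)
 show "left_field G (bracket G X Y) f x = left_field G X (left_field G Y f) x - left_field G Y (left_field G X f) x"
  using bracket_tangent[OF assms(1,2) CG_left[OF assms(3), of x]] 1 by (simp add: left_field_def)
qed

lemma left_field_vadd: "X : E ==> Y : E ==> f : CG ==>
  left_field G (X + Y) f = (%x. left_field G X f x + left_field G Y f x)"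
 by (simp add: left_field_def tangent_add CG_left)

lemma left_field_vscale: "X : E ==> f : CG ==> left_field G (c *R X) f = (%x. c * left_field G X f x)"
 by (simp add: left_field_def tangent_scale CG_left)

lemma bracket_antisym: "X : E ==> Y : E ==> bracket G X Y = - bracket G Y X"
 by (rule tangent_ext) (auto simp: bracket_in bracket_tangent tangent_neg subspace_neg E_sub)

lemma bracket_add_right: "X : E ==> Y : E ==> Z : E ==> bracket G X (Y + Z) = bracket G X Y + bracket G X Z"
 by (rule tangent_ext) (auto simp: bracket_in bracket_tangent tangent_add subspace_add E_sub left_field_vadd
   left_field_CG tan_add)

lemma bracket_scale_right: "X : E ==> Y : E ==> bracket G X (c *R Y) = c *R bracket G X Y"
 by (rule tangent_ext) (auto simp: bracket_in bracket_tangent tangent_scale subspace_scale E_sub left_field_vscale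
   left_field_CG tan_scale algebra_simps)

text \<open>The left invariant field of a bracket is a commutator of operators, for which the
  identity is formal.\<close>

lemma jacobi:
 assumes X: "X : E" and Y: "Y : E" and Z: "Z : E"
 shows "bracket G X (bracket G Y Z) = bracket G (bracket G X Y) Z + bracket G Y (bracket G X Z)"
proof (rule tangent_ext)
 note [simp] = X Y Z bracket_in bracket_tangent bracket_left_field left_field_CG tan_diff tangent_add
   left_field_vadd
 show "bracket G X (bracket G Y Z) : E" "bracket G (bracket G X Y) Z + bracket G Y (bracket G X Z) : E"
  by (simp_all add: subspace_add E_sub)
 fix f assume [simp]: "f : CG"
 show "tangent G (bracket G X (bracket G Y Z)) f = tangent G (bracket G (bracket G X Y) Z + bracket G Y (bracket G X Z)) f"
  by simp
qed

section \<open>The adjoint representation\<close>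

lemma Ad_ex1:
 assumes X: "X : E"
 shows "\<exists>!Y. Y : E \<and> (\<forall>f\<in>CG. tangent G Y f = tangent G X (%x. f (g \<cdot> x \<cdot> iv g)))"
proof (rule tangent_ex1)
 show "point_derivation G (%f. tangent G X (%x. f (g \<cdot> x \<cdot> iv g)))"
  unfolding point_derivation_def by (simp add: X tan_add tan_scale tan_mult CG_conj)
qed

lemma Ad_in: "X : E ==> Ad G g X : E"
 and Ad_tangent: "X : E ==> f : CG ==> tangent G (Ad G g X) f = tangent G X (%x. f (g \<cdot> x \<cdot> iv g))"
 using theI'[OF Ad_ex1] by (auto simp: Ad_def)

lemma Ad_add: "X : E ==> Y : E ==> Ad G g (X + Y) = Ad G g X + Ad G g Y"
 by (rule tangent_ext) (auto simp: Ad_in Ad_tangent tangent_add subspace_add E_sub CG_conj)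

lemma Ad_scale: "X : E ==> Ad G g (c *R X) = c *R Ad G g X"
 by (rule tangent_ext) (auto simp: Ad_in Ad_tangent tangent_scale subspace_scale E_sub CG_conj)

lemma Ad_one: "X : E ==> Ad G \<e> X = X"
 by (rule tangent_ext) (auto simp: Ad_in Ad_tangent)

lemma Ad_mult: "X : E ==> Ad G (g \<cdot> h) X = Ad G g (Ad G h X)"
 by (rule tangent_ext)
   (simp_all only: Ad_in Ad_tangent CG_conj, simp add: inv_mult_group m_assoc)

lemma Ad_inv: "X : E ==> Ad G (iv g) (Ad G g X) = X" "X : E ==> Ad G g (Ad G (iv g) X) = X"
 by (simp_all add: Ad_mult[symmetric] Ad_one)

lemma left_field_Ad:
 assumes "X : E" "f : CG"
 shows "left_field G (Ad G g X) f (g \<cdot> x \<cdot> iv g) = left_field G X (%x. f (g \<cdot> x \<cdot> iv g)) x"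
proof -
 have "g \<cdot> x \<cdot> iv g \<cdot> (g \<cdot> y \<cdot> iv g) = g \<cdot> (x \<cdot> y) \<cdot> iv g" for y
 proof -
  have "g \<cdot> x \<cdot> iv g \<cdot> (g \<cdot> y \<cdot> iv g) = g \<cdot> x \<cdot> (iv g \<cdot> g) \<cdot> (y \<cdot> iv g)"
   by (simp only: m_assoc carrier_UNIV UNIV_I)
  then show ?thesis by (simp add: m_assoc)
 qed
 then show ?thesis
  unfolding left_field_def Ad_tangent[OF assms(1) CG_left[OF assms(2)]] by simp
qed

lemma Ad_bracket:
 assumes X: "X : E" and Y: "Y : E"
 shows "Ad G g (bracket G X Y) = bracket G (Ad G g X) (Ad G g Y)"
 by (rule tangent_ext) (use X Y in \<open>auto simp: Ad_in bracket_in Ad_tangent bracket_tangent CG_conj left_field_CG left_field_Ad\<close>)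

end

lemma has_vector_derivative_componentwise:
 fixes c :: "real => 'v::euclidean_space"
 assumes "\<And>i. i : Basis ==> ((%t. c t \<bullet> i) has_real_derivative (w \<bullet> i)) (at t0)"
 shows "(c hvd w) (at t0)"
proof -
 have "((%t. (c t \<bullet> i) *R i) hvd (w \<bullet> i) *R i) (at t0)" if "i : Basis" for i
  using assms[OF that] bounded_linear.has_vector_derivative[OF bounded_linear_scaleR_left]
  by (simp add: has_real_derivative_iff_has_vector_derivative)
 then have "((%t. \<Sum>i\<in>Basis. (c t \<bullet> i) *R i) hvd (\<Sum>i\<in>Basis. (w \<bullet> i) *R i)) (at t0)"
  by (rule has_vector_derivative_sum)
 then show ?thesis by (simp add: euclidean_representation)
qed

context lie_grp
begin

section \<open>One-parameter subgroups\<close>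

definition curve1 :: "(real => 'a) => 'v => bool" where
 "curve1 a v \<longleftrightarrow> a 0 = \<e> \<and> (\<forall>\<^sub>F t in at 0. a t : U1) \<and> ((%t. ph1 (a t)) hvd v) (at 0)"

lemma one_param_zero: "one_param G X ga ==> ga 0 = \<e>"
proof -
 assume "one_param G X ga"
 then have "ga (0 + 0) = ga 0 \<cdot> ga 0" unfolding one_param_def by blast
 then show ?thesis using r_cancel_one[of "ga 0" "ga 0"] by simp
qed

lemma one_param_minus: "one_param G X ga ==> ga (- t) = iv (ga t)"
proof -
 assume o: "one_param G X ga"
 then have "ga (- t + t) = ga (- t) \<cdot> ga t" unfolding one_param_def by blast
 then show ?thesis using one_param_zero[OF o] inv_equality[of "ga (-t)" "ga t"] by simp
qed

lemma one_param_add: "one_param G X ga ==> ga (s + t) = ga s \<cdot> ga t"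
 by (simp add: one_param_def)

lemma one_param_tendsto: assumes "one_param G X ga" shows "(ga \<longlongrightarrow> ga t) (at t)"
 using assms by (simp add: one_param_def continuous_on_eq_continuous_at isCont_def)

lemma one_param_has_deriv:
 "one_param G X ga ==> f : CG ==> ((%t. f (ga t)) has_real_derivative tangent G X f) (at 0)"
 by (simp add: one_param_def)

text \<open>\<open>one_param\<close> only controls compositions with global smooth functions.
  Testing against \<open>coordinate_function\<close> and dividing by its cut-off factor gives the
  derivative of the chart coordinates.\<close>

lemma one_param_curve1:
 assumes o: "one_param G X ga" and X: "X : E"
 shows "curve1 ga (xi X)"
 unfolding curve1_def
proof (intro conjI)
 show "ga 0 = \<e>" by (rule one_param_zero[OF o])
 note lim = one_param_tendsto[OF o, of 0, unfolded one_param_zero[OF o]]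
 show ev: "\<forall>\<^sub>F t in at 0. ga t : U1"
  using topological_tendstoD[OF lim chart1_facts(1) chart1(2)] .
 have cphi: "((%t. ph1 (ga t)) \<longlongrightarrow> e1) (at 0)"
  unfolding e1_def using chart1_facts(1,4) chart1(2) lim
  by (intro isCont_tendsto_compose[of _ ph1]) (auto simp: continuous_on_eq_continuous_at)
 show "((%t. ph1 (ga t)) hvd xi X) (at 0)"
 proof (rule has_vector_derivative_componentwise)
  fix w :: 'v
  obtain f h where f: "f : CG" "f \<e> = 0" "\<forall>v\<in>E. dirder (%u. f (ps1 u)) v e1 = v \<bullet> w"
   "\<forall>x\<in>U1. f x = ((ph1 x - e1) \<bullet> w) * h (ph1 x)" "continuous_on UNIV h" "h e1 = (1::real)"
   using coordinate_function[of w] by (elim exE conjE)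
  have "((%t. f (ga t)) has_real_derivative xi X \<bullet> w) (at 0)"
   using one_param_has_deriv[OF o f(1)] xi(1)[OF X] xi(3)[OF X f(1)] f(3) by (simp add: Dl_def)
  then have q: "((%t. f (ga t) / t) \<longlongrightarrow> xi X \<bullet> w) (at 0)"
   using f(2) one_param_zero[OF o] by (simp add: DERIV_def)
  have hl: "((%t. h (ph1 (ga t))) \<longlongrightarrow> 1) (at 0)"
   using isCont_tendsto_compose[OF _ cphi, of h] f(5,6) by (simp add: continuous_on_eq_continuous_at)
  have "((%t. (f (ga t) / t) / h (ph1 (ga t))) \<longlongrightarrow> (xi X \<bullet> w) / 1) (at 0)"
   by (intro tendsto_divide q hl) simp
  moreover have "\<forall>\<^sub>F t in at 0. h (ph1 (ga t)) > 0" using order_tendstoD(1)[OF hl, of 0] by simp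
  then have "\<forall>\<^sub>F t in at 0. (f (ga t) / t) / h (ph1 (ga t)) = (ph1 (ga (0 + t)) \<bullet> w - ph1 (ga 0) \<bullet> w) / t"
   using ev by eventually_elim (use f(4) one_param_zero[OF o] in \<open>simp add: e1_def[symmetric] inner_diff_left\<close>)
  ultimately have "((%t. (ph1 (ga (0 + t)) \<bullet> w - ph1 (ga 0) \<bullet> w) / t) \<longlongrightarrow> xi X \<bullet> w) (at 0)"
   by (simp add: Lim_transform_eventually)
  then show "((%t. ph1 (ga t) \<bullet> w) has_real_derivative xi X \<bullet> w) (at 0)" by (simp add: DERIV_def)
 qed
qed

lemma curve1_minus: assumes "curve1 a v" shows "curve1 (%t. a (- t)) (- v)"
proof -
 have "((%t. ph1 (a t)) \<circ> uminus hvd (-1) *R v) (at 0)"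
 proof (rule vector_diff_chain_at)
  show "(uminus hvd (-1)) (at (0::real))"
   using has_vector_derivative_minus[OF has_vector_derivative_id] by simp
  show "((%t. ph1 (a t)) hvd v) (at (- 0))" using assms by (simp add: curve1_def)
 qed
 moreover have "\<forall>\<^sub>F t in at 0. a (- t) : U1"
 proof -
  have "filterlim uminus (at (0::real)) (at 0)"
   using filtermap_at_minus[of "0::real"] by (simp add: filterlim_def)
  moreover have "\<forall>\<^sub>F t in at 0. a t : U1" using assms by (simp add: curve1_def)
  ultimately show ?thesis by (rule eventually_compose_filterlim[rotated])
 qed
 ultimately show ?thesis using assms by (simp add: curve1_def o_def)
qed

lemma chain_curve2:
 fixes F :: "'v \<times> 'v => real"
 assumes a: "curve1 a v" and b: "curve1 b w" and v: "v : E" and w: "w : E"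
  and F: "smooth_on (E \<times> E) (S1 \<times> S1) F"
 shows "((%t. F (ph1 (a t), ph1 (b t))) hvd
   dirder (%u. F (u, e1)) v e1 + dirder (%u. F (e1, u)) w e1) (at 0)"
proof -
 have R: "relopen (E \<times> E) (S1 \<times> S1)" by (intro relopen_Times chart1_facts)
 have z: "0 : E" by (rule subspace_0[OF E_sub])
 have p: "(e1, e1) : S1 \<times> S1" using chart1_facts by auto
 have 0: "ph1 (a 0) = e1" "ph1 (b 0) = e1" using a b by (auto simp: curve1_def e1_def)
 have "((%t. F (ph1 (a t), ph1 (b t))) hvd dirder F (v, w) (ph1 (a 0), ph1 (b 0))) (at 0)"
 proof (rule chain_curve[OF R smooth_on_Ck[OF F]])
  show "((%t. (ph1 (a t), ph1 (b t))) hvd (v, w)) (at 0)"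
   using a b by (auto simp: curve1_def intro!: has_vector_derivative_Pair)
  have "\<forall>\<^sub>F t in at 0. a t : U1" "\<forall>\<^sub>F t in at 0. b t : U1" using a b by (auto simp: curve1_def)
  then show "\<forall>\<^sub>F t in at 0. (ph1 (a t), ph1 (b t)) : E \<times> E"
   by eventually_elim (use chart1_facts(11) relopen_subset[OF chart1_facts(2)] in blast)
 qed (use 0 p v w in auto)
 moreover have "dirder F (v, w) (e1, e1) = dirder F (v, 0) (e1, e1) + dirder F (0, w) (e1, e1)"
  using dirder_linear(1)[OF R smooth_on_Ck[OF F] p, of "(v, 0)" "(0, w)"] v w z by simp
 ultimately show ?thesis unfolding 0 by (simp add: dirder_def)
qed

text \<open>The derivative of \<open>f (ga t \<cdot> de (- t))\<close> vanishes, because the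
  contributions of \<open>X\<close> and \<open>- X\<close> cancel, and smooth functions separate
  points.\<close>

lemma one_param_unique:
 assumes o1: "one_param G X ga" and o2: "one_param G X de" and X: "X : E"
 shows "ga t = de t"
proof -
 have "f (ga t \<cdot> de (- t)) = f \<e>" if f: "f : CG" for f
 proof -
  have "((%t. f (ga t \<cdot> de (- t))) has_real_derivative 0) (at t)" for t
  proof -
   \<comment> \<open>Translation by \<open>ga t\<close> and \<open>de (- t)\<close> reduces the
     derivative at time \<open>t\<close> to the one at time 0.\<close>
   let ?u = "%y. f (ga t \<cdot> y \<cdot> de (- t))"
   have u: "?u : CG" by (rule CG_conj[OF f])
   let ?F = "%p. ?u (ps1 (fst p) \<cdot> ps1 (snd p))"
   note c1 = one_param_curve1[OF o1 X] and c2 = curve1_minus[OF one_param_curve1[OF o2 X]]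
   have F: "smooth_on (E \<times> E) (S1 \<times> S1) ?F"
    using mult_smooth[OF chart1(1) chart1(1) u] by (simp add: S1_def ps1_def)
   have "((%s. ?F (ph1 (ga s), ph1 (de (- s)))) hvd
    dirder (%v. ?F (v, e1)) (xi X) e1 + dirder (%v. ?F (e1, v)) (- xi X) e1) (at 0)"
    by (rule chain_curve2[OF c1 c2 _ _ F]) (auto simp: xi[OF X] subspace_neg[OF E_sub])
   moreover have "dirder (%v. ?F (e1, v)) (- xi X) e1 = - Dl (xi X) ?u"
    using dirder_linear(4)[OF chart1_facts(2) smooth_on_Ck[OF CG_chart1[OF u]] chart1_facts(5) xi(1)[OF X]]
    by (simp add: Dl_def chart1_facts(7))
   moreover have "dirder (%v. ?F (v, e1)) (xi X) e1 = Dl (xi X) ?u"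
    by (simp add: Dl_def chart1_facts(7))
   ultimately have "((%s. ?F (ph1 (ga s), ph1 (de (- s)))) hvd 0) (at 0)" by simp
   then have "((%s. f (ga (s + t) \<cdot> de (- (s + t)))) hvd 0) (at 0)"
    unfolding has_vector_derivative_def
   proof (rule has_derivative_transform_eventually)
    have e: "\<forall>\<^sub>F s in at 0. ga s : U1" "\<forall>\<^sub>F s in at 0. de (- s) : U1"
     using c1 c2 by (auto simp: curve1_def)
    have eq: "?u (ga s \<cdot> de (- s)) = f (ga (s + t) \<cdot> de (- (s + t)))" for s
    proof -
     have "ga (s + t) = ga t \<cdot> ga s" "de (- (s + t)) = de (- s) \<cdot> de (- t)"
      using one_param_add[OF o1, of t s] one_param_add[OF o2, of "-s" "-t"] by (simp_all add: add.commute)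
     then show ?thesis by (simp add: m_assoc)
    qed
    from e show "\<forall>\<^sub>F s in at 0. ?F (ph1 (ga s), ph1 (de (- s))) = f (ga (s + t) \<cdot> de (- (s + t)))"
     by eventually_elim (simp add: chart1_facts(8) eq)
    show "?F (ph1 (ga 0), ph1 (de (- 0))) = f (ga (0 + t) \<cdot> de (- (0 + t)))"
     using one_param_zero[OF o1] one_param_zero[OF o2] chart1_facts(8) chart1(2) by simp
   qed simp
   then have "((%s. f (ga (s + t) \<cdot> de (- (s + t)))) has_real_derivative 0) (at 0)"
    by (simp add: has_real_derivative_iff_has_vector_derivative)
   then have "((%s. f (ga s \<cdot> de (- s))) has_real_derivative 0) (at (0 + t))"
    by (subst DERIV_shift)
   then show ?thesis by simp
  qed
  then have "\<forall>x. ((%t. f (ga t \<cdot> de (- t))) has_real_derivative 0) (at x)" by blast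
  from DERIV_isconst_all[OF this, of t 0] show ?thesis
   using one_param_zero[OF o1] one_param_zero[OF o2] by simp
 qed
 then have "ga t \<cdot> de (- t) = \<e>" by (rule CG_separates)
 then have "ga t \<cdot> iv (de t) = \<e>" by (simp add: one_param_minus[OF o2])
 then show ?thesis using inv_equality[of "ga t" "iv (de t)"] by simp
qed

text \<open>The functions of \<open>coordinate_function\<close> read off the components of
  \<open>xi (Z t)\<close>; the linear map \<open>kap\<close> carries the resulting derivative back
  to \<open>Z\<close>.\<close>

lemma vector_derivative_from_tangent:
 assumes Z: "\<And>t. Z t : E" and Z': "Z' : E"
  and d: "\<And>f. f : CG ==> ((%t. tangent G (Z t) f) has_real_derivative tangent G Z' f) (at t0)"
 shows "(Z hvd Z') (at t0)"
proof -
 have "((%t. xi (Z t)) hvd xi Z') (at t0)"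
 proof (rule has_vector_derivative_componentwise)
  fix w :: 'v
  obtain f h where f: "f : CG" "\<forall>v\<in>E. dirder (%u. f (ps1 u)) v e1 = v \<bullet> w"
   using coordinate_function[of w] by (elim exE conjE)
  have "tangent G X f = xi X \<bullet> w" if "X : E" for X
   using f xi[OF that] by (simp add: Dl_def)
  then show "((%t. xi (Z t) \<bullet> w) has_real_derivative xi Z' \<bullet> w) (at t0)"
   using d[OF f(1)] Z Z' by simp
 qed
 then have "((%t. kap (prj E (xi (Z t)))) hvd kap (prj E (xi Z'))) (at t0)"
  by (rule bounded_linear.has_vector_derivative[OF linear_conv_bounded_linear[THEN iffD1, OF kap_linear]])
 then show ?thesis using Z Z' by (simp add: xi prj_id[OF E_sub])
qed

text \<open>The product rule in the two outer factors gives a left field minus a right field;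
  \<open>tangent_commute\<close> turns the latter into the second term of the bracket.\<close>

lemma Ad_one_param_deriv0:
 assumes o: "one_param G X ga" and X: "X : E" and Y: "Y : E"
 shows "((%t. Ad G (ga t) Y) hvd bracket G X Y) (at 0)"
proof (rule vector_derivative_from_tangent)
 fix f assume f: "f : CG"
 let ?F = "%p. tangent G Y (%z. f (ps1 (fst p) \<cdot> z \<cdot> ps1 (snd p)))"
 note c1 = one_param_curve1[OF o X] and c2 = curve1_minus[OF one_param_curve1[OF o X]]
 have F: "smooth_on (E \<times> E) (S1 \<times> S1) ?F"
  using field3_smooth[OF Y f chart1(1) chart1(1)] by (simp add: S1_def ps1_def)
 have 1: "((%s. ?F (ph1 (ga s), ph1 (ga (- s)))) hvd
   dirder (%v. ?F (v, e1)) (xi X) e1 + dirder (%v. ?F (e1, v)) (- xi X) e1) (at 0)"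
  by (rule chain_curve2[OF c1 c2 _ _ F]) (auto simp: xi[OF X] subspace_neg[OF E_sub])
 have lf: "(%x. tangent G Y (%z. f (x \<cdot> z))) = left_field G Y f" by (simp add: left_field_def)
 have 2: "dirder (%v. ?F (v, e1)) (xi X) e1 = tangent G X (left_field G Y f)"
  using xi(3)[OF X left_field_CG[OF Y f]] by (simp add: Dl_def chart1_facts(7) left_field_def)
 have "dirder (%v. ?F (e1, v)) (- xi X) e1 = - Dl (xi X) (%y. tangent G Y (%z. f (z \<cdot> y)))"
  using dirder_linear(4)[OF chart1_facts(2) smooth_on_Ck[OF CG_chart1[OF right_field_CG[OF Y f]]] chart1_facts(5) xi(1)[OF X]]
  by (simp add: Dl_def chart1_facts(7))
 also have "\<dots> = - tangent G Y (left_field G X f)"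
  using xi(3)[OF X right_field_CG[OF Y f]] tangent_commute[OF Y X f] by (simp add: left_field_def)
 finally have 3: "((%s. ?F (ph1 (ga s), ph1 (ga (- s)))) hvd tangent G (bracket G X Y) f) (at 0)"
  using 1 2 bracket_tangent[OF X Y f] by simp
 then have "((%t. tangent G (Ad G (ga t) Y) f) hvd tangent G (bracket G X Y) f) (at 0)"
  unfolding has_vector_derivative_def
 proof (rule has_derivative_transform_eventually)
  have e: "\<forall>\<^sub>F s in at 0. ga s : U1" "\<forall>\<^sub>F s in at 0. ga (- s) : U1"
   using c1 c2 by (auto simp: curve1_def)
  then show "\<forall>\<^sub>F s in at 0. ?F (ph1 (ga s), ph1 (ga (- s))) = tangent G (Ad G (ga s) Y) f"
   by eventually_elim (simp add: chart1_facts(8) Ad_tangent Y f one_param_minus[OF o])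
  show "?F (ph1 (ga 0), ph1 (ga (- 0))) = tangent G (Ad G (ga 0) Y) f"
   using one_param_zero[OF o] chart1_facts(8) chart1(2) by (simp add: Ad_tangent Y f)
 qed simp
 then show "((%t. tangent G (Ad G (ga t) Y) f) has_real_derivative tangent G (bracket G X Y) f) (at 0)"
  by (simp add: has_real_derivative_iff_has_vector_derivative)
qed (simp_all add: X Y Ad_in bracket_in)

lemma Ad_bounded_linear: "bounded_linear (%Y. Ad G g (prj E Y))"
proof -
 have "linear (%Y. Ad G g (prj E Y))"
  by (rule linearI) (simp_all add: linear_add[OF prj_linear] linear_cmul[OF prj_linear] Ad_add Ad_scale prj_in E_sub)
 then show ?thesis by (simp add: linear_conv_bounded_linear)
qed

lemma Ad_one_param_deriv:
 assumes o: "one_param G X ga" and X: "X : E" and Y: "Y : E"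
 shows "((%t. Ad G (ga t) Y) hvd Ad G (ga t) (bracket G X Y)) (at t)"
proof -
 have "((%s. Ad G (ga t) (prj E (Ad G (ga s) Y))) hvd Ad G (ga t) (prj E (bracket G X Y))) (at 0)"
  by (rule bounded_linear.has_vector_derivative[OF Ad_bounded_linear Ad_one_param_deriv0[OF o X Y]])
 then have "((%s. Ad G (ga (t + s)) Y) hvd Ad G (ga t) (bracket G X Y)) (at 0)"
  using X Y by (simp add: prj_id[OF E_sub] Ad_in bracket_in Ad_mult[symmetric] one_param_add[OF o])
 then have "((%s. Ad G (ga (t + s)) Y) \<circ> (%s. s - t) hvd 1 *R Ad G (ga t) (bracket G X Y)) (at t)"
  by (intro vector_diff_chain_at) (auto intro!: derivative_eq_intros)
 then show ?thesis by (simp add: o_def)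
qed

lemma Ad_one_param_self:
 assumes o: "one_param G X ga" and X: "X : E" and Y: "Y : E" and "bracket G X Y = 0"
 shows "Ad G (ga t) Y = Y"
proof -
 have "Ad G g 0 = 0" for g using Ad_scale[of 0 g 0] subspace_0[OF E_sub] by simp
 then have d: "((%t. Ad G (ga t) Y) has_derivative (%h. 0)) (at s within UNIV)" for s
  using Ad_one_param_deriv[OF o X Y, of s] assms(4) by (simp add: has_vector_derivative_def)
 obtain c where "\<forall>s\<in>UNIV. Ad G (ga s) Y = c"
  using has_derivative_zero_constant[OF convex_UNIV d] by (elim exE)
 then have "Ad G (ga t) Y = Ad G (ga 0) Y" by simp
 then show ?thesis using Ad_one[OF Y] one_param_zero[OF o] by simp
qed

lemma bracket_self: "X : E ==> bracket G X X = 0"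
 using bracket_antisym[of X X] scaleR_2[of "bracket G X X"] by (simp add: eq_neg_iff_add_eq_0)

text \<open>\<open>Ad G (ga t)\<close> fixes \<open>X\<close>, so it can be moved inside the
  bracket. This is the linear differential equation behind the explicit computations of
  \<open>Ad\<close>.\<close>

lemma Ad_one_param_deriv':
 assumes o: "one_param G X ga" and X: "X : E" and Y: "Y : E"
 shows "((%t. Ad G (ga t) Y) hvd bracket G X (Ad G (ga t) Y)) (at t)"
 using Ad_one_param_deriv[OF o X Y, of t] Ad_bracket[OF X Y, of "ga t"]
  Ad_one_param_self[OF o X X bracket_self[OF X], of t] by simp

lemma one_param_conj:
 assumes o: "one_param G X ga" and X: "X : E"
 shows "one_param G (Ad G g X) (%t. g \<cdot> ga t \<cdot> iv g)"
 unfolding one_param_def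
proof (intro conjI allI ballI)
 have "continuous_on UNIV ga" using o by (simp add: one_param_def)
 then show "continuous_on UNIV (%t. g \<cdot> ga t \<cdot> iv g)"
  by (intro mult_continuous_on continuous_on_const)
 fix s t
 have "g \<cdot> ga s \<cdot> iv g \<cdot> (g \<cdot> ga t \<cdot> iv g) = g \<cdot> ga s \<cdot> (iv g \<cdot> g) \<cdot> (ga t \<cdot> iv g)"
  by (simp only: m_assoc carrier_UNIV UNIV_I)
 then show "g \<cdot> ga (s + t) \<cdot> iv g = g \<cdot> ga s \<cdot> iv g \<cdot> (g \<cdot> ga t \<cdot> iv g)"
  by (simp add: one_param_add[OF o] m_assoc)
next
 fix f assume f: "f : CG"
 show "((%t. f (g \<cdot> ga t \<cdot> iv g)) has_real_derivative tangent G (Ad G g X) f) (at 0)"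
  using one_param_has_deriv[OF o CG_conj[OF f, of g "iv g"]] by (simp only: Ad_tangent X f)
qed

lemma one_param_scale:
 assumes o: "one_param G X ga" and X: "X : E"
 shows "one_param G (c *R X) (%t. ga (c * t))"
 unfolding one_param_def
proof (intro conjI allI ballI)
 have "continuous_on UNIV ga" using o by (simp add: one_param_def)
 then show "continuous_on UNIV (%t. ga (c * t))"
  by (rule continuous_on_compose2) (auto intro!: continuous_intros)
 fix s t show "ga (c * (s + t)) = ga (c * s) \<cdot> ga (c * t)"
  by (simp add: distrib_left one_param_add[OF o])
next
 fix f assume f: "f : CG"
 have "((%t. f (ga t)) has_real_derivative tangent G X f) (at (c * 0))"
  using o f by (simp add: one_param_def)
 then have "((%t. f (ga (c * t))) has_real_derivative tangent G X f * c) (at 0)"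
  by (rule DERIV_chain2) (auto intro!: derivative_eq_intros)
 then show "((%t. f (ga (c * t))) has_real_derivative tangent G (c *R X) f) (at 0)"
  by (simp add: tangent_scale X f mult.commute)
qed

lemma lie_exp_eq:
 assumes o: "one_param G X ga" and X: "X : E"
 shows "lie_exp G X = ga 1"
 unfolding lie_exp_def
proof (rule the_equality)
 show "\<exists>ga'. one_param G X ga' \<and> ga 1 = ga' 1" by (intro exI[of _ ga] conjI o refl)
 fix x assume "\<exists>ga'. one_param G X ga' \<and> x = ga' 1"
 then obtain ga' where o': "one_param G X ga'" and x: "x = ga' 1" by (elim exE conjE)
 show "x = ga 1" unfolding x by (rule one_param_unique[OF o' o X])
qed

lemma lie_exp_scale:
 assumes o: "one_param G X ga" and X: "X : E"
 shows "lie_exp G (c *R X) = ga c"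
 using lie_exp_eq[OF one_param_scale[OF o X] subspace_scale[OF E_sub X]] by simp

end

text \<open>The slice of a closed ball is compact and convex, so bounds for the derivatives
  integrate to a Lipschitz constant.\<close>

lemma C1_lipschitz:
 fixes V :: "'v::euclidean_space => 'w::real_normed_vector"
 assumes R: "relopen E S" and V: "Ck_on (Suc 0) E S V" and K: "E \<inter> cball a r \<subseteq> S"
 shows "\<exists>L\<ge>0. \<forall>x\<in>E \<inter> cball a r. \<forall>y\<in>E \<inter> cball a r. norm (V x - V y) \<le> L * norm (x - y)"
proof -
 let ?K = "E \<inter> cball a r"
 have E: "subspace E" using R by (simp add: relopen_def)
 have comp: "compact ?K" using closed_subspace[OF E] by (simp add: closed_Int_compact)
 have "\<exists>M. \<forall>x\<in>?K. norm (dirder V b x) \<le> M" if "b : onb E" for b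
 proof -
  have "continuous_on ?K (dirder V b)"
   using Ck_continuous[OF Ck_Suc_dest(2)[OF R V]] that onb(1)[OF E] continuous_on_subset[OF _ K] by blast
  then have "bounded (dirder V b ` ?K)" using comp compact_continuous_image compact_imp_bounded by blast
  then show ?thesis unfolding bounded_iff by auto
 qed
 then obtain M where M: "\<And>b x. b : onb E ==> x : ?K ==> norm (dirder V b x) \<le> M b" by metis
 define L where "L = (\<Sum>b\<in>onb E. \<bar>M b\<bar>)"
 have "norm (V x - V y) \<le> L * norm (x - y)" if x: "x : ?K" and y: "y : ?K" for x y
 proof -
  have "norm (V (prj E x) - V (prj E y)) \<le> L * norm (x - y)"
  proof (rule differentiable_bound[of ?K _ "%x v. \<Sum>b\<in>onb E. (v \<bullet> b) *R dirder V b x"])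
   show "convex ?K" by (intro convex_Int subspace_imp_convex E convex_cball)
   fix z assume z: "z : ?K"
   then have "z : S" using K by blast
   show "((%x. V (prj E x)) has_derivative (%v. \<Sum>b\<in>onb E. (v \<bullet> b) *R dirder V b z)) (at z within ?K)"
    by (rule has_derivative_at_withinI[OF C1_has_derivative[OF R V \<open>z : S\<close>]])
   show "onorm (%v. \<Sum>b\<in>onb E. (v \<bullet> b) *R dirder V b z) \<le> L"
   proof (rule onorm_le)
    fix v
    have "norm (\<Sum>b\<in>onb E. (v \<bullet> b) *R dirder V b z) \<le> (\<Sum>b\<in>onb E. norm ((v \<bullet> b) *R dirder V b z))"
     by (rule norm_sum)
    also have "\<dots> \<le> (\<Sum>b\<in>onb E. norm v * \<bar>M b\<bar>)"
    proof (rule sum_mono)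
     fix b assume b: "b : onb E"
     have "\<bar>v \<bullet> b\<bar> \<le> norm v" using Cauchy_Schwarz_ineq2[of v b] onb(3)[OF E b] by simp
     moreover have "norm (dirder V b z) \<le> \<bar>M b\<bar>" using M[OF b z] by linarith
     ultimately show "norm ((v \<bullet> b) *R dirder V b z) \<le> norm v * \<bar>M b\<bar>"
      by (simp add: mult_mono)
    qed
    also have "\<dots> = L * norm v" by (simp add: L_def sum_distrib_left sum_distrib_right mult.commute)
    finally show "norm (\<Sum>b\<in>onb E. (v \<bullet> b) *R dirder V b z) \<le> L * norm v" .
   qed
  qed (use x y in auto)
  then show ?thesis using x y by (simp add: prj_id[OF E])
 qed
 moreover have "L \<ge> 0" unfolding L_def by (simp add: sum_nonneg)
 ultimately show ?thesis by blast
qed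

lemma integral_in_subspace:
 fixes g :: "real => 'v::euclidean_space"
 assumes E: "subspace E" and g: "continuous_on {a..b} g" "\<And>t. t : {a..b} ==> g t : E"
 shows "integral {a..b} g : E"
proof -
 have "integral {a..b} (prj E \<circ> g) = prj E (integral {a..b} g)"
  by (rule integral_linear[OF integrable_continuous_interval[OF g(1)] prj_bounded_linear])
 moreover have "integral {a..b} (prj E \<circ> g) = integral {a..b} g"
  by (rule integral_cong) (simp add: prj_id[OF E] g(2))
 ultimately show ?thesis using prj_in[OF E] by metis
qed

lemma deriv_in_subspace:
 fixes c :: "real => 'v::euclidean_space"
 assumes E: "subspace E" and c: "(c hvd w) (at t0)" "\<forall>\<^sub>F t in at t0. c t : E" "c t0 : E"
 shows "w : E"
proof -
 have "((%t. prj E (c t)) hvd prj E w) (at t0)"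
  by (rule bounded_linear.has_vector_derivative[OF prj_bounded_linear c(1)])
 then have "(c hvd prj E w) (at t0)"
  unfolding has_vector_derivative_def
 proof (rule has_derivative_transform_eventually)
  show "\<forall>\<^sub>F t in at t0. prj E (c t) = c t" using c(2) by eventually_elim (simp add: prj_id[OF E])
 qed (simp_all add: prj_id[OF E] c(3))
 from vector_derivative_unique_at[OF this c(1)] show ?thesis using prj_in[OF E, of w] by simp
qed

section \<open>Ordinary differential equations\<close>

text \<open>The integral operator acts on curves defined for all times, with time clamped to the
  interval from \<open>- ep\<close> to \<open>ep\<close>; this places them in the complete space of
  bounded continuous functions, where Banach's fixed point theorem applies.\<close>

lemma picard:
 fixes V :: "'v::euclidean_space => 'v"
 assumes E: "subspace E" and a: "a : E" and r: "r > 0"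
  and Vc: "continuous_on (E \<inter> cball a r) V" and VE: "\<And>x. x : E \<inter> cball a r ==> V x : E"
  and L: "L \<ge> 0" and lip: "\<And>x y. x : E \<inter> cball a r ==> y : E \<inter> cball a r ==> norm (V x - V y) \<le> L * norm (x - y)"
 shows "\<exists>ep>0. \<exists>c. (\<forall>t. c t : E \<inter> cball a r) \<and> continuous_on UNIV c \<and> c 0 = a \<and>
   (\<forall>t. \<bar>t\<bar> < ep \<longrightarrow> (c hvd V (c t)) (at t))"
proof -
 let ?K = "E \<inter> cball a r"
 have comp: "compact ?K" using closed_subspace[OF E] by (simp add: closed_Int_compact)
 have "bounded (V ` ?K)" using comp Vc compact_continuous_image compact_imp_bounded by blast
 then obtain B where B: "B > 0" "\<forall>y\<in>V ` ?K. norm y \<le> B" unfolding bounded_pos by blast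
 have B': "norm (V x) \<le> B" if "x : ?K" for x using B(2) that by blast
 \<comment> \<open>The first bound keeps the iterates in the ball, the second makes the contraction
   constant at most 1/2. The factor 3 counts one integral of length at most \<open>2 * ep\<close>
   and one of length \<open>ep\<close>.\<close>
 define ep where "ep = min (r / (3 * B)) (1 / (6 * L + 6))"
 have eps: "ep > 0" "3 * ep * B \<le> r" "3 * ep * L \<le> 1 / 2"
 proof -
  show "ep > 0" using r B L by (simp add: ep_def)
  have "ep \<le> r / (3 * B)" "ep \<le> 1 / (6 * L + 6)" by (simp_all add: ep_def)
  then show "3 * ep * B \<le> r" using B by (simp add: field_simps)
  have "ep * (6 * L + 6) \<le> 1" using \<open>ep \<le> 1 / (6 * L + 6)\<close> L by (simp add: field_simps)
  then show "3 * ep * L \<le> 1 / 2" using \<open>ep > 0\<close> by (simp add: algebra_simps)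
 qed
 define cl :: "real => real" where "cl t = max (-ep) (min ep t)" for t
 have cl: "cl t : {-ep..ep}" for t using eps by (auto simp: cl_def)
 have clc: "continuous_on UNIV cl" unfolding cl_def by (intro continuous_intros)
 \<comment> \<open>Both integrals start at \<open>- ep\<close>, and the one up to 0 is subtracted,
   so that negative times are treated like positive ones.\<close>
 define P where "P c t = a + integral {-ep..cl t} (%s. V (c s)) - integral {-ep..0} (%s. V (c s))" for c :: "real => 'v" and t
 have Vcc: "continuous_on A (%s. V (c s))" if "continuous_on UNIV c" "\<And>t. c t : ?K" for c :: "real => 'v" and A
  by (rule continuous_on_compose2[OF Vc continuous_on_subset[OF that(1)]]) (use that(2) in auto)
 have PK: "P c t : ?K" and Pc: "continuous_on UNIV (P c)" if c: "continuous_on UNIV c" "\<And>t. c t : ?K" for c t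
 proof -
  let ?g = "%s. V (c s)"
  note gc = Vcc[OF c]
  have gE: "?g s : E" for s using VE c(2) by blast
  have i1: "norm (integral {-ep..cl t} ?g) \<le> B * (cl t - - ep)"
   by (rule integral_bound) (use cl[of t] gc B' c(2) in auto)
  have i2: "norm (integral {-ep..0} ?g) \<le> B * (0 - - ep)"
   by (rule integral_bound) (use eps gc B' c(2) in auto)
  have "B * (cl t - - ep) \<le> B * (2 * ep)" using cl[of t] B by (intro mult_left_mono) auto
  then have "norm (integral {-ep..cl t} ?g) + norm (integral {-ep..0} ?g) \<le> 3 * ep * B"
   using i1 i2 by (simp add: algebra_simps)
  then have "norm (integral {-ep..cl t} ?g - integral {-ep..0} ?g) \<le> r"
   using norm_triangle_ineq4[of "integral {-ep..cl t} ?g" "integral {-ep..0} ?g"] eps(2) by linarith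
  then have "dist a (P c t) \<le> r" by (simp add: P_def dist_norm norm_minus_commute algebra_simps)
  moreover have "P c t : E" unfolding P_def
   by (intro subspace_add[OF E] subspace_diff[OF E] a integral_in_subspace[OF E gc] gE)
  ultimately show "P c t : ?K" by simp
  have "continuous_on {-ep..ep} (%x. integral {-ep..x} ?g)"
   by (rule indefinite_integral_continuous_1[OF integrable_continuous_interval[OF gc]])
  then have "continuous_on UNIV (%t. integral {-ep..cl t} ?g)"
   by (rule continuous_on_compose2[OF _ clc]) (use cl in auto)
  then show "continuous_on UNIV (P c)" unfolding P_def by (intro continuous_intros)
 qed
 let ?D = "PiC UNIV (%_. ?K) :: (real \<Rightarrow>\<^sub>C 'v) set"
 define F where "F c = Bcontfun (P (apply_bcontfun c))" for c
 have D: "c : ?D \<longleftrightarrow> (\<forall>t. apply_bcontfun c t : ?K)" for c :: "real \<Rightarrow>\<^sub>C 'v"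
  by (simp add: mem_PiC_iff Pi_iff)
 have Dc: "continuous_on UNIV (apply_bcontfun c)" for c :: "real \<Rightarrow>\<^sub>C 'v"
  using apply_bcontfun[of c] by (simp add: bcontfun_def)
 have Fapp: "apply_bcontfun (F c) = P (apply_bcontfun c)" if "c : ?D" for c
 proof -
  have c: "\<And>t. apply_bcontfun c t : ?K" using that D by blast
  have "range (P (apply_bcontfun c)) \<subseteq> ?K" using PK[OF Dc c] by blast
  then have "P (apply_bcontfun c) : bcontfun"
   using Pc[OF Dc c] compact_imp_bounded[OF comp] bounded_subset by (auto simp: bcontfun_def)
  then show ?thesis unfolding F_def by (rule Bcontfun_inverse)
 qed
 have "\<exists>!c\<in>?D. F c = c"
 proof (rule Banach_fix[of ?D "1/2"])
  have "closed ?D" by (rule closed_PiC) (simp add: compact_imp_closed[OF comp])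
  then show "complete ?D" by (simp add: complete_eq_closed)
  have "apply_bcontfun (const_bcontfun a :: real \<Rightarrow>\<^sub>C 'v) t : ?K" for t using a r by simp
  then show "?D \<noteq> {}" using D by blast
  show "F ` ?D \<subseteq> ?D"
  proof clarify
   fix c assume c: "c : ?D"
   have "\<forall>t. apply_bcontfun (F c) t : ?K" unfolding Fapp[OF c] using PK[OF Dc, of c] c D by blast
   then show "F c : ?D" using D by blast
  qed
  fix c d assume c: "c : ?D" and d: "d : ?D"
  have cK: "\<And>t. apply_bcontfun c t : ?K" and dK: "\<And>t. apply_bcontfun d t : ?K" using c d D by auto
  let ?g = "%s. V (apply_bcontfun c s)" and ?h = "%s. V (apply_bcontfun d s)"
  have gh: "continuous_on A ?g" "continuous_on A ?h" for A by (rule Vcc[OF Dc cK], rule Vcc[OF Dc dK])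
  have pt: "norm (?g s - ?h s) \<le> L * dist c d" for s
  proof -
   have "norm (?g s - ?h s) \<le> L * norm (apply_bcontfun c s - apply_bcontfun d s)" by (rule lip[OF cK dK])
   also have "\<dots> \<le> L * dist c d" using dist_bounded[of c s d] L by (intro mult_left_mono) (auto simp: dist_norm)
   finally show ?thesis .
  qed
  have int: "norm (integral {-ep..x} ?g - integral {-ep..x} ?h) \<le> L * dist c d * (x + ep)" if "x \<ge> -ep" for x
  proof -
   have "integral {-ep..x} ?g - integral {-ep..x} ?h = integral {-ep..x} (%s. ?g s - ?h s)"
    by (rule integral_diff[symmetric]) (intro integrable_continuous_interval gh)+
   also have "norm \<dots> \<le> (L * dist c d) * (x - - ep)"
    by (rule integral_bound) (use that pt gh in \<open>auto intro!: continuous_intros\<close>)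
   finally show ?thesis by simp
  qed
  show "dist (F c) (F d) \<le> 1/2 * dist c d"
  proof (rule dist_bound)
   fix t
   have nn: "0 \<le> L * dist c d" using L by simp
   have "dist (P (apply_bcontfun c) t) (P (apply_bcontfun d) t) =
     norm ((integral {-ep..cl t} ?g - integral {-ep..cl t} ?h) - (integral {-ep..0} ?g - integral {-ep..0} ?h))"
    by (simp add: P_def dist_norm algebra_simps)
   also have "\<dots> \<le> norm (integral {-ep..cl t} ?g - integral {-ep..cl t} ?h) + norm (integral {-ep..0} ?g - integral {-ep..0} ?h)"
    by (rule norm_triangle_ineq4)
   also have "\<dots> \<le> L * dist c d * (cl t + ep) + L * dist c d * (0 + ep)"
    by (intro add_mono int) (use cl[of t] eps in auto)
   also have "\<dots> \<le> L * dist c d * (2 * ep) + L * dist c d * ep"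
    using cl[of t] by (intro add_mono mult_left_mono nn) auto
   also have "\<dots> = (3 * ep * L) * dist c d" by (simp add: algebra_simps)
   also have "\<dots> \<le> 1/2 * dist c d" by (intro mult_right_mono eps) simp
   finally show "dist (apply_bcontfun (F c) t) (apply_bcontfun (F d) t) \<le> 1/2 * dist c d"
    unfolding Fapp[OF c] Fapp[OF d] .
  qed
 qed auto
 then obtain cc where cc: "cc : ?D" "F cc = cc" by blast
 define c where "c = apply_bcontfun cc"
 have cK: "\<And>t. c t : ?K" and ccont: "continuous_on UNIV c" using cc(1) D Dc by (auto simp: c_def)
 have cP: "c t = P c t" for t using Fapp[OF cc(1)] cc(2) by (simp add: c_def)
 have "c 0 = a" unfolding cP[of 0] P_def using eps(1) by (simp add: cl_def)
 moreover have "(c hvd V (c t)) (at t)" if t: "\<bar>t\<bar> < ep" for t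
 proof -
  let ?I = "%x. integral {-ep..x} (%s. V (c s))"
  have "(?I hvd V (c t)) (at t within {-ep..ep})"
   by (rule integral_has_vector_derivative[OF Vcc[OF ccont cK]]) (use t in auto)
  then have "(?I hvd V (c t)) (at t)"
   using t by (simp add: at_within_Icc_at abs_less_iff)
  then have "((%x. a + ?I x - ?I 0) hvd V (c t)) (at t)"
   by (auto intro!: derivative_eq_intros)
  then show ?thesis
  proof (rule has_vector_derivative_transform_within_open)
   show "open {-ep<..<ep}" "t : {-ep<..<ep}" using t by auto
   fix x assume "x : {-ep<..<ep}"
   then have "cl x = x" by (auto simp: cl_def)
   then show "a + ?I x - ?I 0 = c x" unfolding cP[of x] P_def by simp
  qed
 qed
 ultimately show ?thesis using eps(1) cK ccont by blast
qed

text \<open>Gronwall: the squared norm times \<open>exp (- 2 * L * t)\<close> is nonincreasing for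
  positive times, and negative times follow by reflection. The comparisons of \<open>Ad\<close> and
  \<pi> with explicit solutions rest on this.\<close>

lemma linear_ode_zero:
 fixes q :: "real => 'v::euclidean_space"
 assumes d: "\<And>s. \<bar>s\<bar> \<le> \<bar>t\<bar> ==> (q hvd q' s) (at s)"
  and L: "\<And>s. \<bar>s\<bar> \<le> \<bar>t\<bar> ==> norm (q' s) \<le> L * norm (q s)" and 0: "q 0 = 0"
 shows "q t = 0"
proof -
 have main: "p t = 0" if t: "t \<ge> 0" and d: "\<And>s. \<bar>s\<bar> \<le> t ==> (p hvd p' s) (at s)"
  and L: "\<And>s. \<bar>s\<bar> \<le> t ==> norm (p' s) \<le> L * norm (p s)" and 0: "p 0 = 0" for p p' :: "real => 'v" and t
 proof -
  let ?g = "%t. (p t \<bullet> p t) * exp (- 2 * L * t)"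
  have "?g t \<le> ?g 0"
  proof (rule DERIV_nonpos_imp_nonincreasing[OF t])
   fix u assume "0 \<le> u" "u \<le> t"
   then have u: "\<bar>u\<bar> \<le> t" by simp
   have "((%t. p t \<bullet> p t) has_real_derivative p u \<bullet> p' u + p' u \<bullet> p u) (at u)"
    using bounded_bilinear.has_vector_derivative[OF bounded_bilinear_inner d[OF u] d[OF u]]
    by (simp add: has_real_derivative_iff_has_vector_derivative)
   then have "(?g has_real_derivative ((p u \<bullet> p' u + p' u \<bullet> p u) * exp (- 2 * L * u)
     + (p u \<bullet> p u) * (exp (- 2 * L * u) * (- 2 * L)))) (at u)"
    by (auto intro!: derivative_eq_intros)
   moreover have "p u \<bullet> p' u \<le> norm (p u) * norm (p' u)" by (rule norm_cauchy_schwarz)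
   moreover have "norm (p u) * norm (p' u) \<le> norm (p u) * (L * norm (p u))" by (rule mult_left_mono[OF L[OF u]]) simp
   moreover have "norm (p u) * (L * norm (p u)) = L * (p u \<bullet> p u)" by (simp add: dot_square_norm power2_eq_square)
   ultimately show "\<exists>y. (?g has_real_derivative y) (at u) \<and> y \<le> 0"
    by (intro exI[of _ "(p u \<bullet> p' u + p' u \<bullet> p u) * exp (- 2 * L * u)
     + (p u \<bullet> p u) * (exp (- 2 * L * u) * (- 2 * L))"] conjI)
     (auto simp: inner_commute[of "p' u"] algebra_simps)
  qed
  then have "(p t \<bullet> p t) * exp (- 2 * L * t) \<le> 0" using 0 by simp
  then have "p t \<bullet> p t \<le> 0" by (simp add: mult_le_0_iff)
  then show ?thesis using inner_gt_zero_iff[of "p t"] by linarith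
 qed
 show ?thesis
 proof (cases "t \<ge> 0")
  case False
  have "(%s. q (- s)) (- t) = 0"
  proof (rule main[where p="%s. q (- s)" and p'="%s. - q' (- s)"])
   fix s assume s: "\<bar>s\<bar> \<le> - t"
   have "(uminus hvd - 1) (at s)" by (auto intro!: derivative_eq_intros)
   moreover have "(q hvd q' (- s)) (at (- s))" using d[of "- s"] s by simp
   ultimately show "((%s. q (- s)) hvd - q' (- s)) (at s)"
    using vector_diff_chain_at[of uminus "- 1" s q "q' (- s)"] by (simp add: o_def)
   show "norm (- q' (- s)) \<le> L * norm (q (- s))" using L[of "- s"] s by simp
  qed (use False 0 in auto)
  then show ?thesis by simp
 qed (use main[of t q q'] d L 0 in simp)
qed

lemma ode_unique:
 fixes c1 c2 :: "real => 'v::euclidean_space"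
 assumes lip: "\<And>x y. x : K ==> y : K ==> norm (V x - V y) \<le> L * norm (x - y)"
  and c1: "\<And>t. \<bar>t\<bar> \<le> de ==> c1 t : K \<and> (c1 hvd V (c1 t)) (at t)"
  and c2: "\<And>t. \<bar>t\<bar> \<le> de ==> c2 t : K \<and> (c2 hvd V (c2 t)) (at t)"
  and 0: "c1 0 = c2 0" and t: "\<bar>t\<bar> \<le> de"
 shows "c1 t = c2 t"
proof -
 have "(%t. c1 t - c2 t) t = 0"
 proof (rule linear_ode_zero[where q'="%t. V (c1 t) - V (c2 t)"])
  fix s assume "\<bar>s\<bar> \<le> \<bar>t\<bar>"
  then have s: "\<bar>s\<bar> \<le> de" using t by simp
  show "((%t. c1 t - c2 t) hvd V (c1 s) - V (c2 s)) (at s)"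
   using c1[OF s] c2[OF s] by (auto intro: has_vector_derivative_diff)
  show "norm (V (c1 s) - V (c2 s)) \<le> L * norm (c1 s - c2 s)" using c1[OF s] c2[OF s] lip by blast
 qed (simp add: 0)
 then show ?thesis by simp
qed

context lie_grp
begin

section \<open>Existence of one-parameter subgroups\<close>

text \<open>The extension is the power \<open>n\<close> of \<open>a (t / n)\<close> for large
  \<open>n\<close>. Two choices of \<open>n\<close> agree, since both are powers of the value at a
  common fraction of \<open>t\<close>, and additivity holds because the small elements
  commute.\<close>

lemma extend_local_hom:
 fixes a :: "real => 'a" and de :: real
 assumes a: "continuous_on UNIV a" and d: "de > 0"
  and hom: "\<And>s t. \<bar>s\<bar> \<le> de ==> \<bar>t\<bar> \<le> de ==> a (s + t) = a s \<cdot> a t"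
 shows "\<exists>ga. continuous_on UNIV ga \<and> (\<forall>s t. ga (s + t) = ga s \<cdot> ga t) \<and> (\<forall>t. \<bar>t\<bar> \<le> de \<longrightarrow> ga t = a t)"
proof -
 have a0: "a 0 = \<e>" using hom[of 0 0] d r_cancel_one[of "a 0" "a 0"] by simp
 have pw: "a (real n * x) = a x [^]\<^bsub>G\<^esub> n" if "real n * \<bar>x\<bar> \<le> de" for n x
  using that
 proof (induction n)
  case 0 show ?case by (simp add: a0)
 next
  case (Suc n)
  have s: "real (Suc n) * \<bar>x\<bar> = real n * \<bar>x\<bar> + \<bar>x\<bar>" by (simp add: algebra_simps)
  have nn: "0 \<le> real n * \<bar>x\<bar>" by simp
  have b: "real n * \<bar>x\<bar> \<le> de" and b2: "\<bar>x\<bar> \<le> de"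
   using Suc.prems s nn abs_ge_zero[of x] by linarith+
  have "a (real (Suc n) * x) = a (real n * x + x)" by (simp add: algebra_simps)
  also have "\<dots> = a (real n * x) \<cdot> a x" by (rule hom) (use b b2 in \<open>simp_all add: abs_mult\<close>)
  finally show ?case using Suc.IH[OF b] by simp
 qed
 have indep: "a (t / real n) [^]\<^bsub>G\<^esub> n = a (t / real m) [^]\<^bsub>G\<^esub> m"
  if "n > 0" "m > 0" "\<bar>t\<bar> \<le> real n * de" "\<bar>t\<bar> \<le> real m * de" for n m t
 proof -
  let ?x = "t / real (n * m)"
  have 1: "real m * ?x = t / real n" "real n * ?x = t / real m" using that by (auto simp: field_simps)
  have e: "real m * \<bar>?x\<bar> = \<bar>t\<bar> / real n" "real n * \<bar>?x\<bar> = \<bar>t\<bar> / real m"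
   using that by (auto simp: field_simps abs_mult)
  have "real m * \<bar>?x\<bar> \<le> de" "real n * \<bar>?x\<bar> \<le> de" unfolding e using that by (simp_all add: field_simps)
  then have "a (t / real n) = a ?x [^]\<^bsub>G\<^esub> m" "a (t / real m) = a ?x [^]\<^bsub>G\<^esub> n"
   using pw[of m ?x] pw[of n ?x] 1 by simp_all
  then show ?thesis by (simp add: nat_pow_pow mult.commute)
 qed
 define N where "N t = Suc (nat \<lceil>\<bar>t\<bar> / de\<rceil>)" for t
 have N: "N t > 0" "\<bar>t\<bar> \<le> real (N t) * de" for t
 proof -
  show "N t > 0" by (simp add: N_def)
  have "\<bar>t\<bar> / de \<le> real (N t)" unfolding N_def by linarith
  then show "\<bar>t\<bar> \<le> real (N t) * de" using d by (simp add: field_simps)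
 qed
 define ga where "ga t = a (t / real (N t)) [^]\<^bsub>G\<^esub> N t" for t
 have g: "ga t = a (t / real n) [^]\<^bsub>G\<^esub> n" if "n > 0" "\<bar>t\<bar> \<le> real n * de" for n t
  unfolding ga_def by (rule indep) (use N that in auto)
 have powc: "continuous_on UNIV (%t. a (t / real n) [^]\<^bsub>G\<^esub> (k::nat))" for n k
 proof (induction k)
  case (Suc k)
  have "continuous_on UNIV (%t. a (t / real n))"
   by (rule continuous_on_compose2[OF a]) (auto intro!: continuous_intros simp: divide_inverse)
  then show ?case using mult_continuous_on[OF Suc] by simp
 qed simp
 have "isCont ga t" for t
 proof -
  define n where "n = N (\<bar>t\<bar> + 1)"
  have n: "n > 0" "\<bar>t\<bar> + 1 \<le> real n * de" using N[of "\<bar>t\<bar> + 1"] by (auto simp: n_def)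
  have "isCont (%t. a (t / real n) [^]\<^bsub>G\<^esub> n) t"
   using powc continuous_on_eq_continuous_at open_UNIV by blast
  moreover have "\<forall>\<^sub>F s in nhds t. a (s / real n) [^]\<^bsub>G\<^esub> n = ga s"
   unfolding eventually_nhds_metric
  proof (intro exI[of _ 1] conjI allI impI)
   fix s assume "dist s t < 1"
   then have "\<bar>s\<bar> \<le> real n * de" using n(2) by (auto simp: dist_real_def)
   then show "a (s / real n) [^]\<^bsub>G\<^esub> n = ga s" using g[OF n(1)] by simp
  qed simp
  ultimately show ?thesis using isCont_cong by fast
 qed
 then have "continuous_on UNIV ga" by (simp add: continuous_at_imp_continuous_on)
 moreover have "ga (s + t) = ga s \<cdot> ga t" for s t
 proof -
  define n where "n = N (\<bar>s\<bar> + \<bar>t\<bar>)"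
  have n: "n > 0" "\<bar>s\<bar> + \<bar>t\<bar> \<le> real n * de" using N[of "\<bar>s\<bar> + \<bar>t\<bar>"] by (auto simp: n_def)
  have st: "\<bar>s / real n\<bar> \<le> de" "\<bar>t / real n\<bar> \<le> de" using n by (auto simp: field_simps abs_mult)
  have "ga (s + t) = a (s / real n + t / real n) [^]\<^bsub>G\<^esub> n"
   using g[OF n(1), of "s + t"] n(2) by (simp add: add_divide_distrib)
  also have "\<dots> = (a (s / real n) \<cdot> a (t / real n)) [^]\<^bsub>G\<^esub> n" using hom[OF st] by simp
  also have "\<dots> = a (s / real n) [^]\<^bsub>G\<^esub> n \<cdot> a (t / real n) [^]\<^bsub>G\<^esub> n"
   using hom[OF st] hom[OF st(2,1)] by (intro pow_mult_distrib) (simp_all add: add.commute)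
  also have "\<dots> = ga s \<cdot> ga t" using g[OF n(1), of s] g[OF n(1), of t] n(2) by simp
  finally show ?thesis .
 qed
 moreover have "ga t = a t" if "\<bar>t\<bar> \<le> de" for t
  using g[of 1 t] that by simp
 ultimately show ?thesis by blast
qed

section \<open>Multiplication and left invariant fields in the chart at the identity\<close>

definition mm :: "'v \<times> 'v => 'v" where "mm p = ph1 (ps1 (fst p) \<cdot> ps1 (snd p))"
definition TT :: "('v \<times> 'v) set" where "TT = {p : S1 \<times> S1. ps1 (fst p) \<cdot> ps1 (snd p) : U1}"
text \<open>The left invariant vector field of \<open>X\<close> in coordinates.\<close>

definition VF :: "'v => 'v => 'v" where "VF X u = dirder mm (0, xi X) (u, e1)"

lemma TT: "relopen (E \<times> E) TT" "smooth_on (E \<times> E) TT mm"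
 using mult_chart_smooth[OF chart1(1) chart1(1) chart1(1)] 
 unfolding TT_def mm_def[abs_def] S1_def ps1_def by auto

lemma TT_e1: "u : S1 ==> (u, e1) : TT" "u : S1 ==> mm (u, e1) = u"
 using chart1_facts by (auto simp: TT_def mm_def)

lemma mm_in: "p : TT ==> mm p : S1" "p : TT ==> ps1 (mm p) = ps1 (fst p) \<cdot> ps1 (snd p)"
 using chart1_facts(8,11) by (auto simp: TT_def mm_def)

lemma S1_E: "u : S1 ==> u : E"
 using relopen_subset[OF chart1_facts(2)] by blast

lemma zero_E: "0 : E" by (rule subspace_0[OF E_sub])

lemma mm_line:
 assumes X: "X : E" and u: "u : S1"
 shows "((%h. mm (u, e1 + h *R xi X)) hvd VF X u) (at 0)"
  "\<forall>\<^sub>F h in at 0. (u, e1 + h *R xi X) : TT" "VF X u : E"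
proof -
 show 1: "((%h. mm (u, e1 + h *R xi X)) hvd VF X u) (at 0)"
  using smooth_on_deriv[OF TT, of "(0, xi X)" "(u, e1)"] TT_e1[OF u] xi[OF X] zero_E by (simp add: VF_def)
 obtain d where d: "d > 0" "\<And>t. \<bar>t\<bar> < d ==> (u, e1) + t *R (0, xi X) : TT"
  using relopen_line[OF TT(1) TT_e1(1)[OF u], of "(0, xi X)"] xi[OF X] zero_E by blast
 show 2: "\<forall>\<^sub>F h in at 0. (u, e1 + h *R xi X) : TT"
  unfolding eventually_at using d by (intro exI[of _ d]) auto
 show "VF X u : E"
 proof (rule deriv_in_subspace[OF E_sub 1])
  show "\<forall>\<^sub>F h in at 0. mm (u, e1 + h *R xi X) : E" using 2 by eventually_elim (use mm_in S1_E in blast)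
 qed (use TT_e1[OF u] u S1_E in simp)
qed

lemma VF_smooth: assumes "X : E" shows "smooth_on E S1 (VF X)"
proof -
 have "smooth_on (E \<times> E) TT (dirder mm (0, xi X))"
  by (rule smooth_on_dirder[OF TT]) (use xi[OF assms] zero_E in auto)
 then show ?thesis unfolding VF_def
  by (rule smooth_on_compose[OF chart1_facts(2) TT(1), rotated 2])
    (use TT_e1 in \<open>auto intro!: smooth_on_Pair smooth_on_const smooth_on_ident\<close>)
qed

lemma VF_left_field:
 assumes X: "X : E" and u: "u : S1" and f: "f : CG"
 shows "dirder (%u. f (ps1 u)) (VF X u) u = left_field G X f (ps1 u)"
proof -
 note l = mm_line[OF X u]
 have "((%h. f (ps1 (mm (u, e1 + h *R xi X)))) hvd dirder (%u. f (ps1 u)) (VF X u) (mm (u, e1 + 0 *R xi X))) (at 0)"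
 proof (rule chain_curve[OF chart1_facts(2) smooth_on_Ck[OF CG_chart1[OF f]] _ l(1) _ l(3)])
  show "\<forall>\<^sub>F h in at 0. mm (u, e1 + h *R xi X) : E" using l(2) by eventually_elim (use mm_in S1_E in blast)
 qed (use u TT_e1[OF u] in simp)
 then have "((%h. f (ps1 u \<cdot> ps1 (e1 + h *R xi X))) hvd dirder (%u. f (ps1 u)) (VF X u) u) (at 0)"
  unfolding has_vector_derivative_def TT_e1(2)[OF u] scaleR_zero_left add_0_right
 proof (rule has_derivative_transform_eventually)
  show "\<forall>\<^sub>F h in at 0. f (ps1 (mm (u, e1 + h *R xi X))) = f (ps1 u \<cdot> ps1 (e1 + h *R xi X))"
   using l(2) by eventually_elim (simp add: mm_in)
 qed (simp_all add: mm_in TT_e1 u chart1_facts(7))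
 then have "Dl (xi X) (%y. f (ps1 u \<cdot> y)) = dirder (%u. f (ps1 u)) (VF X u) u" by (rule Dl_eqI)
 then show ?thesis using xi(3)[OF X CG_left[OF f, of "ps1 u"]] by (simp add: left_field_def)
qed

text \<open>Associativity, differentiated: in u (v z) = (u v) z the factor z moves away from the
  identity in the direction of \<open>X\<close>.\<close>

lemma VF_left_inv:
 assumes X: "X : E" and uv: "(u, v) : TT"
 shows "dirder mm (0, VF X v) (u, v) = VF X (mm (u, v))"
proof -
 have u: "u : S1" and v: "v : S1" using uv by (auto simp: TT_def)
 have w: "mm (u, v) : S1" by (rule mm_in(1)[OF uv])
 note lv = mm_line[OF X v] and lw = mm_line[OF X w]
 let ?k = "%h. mm (v, e1 + h *R xi X)"
 have k0: "?k 0 = v" using TT_e1[OF v] by simp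
 have "((%h. mm (u, ?k h)) hvd dirder mm (0, VF X v) (u, ?k 0)) (at 0)"
 proof (rule chain_curve[OF TT(1) smooth_on_Ck[OF TT(2)]])
  show "((%h. (u, ?k h)) hvd (0, VF X v)) (at 0)"
   by (intro has_vector_derivative_Pair has_vector_derivative_const lv)
  show "\<forall>\<^sub>F h in at 0. (u, ?k h) : E \<times> E" using lv(2) by eventually_elim (use mm_in S1_E u in blast)
 qed (use uv k0 zero_E lv(3) in auto)
 then have "((%h. mm (mm (u, v), e1 + h *R xi X)) hvd dirder mm (0, VF X v) (u, v)) (at 0)"
  unfolding has_vector_derivative_def k0
 proof (rule has_derivative_transform_eventually)
  show "\<forall>\<^sub>F h in at 0. mm (u, ?k h) = mm (mm (u, v), e1 + h *R xi X)"
   using lv(2)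
  proof eventually_elim
   case (elim h)
   then show ?case using mm_in(2)[OF elim] mm_in(2)[OF uv] by (simp add: mm_def[of "(u, mm (v, e1 + h *R xi X))"] mm_def[of "(mm (u, v), e1 + h *R xi X)"] m_assoc)
  qed
  show "mm (u, ?k 0) = mm (mm (u, v), e1 + 0 *R xi X)" using TT_e1[OF v] TT_e1[OF w] by simp
 qed simp
 from vector_derivative_unique_at[OF this lw(1)] show ?thesis .
qed

text \<open>An integral curve \<open>c\<close> of the left invariant field is a local homomorphism:
  by left invariance \<open>mm (c s, c t)\<close> and \<open>c (s + t)\<close> solve the same
  equation in \<open>t\<close>. Then \<open>extend_local_hom\<close> applies.\<close>

lemma one_param_exists:
 assumes X: "X : E"
 shows "\<exists>ga. one_param G X ga"
proof -
 obtain r where r: "r > 0" "E \<inter> cball e1 r \<subseteq> S1" by (rule small_radius)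
 let ?K = "E \<inter> cball e1 r"
 note Vs = VF_smooth[OF X]
 obtain L where L: "L \<ge> 0" "\<forall>x\<in>?K. \<forall>y\<in>?K. norm (VF X x - VF X y) \<le> L * norm (x - y)"
  using C1_lipschitz[OF chart1_facts(2) smooth_on_Ck[OF Vs] r(2)] by blast
 have lip: "norm (VF X x - VF X y) \<le> L * norm (x - y)" if "x : ?K" "y : ?K" for x y using L(2) that by blast
 have "\<exists>ep>0. \<exists>c. (\<forall>t. c t : ?K) \<and> continuous_on UNIV c \<and> c 0 = e1 \<and>
   (\<forall>t. \<bar>t\<bar> < ep \<longrightarrow> (c hvd VF X (c t)) (at t))"
  by (rule picard[OF E_sub chart1_facts(6) r(1) continuous_on_subset[OF smooth_on_continuous[OF Vs] r(2)] _ L(1) lip])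
    (use mm_line(3)[OF X] r(2) in blast)+
 then obtain ep c where eps: "ep > 0" and cK: "\<And>t. c t : ?K" and cc: "continuous_on UNIV c" and c0: "c 0 = e1"
  and cd: "\<And>t. \<bar>t\<bar> < ep ==> (c hvd VF X (c t)) (at t)" by blast
 have cS: "c t : S1" "c t : E" for t using cK r(2) by auto
 define a where "a t = ps1 (c t)" for t
 have ac: "continuous_on UNIV a" unfolding a_def
  by (rule continuous_on_compose2[OF chart1_facts(3) cc]) (use cS in auto)
 have a0: "a 0 = \<e>" by (simp add: a_def c0 chart1_facts(7))
 let ?W = "{x : U1. ph1 x : ball e1 r}"
 have W: "open ?W"
  using continuous_open_preimage[OF chart1_facts(4,1), of "ball e1 r"] by (simp add: vimage_def Int_def)
 have "open ((%p. a (fst p) \<cdot> a (snd p)) -` ?W)"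
  by (rule open_vimage[OF W], rule mult_continuous_on) (rule continuous_on_compose2[OF ac], auto intro!: continuous_intros)+
 moreover have "(0, 0) : (%p. a (fst p) \<cdot> a (snd p)) -` ?W"
  using r(1) by (simp add: a0 chart1(2) e1_def[symmetric])
 ultimately obtain d where d: "d > 0" "ball (0, 0) d \<subseteq> (%p. a (fst p) \<cdot> a (snd p)) -` ?W"
  unfolding open_contains_ball by blast
 \<comment> \<open>For times of at most this size the pair stays in the ball of radius
   \<open>d\<close>, where products remain in the chart, and the sum of the times stays within the
   existence time \<open>ep\<close>.\<close>
 define de where "de = min (d / 3) (min (ep / 3) (1 / (L + 2)))"
 have del: "de > 0" "de \<le> d / 3" "de \<le> ep / 3" "L * de < 1"
 proof -
  show "de > 0" "de \<le> d / 3" "de \<le> ep / 3" using d eps L by (auto simp: de_def)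
  have "de \<le> 1 / (L + 2)" by (simp add: de_def)
  then have "L * de \<le> L * (1 / (L + 2))" using L by (intro mult_left_mono) auto
  also have "\<dots> < 1" using L by (simp add: field_simps)
  finally show "L * de < 1" .
 qed
 have st: "(c s, c t) : TT \<and> mm (c s, c t) : ?K" if "\<bar>s\<bar> \<le> de" "\<bar>t\<bar> \<le> de" for s t
 proof -
  have "dist (0, 0) (s, t) \<le> \<bar>s\<bar> + \<bar>t\<bar>" by (simp add: dist_Pair_Pair dist_real_def sqrt_sum_squares_le_sum_abs)
  then have "(s, t) : ball (0, 0) d" using that del d by auto
  then have "a s \<cdot> a t : ?W" using d(2) by auto
  then have "(c s, c t) : TT" "mm (c s, c t) : ball e1 r" using cS by (auto simp: TT_def mm_def a_def)
  then show ?thesis using mm_in(1) S1_E by auto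
 qed
 have hom: "a (s + t) = a s \<cdot> a t" if s: "\<bar>s\<bar> \<le> de" and t: "\<bar>t\<bar> \<le> de" for s t
 proof -
  have "mm (c s, c t) = c (s + t)"
  proof (rule ode_unique[where K="?K" and V="VF X" and L=L and de=de and ?c1.0="%t. mm (c s, c t)" and ?c2.0="%t. c (s + t)", OF lip _ _ _ t])
   fix t' assume t': "\<bar>t'\<bar> \<le> de"
   note T = st[OF s t']
   have "((%t. mm (c s, c t)) hvd dirder mm (0, VF X (c t')) (c s, c t')) (at t')"
   proof (rule chain_curve[OF TT(1) smooth_on_Ck[OF TT(2)]])
    show "((%t. (c s, c t)) hvd (0, VF X (c t'))) (at t')"
     by (intro has_vector_derivative_Pair has_vector_derivative_const cd) (use t' del eps in linarith)
    show "\<forall>\<^sub>F t in at t'. (c s, c t) : E \<times> E" using cS by simp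
   qed (use T zero_E mm_line(3)[OF X cS(1)] in auto)
   then show "mm (c s, c t') : ?K \<and> ((%t. mm (c s, c t)) hvd VF X (mm (c s, c t'))) (at t')"
    using T VF_left_inv[OF X conjunct1[OF T]] by simp
   have "(c hvd VF X (c (s + t'))) (at (s + t'))"
    by (rule cd) (use s t' del eps in linarith)
   then have "(c \<circ> (%t. s + t) hvd 1 *R VF X (c (s + t'))) (at t')"
    by (intro vector_diff_chain_at) (auto intro!: derivative_eq_intros)
   then show "c (s + t') : ?K \<and> ((%t. c (s + t)) hvd VF X (c (s + t'))) (at t')"
    using cK by (simp add: o_def)
  qed (use del c0 TT_e1 cS in auto)
  then show ?thesis using mm_in(2)[OF conjunct1[OF st[OF s t]]] by (simp add: a_def)
 qed
 obtain ga where g: "continuous_on UNIV ga" "\<And>s t. ga (s + t) = ga s \<cdot> ga t" "\<And>t. \<bar>t\<bar> \<le> de ==> ga t = a t"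
  using extend_local_hom[OF ac del(1) hom] by blast
 have "((%t. f (ga t)) has_real_derivative tangent G X f) (at 0)" if f: "f : CG" for f
 proof -
  have "((%t. f (ps1 (c t))) hvd dirder (%u. f (ps1 u)) (VF X (c 0)) (c 0)) (at 0)"
   by (rule chain_curve[OF chart1_facts(2) smooth_on_Ck[OF CG_chart1[OF f]]])
     (use cS cd[of 0] eps mm_line(3)[OF X cS(1)] in auto)
  then have "((%t. f (a t)) hvd tangent G X f) (at 0)"
   using VF_left_field[OF X chart1_facts(5) f] by (simp add: c0 chart1_facts(7) left_field_at_one a_def)
  then have "((%t. f (ga t)) hvd tangent G X f) (at 0)"
   by (rule has_vector_derivative_transform_within[OF _ del(1)]) (auto simp: g(3))
  then show ?thesis by (simp add: has_real_derivative_iff_has_vector_derivative)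
 qed
 then have "one_param G X ga" using g by (auto simp: one_param_def)
 then show ?thesis by blast
qed

end

section \<open>Smooth functions and polynomials on a subspace\<close>

lemma C_infI: "(\<And>x. x \<notin> S ==> f x = 0) ==> smooth_on S S f ==> f : C_inf S"
 by (simp add: C_inf_def)

lemma C_inf_outside: "f : C_inf S ==> x \<notin> S ==> f x = 0"
 by (simp add: C_inf_def)

lemma C_inf_smooth: "f : C_inf S ==> smooth_on S S f"
 by (simp add: C_inf_def)

lemma C_inf_eqI: "f : C_inf S ==> g : C_inf S ==> (\<And>x. x : S ==> f x = g x) ==> f = g"
 by (rule ext) (metis C_inf_outside)

lemma C_inf_zero: "(%_. 0) : C_inf S"
 by (simp add: C_inf_def smooth_on_const)

lemma C_inf_add: "f : C_inf S ==> g : C_inf S ==> (%x. f x + g x) : C_inf S"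
 by (simp add: C_inf_def smooth_on_add)

lemma C_inf_diff: "f : C_inf S ==> g : C_inf S ==> (%x. f x - g x) : C_inf S"
 by (simp add: C_inf_def smooth_on_diff)

lemma C_inf_mult: "f : C_inf S ==> g : C_inf S ==> (%x. f x * g x) : C_inf S"
 by (simp add: C_inf_def smooth_on_mult)

lemma C_inf_scale: "f : C_inf S ==> (%x. c * f x) : C_inf S"
 by (simp add: C_inf_def smooth_on_mult smooth_on_const)

lemma C_inf_sum: "(\<And>i. i : I ==> f i : C_inf S) ==> (%x. \<Sum>i\<in>I. f i x) : C_inf S"
 by (simp add: C_inf_def smooth_on_sum)

lemma ext0_C_inf:
 assumes "subspace S" "smooth_on S S f" shows "ext0 S f : C_inf S"
proof (rule C_infI)
 show "smooth_on S S (ext0 S f)"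
  by (rule smooth_on_cong[OF relopen_self[OF assms(1)] _ assms(2)]) (simp add: ext0_def)
qed (simp add: ext0_def)

lemma C_inf_pullback:
 assumes "subspace S" "subspace S'" "bounded_linear w" "w ` S' \<subseteq> S" "f : C_inf S"
 shows "ext0 S' (%x. f (w x)) : C_inf S'"
 by (rule ext0_C_inf[OF assms(2)],
   rule smooth_on_compose[OF relopen_self[OF assms(2)] relopen_self[OF assms(1)] smooth_on_id_linear[OF assms(3)] assms(4) C_inf_smooth[OF assms(5)]])

lemma Pol_C_inf: assumes "subspace S" "p : Pol S" shows "p : C_inf S"
 using assms by (auto simp: Pol_def intro!: ext0_C_inf smooth_on_polynomial)

lemma dir_deriv_apply: "x : S ==> dir_deriv S X f x = dirder f X x"
 by (simp add: dir_deriv_def ext0_def dirder_def)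

lemma dir_deriv_outside: "x \<notin> S ==> dir_deriv S X f x = 0"
 by (simp add: dir_deriv_def ext0_def)

lemma dir_deriv_C_inf:
 assumes "subspace S" "X : S" "f : C_inf S" shows "dir_deriv S X f : C_inf S"
proof -
 have "dir_deriv S X f = ext0 S (dirder f X)" by (simp add: dir_deriv_def dirder_def[abs_def])
 then show ?thesis
  using ext0_C_inf[OF assms(1) smooth_on_dirder[OF relopen_self[OF assms(1)] C_inf_smooth[OF assms(3)] assms(2)]] by simp
qed

lemma C_inf_deriv:
 assumes "subspace S" "f : C_inf S" "X : S" "x : S"
 shows "((%t. f (x + t *R X)) hvd dir_deriv S X f x) (at 0)"
 unfolding dir_deriv_apply[OF assms(4)]
 by (rule smooth_on_deriv[OF relopen_self[OF assms(1)] C_inf_smooth[OF assms(2)] assms(3,4)])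

lemma dir_deriv_eqI:
 assumes "x : S" "((%t. f (x + t *R X)) hvd d) (at 0)"
 shows "dir_deriv S X f x = d"
 unfolding dir_deriv_apply[OF assms(1)] dirder_def by (rule vector_derivative_at[OF assms(2)])

lemma dir_deriv_add:
 assumes "subspace S" "X : S" "f : C_inf S" "g : C_inf S"
 shows "dir_deriv S X (%x. f x + g x) = (%x. dir_deriv S X f x + dir_deriv S X g x)"
proof
 fix x show "dir_deriv S X (%x. f x + g x) x = dir_deriv S X f x + dir_deriv S X g x"
  by (cases "x : S") (auto intro!: dir_deriv_eqI has_vector_derivative_add C_inf_deriv assms simp: dir_deriv_outside)
qed

lemma dir_deriv_mult:
 assumes "subspace S" "X : S" "f : C_inf S" "g : C_inf S"
 shows "dir_deriv S X (%x. f x * g x) = (%x. f x * dir_deriv S X g x + dir_deriv S X f x * g x)"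
proof
 fix x
 have "dir_deriv S X (%x. f x * g x) x = f (x + 0 *R X) * dir_deriv S X g x + dir_deriv S X f x * g (x + 0 *R X)"
  if "x : S"
  by (rule dir_deriv_eqI[OF that]) (rule has_vector_derivative_mult[OF C_inf_deriv C_inf_deriv]; (rule assms that))
 then show "dir_deriv S X (%x. f x * g x) x = f x * dir_deriv S X g x + dir_deriv S X f x * g x"
  by (cases "x : S") (simp_all add: dir_deriv_outside)
qed

lemma dir_deriv_scale:
 assumes "subspace S" "X : S" "f : C_inf S"
 shows "dir_deriv S X (%x. c * f x) = (%x. c * dir_deriv S X f x)"
proof
 fix x show "dir_deriv S X (%x. c * f x) x = c * dir_deriv S X f x"
  by (cases "x : S") (auto intro!: dir_deriv_eqI bounded_linear.has_vector_derivative[OF bounded_linear_mult_right]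
     C_inf_deriv assms simp: dir_deriv_outside)
qed

lemma dir_deriv_commute:
 assumes "subspace S" "X : S" "Y : S" "f : C_inf S"
 shows "dir_deriv S X (dir_deriv S Y f) = dir_deriv S Y (dir_deriv S X f)"
proof
 fix x
 have R: "relopen S S" using assms by (simp add: relopen_self)
 have "dir_deriv S U (dir_deriv S V f) x = dirder (dirder f V) U x" if "x : S" "U : S" for U V
  unfolding dir_deriv_apply[OF that(1)] by (rule dirder_cong[OF R that]) (simp add: dir_deriv_apply)
 then show "dir_deriv S X (dir_deriv S Y f) x = dir_deriv S Y (dir_deriv S X f) x"
  using dirder_commute[OF R smooth_on_Ck[OF C_inf_smooth[OF assms(4)]], of Y X x] assms
  by (cases "x : S") (simp_all add: dir_deriv_outside)
qed

lemma dir_deriv_sum_vec: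
 assumes "subspace S" "\<And>i. i : I ==> v i : S" "f : C_inf S"
 shows "dir_deriv S (\<Sum>i\<in>I. c i *R v i) f x = (\<Sum>i\<in>I. of_real (c i) * dir_deriv S (v i) f x)"
proof (cases "x : S")
 case True
 then show ?thesis
  using dirder_sum[OF relopen_self[OF assms(1)] smooth_on_Ck[OF C_inf_smooth[OF assms(3)]] True, of I v c] assms(2)
  by (simp add: dir_deriv_apply scaleR_conv_of_real)
qed (simp add: dir_deriv_outside)

lemma dir_deriv_vec:
 assumes "subspace S" "f : C_inf S" "X : S"
 shows "Y : S ==> dir_deriv S (X + Y) f x = dir_deriv S X f x + dir_deriv S Y f x"
  "dir_deriv S (c *R X) f x = of_real c * dir_deriv S X f x"
  "dir_deriv S (- X) f x = - dir_deriv S X f x"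
  "Y : S ==> dir_deriv S (X - Y) f x = dir_deriv S X f x - dir_deriv S Y f x"
  "dir_deriv S 0 f x = 0"
proof -
 note d = dirder_linear[OF relopen_self[OF assms(1)] smooth_on_Ck[OF C_inf_smooth[OF assms(2)]], of x]
 show "Y : S ==> dir_deriv S (X + Y) f x = dir_deriv S X f x + dir_deriv S Y f x"
  using d(1) assms(3) by (cases "x : S") (auto simp: dir_deriv_apply dir_deriv_outside)
 show "dir_deriv S (c *R X) f x = of_real c * dir_deriv S X f x"
  using d(2) assms(3) by (cases "x : S") (auto simp: dir_deriv_apply dir_deriv_outside scaleR_conv_of_real)
 show "dir_deriv S (- X) f x = - dir_deriv S X f x"
  using d(4) assms(3) by (cases "x : S") (auto simp: dir_deriv_apply dir_deriv_outside)
 show "Y : S ==> dir_deriv S (X - Y) f x = dir_deriv S X f x - dir_deriv S Y f x"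
  using d(3) assms(3) by (cases "x : S") (auto simp: dir_deriv_apply dir_deriv_outside)
 show "dir_deriv S 0 f x = 0"
  using d(5) by (cases "x : S") (auto simp: dir_deriv_apply dir_deriv_outside)
qed

lemma polynomial_function_compose_linear:
 assumes "bounded_linear h" "polynomial_function p"
 shows "polynomial_function (%x. h (p x))"
 unfolding polynomial_function_def
proof (intro allI impI)
 fix f :: "'b => real" assume "bounded_linear f"
 then have "bounded_linear (%x. f (h x))" using assms(1) by (rule bounded_linear_compose)
 then have "real_polynomial_function ((%x. f (h x)) \<circ> p)" using assms(2) unfolding polynomial_function_def by blast
 then show "real_polynomial_function (f \<circ> (%x. h (p x)))" by (simp add: o_def)
qed

text \<open>The form is only assumed bilinear on the subspace, as this is all that is known of the Killing form.\<close>

locale form_space =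
 fixes S :: "'v::euclidean_space set" and B :: "'v => 'v => real"
 assumes subS: "subspace S"
  and B_add: "x : S ==> y : S ==> z : S ==> B (x + y) z = B x z + B y z"
  and B_scale: "x : S ==> y : S ==> B (c *R x) y = c * B x y"
  and B_sym: "x : S ==> y : S ==> B x y = B y x"
  and B_pos: "x : S ==> x \<noteq> 0 ==> B x x > 0"
begin

lemma S_simps [simp]: "0 : S" "x : S ==> y : S ==> x + y : S" "x : S ==> y : S ==> x - y : S"
 "x : S ==> c *R x : S" "x : S ==> - x : S"
 using subS by (auto simp: subspace_0 subspace_add subspace_diff subspace_scale subspace_neg)

lemma S_sum: "(\<And>i. i : I ==> f i : S) ==> sum f I : S"
 using subS by (rule subspace_sum)

lemma B_add2: "x : S ==> y : S ==> z : S ==> B x (y + z) = B x y + B x z"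
 using B_add[of y z x] by (simp add: B_sym)

lemma B_scale2: "x : S ==> y : S ==> B x (c *R y) = c * B x y"
 using B_scale[of y x c] by (simp add: B_sym)

lemma B_zero: "x : S ==> B 0 x = 0" "x : S ==> B x 0 = 0"
 using B_scale[of x x 0] B_scale2[of x x 0] by simp_all

lemma B_minus: "x : S ==> y : S ==> B (- x) y = - B x y" "x : S ==> y : S ==> B x (- y) = - B x y"
 using B_scale[of x y "-1"] B_scale2[of x y "-1"] by simp_all

lemma B_diff: "x : S ==> y : S ==> z : S ==> B (x - y) z = B x z - B y z"
 "x : S ==> y : S ==> z : S ==> B z (x - y) = B z x - B z y"
 using B_add[of x "- y" z] B_add2[of z x "- y"] by (simp_all add: B_minus)

lemma B_sum: "(\<And>i. i : I ==> f i : S) ==> y : S ==> B (\<Sum>i\<in>I. c i *R f i) y = (\<Sum>i\<in>I. c i * B (f i) y)"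
 by (induction I rule: infinite_finite_induct) (auto simp: B_zero B_add B_scale S_sum)

lemma B_sum2: "(\<And>i. i : I ==> f i : S) ==> y : S ==> B y (\<Sum>i\<in>I. c i *R f i) = (\<Sum>i\<in>I. c i * B y (f i))"
 using B_sum[of I f y c] by (simp add: B_sym S_sum)

lemma B_bounded_linear: assumes "X : S" shows "bounded_linear (%y. B X (prj S y))"
proof -
 have "linear (%y. B X (prj S y))"
  by (rule linearI) (simp_all add: linear_add[OF prj_linear] linear_cmul[OF prj_linear] B_add2 B_scale2 prj_in subS assms)
 then show ?thesis by (simp add: linear_conv_bounded_linear)
qed

text \<open>A Parseval expansion in place of orthonormality: it is what traces use, and it passes
  easily to images under isometries and to families adapted to a decomposition.\<close>

definition frame :: "'i set => ('i => 'v) => bool" where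
 "frame I e \<longleftrightarrow> finite I \<and> (\<forall>i\<in>I. e i : S) \<and> (\<forall>x\<in>S. x = (\<Sum>i\<in>I. B x (e i) *R e i))"

text \<open>Each frame is expanded in the other and the sums are exchanged; symmetry of
  \<open>q\<close> and of \<open>B\<close> makes the two expansions meet.\<close>

lemma frame_trace:
 assumes e: "frame I e" and f: "frame J f"
  and q1: "\<And>x y z. x : S ==> y : S ==> z : S ==> q (x + y) z = q x z + q y z"
  and q2: "\<And>c x z. x : S ==> z : S ==> q (c *R x) z = of_real c * (q x z :: complex)"
  and q3: "\<And>x y. x : S ==> y : S ==> q x y = q y x"
 shows "(\<Sum>i\<in>I. q (e i) (e i)) = (\<Sum>j\<in>J. q (f j) (f j))"
proof -
 have q0: "q 0 z = 0" if "z : S" for z using q2[of 0 z 0] that by simp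
 have qs: "q (\<Sum>i\<in>K. c i *R g i) z = (\<Sum>i\<in>K. of_real (c i) * q (g i) z)"
  if "\<forall>i\<in>K. g i : S" "z : S" for K :: "'k set" and c g z
  using that by (induction K rule: infinite_finite_induct) (auto simp: q0 q1 q2 S_sum)
 have eS: "\<forall>i\<in>I. e i : S" and fS: "\<forall>j\<in>J. f j : S" using e f by (auto simp: frame_def)
 have "(\<Sum>i\<in>I. q (e i) (e i)) = (\<Sum>i\<in>I. q (\<Sum>j\<in>J. B (e i) (f j) *R f j) (e i))"
  using f eS by (intro sum.cong) (auto simp: frame_def)
 also have "\<dots> = (\<Sum>i\<in>I. \<Sum>j\<in>J. of_real (B (e i) (f j)) * q (f j) (e i))"
  using eS fS qs[of J f] by (intro sum.cong) auto
 also have "\<dots> = (\<Sum>j\<in>J. \<Sum>i\<in>I. of_real (B (f j) (e i)) * q (e i) (f j))"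
  by (subst sum.swap) (use eS fS in \<open>auto intro!: sum.cong simp: q3 B_sym\<close>)
 also have "\<dots> = (\<Sum>j\<in>J. q (\<Sum>i\<in>I. B (f j) (e i) *R e i) (f j))"
  using eS fS qs[of I e] by (intro sum.cong) auto
 also have "\<dots> = (\<Sum>j\<in>J. q (f j) (f j))"
  using e fS by (intro sum.cong) (auto simp: frame_def)
 finally show ?thesis .
qed

end

text \<open>Gram-Schmidt by induction on the dimension. The last conclusion will turn sums of
  squared norms over a root space into its multiplicity.\<close>

lemma frame_exists_dim:
 "form_space S B ==> dim S = n ==> \<exists>b\<subseteq>S. finite b \<and> (\<forall>x\<in>S. x = (\<Sum>v\<in>b. B x v *R v)) \<and>
  (\<Sum>v\<in>b. B v v) = real (dim S)"
proof (induction n arbitrary: S rule: less_induct)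
 case (less n)
 interpret form_space S B by fact
 show ?case
 proof (cases "S = {0}")
  case True
  then show ?thesis by (intro exI[of _ "{}"]) auto
 next
  case False
  then obtain x where x: "x : S" "x \<noteq> 0" using S_simps(1) by blast
  define e where "e = (1 / sqrt (B x x)) *R x"
  have eS: "e : S" using x by (simp add: e_def)
  have ee: "B e e = 1" using B_pos[OF x] x by (simp add: e_def B_scale B_scale2)
  define S' where "S' = {y : S. B e y = 0}"
  have sub': "subspace S'" unfolding S'_def subspace_def using eS by (auto simp: B_zero B_add2 B_scale2)
  have fs': "form_space S' B"
   by unfold_locales (use sub' in \<open>auto simp: S'_def intro: B_add B_scale B_sym B_pos\<close>)
  have "e \<notin> S'" by (simp add: S'_def ee)
  then have "S' \<subset> S" using eS by (auto simp: S'_def)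
  then have "dim S' < n" using less.prems(2) subS sub'
   by (metis dim_psubset span_eq_iff)
  from less.IH[OF this fs' refl] obtain b where b: "b \<subseteq> S'" "finite b" "\<forall>x\<in>S'. x = (\<Sum>v\<in>b. B x v *R v)" "(\<Sum>v\<in>b. B v v) = real (dim S')"
   by (elim exE conjE)
  have enb: "e \<notin> b" using b(1) ee by (auto simp: S'_def)
  have bS: "v : S \<and> B e v = 0" if "v : b" for v using b(1) that by (auto simp: S'_def)
  have yS': "y - B y e *R e : S'" if y: "y : S" for y
   using y eS ee by (simp add: S'_def B_diff B_scale2 B_sym[of e y])
  have "S \<subseteq> span (insert e S')"
  proof
   fix y assume "y : S"
   then have "(y - B y e *R e) + B y e *R e : span (insert e S')"
    by (intro span_add span_scale span_base) (simp_all add: yS')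
   then show "y : span (insert e S')" by simp
  qed
  then have "dim S = dim (insert e S')" using \<open>S' \<subset> S\<close> eS dim_subset[of "insert e S'" S] dim_subset[of S "span (insert e S')"]
   by (simp only: dim_span) fastforce
  also have "\<dots> = dim S' + 1" using \<open>e \<notin> S'\<close> by (simp add: dim_insert span_eq_iff[THEN iffD2, OF sub'])
  finally have dim: "(\<Sum>v\<in>insert e b. B v v) = real (dim S)" using b enb ee by simp
  have "y = (\<Sum>v\<in>insert e b. B y v *R v)" if y: "y : S" for y
  proof -
   let ?y' = "y - B y e *R e"
   have "?y' : S'" by (rule yS'[OF y])
   then have "?y' = (\<Sum>v\<in>b. B ?y' v *R v)" using b(3) by blast
   also have "\<dots> = (\<Sum>v\<in>b. B y v *R v)"
    using bS y eS by (intro sum.cong) (auto simp: B_diff B_scale)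
   finally show ?thesis using enb b(2) by (simp add: algebra_simps)
  qed
  then show ?thesis using b bS eS dim by (intro exI[of _ "insert e b"]) auto
 qed
qed

context form_space
begin

lemma frame_exists: "\<exists>b. frame b (%v. v) \<and> (\<Sum>v\<in>b. B v v) = real (dim S)"
 using frame_exists_dim[OF form_space_axioms refl] unfolding frame_def by blast

definition fr where "fr = (SOME b. frame b (%v. v) \<and> (\<Sum>v\<in>b. B v v) = real (dim S))"

lemma fr_frame: "frame fr (%v. v)" and fr_trace: "(\<Sum>v\<in>fr. B v v) = real (dim S)"
 unfolding fr_def using someI_ex[OF frame_exists] by auto

lemma fr: "finite fr" "v : fr ==> v : S" "x : S ==> (\<Sum>v\<in>fr. B x v *R v) = x"
 using fr_frame unfolding frame_def by auto

lemma riesz: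
 assumes "\<And>x y. x : S ==> y : S ==> h (x + y) = h x + (h y :: real)" "\<And>c x. x : S ==> h (c *R x) = c * h x"
 obtains X where "X : S" "\<forall>x\<in>S. B X x = h x"
proof -
 have hs: "h (\<Sum>i\<in>K. c i *R i) = (\<Sum>i\<in>K. c i * h i)" if "\<forall>i\<in>K. i : S" for K c
  using that assms(2)[of 0 0] by (induction K rule: infinite_finite_induct) (auto simp: assms S_sum)
 let ?X = "\<Sum>v\<in>fr. h v *R v"
 have X: "?X : S" using fr by (intro S_sum) auto
 moreover have "B ?X x = h x" if x: "x : S" for x
 proof -
  have "B ?X x = (\<Sum>v\<in>fr. h v * B v x)" using fr x by (intro B_sum) auto
  also have "\<dots> = (\<Sum>v\<in>fr. B x v * h v)" using fr x by (intro sum.cong) (auto simp: B_sym)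
  also have "\<dots> = h (\<Sum>v\<in>fr. B x v *R v)" using fr by (intro hs[symmetric]) auto
  finally show ?thesis using fr(3)[OF x] by simp
 qed
 ultimately show ?thesis using that[of ?X] by blast
qed

text \<open>The vector \<open>X\<close> as a linear polynomial function, under the identification of
  \<open>S\<close> with its dual by \<open>B\<close>.\<close>

definition lf :: "'v => 'v => complex" where "lf X = ext0 S (%x. of_real (B X x))"

lemma lf_apply: "x : S ==> lf X x = of_real (B X x)"
 by (simp add: lf_def ext0_def)

lemma lf_Pol: assumes "X : S" shows "lf X : Pol S"
proof -
 have "bounded_linear (%y. of_real (B X (prj S y)) :: complex)"
  by (rule bounded_linear_compose[OF bounded_linear_of_real B_bounded_linear[OF assms]])
 then have "polynomial_function (%y. of_real (B X (prj S y)) :: complex)" by (rule polynomial_function_bounded_linear)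
 moreover have "lf X = ext0 S (%y. of_real (B X (prj S y)) :: complex)"
  by (rule ext) (simp add: lf_def ext0_def prj_id[OF subS])
 ultimately show ?thesis by (auto simp: Pol_def)
qed

lemma lf_C: "X : S ==> lf X : C_inf S"
 by (rule Pol_C_inf[OF subS lf_Pol])

lemma dir_deriv_lf: "X : S ==> Y : S ==> x : S ==> dir_deriv S Y (lf X) x = of_real (B X Y)"
proof (rule dir_deriv_eqI)
 assume X: "X : S" and Y: "Y : S" and x: "x : S"
 have "((%t. of_real (B X x) + t *R of_real (B X Y)) hvd (of_real (B X Y) :: complex)) (at 0)"
  by (rule line_vderiv)
 then show "((%t. lf X (x + t *R Y)) hvd of_real (B X Y)) (at 0)"
  using X Y x by (simp add: lf_apply B_add2 B_scale2 scaleR_conv_of_real)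
qed

definition cst :: "complex => 'v => complex" where "cst c = ext0 S (%_. c)"

lemma cst_Pol: "cst c : Pol S"
 unfolding Pol_def cst_def by (auto intro!: exI[of _ "%_. c"])

lemma cst_C: "cst c : C_inf S"
 by (rule Pol_C_inf[OF subS cst_Pol])

lemma cst_mult: "f : C_inf S ==> (%x. cst c x * f x) = (%x. c * f x)"
 by (rule ext) (auto simp: cst_def ext0_def C_inf_outside)

lemma Pol_add: "p : Pol S ==> q : Pol S ==> (%x. p x + q x) : Pol S"
proof -
 assume "p : Pol S" "q : Pol S"
 then obtain p' q' where "polynomial_function p'" "polynomial_function q'" "p = ext0 S p'" "q = ext0 S q'"
  by (auto simp: Pol_def)
 then show ?thesis unfolding Pol_def
  by (auto intro!: exI[of _ "%x. p' x + q' x"] simp: ext0_def)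
qed

lemma Pol_mult: "p : Pol S ==> q : Pol S ==> (%x. p x * q x) : Pol S"
proof -
 assume "p : Pol S" "q : Pol S"
 then obtain p' q' where pq: "polynomial_function p'" "polynomial_function q'" "p = ext0 S p'" "q = ext0 S q'"
  by (auto simp: Pol_def)
 have "polynomial_function (%x. Re (p' x) *R q' x + Im (p' x) *R (\<i> * q' x))"
  by (intro polynomial_function_add polynomial_function_mult polynomial_function_compose_linear[OF bounded_linear_Re]
    polynomial_function_compose_linear[OF bounded_linear_Im] polynomial_function_compose_linear[OF bounded_linear_mult_right] pq)
 moreover have "Re (p' x) *R q' x + Im (p' x) *R (\<i> * q' x) = p' x * q' x" for x
  by (simp add: complex_eq_iff)
 ultimately have "polynomial_function (%x. p' x * q' x)" by simp
 moreover have "(%x. p x * q x) = ext0 S (%x. p' x * q' x)" using pq by (auto simp: ext0_def)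
 ultimately show ?thesis unfolding Pol_def by blast
qed

end

section \<open>Homogeneous components\<close>

context form_space
begin

text \<open>Homogeneous polynomials of degree \<open>d\<close>, generated by multiplication with
  linear forms, since the operators are controlled through their commutators with
  \<open>lf X\<close>. Zero belongs to every degree.\<close>

inductive PH :: "nat => ('v => complex) => bool" where
 PH_zero: "PH d (%_. 0)"
| PH_cst: "PH 0 (cst c)"
| PH_step: "X : S ==> PH d q ==> PH (Suc d) (%x. lf X x * q x)"
| PH_add: "PH d p ==> PH d q ==> PH d (%x. p x + q x)"

lemma Pol_zero: "(%_. 0) : Pol S"
proof -
 have "cst 0 = (%_. 0)" by (rule ext) (simp add: cst_def ext0_def)
 then show ?thesis using cst_Pol[of 0] by simp
qed

lemma PH_Pol: "PH d q ==> q : Pol S"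
 by (induction rule: PH.induct) (auto intro: Pol_zero cst_Pol Pol_mult lf_Pol Pol_add)

lemma PH_C: "PH d q ==> q : C_inf S"
 using PH_Pol Pol_C_inf[OF subS] by blast

lemma PH_scale: "PH d q ==> PH d (%x. c * q x)"
proof (induction rule: PH.induct)
 case (PH_cst a)
 have "(%x. c * cst a x) = cst (c * a)" by (rule ext) (simp add: cst_def ext0_def)
 then show ?case using PH.PH_cst by simp
next
 case (PH_step X d q)
 then show ?case using PH.PH_step[of X d "%x. c * q x"] by (simp add: mult.left_commute)
qed (auto simp: distrib_left intro: PH.PH_add PH.PH_zero)

lemma PH_homog: "PH d q ==> x : S ==> q (t *R x) = of_real t ^ d * q x"
 by (induction rule: PH.induct) (auto simp: cst_def ext0_def lf_apply B_scale2 algebra_simps)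

definition dec :: "('v => complex) => (nat => 'v => complex) => nat => bool" where
 "dec p q N \<longleftrightarrow> (\<forall>d. PH d (q d)) \<and> (\<forall>d>N. q d = (%_. 0)) \<and> p = (%x. \<Sum>d\<le>N. q d x)"

lemma dec_mono: assumes "dec p q N" "N \<le> M" shows "dec p q M"
proof -
 have "(\<Sum>d\<le>N. q d x) = (\<Sum>d\<le>M. q d x)" for x
  by (rule sum.mono_neutral_left) (use assms in \<open>auto simp: dec_def\<close>)
 then show ?thesis using assms by (auto simp: dec_def)
qed

lemma dec_PH: "PH e p ==> dec p (%d. if d = e then p else (%_. 0)) e"
 unfolding dec_def by (auto intro!: PH_zero simp: if_distribR[of _ p] if_distrib[of "%f. f _"] cong: if_cong)

lemma dec_add:
 assumes "dec p q N" "dec p' q' N'"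
 shows "dec (%x. p x + p' x) (%d x. q d x + q' d x) (max N N')"
 using dec_mono[OF assms(1), of "max N N'"] dec_mono[OF assms(2), of "max N N'"]
 unfolding dec_def by (auto intro: PH_add simp: sum.distrib)

lemma dec_scale: "dec p q N ==> dec (%x. c * p x) (%d x. c * q d x) N"
 unfolding dec_def by (auto intro: PH_scale simp: sum_distrib_left)

lemma dec_lf:
 assumes "dec p q N" "X : S"
 shows "dec (%x. lf X x * p x) (%d x. case d of 0 => 0 | Suc d' => lf X x * q d' x) (Suc N)"
 unfolding dec_def
proof (intro conjI allI impI)
 fix d show "PH d (%x. case d of 0 => 0 | Suc d' => lf X x * q d' x)"
  using assms by (cases d) (auto simp: dec_def intro: PH_zero PH_step)
next
 fix d assume "Suc N < d"
 then show "(%x. case d of 0 => 0 | Suc d' => lf X x * q d' x) = (%_. 0)"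
  using assms by (cases d) (auto simp: dec_def)
next
 show "(%x. lf X x * p x) = (%x. \<Sum>d\<le>Suc N. case d of 0 => 0 | Suc d' => lf X x * q d' x)"
  using assms by (simp add: dec_def sum.atMost_Suc_shift sum_distrib_left del: sum.atMost_Suc)
qed

lemma dec_sum:
 assumes "\<And>i. i : I ==> \<exists>q N. dec (p i) q N"
 shows "\<exists>q N. dec (%x. \<Sum>i\<in>I. p i x) q N"
 using assms
proof (induction I rule: infinite_finite_induct)
 case (insert i I)
 obtain q N q' N' where "dec (p i) q N" "dec (%x. \<Sum>i\<in>I. p i x) q' N'" using insert by blast
 from dec_add[OF this] show ?case using insert.hyps by auto
qed (use dec_PH[OF PH_zero] in auto)

lemma dec_PH_mult:
 assumes "PH d p" "dec p' q N"
 shows "\<exists>r M. dec (%x. p x * p' x) r M"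
 using assms(1)
proof (induction rule: PH.induct)
 case (PH_zero d) then show ?case using dec_PH[OF PH.PH_zero] by auto
next
 case (PH_cst c)
 have "p' : C_inf S" using assms(2) PH_C by (auto simp: dec_def intro!: C_inf_sum)
 then show ?case using dec_scale[OF assms(2), of c] by (auto simp: cst_mult)
next
 case (PH_step X d q)
 then obtain r M where "dec (%x. q x * p' x) r M" by blast
 from dec_lf[OF this PH_step(1)] show ?case by (auto simp: mult.assoc)
next
 case (PH_add d p q)
 then obtain r M r' M' where "dec (%x. p x * p' x) r M" "dec (%x. q x * p' x) r' M'" by blast
 from dec_add[OF this] show ?case by (auto simp: distrib_right)
qed

lemma dec_mult:
 assumes "dec p q N" "dec p' q' N'"
 shows "\<exists>r M. dec (%x. p x * p' x) r M"
proof -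
 have q: "PH d (q d)" for d using assms(1) by (simp add: dec_def)
 have "\<exists>r M. dec (%x. \<Sum>d\<in>{..N}. q d x * p' x) r M"
  by (rule dec_sum) (rule dec_PH_mult[OF q assms(2)])
 then show ?thesis using assms(1) by (simp add: dec_def sum_distrib_right)
qed

lemma dec_exists: assumes "p : Pol S" shows "\<exists>q N. dec p q N"
proof -
 have r: "\<exists>q N. dec (ext0 S (%x. complex_of_real (r x))) q N" if "real_polynomial_function r" for r :: "'v => real"
  using that
 proof (induction rule: real_polynomial_function.induct)
  case (linear h)
  have lin: "linear h" using linear bounded_linear.linear by blast
  obtain X where X: "X : S" "\<forall>x\<in>S. B X x = h x"
   by (rule riesz[of h]) (use lin in \<open>auto simp: linear_add linear_cmul\<close>)
  have "ext0 S (%x. complex_of_real (h x)) = (%x. lf X x * cst 1 x)"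
   using X by (auto simp: ext0_def lf_def cst_def)
  then show ?case using dec_PH[OF PH_step[OF X(1) PH_cst[of 1]]] by auto
 next
  case (const c)
  have "ext0 S (%x. complex_of_real c) = cst (of_real c)" by (simp add: cst_def)
  then show ?case using dec_PH[OF PH_cst] by auto
 next
  case (add f g)
  then obtain q N q' N' where "dec (ext0 S (%x. complex_of_real (f x))) q N"
   "dec (ext0 S (%x. complex_of_real (g x))) q' N'" by blast
  from dec_add[OF this] show ?case by (auto simp: ext0_def if_distrib cong: if_cong)
 next
  case (mult f g)
  then obtain q N q' N' where "dec (ext0 S (%x. complex_of_real (f x))) q N"
   "dec (ext0 S (%x. complex_of_real (g x))) q' N'" by blast
  from dec_mult[OF this] show ?case by (auto simp: ext0_def if_distrib cong: if_cong)
 qed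
 obtain p' where p': "polynomial_function p'" "p = ext0 S p'" using assms by (auto simp: Pol_def)
 have "real_polynomial_function (%x. Re (p' x))" "real_polynomial_function (%x. Im (p' x))"
  using p'(1) bounded_linear_Re bounded_linear_Im unfolding polynomial_function_def by (auto simp: o_def)
 from r[OF this(1)] r[OF this(2)] obtain q N q' N' where
  q: "dec (ext0 S (%x. complex_of_real (Re (p' x)))) q N" "dec (ext0 S (%x. complex_of_real (Im (p' x)))) q' N'" by blast
 have "p = (%x. ext0 S (%x. complex_of_real (Re (p' x))) x + \<i> * ext0 S (%x. complex_of_real (Im (p' x))) x)"
  unfolding p'(2) by (auto simp: ext0_def complex_eq_iff)
 then show ?thesis using dec_add[OF q(1) dec_scale[OF q(2), of \<i>]] by auto
qed

text \<open>Along the line through \<open>x\<close> the difference of two decompositions is a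
  polynomial in \<open>t\<close> with infinitely many zeros.\<close>

lemma dec_unique: assumes "dec p q N" "dec p q' N'" shows "q = q'"
proof (intro ext)
 fix d x
 let ?M = "max (max N N') d"
 have M: "dec p q ?M" "dec p q' ?M" using assms dec_mono by (meson max.cobounded1 max.cobounded2 order_trans)+
 show "q d x = q' d x"
 proof (cases "x : S")
  case False
  then show ?thesis using M PH_C C_inf_outside unfolding dec_def by metis
 next
  case True
  have "(\<Sum>i\<le>?M. (q i x - q' i x) * of_real t ^ i) = 0" for t :: real
  proof -
   have "p (t *R x) = (\<Sum>i\<le>?M. q i (t *R x))" "p (t *R x) = (\<Sum>i\<le>?M. q' i (t *R x))"
    using M unfolding dec_def by metis+
   then have "(\<Sum>i\<le>?M. q i (t *R x) - q' i (t *R x)) = 0" by (simp add: sum_subtractf)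
   moreover have "q i (t *R x) - q' i (t *R x) = (q i x - q' i x) * of_real t ^ i" for i
    using M PH_homog[OF _ True] by (simp add: dec_def algebra_simps)
   ultimately show ?thesis by simp
  qed
  then have "range complex_of_real \<subseteq> {z. (\<Sum>i\<le>?M. (q i x - q' i x) * z ^ i) = 0}" by auto
  moreover have "infinite (range complex_of_real)"
   using finite_imageD[of complex_of_real UNIV] infinite_UNIV_char_0[where 'a=real] inj_of_real by blast
  ultimately have "infinite {z. (\<Sum>i\<le>?M. (q i x - q' i x) * z ^ i) = 0}" using finite_subset by blast
  then have "\<forall>i\<le>?M. q i x - q' i x = 0"
   using polyfun_finite_roots[of "%i. q i x - q' i x" ?M] by blast
  then show ?thesis by auto
 qed
qed

definition cmp :: "('v => complex) => nat => 'v => complex" where "cmp p = (SOME q. \<exists>N. dec p q N)"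

lemma cmp_eq: assumes "dec p q N" shows "cmp p = q"
proof -
 have "\<exists>N. dec p (cmp p) N" unfolding cmp_def using assms by (intro someI[of "%q. \<exists>N. dec p q N"]) blast
 then show ?thesis using dec_unique[OF _ assms] by blast
qed

lemma cmp_dec: assumes "p : Pol S" obtains N where "dec p (cmp p) N"
 using dec_exists[OF assms] cmp_eq by metis

lemma cmp_PH: "p : Pol S ==> PH d (cmp p d)"
 using cmp_dec[of p] unfolding dec_def by metis

lemma cmp_add: assumes "p : Pol S" "q : Pol S" shows "cmp (%x. p x + q x) d = (%x. cmp p d x + cmp q d x)"
proof -
 obtain N N' where "dec p (cmp p) N" "dec q (cmp q) N'" using assms cmp_dec by metis
 from cmp_eq[OF dec_add[OF this]] show ?thesis by simp
qed

lemma cmp_scale: assumes "p : Pol S" shows "cmp (%x. c * p x) d = (%x. c * cmp p d x)"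
proof -
 obtain N where "dec p (cmp p) N" using assms cmp_dec by metis
 from cmp_eq[OF dec_scale[OF this]] show ?thesis by simp
qed

end

text \<open>Linear forms pull back to linear forms, represented by Riesz on \<open>S'\<close>.
  Restriction from \<open>ss\<close> to \<open>aa\<close> and the action of K are both instances, so
  homogeneous components will be compatible with both.\<close>

lemma PH_pullback:
 assumes fs: "form_space S B" and fs': "form_space S' B'" and w: "w ` S' \<subseteq> S"
  "\<And>x y. x : S' ==> y : S' ==> w (x + y) = w x + w y" "\<And>c x. x : S' ==> w (c *R x) = c *R w x"
 shows "form_space.PH S B d q ==> form_space.PH S' B' d (ext0 S' (%x. q (w x)))"
proof -
 interpret a: form_space S B by fact
 interpret b: form_space S' B' by fact
 have wS: "x : S' ==> w x : S" for x using w(1) by auto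
 assume "a.PH d q"
 then show ?thesis
 proof (induction rule: a.PH.induct)
  case (PH_zero d)
  have "ext0 S' (%x. 0) = (%_. 0::complex)" by (auto simp: ext0_def)
  then show ?case using b.PH_zero by simp
 next
  case (PH_cst c)
  have "ext0 S' (%x. a.cst c (w x)) = b.cst c" using wS by (auto simp: ext0_def a.cst_def b.cst_def)
  then show ?case using b.PH_cst by simp
 next
  case (PH_step X d q)
  obtain Y where Y: "Y : S'" "\<forall>x\<in>S'. B' Y x = B X (w x)"
   by (rule b.riesz[of "%x. B X (w x)"]) (use PH_step(1) wS in \<open>auto simp: w a.B_add2 a.B_scale2\<close>)
  have "ext0 S' (%x. a.lf X (w x) * q (w x)) = (%x. b.lf Y x * ext0 S' (%x. q (w x)) x)"
   using Y wS by (auto simp: ext0_def a.lf_def b.lf_def)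
  then show ?case using b.PH_step[OF Y(1) PH_step.IH] by simp
 next
  case (PH_add d p q)
  have "ext0 S' (%x. p (w x) + q (w x)) = (%x. ext0 S' (%x. p (w x)) x + ext0 S' (%x. q (w x)) x)"
   by (auto simp: ext0_def)
  then show ?case using b.PH_add[OF PH_add.IH] by simp
 qed
qed

lemma dec_pullback:
 assumes fs: "form_space S B" and fs': "form_space S' B'" and w: "w ` S' \<subseteq> S"
  "\<And>x y. x : S' ==> y : S' ==> w (x + y) = w x + w y" "\<And>c x. x : S' ==> w (c *R x) = c *R w x"
  and N: "form_space.dec S B p q N"
 shows "form_space.dec S' B' (ext0 S' (%x. p (w x))) (%d. ext0 S' (%x. q d (w x))) N"
proof -
 interpret a: form_space S B by fact
 interpret b: form_space S' B' by fact
 show ?thesis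
  unfolding b.dec_def
 proof (intro conjI allI impI)
  show "b.PH d (ext0 S' (%x. q d (w x)))" for d
   by (rule PH_pullback[OF fs fs' w]) (use N in \<open>auto simp: a.dec_def\<close>)
  show "ext0 S' (%x. q d (w x)) = (%_. 0)" if "N < d" for d
   using N that by (auto simp: a.dec_def ext0_def)
  have "p y = (\<Sum>d\<le>N. q d y)" for y using N unfolding a.dec_def by metis
  then show "ext0 S' (%x. p (w x)) = (%x. \<Sum>d\<le>N. ext0 S' (%x. q d (w x)) x)"
   by (auto simp: ext0_def)
 qed
qed

lemma cmp_pullback:
 assumes fs: "form_space S B" and fs': "form_space S' B'" and w: "w ` S' \<subseteq> S"
  "\<And>x y. x : S' ==> y : S' ==> w (x + y) = w x + w y" "\<And>c x. x : S' ==> w (c *R x) = c *R w x"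
  and p: "p : Pol S"
 shows "form_space.cmp S' B' (ext0 S' (%x. p (w x))) d = ext0 S' (%x. form_space.cmp S B p d (w x))"
  "ext0 S' (%x. p (w x)) : Pol S'"
proof -
 interpret a: form_space S B by fact
 interpret b: form_space S' B' by fact
 obtain N where N: "a.dec p (a.cmp p) N" using a.cmp_dec[OF p] by metis
 have D: "b.dec (ext0 S' (%x. p (w x))) (%d. ext0 S' (%x. a.cmp p d (w x))) N"
  by (rule dec_pullback[OF fs fs' w N])
 then show "b.cmp (ext0 S' (%x. p (w x))) d = ext0 S' (%x. a.cmp p d (w x))"
  using b.cmp_eq by metis
 have P: "b.PH d (ext0 S' (%x. a.cmp p d (w x)))" for d using D by (simp add: b.dec_def)
 have "(%x. \<Sum>d\<le>M. ext0 S' (%x. a.cmp p d (w x)) x) : Pol S'" for M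
  by (induction M) (auto intro!: b.Pol_add b.PH_Pol[OF P])
 from this[of N]
 show "ext0 S' (%x. p (w x)) : Pol S'" using D by (simp add: b.dec_def)
qed

section \<open>Operators recovered from iterated commutators\<close>

text \<open>Common axioms for the Laplacian with the directional derivatives and for the Dunkl
  Laplacian with the Dunkl operators. The algebra homomorphism is built from \<open>L\<close>; that
  the \<open>T X\<close> commute with each other comes out of it, as multiplication of polynomials
  is commutative.\<close>

locale comm_ops = form_space S B for S :: "'v::euclidean_space set" and B +
 fixes L :: "('v => complex) => 'v => complex" and T :: "'v => ('v => complex) => 'v => complex"
 assumes L_C: "f : C_inf S ==> L f : C_inf S"
  and L_add: "f : C_inf S ==> g : C_inf S ==> L (%x. f x + g x) = (%x. L f x + L g x)"
  and L_scale: "f : C_inf S ==> L (%x. c * f x) = (%x. c * L f x)"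
  and T_C: "X : S ==> f : C_inf S ==> T X f : C_inf S"
  and L_lf: "X : S ==> f : C_inf S ==> L (%x. lf X x * f x) = (%x. lf X x * L f x + 2 * T X f x)"
  and L_T: "X : S ==> f : C_inf S ==> L (T X f) = T X (L f)"
begin

lemma T_eq: "X : S ==> f : C_inf S ==> T X f = (%x. (L (%x. lf X x * f x) x - lf X x * L f x) / 2)"
 by (simp add: L_lf)

lemma T_add: assumes "X : S" "f : C_inf S" "g : C_inf S" shows "T X (%x. f x + g x) = (%x. T X f x + T X g x)"
 unfolding T_eq[OF assms(1) C_inf_add[OF assms(2,3)]] T_eq[OF assms(1,2)] T_eq[OF assms(1,3)]
 using L_add[OF C_inf_mult[OF lf_C[OF assms(1)] assms(2)] C_inf_mult[OF lf_C[OF assms(1)] assms(3)]]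
 by (auto simp: L_add assms algebra_simps add_divide_distrib diff_divide_distrib)

lemma T_scale: assumes "X : S" "f : C_inf S" shows "T X (%x. c * f x) = (%x. c * T X f x)"
 unfolding T_eq[OF assms(1) C_inf_scale[OF assms(2)]] T_eq[OF assms(1,2)]
 using L_scale[OF C_inf_mult[OF lf_C[OF assms(1)] assms(2)], of c]
 by (auto simp: L_scale assms algebra_simps)

lemma L_zero: "L (%_. 0) = (%_. 0)"
 using L_scale[OF C_inf_zero, of 0] by simp

primrec adp :: "nat => ('v => complex) => ('v => complex) => 'v => complex" where
 "adp 0 p f = (%x. p x * f x)"
| "adp (Suc d) p f = (%x. L (adp d p f) x - adp d p (L f) x)"

lemma adp_C: "p : C_inf S ==> f : C_inf S ==> adp d p f : C_inf S"
 by (induction d arbitrary: f) (auto intro!: C_inf_mult C_inf_diff L_C)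

lemma adp_add: "p : C_inf S ==> q : C_inf S ==> f : C_inf S ==>
 adp d (%x. p x + q x) f = (%x. adp d p f x + adp d q f x)"
proof (induction d arbitrary: f)
 case (Suc d)
 then show ?case by (simp add: L_add adp_C L_C) (auto simp: algebra_simps)
qed (simp add: distrib_right)

lemma adp_scale: "p : C_inf S ==> f : C_inf S ==> adp d (%x. c * p x) f = (%x. c * adp d p f x)"
proof (induction d arbitrary: f)
 case (Suc d)
 then show ?case by (simp add: L_scale adp_C L_C) (auto simp: algebra_simps)
qed (simp add: mult.assoc)

lemma adp_add2: "p : C_inf S ==> f : C_inf S ==> g : C_inf S ==>
 adp d p (%x. f x + g x) = (%x. adp d p f x + adp d p g x)"
proof (induction d arbitrary: f g)
 case (Suc d)
 then show ?case by (simp add: L_add adp_C L_C) (auto simp: algebra_simps)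
qed (simp add: distrib_left)

lemma adp_scale2: "p : C_inf S ==> f : C_inf S ==> adp d p (%x. c * f x) = (%x. c * adp d p f x)"
proof (induction d arbitrary: f)
 case (Suc d)
 then show ?case by (simp add: L_scale adp_C L_C) (auto simp: algebra_simps)
qed (simp add: mult.left_commute)

text \<open>The Leibniz rule for iterated commutators; the second commutator of \<open>lf X\<close> with \<open>L\<close> vanishes.\<close>

lemma adp_lf:
 assumes X: "X : S" and q: "q : C_inf S"
 shows "f : C_inf S ==> adp (Suc n) (%x. lf X x * q x) f =
  (%x. lf X x * adp (Suc n) q f x + 2 * of_nat (Suc n) * T X (adp n q f) x)"
proof (induction n arbitrary: f)
 case 0
 have "(%x. lf X x * q x * f x) = (%x. lf X x * (q x * f x))" by (simp add: mult.assoc)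
 then show ?case using L_lf[OF X C_inf_mult[OF q 0]] by (auto simp: algebra_simps)
next
 case (Suc n)
 let ?A = "%n f. adp n q f"
 have f: "f : C_inf S" by fact
 note C = adp_C[OF q] L_C
 have "adp (Suc (Suc n)) (%x. lf X x * q x) f =
   (%x. L (%x. lf X x * ?A (Suc n) f x + 2 * of_nat (Suc n) * T X (?A n f) x) x -
    (lf X x * ?A (Suc n) (L f) x + 2 * of_nat (Suc n) * T X (?A n (L f)) x))"
  unfolding adp.simps(2)[of "Suc n"] Suc.IH[OF f] Suc.IH[OF L_C[OF f]] by (rule refl)
 also have "L (%x. lf X x * ?A (Suc n) f x + 2 * of_nat (Suc n) * T X (?A n f) x) =
   (%x. lf X x * L (?A (Suc n) f) x + 2 * T X (?A (Suc n) f) x + 2 * of_nat (Suc n) * T X (L (?A n f)) x)"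
  by (subst L_add[OF C_inf_mult[OF lf_C[OF X] C(1)[OF f]] C_inf_scale[OF T_C[OF X C(1)[OF f]]]])
    (simp only: L_lf[OF X C(1)[OF f]] L_scale[OF T_C[OF X C(1)[OF f]]] L_T[OF X C(1)[OF f]])
 finally have "adp (Suc (Suc n)) (%x. lf X x * q x) f =
   (%x. lf X x * ?A (Suc (Suc n)) f x + 2 * T X (?A (Suc n) f) x +
    2 * of_nat (Suc n) * (T X (L (?A n f)) x - T X (?A n (L f)) x))"
  unfolding adp.simps(2)[of "Suc n"] by (auto simp: algebra_simps simp del: adp.simps)
 moreover have "T X (?A (Suc n) f) = (%x. T X (L (?A n f)) x - T X (?A n (L f)) x)"
 proof -
  have "?A (Suc n) f = (%x. L (?A n f) x + (-1) * ?A n (L f) x)" by simp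
  then have "T X (?A (Suc n) f) = (%x. T X (L (?A n f)) x + T X (%x. (-1) * ?A n (L f) x) x)"
   using T_add[OF X C(2)[OF C(1)[OF f, of n]] C_inf_scale[OF C(1)[OF C(2)[OF f], of n]], of "-1"] by (simp only:)
  then show ?thesis using T_scale[OF X C(1)[OF C(2)[OF f], of n], of "-1"] by simp
 qed
 ultimately show ?case by (auto simp: algebra_simps simp del: adp.simps)
qed

text \<open>By \<open>adp_lf\<close>, a linear factor delays the vanishing of the iterated
  commutators by exactly one.\<close>

lemma PH_adp_zero: "PH d q ==> f : C_inf S ==> adp (Suc d) q f = (%_. 0)"
proof (induction arbitrary: f rule: PH.induct)
 case (PH_zero d)
 show ?case using adp_scale[OF C_inf_zero PH_zero, of "Suc d" 0] by simp
next
 case (PH_cst c)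
 then show ?case by (simp add: cst_mult L_C L_scale)
next
 case (PH_step X d q)
 note q = PH_C[OF PH_step(2)]
 have "adp (Suc (Suc d)) q f = (%x. L (adp (Suc d) q f) x - adp (Suc d) q (L f) x)" by simp
 also have "\<dots> = (%_. 0)" using PH_step.IH[OF PH_step.prems] PH_step.IH[OF L_C[OF PH_step.prems]]
  by (simp add: L_zero del: adp.simps)
 finally have "adp (Suc (Suc d)) q f = (%_. 0)" .
 moreover have "T X (%_. 0) = (%_. 0)" using T_scale[OF PH_step(1) C_inf_zero, of 0] by simp
 ultimately show ?case
  using adp_lf[OF PH_step(1) q PH_step.prems, of "Suc d"] PH_step.IH[OF PH_step.prems] by (simp del: adp.simps)
next
 case (PH_add d p q)
 then show ?case using adp_add[OF PH_C[OF PH_add(1)] PH_C[OF PH_add(2)]] by (simp del: adp.simps)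
qed

text \<open>By \<open>adp_lf\<close> the k-th linear factor of a homogeneous polynomial contributes
  the factor 2k, which explains the divisor \<open>2 ^ d * fact d\<close>.\<close>

definition Dh :: "nat => ('v => complex) => ('v => complex) => 'v => complex"
 where "Dh d q f = (%x. adp d q f x / (2 ^ d * fact d))"

lemma Dh_C: "q : C_inf S ==> f : C_inf S ==> Dh d q f : C_inf S"
 unfolding Dh_def using C_inf_scale[OF adp_C, of q f "1 / (2 ^ d * fact d)"] by simp

lemma Dh_zero: "f : C_inf S ==> Dh d (%_. 0) f = (%_. 0)"
 using adp_scale[OF C_inf_zero, of f d 0] by (simp add: Dh_def)

lemma Dh_step:
 assumes X: "X : S" and q: "PH d q" and f: "f : C_inf S"
 shows "Dh (Suc d) (%x. lf X x * q x) f = T X (Dh d q f)"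
proof -
 have "T X (Dh d q f) = (%x. 1 / (2 ^ d * fact d) * T X (adp d q f) x)"
  using T_scale[OF X adp_C[OF PH_C[OF q] f], of "1 / (2 ^ d * fact d)" d] by (simp add: Dh_def)
 note TD = this
 show ?thesis unfolding TD unfolding Dh_def adp_lf[OF X PH_C[OF q] f] PH_adp_zero[OF q f]
 proof
  fix x
  have "(2::complex) ^ Suc d * fact (Suc d) = (2 * of_nat (Suc d)) * (2 ^ d * fact d)" by (simp add: algebra_simps)
  moreover have "(2::complex) * of_nat (Suc d) \<noteq> 0" by (simp del: of_nat_Suc)
  ultimately show "(lf X x * 0 + 2 * of_nat (Suc d) * T X (adp d q f) x) / (2 ^ Suc d * fact (Suc d)) =
    1 / (2 ^ d * fact d) * T X (adp d q f) x"
   by (simp del: of_nat_Suc power_Suc fact_Suc)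
 qed
qed

text \<open>For a polynomial only finitely many components are nonzero, so no degree bound enters
  the definition; \<open>DD_dec\<close> rewrites the sum with any bound.\<close>

definition DD :: "('v => complex) => ('v => complex) => 'v => complex"
 where "DD p f = (%x. \<Sum>d\<in>{d. cmp p d \<noteq> (%_. 0)}. Dh d (cmp p d) f x)"

lemma DD_dec: assumes "dec p q N" "f : C_inf S" shows "DD p f = (%x. \<Sum>d\<le>N. Dh d (q d) f x)"
proof
 fix x
 have "{d. q d \<noteq> (%_. 0)} \<subseteq> {..N}" using assms(1) by (auto simp: dec_def not_le[symmetric])
 then show "DD p f x = (\<Sum>d\<le>N. Dh d (q d) f x)"
  unfolding DD_def cmp_eq[OF assms(1)]
  by (intro sum.mono_neutral_left) (auto simp: Dh_zero[OF assms(2)])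
qed

lemma DD_C: assumes "p : Pol S" "f : C_inf S" shows "DD p f : C_inf S"
proof -
 obtain N where N: "dec p (cmp p) N" using cmp_dec[OF assms(1)] by metis
 show ?thesis unfolding DD_dec[OF N assms(2)]
  by (intro C_inf_sum Dh_C assms(2)) (use N PH_C in \<open>auto simp: dec_def\<close>)
qed

lemma DD_add: assumes "p : Pol S" "q : Pol S" "f : C_inf S"
 shows "DD (%x. p x + q x) f = (%x. DD p f x + DD q f x)"
proof -
 obtain N M where N: "dec p (cmp p) N" "dec q (cmp q) M" using assms cmp_dec by metis
 have C: "cmp p d : C_inf S" "cmp q d : C_inf S" for d using assms cmp_PH PH_C by blast+
 note m = dec_mono[OF N(1), of "max N M"] dec_mono[OF N(2), of "max N M"]
 show ?thesis
  unfolding DD_dec[OF dec_add[OF N] assms(3)] DD_dec[OF m(1) assms(3), simplified] DD_dec[OF m(2) assms(3), simplified]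
  by (simp add: Dh_def adp_add[OF C assms(3)] add_divide_distrib sum.distrib)
qed

lemma DD_scale: assumes "p : Pol S" "f : C_inf S" shows "DD (%x. c * p x) f = (%x. c * DD p f x)"
proof -
 obtain N where N: "dec p (cmp p) N" using assms cmp_dec by metis
 have C: "cmp p d : C_inf S" for d using assms cmp_PH PH_C by blast
 show ?thesis unfolding DD_dec[OF dec_scale[OF N] assms(2)] DD_dec[OF N assms(2)]
  by (simp add: Dh_def adp_scale[OF C assms(2)] sum_distrib_left)
qed

lemma DD_cst: assumes "f : C_inf S" shows "DD (cst c) f = (%x. c * f x)"
 unfolding DD_dec[OF dec_PH[OF PH_cst] assms] by (simp add: Dh_def cst_mult[OF assms])

lemma T_sum:
 assumes "X : S" "\<And>i. i : I ==> g i : C_inf S"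
 shows "T X (%x. \<Sum>i\<in>I. g i x) = (%x. \<Sum>i\<in>I. T X (g i) x)"
 using assms(2)
proof (induction I rule: infinite_finite_induct)
 case (insert i I)
 then show ?case using T_add[OF assms(1), of "g i" "%x. \<Sum>i\<in>I. g i x"] by (simp add: C_inf_sum)
qed (use T_scale[OF assms(1) C_inf_zero, of 0] in auto)

lemma DD_lf: assumes X: "X : S" and p: "p : Pol S" and f: "f : C_inf S"
 shows "DD (%x. lf X x * p x) f = T X (DD p f)"
proof -
 obtain N where N: "dec p (cmp p) N" using assms cmp_dec by metis
 have P: "PH d (cmp p d)" for d using p cmp_PH by blast
 have "DD (%x. lf X x * p x) f = (%x. \<Sum>d\<le>N. Dh (Suc d) (%x. lf X x * cmp p d x) f x)"
  unfolding DD_dec[OF dec_lf[OF N X] f]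
  by (simp add: sum.atMost_Suc_shift Dh_zero[OF f] del: sum.atMost_Suc)
 also have "\<dots> = T X (DD p f)"
  unfolding DD_dec[OF N f] Dh_step[OF X P f]
  by (rule T_sum[symmetric, OF X]) (rule Dh_C[OF PH_C[OF P] f])
 finally show ?thesis .
qed

lemma DD_add2: assumes "p : Pol S" "f : C_inf S" "g : C_inf S"
 shows "DD p (%x. f x + g x) = (%x. DD p f x + DD p g x)"
proof -
 obtain N where N: "dec p (cmp p) N" using assms cmp_dec by metis
 have C: "cmp p d : C_inf S" for d using assms cmp_PH PH_C by blast
 show ?thesis unfolding DD_dec[OF N assms(2)] DD_dec[OF N assms(3)] DD_dec[OF N C_inf_add[OF assms(2,3)]]
  by (simp add: Dh_def adp_add2[OF C assms(2,3)] add_divide_distrib sum.distrib)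
qed

lemma DD_scale2: assumes "p : Pol S" "f : C_inf S" shows "DD p (%x. c * f x) = (%x. c * DD p f x)"
proof -
 obtain N where N: "dec p (cmp p) N" using assms cmp_dec by metis
 have C: "cmp p d : C_inf S" for d using assms cmp_PH PH_C by blast
 show ?thesis unfolding DD_dec[OF N assms(2)] DD_dec[OF N C_inf_scale[OF assms(2)]]
  by (simp add: Dh_def adp_scale2[OF C assms(2)] sum_distrib_left)
qed

lemma Pol_induct [consumes 1, case_names cst lf add]:
 assumes "p : Pol S" "\<And>c. Q (cst c)" "\<And>X q. X : S ==> q : Pol S ==> Q q ==> Q (%x. lf X x * q x)"
  "\<And>p q. p : Pol S ==> q : Pol S ==> Q p ==> Q q ==> Q (%x. p x + q x)"
 shows "Q p"
proof -
 have z: "cst 0 = (%_. 0)" by (rule ext) (simp add: cst_def ext0_def)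
 have PH: "Q q" if "PH d q" for d q
  using that assms(2)[of 0] by (induction rule: PH.induct) (auto simp: z intro: assms PH_Pol)
 obtain N where N: "dec p (cmp p) N" using cmp_dec[OF assms(1)] by metis
 have "Q (%x. \<Sum>d\<le>M. cmp p d x) \<and> (%x. \<Sum>d\<le>M. cmp p d x) : Pol S" for M
  by (induction M) (auto intro!: assms(4) Pol_add PH[OF cmp_PH] PH_Pol[OF cmp_PH] assms(1))
 note M = this
 have eq: "(%x. \<Sum>d\<le>N. cmp p d x) = p" using N unfolding dec_def by (elim conjE) (rule sym)
 show ?thesis using conjunct1[OF M[of N]] unfolding eq .
qed

lemma DD_mult: assumes "p : Pol S" "q : Pol S" and f: "f : C_inf S" shows "DD (%x. p x * q x) f = DD p (DD q f)"
 using assms(1)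
proof (induction p rule: Pol_induct)
 case (cst c)
 show ?case using assms by (simp add: cst_mult[OF Pol_C_inf[OF subS]] DD_scale DD_cst DD_C)
next
 case (lf X p)
 then show ?case using assms DD_lf[OF lf(1) Pol_mult[OF lf(2) assms(2)] f] DD_lf[OF lf(1,2) DD_C[OF assms(2) f]]
  by (simp add: mult.assoc)
next
 case (add p p')
 then show ?case using assms by (simp add: distrib_right DD_add Pol_mult DD_C)
qed

lemma DD_sym_hom: "sym_hom S B T DD"
proof -
 have one: "DD (ext0 S (%_. 1)) f = f" if "f : C_inf S" for f
  using DD_cst[OF that, of 1] by (simp add: cst_def)
 have X: "DD (ext0 S (%x. of_real (B X x))) f = T X f" if "X : S" "f : C_inf S" for X f
 proof -
  have "ext0 S (%x. of_real (B X x)) = (%x. lf X x * cst 1 x)" by (auto simp: lf_def cst_def ext0_def)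
  then show ?thesis using DD_lf[OF that(1) cst_Pol[of 1] that(2)] DD_cst[OF that(2), of 1] by simp
 qed
 show ?thesis unfolding sym_hom_def
  using DD_C DD_add2 DD_scale2 DD_add DD_scale DD_mult one X by blast
qed

text \<open>A homomorphism is determined by its values on constants and linear forms, so the one
  picked by SOME in \<open>sym_ext\<close> coincides with \<open>DD\<close>.\<close>

lemma sym_ext_eq: assumes p: "p : Pol S" and f: "f : C_inf S" shows "sym_ext S B T p f = DD p f"
proof -
 let ?D = "sym_ext S B T"
 have h: "sym_hom S B T ?D" unfolding sym_ext_def by (rule someI[where P="sym_hom S B T", OF DD_sym_hom])
 note h' = h[unfolded sym_hom_def]
 have c1: "cst c = (%x. c * cst 1 x)" for c by (auto simp: cst_def ext0_def)
 from p f show ?thesis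
 proof (induction p arbitrary: f rule: Pol_induct)
  case (cst c)
  have "?D (%x. c * cst 1 x) f = (%x. c * ?D (cst 1) f x)" using h' cst_Pol cst by blast
  moreover have "?D (cst 1) f = f" using h' cst by (simp add: cst_def)
  ultimately have "?D (cst c) f = (%x. c * f x)" by (simp only: c1[of c, symmetric])
  then show ?case using DD_cst[OF cst] by simp
 next
  case (lf X q)
  have "?D (%x. lf X x * q x) f = ?D (lf X) (?D q f)" using h' lf lf_Pol[OF lf(1)] by blast
  also have "?D q f = DD q f" by (rule lf(3)[OF lf(4)])
  also have "?D (lf X) (DD q f) = T X (DD q f)" using h' lf(1) DD_C[OF lf(2,4)] unfolding lf_def by blast
  finally show ?case using DD_lf[OF lf(1,2,4)] by simp
 next
  case (add p q)
  have "?D (%x. p x + q x) f = (%x. ?D p f x + ?D q f x)" using h' add by blast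
  then show ?case using add DD_add by simp
 qed
qed

end

section \<open>The Laplacian and Hadamard's lemma\<close>

context form_space
begin

definition Lap :: "('v => complex) => 'v => complex" where
 "Lap f = (%x. \<Sum>v\<in>fr. dir_deriv S v (dir_deriv S v f) x)"

lemma dd_C: "X : S ==> f : C_inf S ==> dir_deriv S X f : C_inf S"
 by (rule dir_deriv_C_inf[OF subS])

lemma Lap_C: "f : C_inf S ==> Lap f : C_inf S"
 unfolding Lap_def by (intro C_inf_sum dd_C fr)

lemma Lap_add: "f : C_inf S ==> g : C_inf S ==> Lap (%x. f x + g x) = (%x. Lap f x + Lap g x)"
 unfolding Lap_def by (simp add: dir_deriv_add[OF subS] dd_C fr sum.distrib cong: sum.cong)

lemma Lap_scale: "f : C_inf S ==> Lap (%x. c * f x) = (%x. c * Lap f x)"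
 unfolding Lap_def by (simp add: dir_deriv_scale[OF subS] dd_C fr sum_distrib_left cong: sum.cong)

lemma dd_lf:
 assumes X: "X : S" and Y: "Y : S" and f: "f : C_inf S"
 shows "dir_deriv S Y (%x. lf X x * f x) = (%x. lf X x * dir_deriv S Y f x + of_real (B X Y) * f x)"
proof
 fix x show "dir_deriv S Y (%x. lf X x * f x) x = lf X x * dir_deriv S Y f x + of_real (B X Y) * f x"
  unfolding dir_deriv_mult[OF subS Y lf_C[OF X] f]
  by (cases "x : S") (simp_all add: dir_deriv_lf X Y C_inf_outside[OF f])
qed

lemma Lap_lf: assumes X: "X : S" and f: "f : C_inf S"
 shows "Lap (%x. lf X x * f x) = (%x. lf X x * Lap f x + 2 * dir_deriv S X f x)"
proof
 fix x
 have "dir_deriv S v (dir_deriv S v (%x. lf X x * f x)) x =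
   lf X x * dir_deriv S v (dir_deriv S v f) x + 2 * (of_real (B X v) * dir_deriv S v f x)" if v: "v : fr" for v
 proof -
  note vS = fr(2)[OF v]
  have "dir_deriv S v (%x. lf X x * dir_deriv S v f x + of_real (B X v) * f x) =
   (%x. dir_deriv S v (%x. lf X x * dir_deriv S v f x) x + of_real (B X v) * dir_deriv S v f x)"
   using dir_deriv_add[OF subS vS C_inf_mult[OF lf_C[OF X] dd_C[OF vS f]] C_inf_scale[OF f]]
    dir_deriv_scale[OF subS vS f] by simp
  then show ?thesis using dd_lf[OF X vS f] dd_lf[OF X vS dd_C[OF vS f]] by simp
 qed
 then have "Lap (%x. lf X x * f x) x = lf X x * Lap f x + 2 * (\<Sum>v\<in>fr. of_real (B X v) * dir_deriv S v f x)"
  unfolding Lap_def by (simp add: sum.distrib sum_distrib_left cong: sum.cong)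
 also have "(\<Sum>v\<in>fr. of_real (B X v) * dir_deriv S v f x) = dir_deriv S X f x"
  using dir_deriv_sum_vec[OF subS fr(2) f, of fr "%v. v" "B X" x] fr(3)[OF X] by simp
 finally show "Lap (%x. lf X x * f x) x = lf X x * Lap f x + 2 * dir_deriv S X f x" .
qed

text \<open>The Laplacian is the trace of a symmetric bilinear form in the directions, hence
  independent of the frame; later the frame is adapted to the root decomposition.\<close>

lemma Lap_frame:
 assumes e: "frame I e" and f: "f : C_inf S" and x: "x : S"
 shows "Lap f x = (\<Sum>i\<in>I. dir_deriv S (e i) (dir_deriv S (e i) f) x)"
 unfolding Lap_def
proof (rule frame_trace[OF fr_frame e, where q="%X Y. dir_deriv S X (dir_deriv S Y f) x"])
 show "dir_deriv S (X + Y) (dir_deriv S Z f) x = dir_deriv S X (dir_deriv S Z f) x + dir_deriv S Y (dir_deriv S Z f) x"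
  if "X : S" "Y : S" "Z : S" for X Y Z using that by (intro dir_deriv_vec(1)[OF subS dd_C] f)
 show "dir_deriv S (c *R X) (dir_deriv S Z f) x = of_real c * dir_deriv S X (dir_deriv S Z f) x"
  if "X : S" "Z : S" for c X Z using that by (intro dir_deriv_vec(2)[OF subS dd_C] f)
 show "dir_deriv S X (dir_deriv S Y f) x = dir_deriv S Y (dir_deriv S X f) x" if "X : S" "Y : S" for X Y
  using dir_deriv_commute[OF subS that f] by simp
qed

text \<open>The derivative is integrated along the segment from \<open>x\<close> to
  \<open>x0\<close>; expanding the direction in the frame produces the factors that vanish at
  \<open>x0\<close>.\<close>

lemma hadamard:
 assumes f: "f : C_inf S" and x0: "x0 : S"
 obtains g where "\<forall>v\<in>fr. g v : C_inf S"
  "f = (%x. cst (f x0) x + (\<Sum>v\<in>fr. (lf v x - cst (of_real (B v x0)) x) * g v x))"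
proof -
 define g where "g v = ext0 S (%x. integral {0..1} (%t. t ^ 0 *R dirder f v (x + t *R (- x + x0))))" for v
 note R = relopen_self[OF subS]
 have "g v : C_inf S" if v: "v : fr" for v
 proof -
  have "smooth_on S S (%x. integral {0..1} (%t. t ^ 0 *R dirder f v (x + t *R (- x + x0))))"
   unfolding smooth_on_def
  proof
   fix k show "Ck_on k S S (%x. integral {0..1} (%t. t ^ 0 *R dirder f v (x + t *R (- x + x0))))"
    by (rule Ck_integral[OF subS bounded_linear_minus[OF bounded_linear_ident] _ x0
      smooth_on_Ck[OF smooth_on_dirder[OF R C_inf_smooth[OF f] fr(2)[OF v]]]]) simp
  qed
  then show ?thesis unfolding g_def by (rule ext0_C_inf[OF subS])
 qed
 moreover have "f x = cst (f x0) x + (\<Sum>v\<in>fr. (lf v x - cst (of_real (B v x0)) x) * g v x)" for x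
 proof (cases "x : S")
  case False
  then show ?thesis by (simp add: C_inf_outside[OF f] cst_def ext0_def g_def)
 next
  case True
  let ?u = "- x + x0"
  have u: "?u : S" using True x0 by simp
  have pS: "x + t *R ?u : S" for t using True u by simp
  note f1 = smooth_on_Ck[OF C_inf_smooth[OF f], of "Suc 0"]
  have i1: "((%t. dirder f ?u (x + t *R ?u)) has_integral f x0 - f x) {0..1}"
   using line_integral[OF R f1 u, of 0 1 x] pS by simp
  have d: "dirder f ?u (x + t *R ?u) = (\<Sum>v\<in>fr. B ?u v *R dirder f v (x + t *R ?u))" for t
   using dirder_sum[OF R f1 pS fr(2), of fr "%v. v" "B ?u" t] fr(3)[OF u] by simp
  have "((%t. B ?u v *R dirder f v (x + t *R ?u)) has_integral B ?u v *R g v x) {0..1}" if v: "v : fr" for v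
  proof -
   have "continuous_on {0..1} (%t. dirder f v (x + t *R ?u))"
    by (rule continuous_on_compose2[OF smooth_on_continuous[OF smooth_on_dirder[OF R C_inf_smooth[OF f] fr(2)[OF v]]]])
      (use pS in \<open>auto intro!: continuous_intros\<close>)
   then have "(%t. dirder f v (x + t *R ?u)) integrable_on {0..1}" by (rule integrable_continuous_interval)
   then have "((%t. dirder f v (x + t *R ?u)) has_integral g v x) {0..1}"
    using True by (simp add: g_def ext0_def has_integral_integral)
   then show ?thesis by (rule has_integral_cmul)
  qed
  then have "((%t. \<Sum>v\<in>fr. B ?u v *R dirder f v (x + t *R ?u)) has_integral (\<Sum>v\<in>fr. B ?u v *R g v x)) {0..1}"
   by (rule has_integral_sum[OF fr(1)])
  then have "f x0 - f x = (\<Sum>v\<in>fr. B ?u v *R g v x)"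
   using has_integral_unique[OF i1] by (simp only: d)
  also have "\<dots> = - (\<Sum>v\<in>fr. (lf v x - cst (of_real (B v x0)) x) * g v x)"
   unfolding sum_negf[symmetric]
  proof (rule sum.cong[OF refl])
   fix v assume v: "v : fr"
   have B: "B ?u v = B v x0 - B v x"
    using B_add[of "- x" x0 v] B_minus(1)[of x v] B_sym[of x0 v] B_sym[of x v] True x0 fr(2)[OF v] by simp
   show "B ?u v *R g v x = - ((lf v x - cst (of_real (B v x0)) x) * g v x)"
    unfolding B using True by (simp add: lf_apply cst_def ext0_def scaleR_conv_of_real algebra_simps)
  qed
  finally have e: "f x0 - f x = - (\<Sum>v\<in>fr. (lf v x - cst (of_real (B v x0)) x) * g v x)" .
  have "b = a + c" if "a - b = - c" for a b c :: complex using that by (simp add: diff_eq_eq)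
  from this[OF e] show ?thesis using True by (simp add: cst_def ext0_def)
 qed
 ultimately show ?thesis using that[of g] by blast
qed

text \<open>Each summand of Hadamard's expansion is killed, because \<Lambda> evaluates its linear
  factor at \<open>x0\<close>, where it is 0. With \<Lambda> the value at \<open>x0\<close> of the
  difference of two operators, their equality is reduced to constants and to commutators with linear
  forms.\<close>

lemma hadamard_principle:
 assumes x0: "x0 : S"
  and add: "\<And>f g. f : C_inf S ==> g : C_inf S ==> \<Lambda> (%x. f x + g x) = \<Lambda> f + (\<Lambda> g :: complex)"
  and scale: "\<And>f c. f : C_inf S ==> \<Lambda> (%x. c * f x) = c * \<Lambda> f"
  and lf: "\<And>X f. X : S ==> f : C_inf S ==> \<Lambda> (%x. lf X x * f x) = lf X x0 * \<Lambda> f"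
  and c: "\<Lambda> (cst 1) = 0" and f: "f : C_inf S"
 shows "\<Lambda> f = 0"
proof -
 obtain g where g: "\<forall>v\<in>fr. g v : C_inf S"
  and fg: "f = (%x. cst (f x0) x + (\<Sum>v\<in>fr. (lf v x - cst (of_real (B v x0)) x) * g v x))"
  by (rule hadamard[OF f x0])
 have c': "\<Lambda> (cst a) = 0" for a
 proof -
  have "cst a = (%x. a * cst 1 x)" by (auto simp: cst_def ext0_def)
  then show ?thesis using scale[OF cst_C[of 1], of a] c by simp
 qed
 let ?h = "%v x. (lf v x - cst (of_real (B v x0)) x) * g v x"
 have hC: "?h v : C_inf S" if "v : fr" for v
  using that g by (intro C_inf_mult C_inf_diff lf_C cst_C fr) auto
 have h0: "\<Lambda> (?h v) = 0" if v: "v : fr" for v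
 proof -
  have gv: "g v : C_inf S" using g v by blast
  have h: "?h v = (%x. lf v x * g v x + (- of_real (B v x0)) * g v x)"
   by (rule ext) (auto simp: cst_def ext0_def C_inf_outside[OF gv] algebra_simps)
  have "\<Lambda> (?h v) = \<Lambda> (%x. lf v x * g v x) + \<Lambda> (%x. (- of_real (B v x0)) * g v x)"
   unfolding h by (rule add[OF C_inf_mult[OF lf_C[OF fr(2)[OF v]] gv] C_inf_scale[OF gv]])
  then show ?thesis unfolding lf[OF fr(2)[OF v] gv] scale[OF gv] by (simp add: lf_apply x0)
 qed
 have z: "\<Lambda> (%_. 0) = 0" using scale[OF C_inf_zero, of 0] by simp
 have "\<Lambda> (%x. \<Sum>v\<in>J. ?h v x) = 0" if "J \<subseteq> fr" for J
  using finite_subset[OF that fr(1)] that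
 proof (induction J rule: finite_induct)
  case (insert v J)
  then have "\<Lambda> (%x. ?h v x + (\<Sum>v\<in>J. ?h v x)) = \<Lambda> (?h v) + \<Lambda> (%x. \<Sum>v\<in>J. ?h v x)"
   by (intro add C_inf_sum hC) auto
  then show ?case using insert h0 by simp
 qed (simp add: z)
 then have "\<Lambda> (%x. \<Sum>v\<in>fr. ?h v x) = 0" by blast
 moreover have "\<Lambda> f = \<Lambda> (cst (f x0)) + \<Lambda> (%x. \<Sum>v\<in>fr. ?h v x)"
  by (subst fg) (intro add cst_C C_inf_sum hC)
 ultimately show ?thesis by (simp add: c')
qed

text \<open>On the line through \<open>x\<close> in direction \<open>h\<close> only finitely many
  parameters are singular, and continuity gives the value at parameter 0.\<close>

lemma regular_dense:
 assumes A: "finite A" and h: "h : S" "\<forall>\<alpha>\<in>A. \<alpha> h \<noteq> 0"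
  and lin: "\<And>\<alpha> x t. \<alpha> : A ==> x : S ==> \<alpha> (x + t *R h) = \<alpha> x + t * (\<alpha> h :: real)"
  and g: "g : C_inf S" and z: "\<And>x. x : S ==> \<forall>\<alpha>\<in>A. \<alpha> x \<noteq> 0 ==> g x = 0"
 shows "g x = 0"
proof (cases "x : S")
 case True
 have "continuous_on UNIV (%t::real. g (x + t *R h))"
  by (rule continuous_on_compose2[OF smooth_on_continuous[OF C_inf_smooth[OF g]]])
    (use True h in \<open>auto intro!: continuous_intros\<close>)
 then have l: "((%t::real. g (x + t *R h)) \<longlongrightarrow> g (x + 0 *R h)) (at 0)"
  using continuous_on_eq_continuous_at[OF open_UNIV] unfolding isCont_def by blast
 let ?F = "(%\<alpha>. - \<alpha> x / \<alpha> h) ` A"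
 have "\<forall>\<^sub>F t in at 0. t \<notin> ?F - {0}"
 proof -
  have "open (- (?F - {0}))" by (rule open_Compl, rule finite_imp_closed) (use A in simp)
  then show ?thesis unfolding eventually_at_topological by (intro exI[of _ "- (?F - {0})"]) simp
 qed
 then have "\<forall>\<^sub>F t in at 0. g (x + t *R h) = 0"
  using eventually_neq_at_within[of 0 0 UNIV]
 proof eventually_elim
  case (elim t)
  have "\<alpha> (x + t *R h) \<noteq> 0" if a: "\<alpha> : A" for \<alpha>
  proof
   assume "\<alpha> (x + t *R h) = 0"
   then have "t = - \<alpha> x / \<alpha> h" using lin[OF a True] h(2) a by (simp add: field_simps)
   then show False using elim a by blast
  qed
  then show ?case using z[of "x + t *R h"] True h(1) by simp
 qed
 then have "((%t::real. g (x + t *R h)) \<longlongrightarrow> 0) (at 0)" by (rule tendsto_eventually)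
 from tendsto_unique[OF _ l this] show ?thesis by simp
qed (rule C_inf_outside[OF g])

end

section \<open>Dunkl operators\<close>

locale dunkl_data = form_space S B for S :: "'v::euclidean_space set" and B +
 fixes A :: "('v => real) set" and m :: "('v => real) => real" and H :: "('v => real) => 'v"
 assumes A_fin: "finite A"
  and H_S: "\<alpha> : A ==> H \<alpha> : S" and H_ne: "\<alpha> : A ==> H \<alpha> \<noteq> 0"
  and H_eq: "\<alpha> : A ==> x : S ==> \<alpha> x = B (H \<alpha>) x"
begin

definition s :: "('v => real) => 'v => 'v" where
 "s \<alpha> x = x - (2 * \<alpha> x / B (H \<alpha>) (H \<alpha>)) *R H \<alpha>"

text \<open>Normalised so that \<open>kp \<alpha> *R H \<alpha>\<close> is the coroot of
  \<alpha>.\<close>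

definition kp :: "('v => real) => real" where "kp \<alpha> = 2 / B (H \<alpha>) (H \<alpha>)"

text \<open>The permutation is asked for only up to sign, because \<open>A\<close> will consist of
  positive roots and a Dunkl operator does not change when a root is replaced by its
  negative.\<close>

definition isoA :: "('v => 'v) => bool" where
 "isoA w \<longleftrightarrow> w ` S = S \<and> (\<forall>x\<in>S. \<forall>y\<in>S. w (x + y) = w x + w y) \<and> (\<forall>c. \<forall>x\<in>S. w (c *R x) = c *R w x) \<and>
   (\<forall>x\<in>S. \<forall>y\<in>S. B (w x) (w y) = B x y) \<and>
   (\<exists>\<sigma>. bij_betw \<sigma> A A \<and> (\<forall>\<beta>\<in>A. m (\<sigma> \<beta>) = m \<beta> \<and>
    ((\<forall>x\<in>S. \<sigma> \<beta> (w x) = \<beta> x) \<or> (\<forall>x\<in>S. \<sigma> \<beta> (w x) = - \<beta> x))))"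

lemma HH: "\<alpha> : A ==> B (H \<alpha>) (H \<alpha>) > 0"
 by (rule B_pos[OF H_S H_ne])

lemma al_lin: assumes "\<alpha> : A" shows "x : S ==> y : S ==> \<alpha> (x + y) = \<alpha> x + \<alpha> y" "x : S ==> \<alpha> (c *R x) = c * \<alpha> x"
 using H_eq[OF assms] H_S[OF assms] by (simp_all add: B_add2 B_scale2)

lemma s_S: "\<alpha> : A ==> x : S ==> s \<alpha> x : S"
 by (simp add: s_def H_S)

lemma s_kp: "s \<alpha> x = x - (kp \<alpha> * \<alpha> x) *R H \<alpha>"
 by (simp add: s_def kp_def)

lemma s_add: "\<alpha> : A ==> x : S ==> y : S ==> s \<alpha> (x + y) = s \<alpha> x + s \<alpha> y"
 by (simp add: s_kp al_lin algebra_simps)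

lemma s_scale: "\<alpha> : A ==> x : S ==> s \<alpha> (c *R x) = c *R s \<alpha> x"
 by (simp add: s_kp al_lin algebra_simps)

lemma al_s: "\<alpha> : A ==> x : S ==> \<alpha> (s \<alpha> x) = - \<alpha> x"
 using HH[of \<alpha>] H_S[of \<alpha>] by (simp add: H_eq s_S) (simp add: s_def B_diff B_scale2 H_eq)

lemma s_s: "\<alpha> : A ==> x : S ==> s \<alpha> (s \<alpha> x) = x"
 using al_s[of \<alpha> x] by (simp add: s_def[of \<alpha> "s \<alpha> x"]) (simp add: s_def)

definition sp :: "('v => 'v) => ('v => complex) => 'v => complex" where "sp w f = ext0 S (%x. f (w x))"

lemma sp_apply: "x : S ==> sp w f x = f (w x)"
 by (simp add: sp_def ext0_def)

lemma sp_outside: "x \<notin> S ==> sp w f x = 0"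
 by (simp add: sp_def ext0_def)

lemma sp_C:
 assumes w: "w ` S \<subseteq> S" "\<And>x y. x : S ==> y : S ==> w (x + y) = w x + w y" "\<And>c x. x : S ==> w (c *R x) = c *R w x"
  and f: "f : C_inf S"
 shows "sp w f : C_inf S"
proof -
 have "linear (%y. w (prj S y))"
  by (rule linearI) (simp_all add: linear_add[OF prj_linear] linear_cmul[OF prj_linear] w prj_in subS)
 then have "bounded_linear (%y. w (prj S y))" by (simp add: linear_conv_bounded_linear)
 from C_inf_pullback[OF subS subS this _ f] have "ext0 S (%x. f (w (prj S x))) : C_inf S"
  using w(1) prj_in[OF subS] by blast
 moreover have "ext0 S (%x. f (w (prj S x))) = sp w f"
  by (rule ext) (simp add: sp_def ext0_def prj_id[OF subS])
 ultimately show ?thesis by simp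
qed

lemma sps_C: "\<alpha> : A ==> f : C_inf S ==> sp (s \<alpha>) f : C_inf S"
 by (rule sp_C) (auto simp: s_S s_add s_scale)

definition quot :: "('v => real) => ('v => complex) => 'v => complex" where
 "quot \<alpha> f = (THE g. g : C_inf S \<and> (\<forall>x\<in>S. of_real (\<alpha> x) * g x = f x - f (s \<alpha> x)))"

lemma quot_unique:
 assumes a: "\<alpha> : A" and g: "g : C_inf S" "g' : C_inf S" "\<forall>x\<in>S. of_real (\<alpha> x) * g x = of_real (\<alpha> x) * g' x"
 shows "g = g'"
proof
 fix x
 have "(%x. g x - g' x) x = 0"
 proof (rule regular_dense[of "{\<alpha>}" "H \<alpha>"])
  show "\<forall>\<beta>\<in>{\<alpha>}. \<beta> (H \<alpha>) \<noteq> 0" using HH[OF a] H_eq[OF a H_S[OF a]] by simp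
  show "(%x. g x - g' x) : C_inf S" by (rule C_inf_diff[OF g(1,2)])
 qed (use a g(3) H_S[OF a] in \<open>auto simp: al_lin\<close>)
 then show "g x = g' x" by simp
qed

text \<open>The quotient is explicit: the segment from \<open>x\<close> to its reflection points
  along \<open>H \<alpha>\<close> with length factor \<open>- kp \<alpha> * \<alpha> x\<close>, so
  the integral of the derivative over this segment contains the factor \<open>\<alpha> x\<close>.
  Uniqueness holds off the hyperplane and extends by density.\<close>

lemma quot_ex1:
 assumes a: "\<alpha> : A" and f: "f : C_inf S"
 shows "\<exists>!g. g : C_inf S \<and> (\<forall>x\<in>S. of_real (\<alpha> x) * g x = f x - f (s \<alpha> x))"
proof (rule ex_ex1I)
 let ?A = "%x. (- kp \<alpha> * \<alpha> (prj S x)) *R H \<alpha>"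
 let ?g = "ext0 S (%x. of_real (kp \<alpha>) * integral {0..1} (%t. t ^ 0 *R dirder f (H \<alpha>) (x + t *R (?A x + 0))))"
 note R = relopen_self[OF subS] and Ha = H_S[OF a]
 have "bounded_linear ?A"
 proof -
  have "linear ?A" by (rule linearI)
   (simp_all add: linear_add[OF prj_linear] linear_cmul[OF prj_linear] prj_in subS al_lin[OF a] algebra_simps)
  then show ?thesis by (simp add: linear_conv_bounded_linear)
 qed
 then have "smooth_on S S (%x. integral {0..1} (%t. t ^ 0 *R dirder f (H \<alpha>) (x + t *R (?A x + 0))))"
  unfolding smooth_on_def
  by (intro allI Ck_integral[OF subS _ _ _ smooth_on_Ck[OF smooth_on_dirder[OF R C_inf_smooth[OF f] Ha]]])
    (simp_all add: Ha)
 then have gC: "?g : C_inf S"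
  by (intro ext0_C_inf[OF subS] smooth_on_mult smooth_on_const)
 have "of_real (\<alpha> x) * ?g x = f x - f (s \<alpha> x)" if x: "x : S" for x
 proof -
  let ?u = "(- kp \<alpha> * \<alpha> x) *R H \<alpha>"
  have u: "?u : S" using Ha by simp
  have pS: "x + t *R ?u : S" for t using x u S_simps by blast
  note f1 = smooth_on_Ck[OF C_inf_smooth[OF f], of "Suc 0"]
  have "((%t. dirder f ?u (x + t *R ?u)) has_integral f (x + ?u) - f x) {0..1}"
   using line_integral[OF R f1 u, of 0 1 x] pS by simp
  from integral_unique[OF this]
  have "f (x + ?u) - f x = integral {0..1} (%t. (- kp \<alpha> * \<alpha> x) *R dirder f (H \<alpha>) (x + t *R ?u))"
   unfolding dirder_linear(2)[OF R f1 pS Ha] by (rule sym)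
  also have "\<dots> = (- kp \<alpha> * \<alpha> x) *R integral {0..1} (%t. dirder f (H \<alpha>) (x + t *R ?u))"
   by (rule integral_cmul)
  finally show ?thesis using x
   by (simp add: s_kp ext0_def prj_id[OF subS] scaleR_conv_of_real algebra_simps)
 qed
 then show "\<exists>g. g : C_inf S \<and> (\<forall>x\<in>S. of_real (\<alpha> x) * g x = f x - f (s \<alpha> x))" using gC by blast
next
 fix g g' assume "g : C_inf S \<and> (\<forall>x\<in>S. of_real (\<alpha> x) * g x = f x - f (s \<alpha> x))"
  "g' : C_inf S \<and> (\<forall>x\<in>S. of_real (\<alpha> x) * g' x = f x - f (s \<alpha> x))"
 then show "g = g'" by (intro quot_unique[OF a]) simp_all
qed

lemma quot: assumes "\<alpha> : A" "f : C_inf S"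
 shows "quot \<alpha> f : C_inf S" "x : S ==> of_real (\<alpha> x) * quot \<alpha> f x = f x - f (s \<alpha> x)"
 using theI'[OF quot_ex1[OF assms]] unfolding quot_def by auto

lemma quot_eqI: assumes "\<alpha> : A" "f : C_inf S" "g : C_inf S" "\<And>x. x : S ==> of_real (\<alpha> x) * g x = f x - f (s \<alpha> x)"
 shows "quot \<alpha> f = g"
 by (rule quot_unique[OF assms(1) quot(1)[OF assms(1,2)] assms(3)]) (simp add: quot(2)[OF assms(1,2)] assms(4))

lemma quot_add: "\<alpha> : A ==> f : C_inf S ==> g : C_inf S ==> quot \<alpha> (%x. f x + g x) = (%x. quot \<alpha> f x + quot \<alpha> g x)"
 by (rule quot_eqI) (auto intro!: C_inf_add quot simp: distrib_left quot(2))

lemma quot_scale: "\<alpha> : A ==> f : C_inf S ==> quot \<alpha> (%x. c * f x) = (%x. c * quot \<alpha> f x)"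
proof (rule quot_eqI)
 fix x assume a: "\<alpha> : A" "f : C_inf S" "x : S"
 have "of_real (\<alpha> x) * (c * quot \<alpha> f x) = c * (of_real (\<alpha> x) * quot \<alpha> f x)" by simp
 then show "of_real (\<alpha> x) * (c * quot \<alpha> f x) = c * f x - c * f (s \<alpha> x)"
  unfolding quot(2)[OF a] by (simp add: right_diff_distrib)
qed (auto intro!: C_inf_scale quot)

lemma quot_lf:
 assumes a: "\<alpha> : A" and X: "X : S" and f: "f : C_inf S"
 shows "quot \<alpha> (%x. lf X x * f x) = (%x. lf X x * quot \<alpha> f x + of_real (kp \<alpha> * \<alpha> X) * sp (s \<alpha>) f x)"
proof (rule quot_eqI[OF a C_inf_mult[OF lf_C[OF X] f]])
 show "(%x. lf X x * quot \<alpha> f x + of_real (kp \<alpha> * \<alpha> X) * sp (s \<alpha>) f x) : C_inf S"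
  by (intro C_inf_add C_inf_mult C_inf_scale lf_C X quot a f sps_C)
 fix x assume x: "x : S"
 have l: "lf X (s \<alpha> x) = lf X x - of_real (kp \<alpha> * \<alpha> x * \<alpha> X)"
  using x X a H_S[OF a] by (simp add: lf_apply s_S s_kp B_diff B_scale2 H_eq[OF a X] B_sym)
 have "of_real (\<alpha> x) * (lf X x * quot \<alpha> f x + of_real (kp \<alpha> * \<alpha> X) * sp (s \<alpha>) f x) =
  lf X x * (of_real (\<alpha> x) * quot \<alpha> f x) + of_real (kp \<alpha> * \<alpha> x * \<alpha> X) * f (s \<alpha> x)"
  using x by (simp add: sp_apply algebra_simps)
 then show "of_real (\<alpha> x) * (lf X x * quot \<alpha> f x + of_real (kp \<alpha> * \<alpha> X) * sp (s \<alpha>) f x) =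
  lf X x * f x - lf X (s \<alpha> x) * f (s \<alpha> x)"
  unfolding quot(2)[OF a f x] l by (simp add: algebra_simps)
qed

definition DU :: "'v => ('v => complex) => 'v => complex" where
 "DU \<xi> f = (%x. dir_deriv S \<xi> f x + (\<Sum>\<alpha>\<in>A. of_real (m \<alpha> * \<alpha> \<xi>) * quot \<alpha> f x))"

text \<open>The commutator of \<open>DU \<xi>\<close> with multiplication by
  \<open>lf X\<close>.\<close>

definition NN :: "'v => 'v => ('v => complex) => 'v => complex" where
 "NN \<xi> X f = (%x. of_real (B X \<xi>) * f x + (\<Sum>\<alpha>\<in>A. of_real (m \<alpha> * \<alpha> \<xi>) * (of_real (kp \<alpha> * \<alpha> X) * sp (s \<alpha>) f x)))"

lemma DU_C: "\<xi> : S ==> f : C_inf S ==> DU \<xi> f : C_inf S"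
 unfolding DU_def by (intro C_inf_add C_inf_sum C_inf_scale dd_C quot)

lemma NN_C: "f : C_inf S ==> NN \<xi> X f : C_inf S"
 unfolding NN_def by (intro C_inf_add C_inf_sum C_inf_scale sps_C)

lemma DU_add: "\<xi> : S ==> f : C_inf S ==> g : C_inf S ==> DU \<xi> (%x. f x + g x) = (%x. DU \<xi> f x + DU \<xi> g x)"
 unfolding DU_def by (simp add: dir_deriv_add[OF subS] quot_add distrib_left sum.distrib algebra_simps)

lemma DU_scale: "\<xi> : S ==> f : C_inf S ==> DU \<xi> (%x. c * f x) = (%x. c * DU \<xi> f x)"
 unfolding DU_def by (simp add: dir_deriv_scale[OF subS] quot_scale distrib_left sum_distrib_left mult.left_commute)

lemma DU_sum: "\<xi> : S ==> (\<And>i. i : I ==> f i : C_inf S) ==>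
 DU \<xi> (%x. \<Sum>i\<in>I. f i x) = (%x. \<Sum>i\<in>I. DU \<xi> (f i) x)"
proof (induction I rule: infinite_finite_induct)
 case (insert i I)
 then show ?case using DU_add[of \<xi> "f i" "%x. \<Sum>i\<in>I. f i x"] by (simp add: C_inf_sum)
qed (use DU_scale[OF _ C_inf_zero, of \<xi> 0] in auto)

lemma DU_vec_sum: "(\<And>i. i : I ==> v i : S) ==> f : C_inf S ==>
 DU (\<Sum>i\<in>I. c i *R v i) f x = (\<Sum>i\<in>I. of_real (c i) * DU (v i) f x)"
proof -
 assume v: "\<And>i. i : I ==> v i : S" and f: "f : C_inf S"
 have "\<alpha> (\<Sum>i\<in>I. c i *R v i) = (\<Sum>i\<in>I. c i * \<alpha> (v i))" if a: "\<alpha> : A" for \<alpha>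
  using B_sum2[OF v H_S[OF a], of I, where c=c] v by (simp add: H_eq[OF a] S_sum)
 note e = this
 have "(\<Sum>\<alpha>\<in>A. of_real (m \<alpha> * \<alpha> (\<Sum>i\<in>I. c i *R v i)) * quot \<alpha> f x) =
   (\<Sum>\<alpha>\<in>A. \<Sum>i\<in>I. of_real (c i) * (of_real (m \<alpha> * \<alpha> (v i)) * quot \<alpha> f x))"
  by (rule sum.cong[OF refl], subst e) (simp_all add: sum_distrib_left sum_distrib_right mult_ac)
 also have "\<dots> = (\<Sum>i\<in>I. of_real (c i) * (\<Sum>\<alpha>\<in>A. of_real (m \<alpha> * \<alpha> (v i)) * quot \<alpha> f x))"
  by (subst sum.swap) (simp add: sum_distrib_left)
 finally show ?thesis using dir_deriv_sum_vec[OF subS v f, where c=c and x=x]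
  by (simp add: DU_def distrib_left sum.distrib)
qed

lemma DU_lf:
 assumes "\<xi> : S" "X : S" "f : C_inf S"
 shows "DU \<xi> (%x. lf X x * f x) = (%x. lf X x * DU \<xi> f x + NN \<xi> X f x)"
 unfolding DU_def NN_def dd_lf[OF assms(2,1,3)]
 by (simp add: quot_lf assms distrib_left sum.distrib sum_distrib_left mult.left_commute add_ac cong: sum.cong)

lemma quot_cst: "\<alpha> : A ==> quot \<alpha> (cst c) = (%_. 0)"
 by (rule quot_eqI[OF _ cst_C C_inf_zero]) (auto simp: s_S cst_def ext0_def)

lemma dd_cst: "\<xi> : S ==> dir_deriv S \<xi> (cst c) = (%_. 0)"
proof
 fix x assume "\<xi> : S"
 then have "x : S ==> dir_deriv S \<xi> (cst c) x = 0"
  by (intro dir_deriv_eqI) (auto simp: cst_def ext0_def)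
 then show "dir_deriv S \<xi> (cst c) x = 0" by (cases "x : S") (auto simp: dir_deriv_outside)
qed

lemma DU_cst: "\<xi> : S ==> DU \<xi> (cst c) = (%_. 0)"
 by (simp add: DU_def quot_cst dd_cst)

section \<open>Symmetries of the Dunkl operators\<close>

lemma isoA_simps:
 assumes "isoA w"
 shows "x : S ==> w x : S" "x : S ==> y : S ==> w (x + y) = w x + w y" "x : S ==> w (c *R x) = c *R w x"
  "x : S ==> y : S ==> B (w x) (w y) = B x y" "w ` S = S"
 using assms unfolding isoA_def by auto

lemma isoA_C: "isoA w ==> f : C_inf S ==> sp w f : C_inf S"
 by (rule sp_C) (auto simp: isoA_simps)

text \<open>The quotient is odd in the root, so a change of sign of the root shows up as the factor
  \<open>ep\<close>.\<close>

lemma quot_equiv: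
 assumes w: "isoA w" and b: "\<beta> : A" "\<beta>' : A" and e: "ep = 1 \<or> ep = -1" and eq: "\<forall>x\<in>S. \<beta>' (w x) = ep * \<beta> x"
  and f: "f : C_inf S" and x: "x : S"
 shows "quot \<beta>' f (w x) = of_real ep * quot \<beta> (sp w f) x"
proof -
 note ws = isoA_simps[OF w]
 have ee: "ep * ep = 1" using e by auto
 have H': "H \<beta>' = ep *R w (H \<beta>)"
 proof -
  let ?d = "H \<beta>' - ep *R w (H \<beta>)"
  have dS: "?d : S" using b H_S ws(1) by simp
  then obtain y where y: "y : S" "?d = w y" using ws(5) by blast
  have "B ?d (w y) = B (H \<beta>') (w y) - ep * B (w (H \<beta>)) (w y)"
   using b H_S ws(1) y(1) by (simp add: B_diff B_scale)
  also have "\<dots> = \<beta>' (w y) - ep * \<beta> y" using b y(1) H_S ws(1,4) by (simp add: H_eq)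
  also have "\<dots> = 0" using eq y(1) by simp
  finally have "B ?d ?d = 0" using y(2) by simp
  then show ?thesis using B_pos[OF dS] by fastforce
 qed
 have HH': "B (H \<beta>') (H \<beta>') = B (H \<beta>) (H \<beta>)"
  using b H_S ws ee by (simp add: H' B_scale B_scale2 mult.assoc[symmetric])
 have sw: "s \<beta>' (w y) = w (s \<beta> y)" if y: "y : S" for y
 proof -
  have "s \<beta>' (w y) = w y - (2 * (ep * \<beta> y) / B (H \<beta>) (H \<beta>)) *R (ep *R w (H \<beta>))"
   using eq y by (simp add: s_def HH' H'[symmetric])
  also have "\<dots> = w y - (2 * \<beta> y / B (H \<beta>) (H \<beta>)) *R w (H \<beta>)"
   using e by auto
  also have "\<dots> = w (y + (- (2 * \<beta> y / B (H \<beta>) (H \<beta>))) *R H \<beta>)"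
   using y b H_S by (simp only: ws S_simps) simp
  finally show ?thesis by (simp add: s_def)
 qed
 have qC: "sp w (quot \<beta>' f) : C_inf S" by (rule isoA_C[OF w quot(1)[OF b(2) f]])
 have "quot \<beta> (sp w f) = (%x. of_real ep * sp w (quot \<beta>' f) x)"
 proof (rule quot_eqI[OF b(1) isoA_C[OF w f] C_inf_scale[OF qC]])
  fix y assume y: "y : S"
  have "of_real (\<beta> y) * (of_real ep * sp w (quot \<beta>' f) y) = of_real (\<beta>' (w y)) * quot \<beta>' f (w y)"
   using eq y by (simp add: sp_apply)
  also have "\<dots> = f (w y) - f (s \<beta>' (w y))" by (rule quot(2)[OF b(2) f ws(1)[OF y]])
  finally show "of_real (\<beta> y) * (of_real ep * sp w (quot \<beta>' f) y) = sp w f y - sp w f (s \<beta> y)"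
   using y b by (simp add: sp_apply s_S sw)
 qed
 then show ?thesis using x ee by (simp add: sp_apply mult.assoc[symmetric] of_real_mult[symmetric] del: of_real_mult)
qed

lemma dd_equiv:
 assumes w: "isoA w" and \<xi>: "\<xi> : S" and f: "f : C_inf S" and x: "x : S"
 shows "dir_deriv S (w \<xi>) f (w x) = dir_deriv S \<xi> (sp w f) x"
proof (rule dir_deriv_eqI[symmetric, OF x])
 note ws = isoA_simps[OF w]
 have "((%t. f (w x + t *R w \<xi>)) hvd dir_deriv S (w \<xi>) f (w x)) (at 0)"
  by (rule C_inf_deriv[OF subS f ws(1)[OF \<xi>] ws(1)[OF x]])
 then show "((%t. sp w f (x + t *R \<xi>)) hvd dir_deriv S (w \<xi>) f (w x)) (at 0)"
  using x \<xi> by (simp add: sp_apply ws)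
qed

text \<open>The sum is reindexed by \<sigma>; the sign of a root occurs once in the coefficient and
  once in the quotient.\<close>

lemma DU_equiv:
 assumes w: "isoA w" and \<xi>: "\<xi> : S" and f: "f : C_inf S" and x: "x : S"
 shows "DU (w \<xi>) f (w x) = DU \<xi> (sp w f) x"
proof -
 obtain \<sigma> where s: "bij_betw \<sigma> A A" "\<forall>\<beta>\<in>A. m (\<sigma> \<beta>) = m \<beta> \<and>
    ((\<forall>x\<in>S. \<sigma> \<beta> (w x) = \<beta> x) \<or> (\<forall>x\<in>S. \<sigma> \<beta> (w x) = - \<beta> x))"
  using w unfolding isoA_def by blast
 have "(\<Sum>\<alpha>\<in>A. of_real (m \<alpha> * \<alpha> (w \<xi>)) * quot \<alpha> f (w x)) =
  (\<Sum>\<beta>\<in>A. of_real (m (\<sigma> \<beta>) * \<sigma> \<beta> (w \<xi>)) * quot (\<sigma> \<beta>) f (w x))"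
  by (rule sum.reindex_bij_betw[OF s(1), symmetric])
 also have "\<dots> = (\<Sum>\<beta>\<in>A. of_real (m \<beta> * \<beta> \<xi>) * quot \<beta> (sp w f) x)"
 proof (rule sum.cong[OF refl])
  fix \<beta> assume b: "\<beta> : A"
  then have sb: "\<sigma> \<beta> : A" "m (\<sigma> \<beta>) = m \<beta>" using s by (auto simp: bij_betw_def)
  obtain ep :: real where e: "ep = 1 \<or> ep = -1" "\<forall>x\<in>S. \<sigma> \<beta> (w x) = ep * \<beta> x"
   using bspec[OF s(2) b] by (metis mult_1 mult_minus1)
  show "of_real (m (\<sigma> \<beta>) * \<sigma> \<beta> (w \<xi>)) * quot (\<sigma> \<beta>) f (w x) = of_real (m \<beta> * \<beta> \<xi>) * quot \<beta> (sp w f) x"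
   using quot_equiv[OF w b sb(1) e f x] e \<xi> sb(2) by auto
 qed
 finally show ?thesis using dd_equiv[OF assms] by (simp add: DU_def)
qed

end

section \<open>Commutativity of Dunkl operators and the Dunkl Laplacian\<close>

locale dunkl_comm = dunkl_data S B A m H
 for S :: "'v::euclidean_space set" and B A m H +
 assumes s_iso: "\<alpha> : A ==> isoA (s \<alpha>)"
begin

lemma DU_outside: "\<xi> : S ==> f : C_inf S ==> x \<notin> S ==> DU \<xi> f x = 0"
 using C_inf_outside[OF DU_C] by blast

lemma DU_vec2: "X : S ==> Y : S ==> f : C_inf S ==> DU (X + c *R Y) f x = DU X f x + of_real c * DU Y f x"
 using DU_vec_sum[of "{0, 1::nat}" "%i. if i = 0 then X else Y" f "%i. if i = 0 then 1 else c" x] by simp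

text \<open>Equivariance under the reflection, which changes \<xi> by a multiple of
  \<open>H \<alpha>\<close>.\<close>

lemma sp_DU:
 assumes a: "\<alpha> : A" and \<xi>: "\<xi> : S" and f: "f : C_inf S"
 shows "sp (s \<alpha>) (DU \<xi> f) x = DU \<xi> (sp (s \<alpha>) f) x - of_real (kp \<alpha> * \<alpha> \<xi>) * DU (H \<alpha>) (sp (s \<alpha>) f) x"
proof (cases "x : S")
 case False
 then show ?thesis using DU_outside[OF \<xi> sps_C[OF a f]] DU_outside[OF H_S[OF a] sps_C[OF a f]] by (simp add: sp_outside)
next
 case True
 have "DU (s \<alpha> (s \<alpha> \<xi>)) f (s \<alpha> x) = DU (s \<alpha> \<xi>) (sp (s \<alpha>) f) x"
  by (rule DU_equiv[OF s_iso[OF a] s_S[OF a \<xi>] f True])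
 then have "DU \<xi> f (s \<alpha> x) = DU (s \<alpha> \<xi>) (sp (s \<alpha>) f) x" unfolding s_s[OF a \<xi>] .
 moreover have "s \<alpha> \<xi> = \<xi> + (- (kp \<alpha> * \<alpha> \<xi>)) *R H \<alpha>" by (simp add: s_kp)
 ultimately show ?thesis using True DU_vec2[OF \<xi> H_S[OF a] sps_C[OF a f], of "- (kp \<alpha> * \<alpha> \<xi>)" x]
  by (simp add: sp_apply)
qed

text \<open>The defect in moving \<open>DU b\<close> past \<open>NN a X\<close>. Its symmetry in
  \<open>a\<close> and \<open>b\<close> is what makes the Dunkl operators commute.\<close>

definition QQ :: "'v => 'v => 'v => ('v => complex) => 'v => complex" where
 "QQ a b X f = (%x. \<Sum>\<alpha>\<in>A. of_real (m \<alpha> * \<alpha> a * (kp \<alpha> * \<alpha> X) * (kp \<alpha> * \<alpha> b)) * DU (H \<alpha>) (sp (s \<alpha>) f) x)"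

lemma DU_NN:
 assumes b: "b : S" and f: "f : C_inf S"
 shows "DU b (NN a X f) x = of_real (B X a) * DU b f x +
  (\<Sum>\<alpha>\<in>A. of_real (m \<alpha> * \<alpha> a * (kp \<alpha> * \<alpha> X)) * DU b (sp (s \<alpha>) f) x)"
proof -
 let ?g = "%\<alpha> x. of_real (m \<alpha> * \<alpha> a * (kp \<alpha> * \<alpha> X)) * sp (s \<alpha>) f x"
 have gC: "?g \<alpha> : C_inf S" if "\<alpha> : A" for \<alpha> by (rule C_inf_scale[OF sps_C[OF that f]])
 have NN: "NN a X f = (%x. of_real (B X a) * f x + (\<Sum>\<alpha>\<in>A. ?g \<alpha> x))"
  by (simp add: NN_def mult.assoc)
 have "DU b (NN a X f) x = of_real (B X a) * DU b f x + (\<Sum>\<alpha>\<in>A. DU b (?g \<alpha>) x)"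
 proof -
  have c1: "(%x. of_real (B X a) * f x) : C_inf S" by (rule C_inf_scale[OF f])
  have c2: "(%x. \<Sum>\<alpha>\<in>A. ?g \<alpha> x) : C_inf S" by (rule C_inf_sum[OF gC])
  have "DU b (%x. \<Sum>\<alpha>\<in>A. ?g \<alpha> x) = (%x. \<Sum>\<alpha>\<in>A. DU b (?g \<alpha>) x)" by (rule DU_sum[OF b gC])
  then show ?thesis unfolding NN DU_add[OF b c1 c2] DU_scale[OF b f] by (simp only:)
 qed
 also have "(\<Sum>\<alpha>\<in>A. DU b (?g \<alpha>) x) = (\<Sum>\<alpha>\<in>A. of_real (m \<alpha> * \<alpha> a * (kp \<alpha> * \<alpha> X)) * DU b (sp (s \<alpha>) f) x)"
  by (rule sum.cong[OF refl]) (simp only: DU_scale[OF b sps_C[OF _ f]])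
 finally show ?thesis .
qed

lemma NN_DU:
 assumes b: "b : S" and f: "f : C_inf S"
 shows "NN a X (DU b f) x = DU b (NN a X f) x - QQ a b X f x"
proof -
 have "NN a X (DU b f) x = of_real (B X a) * DU b f x +
   (\<Sum>\<alpha>\<in>A. of_real (m \<alpha> * \<alpha> a * (kp \<alpha> * \<alpha> X)) * sp (s \<alpha>) (DU b f) x)"
  by (simp add: NN_def mult.assoc)
 also have "(\<Sum>\<alpha>\<in>A. of_real (m \<alpha> * \<alpha> a * (kp \<alpha> * \<alpha> X)) * sp (s \<alpha>) (DU b f) x) =
   (\<Sum>\<alpha>\<in>A. of_real (m \<alpha> * \<alpha> a * (kp \<alpha> * \<alpha> X)) * DU b (sp (s \<alpha>) f) x) - QQ a b X f x"
  unfolding QQ_def sum_subtractf[symmetric]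
  by (rule sum.cong[OF refl]) (simp add: sp_DU[OF _ b f] algebra_simps)
 finally show ?thesis unfolding DU_NN[OF b f] by (simp only: add_diff_eq)
qed

lemma DU_DU_lf:
 assumes a: "a : S" and b: "b : S" and X: "X : S" and f: "f : C_inf S"
 shows "DU a (DU b (%x. lf X x * f x)) x =
  lf X x * DU a (DU b f) x + DU b (NN a X f) x - QQ a b X f x + DU a (NN b X f) x"
 unfolding DU_lf[OF b X f] DU_add[OF a C_inf_mult[OF lf_C[OF X] DU_C[OF b f]] NN_C[OF f]]
  DU_lf[OF a X DU_C[OF b f]] NN_DU[OF b f] by simp

text \<open>Commuting either product with \<open>lf X\<close> produces the same two mixed terms and
  the symmetric \<open>QQ\<close>, and both products kill constants, so
  \<open>hadamard_principle\<close> applies to the difference.\<close>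

theorem DU_commute:
 assumes a: "a : S" and b: "b : S" and f: "f : C_inf S"
 shows "DU a (DU b f) = DU b (DU a f)"
proof (rule C_inf_eqI)
 fix x assume x: "x : S"
 note C = DU_C[OF a] DU_C[OF b]
 have "DU a (DU b f) x - DU b (DU a f) x = 0"
 proof (rule hadamard_principle[OF x _ _ _ _ f, where \<Lambda>="%f. DU a (DU b f) x - DU b (DU a f) x"])
  fix f g assume fg: "f : C_inf S" "g : C_inf S"
  show "DU a (DU b (%x. f x + g x)) x - DU b (DU a (%x. f x + g x)) x =
   DU a (DU b f) x - DU b (DU a f) x + (DU a (DU b g) x - DU b (DU a g) x)"
   unfolding DU_add[OF a fg] DU_add[OF b fg] DU_add[OF a C(2)[OF fg(1)] C(2)[OF fg(2)]]
    DU_add[OF b C(1)[OF fg(1)] C(1)[OF fg(2)]] by simp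
 next
  fix f and c :: complex assume g: "f : C_inf S"
  show "DU a (DU b (%x. c * f x)) x - DU b (DU a (%x. c * f x)) x = c * (DU a (DU b f) x - DU b (DU a f) x)"
   unfolding DU_scale[OF a g] DU_scale[OF b g] DU_scale[OF a C(2)[OF g]] DU_scale[OF b C(1)[OF g]]
   by (simp add: right_diff_distrib)
 next
  fix X f assume X: "X : S" and g: "f : C_inf S"
  have "QQ a b X f x = QQ b a X f x" by (simp add: QQ_def mult_ac)
  then show "DU a (DU b (%x. lf X x * f x)) x - DU b (DU a (%x. lf X x * f x)) x =
   lf X x * (DU a (DU b f) x - DU b (DU a f) x)"
   unfolding DU_DU_lf[OF a b X g] DU_DU_lf[OF b a X g] by (simp add: right_diff_distrib)
 next
  have "DU \<xi> (%_. 0) = (%_. 0)" if "\<xi> : S" for \<xi>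
   using DU_scale[OF that C_inf_zero, of 0] by simp
  then show "DU a (DU b (cst 1)) x - DU b (DU a (cst 1)) x = 0" by (simp add: DU_cst a b)
 qed
 then show "DU a (DU b f) x = DU b (DU a f) x" by simp
qed (intro DU_C a b f)+

definition LD :: "('v => complex) => 'v => complex" where "LD f = (%x. \<Sum>v\<in>fr. DU v (DU v f) x)"

lemma LD_C: "f : C_inf S ==> LD f : C_inf S"
 unfolding LD_def by (intro C_inf_sum DU_C fr)

lemma LD_add: "f : C_inf S ==> g : C_inf S ==> LD (%x. f x + g x) = (%x. LD f x + LD g x)"
 unfolding LD_def by (simp add: DU_add DU_C fr sum.distrib cong: sum.cong)

lemma LD_scale: "f : C_inf S ==> LD (%x. c * f x) = (%x. c * LD f x)"
 unfolding LD_def by (simp add: DU_scale DU_C fr sum_distrib_left cong: sum.cong)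

lemma DU_frame_sum:
 assumes X: "X : S" and f: "f : C_inf S"
 shows "(\<Sum>v\<in>fr. of_real (B X v) * DU v f x) = DU X f x"
 using DU_vec_sum[where I=fr and v="%v. v" and c="B X", OF fr(2) f] fr(3)[OF X] by simp

text \<open>Summed over the frame, the terms \<open>DU v (NN v X f)\<close> give
  \<open>DU X f\<close> plus a reflection sum, and they occur twice; the \<open>QQ\<close> terms
  give twice the same reflection sum with the opposite sign.\<close>

lemma LD_lf:
 assumes X: "X : S" and f: "f : C_inf S"
 shows "LD (%x. lf X x * f x) = (%x. lf X x * LD f x + 2 * DU X f x)"
proof
 fix x
 let ?c = "%\<alpha>. complex_of_real (m \<alpha> * (kp \<alpha> * \<alpha> X))"
 let ?P = "\<Sum>\<alpha>\<in>A. ?c \<alpha> * DU (H \<alpha>) (sp (s \<alpha>) f) x"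
 have 1: "(\<Sum>v\<in>fr. DU v (NN v X f) x) = DU X f x + ?P"
 proof -
  have "(\<Sum>v\<in>fr. \<Sum>\<alpha>\<in>A. of_real (m \<alpha> * \<alpha> v * (kp \<alpha> * \<alpha> X)) * DU v (sp (s \<alpha>) f) x) =
    (\<Sum>\<alpha>\<in>A. ?c \<alpha> * (\<Sum>v\<in>fr. of_real (B (H \<alpha>) v) * DU v (sp (s \<alpha>) f) x))"
   by (subst sum.swap) (auto simp: sum_distrib_left H_eq fr mult_ac intro!: sum.cong)
  also have "\<dots> = ?P"
   by (intro sum.cong refl) (simp add: DU_frame_sum[OF H_S sps_C[OF _ f]])
  finally have e: "(\<Sum>v\<in>fr. \<Sum>\<alpha>\<in>A. of_real (m \<alpha> * \<alpha> v * (kp \<alpha> * \<alpha> X)) * DU v (sp (s \<alpha>) f) x) = ?P" .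
  have "(\<Sum>v\<in>fr. DU v (NN v X f) x) = (\<Sum>v\<in>fr. of_real (B X v) * DU v f x +
    (\<Sum>\<alpha>\<in>A. of_real (m \<alpha> * \<alpha> v * (kp \<alpha> * \<alpha> X)) * DU v (sp (s \<alpha>) f) x))"
   by (rule sum.cong[OF refl]) (rule DU_NN[OF fr(2) f])
  then show ?thesis by (simp only: sum.distrib e DU_frame_sum[OF X f])
 qed
 have 2: "(\<Sum>v\<in>fr. QQ v v X f x) = 2 * ?P"
 proof -
  have "(\<Sum>v\<in>fr. B (H \<alpha>) v * B (H \<alpha>) v) * kp \<alpha> = 2" if a: "\<alpha> : A" for \<alpha>
  proof -
   have "(\<Sum>v\<in>fr. B (H \<alpha>) v * B (H \<alpha>) v) = B (H \<alpha>) (\<Sum>v\<in>fr. B (H \<alpha>) v *R v)"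
    by (rule B_sum2[symmetric]) (auto simp: fr H_S a)
   also have "\<dots> = B (H \<alpha>) (H \<alpha>)" by (simp add: fr(3)[OF H_S[OF a]])
   finally show ?thesis using HH[OF a] by (simp add: kp_def)
  qed
  note k = this
  have "(\<Sum>v\<in>fr. QQ v v X f x) = (\<Sum>\<alpha>\<in>A. \<Sum>v\<in>fr. ?c \<alpha> * of_real (B (H \<alpha>) v * B (H \<alpha>) v * kp \<alpha>) * DU (H \<alpha>) (sp (s \<alpha>) f) x)"
   unfolding QQ_def by (subst sum.swap) (auto simp: H_eq fr mult_ac intro!: sum.cong)
  also have "\<dots> = (\<Sum>\<alpha>\<in>A. ?c \<alpha> * of_real ((\<Sum>v\<in>fr. B (H \<alpha>) v * B (H \<alpha>) v) * kp \<alpha>) * DU (H \<alpha>) (sp (s \<alpha>) f) x)"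
   by (simp only: sum_distrib_left sum_distrib_right of_real_sum)
  also have "\<dots> = (\<Sum>\<alpha>\<in>A. ?c \<alpha> * of_real 2 * DU (H \<alpha>) (sp (s \<alpha>) f) x)"
   by (rule sum.cong[OF refl]) (simp only: k)
  also have "\<dots> = 2 * ?P" by (simp add: sum_distrib_left mult_ac)
  finally show ?thesis .
 qed
 have "LD (%x. lf X x * f x) x = (\<Sum>v\<in>fr. lf X x * DU v (DU v f) x + 2 * DU v (NN v X f) x - QQ v v X f x)"
  unfolding LD_def by (rule sum.cong[OF refl]) (simp add: DU_DU_lf[OF fr(2) fr(2) X f])
 also have "\<dots> = lf X x * LD f x + 2 * (\<Sum>v\<in>fr. DU v (NN v X f) x) - (\<Sum>v\<in>fr. QQ v v X f x)"
  by (simp add: sum.distrib sum_subtractf sum_distrib_left LD_def)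
 finally show "LD (%x. lf X x * f x) x = lf X x * LD f x + 2 * DU X f x"
  unfolding 1 2 by simp
qed

lemma LD_DU:
 assumes X: "X : S" and f: "f : C_inf S"
 shows "LD (DU X f) = DU X (LD f)"
proof -
 have "DU v (DU v (DU X f)) = DU X (DU v (DU v f))" if v: "v : fr" for v
  using DU_commute[OF fr(2)[OF v] X f] DU_commute[OF fr(2)[OF v] X DU_C[OF fr(2)[OF v] f]] by simp
 then show ?thesis unfolding LD_def
  by (subst DU_sum[OF X]) (auto intro!: DU_C fr f sum.cong)
qed

sublocale dun: comm_ops S B LD DU
 by unfold_locales (simp_all add: LD_C LD_add LD_scale DU_C LD_lf LD_DU)

text \<open>Both sides have the commutator \<open>2 * DU X\<close> with \<open>lf X\<close> and kill constants.\<close>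

theorem LD_formula:
 assumes f: "f : C_inf S" and x: "x : S" and reg: "\<forall>\<alpha>\<in>A. \<alpha> x \<noteq> 0"
 shows "LD f x = Lap f x + (\<Sum>\<alpha>\<in>A. of_real (m \<alpha>) *
   (of_real (2 / \<alpha> x) * dir_deriv S (H \<alpha>) f x - of_real (B (H \<alpha>) (H \<alpha>) / (\<alpha> x)\<^sup>2) * (f x - f (s \<alpha> x))))"
proof -
 let ?P = "%f. \<Sum>\<alpha>\<in>A. of_real (m \<alpha>) *
   (of_real (2 / \<alpha> x) * dir_deriv S (H \<alpha>) f x - of_real (B (H \<alpha>) (H \<alpha>) / (\<alpha> x)\<^sup>2) * (f x - f (s \<alpha> x)))"
 have "LD f x - (Lap f x + ?P f) = 0"
 proof (rule hadamard_principle[OF x _ _ _ _ f, where \<Lambda>="%f. LD f x - (Lap f x + ?P f)"])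
  fix f g assume fg: "f : C_inf S" "g : C_inf S"
  have "?P (%x. f x + g x) = ?P f + ?P g"
   unfolding sum.distrib[symmetric]
   by (rule sum.cong[OF refl]) (simp only: dir_deriv_add[OF subS H_S fg] algebra_simps)
  then show "LD (%x. f x + g x) x - (Lap (%x. f x + g x) x + ?P (%x. f x + g x)) =
   LD f x - (Lap f x + ?P f) + (LD g x - (Lap g x + ?P g))"
   by (simp only: LD_add[OF fg] Lap_add[OF fg]) simp
 next
  fix f and c :: complex assume g: "f : C_inf S"
  have "?P (%x. c * f x) = c * ?P f"
   unfolding sum_distrib_left
   by (rule sum.cong[OF refl]) (simp only: dir_deriv_scale[OF subS H_S g] algebra_simps)
  then show "LD (%x. c * f x) x - (Lap (%x. c * f x) x + ?P (%x. c * f x)) = c * (LD f x - (Lap f x + ?P f))"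
   by (simp only: LD_scale[OF g] Lap_scale[OF g]) (simp add: algebra_simps)
 next
  fix X f assume X: "X : S" and g: "f : C_inf S"
  let ?R = "\<Sum>\<alpha>\<in>A. of_real (m \<alpha> * \<alpha> X) * quot \<alpha> f x"
  have "?P (%x. lf X x * f x) = lf X x * ?P f + 2 * ?R"
   unfolding sum_distrib_left sum.distrib[symmetric]
  proof (rule sum.cong[OF refl])
   fix \<alpha> assume a: "\<alpha> : A"
   have ax: "\<alpha> x \<noteq> 0" using reg a by blast
   let ?n = "B (H \<alpha>) (H \<alpha>)"
   have dd: "dir_deriv S (H \<alpha>) (%x. lf X x * f x) x = lf X x * dir_deriv S (H \<alpha>) f x + of_real (\<alpha> X) * f x"
    using dd_lf[OF X H_S[OF a] g] H_eq[OF a X] B_sym[OF X H_S[OF a]] by simp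
   have l: "lf X (s \<alpha> x) = lf X x - of_real (kp \<alpha> * \<alpha> x * \<alpha> X)"
    using x X a H_S[OF a] by (simp add: lf_apply s_S s_kp B_diff B_scale2 H_eq[OF a X] B_sym)
   \<comment> \<open>The derivative term contributes \<open>2 * \<alpha> X / \<alpha> x\<close>
     times \<open>f x\<close>, and the reflected value of \<open>lf X\<close> minus the same
     multiple of \<open>f (s \<alpha> x)\<close>; together they are twice the coefficient of the
     quotient.\<close>
   have nk: "?n / (\<alpha> x)\<^sup>2 * (kp \<alpha> * \<alpha> x * \<alpha> X) = 2 * \<alpha> X / \<alpha> x"
    using HH[OF a] ax by (simp add: kp_def power2_eq_square)
   have q: "quot \<alpha> f x = of_real (1 / \<alpha> x) * (f x - f (s \<alpha> x))"
    using quot(2)[OF a g x] ax by (simp add: field_simps)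
   have "of_real (?n / (\<alpha> x)\<^sup>2) * (lf X x * f x - lf X (s \<alpha> x) * f (s \<alpha> x)) =
     lf X x * (of_real (?n / (\<alpha> x)\<^sup>2) * (f x - f (s \<alpha> x))) + of_real (?n / (\<alpha> x)\<^sup>2 * (kp \<alpha> * \<alpha> x * \<alpha> X)) * f (s \<alpha> x)"
    unfolding l of_real_mult by (simp only: algebra_simps)
   then have e: "of_real (?n / (\<alpha> x)\<^sup>2) * (lf X x * f x - lf X (s \<alpha> x) * f (s \<alpha> x)) =
     lf X x * (of_real (?n / (\<alpha> x)\<^sup>2) * (f x - f (s \<alpha> x))) + of_real (2 * \<alpha> X / \<alpha> x) * f (s \<alpha> x)"
    unfolding nk .
   show "of_real (m \<alpha>) * (of_real (2 / \<alpha> x) * dir_deriv S (H \<alpha>) (%x. lf X x * f x) x -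
      of_real (?n / (\<alpha> x)\<^sup>2) * (lf X x * f x - lf X (s \<alpha> x) * f (s \<alpha> x))) =
     lf X x * (of_real (m \<alpha>) * (of_real (2 / \<alpha> x) * dir_deriv S (H \<alpha>) f x - of_real (?n / (\<alpha> x)\<^sup>2) * (f x - f (s \<alpha> x)))) +
     2 * (of_real (m \<alpha> * \<alpha> X) * quot \<alpha> f x)"
    unfolding dd e q using ax by (simp add: algebra_simps)
  qed
  moreover have "DU X f x = dir_deriv S X f x + ?R" by (simp add: DU_def)
  ultimately show "LD (%x. lf X x * f x) x - (Lap (%x. lf X x * f x) x + ?P (%x. lf X x * f x)) =
   lf X x * (LD f x - (Lap f x + ?P f))"
   unfolding LD_lf[OF X g] Lap_lf[OF X g] by (simp only: algebra_simps)
 next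
  have z: "dir_deriv S v (%_. 0) = (%_. 0)" if "v : S" for v
   using dir_deriv_scale[OF subS that C_inf_zero, of 0] by simp
  have z': "DU v (%_. 0) = (%_. 0)" if "v : S" for v
   using DU_scale[OF that C_inf_zero, of 0] by simp
  have "LD (cst 1) x = 0" "Lap (cst 1) x = 0"
   by (simp_all add: LD_def Lap_def DU_cst dd_cst fr z z')
  moreover have "?P (cst 1) = 0"
   by (rule sum.neutral, rule ballI) (simp only: dd_cst[OF H_S], simp add: cst_def ext0_def x s_S)
  ultimately show "LD (cst 1) x - (Lap (cst 1) x + ?P (cst 1)) = 0" by simp
 qed
 then show ?thesis by simp
qed

text \<open>An isometry carries a frame to a frame with the same trace; then \<open>DU_equiv\<close>
  is applied to each of the two factors.\<close>

lemma LD_equiv: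
 assumes w: "isoA w" and f: "f : C_inf S" and x: "x : S"
 shows "LD f (w x) = LD (sp w f) x"
proof -
 note ws = isoA_simps[OF w]
 have fw: "frame fr w"
  unfolding frame_def
 proof (intro conjI ballI fr(1))
  show "w v : S" if "v : fr" for v using that fr ws by blast
  fix y assume "y : S"
  then obtain z where z: "z : S" "y = w z" using ws(5) by blast
  have lin: "w (\<Sum>v\<in>K. c v *R v) = (\<Sum>v\<in>K. c v *R w v)" if "K \<subseteq> fr" for K and c :: "'v => real"
   using finite_subset[OF that fr(1)] that
  proof (induction K rule: finite_induct)
   case empty show ?case using ws(3)[of 0 0] by simp
  next
   case (insert v K)
   have "v : S" using insert fr by auto
   moreover have "(\<Sum>v\<in>K. c v *R v) : S" using insert fr by (intro S_sum) auto
   ultimately show ?case using insert by (simp add: ws)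
  qed
  have "y = w (\<Sum>v\<in>fr. B z v *R v)" using fr(3)[OF z(1)] z(2) by simp
  also have "\<dots> = (\<Sum>v\<in>fr. B z v *R w v)" by (rule lin) simp
  also have "\<dots> = (\<Sum>v\<in>fr. B y (w v) *R w v)"
   unfolding z(2) by (rule sum.cong[OF refl]) (simp only: ws(4)[OF z(1) fr(2)])
  finally show "y = (\<Sum>v\<in>fr. B y (w v) *R w v)" .
 qed
 have "LD f (w x) = (\<Sum>v\<in>fr. DU (w v) (DU (w v) f) (w x))"
  unfolding LD_def
 proof (rule frame_trace[OF fr_frame fw, where q="%X Y. DU X (DU Y f) (w x)"])
  show "DU (X + Y) (DU Z f) (w x) = DU X (DU Z f) (w x) + DU Y (DU Z f) (w x)"
   if "X : S" "Y : S" "Z : S" for X Y Z using DU_vec2[OF that(1,2) DU_C[OF that(3) f], of 1] by simp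
  show "DU (c *R X) (DU Z f) (w x) = of_real c * DU X (DU Z f) (w x)"
   if "X : S" "Z : S" for c X Z
   using DU_vec_sum[of "{0::nat}" "%_. X" "DU Z f" "%_. c" "w x"] that DU_C[OF that(2) f] by simp
  show "DU X (DU Y f) (w x) = DU Y (DU X f) (w x)" if "X : S" "Y : S" for X Y
   using DU_commute[OF that f] by simp
 qed
 also have "\<dots> = (\<Sum>v\<in>fr. DU v (DU v (sp w f)) x)"
 proof (rule sum.cong[OF refl])
  fix v assume v: "v : fr"
  have "sp w (DU (w v) f) = DU v (sp w f)"
  proof (rule C_inf_eqI[OF isoA_C[OF w DU_C[OF ws(1)[OF fr(2)[OF v]] f]] DU_C[OF fr(2)[OF v] isoA_C[OF w f]]])
   fix y assume "y : S"
   then show "sp w (DU (w v) f) y = DU v (sp w f) y"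
    using DU_equiv[OF w fr(2)[OF v] f] by (simp add: sp_apply)
  qed
  then show "DU (w v) (DU (w v) f) (w x) = DU v (DU v (sp w f)) x"
   using DU_equiv[OF w fr(2)[OF v] DU_C[OF ws(1)[OF fr(2)[OF v]] f] x] by simp
 qed
 finally show ?thesis by (simp add: LD_def)
qed

end

section \<open>Traces\<close>

definition lin_on :: "'v::real_vector set => ('v => 'v) => bool" where
 "lin_on E f \<longleftrightarrow> (\<forall>x\<in>E. f x : E) \<and> (\<forall>x\<in>E. \<forall>y\<in>E. f (x + y) = f x + f y) \<and> (\<forall>c. \<forall>x\<in>E. f (c *R x) = c *R f x)"

lemma lin_onD: assumes "lin_on E f"
 shows "x : E ==> f x : E" "x : E ==> y : E ==> f (x + y) = f x + f y" "x : E ==> f (c *R x) = c *R f x"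
 using assms by (auto simp: lin_on_def)

lemma lin_on_sum:
 assumes f: "lin_on E f" and E: "subspace E"
 shows "(\<And>i. i : I ==> v i : E) ==> f (\<Sum>i\<in>I. c i *R v i) = (\<Sum>i\<in>I. c i *R f (v i))"
proof (induction I rule: infinite_finite_induct)
 case (insert i I)
 then show ?case by (simp add: lin_onD[OF f] subspace_sum[OF E] subspace_scale[OF E])
qed (use lin_onD(3)[OF f subspace_0[OF E], of 0] in auto)

context
 fixes E :: "'v::euclidean_space set"
 assumes E: "subspace E"
begin

text \<open>The same choice as inside \<open>trace_on\<close>, so that both refer to one
  basis.\<close>

definition bs where "bs = (SOME b. b \<subseteq> E \<and> independent b \<and> span b = E)"

lemma bs: "bs \<subseteq> E" "independent bs" "span bs = E" "finite bs"
proof -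
 obtain b where "b \<subseteq> E" "independent b" "E \<subseteq> span b" using maximal_independent_subset[of E] by metis
 then have "b \<subseteq> E \<and> independent b \<and> span b = E"
  using span_minimal[OF _ E] by blast
 then have "bs \<subseteq> E \<and> independent bs \<and> span bs = E" unfolding bs_def by (rule someI)
 then show "bs \<subseteq> E" "independent bs" "span bs = E" "finite bs" by (auto dest: independent_imp_finite)
qed

lemma trace_bs: "trace_on E f = (\<Sum>v\<in>bs. representation bs (f v) v)"
 by (simp add: trace_on_def bs_def Let_def)

lemma rep_expand: "x : E ==> (\<Sum>w\<in>bs. representation bs x w *R w) = x"
 using sum_representation_eq[OF bs(2), of x bs] bs by simp

lemma rep_sum: "(\<And>w. w : I ==> g w : E) ==> representation bs (\<Sum>w\<in>I. c w *R g w) v = (\<Sum>w\<in>I. c w * representation bs (g w) v)"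
 using representation_sum[OF bs(2), of I "%w. c w *R g w"] bs(3) E
 by (simp add: subspace_scale representation_scale[OF bs(2)])

lemma trace_cong: "(\<And>x. x : E ==> f x = g x) ==> trace_on E f = trace_on E g"
 using bs(1) by (auto simp: trace_bs intro!: sum.cong)

lemma trace_add: "lin_on E f ==> lin_on E g ==> trace_on E (%x. f x + g x) = trace_on E f + trace_on E g"
 unfolding trace_bs sum.distrib[symmetric]
 using bs by (intro sum.cong refl) (auto simp: representation_add[OF bs(2)] lin_onD)

lemma trace_scale: "lin_on E f ==> trace_on E (%x. c *R f x) = c * trace_on E f"
 unfolding trace_bs sum_distrib_left
 using bs by (intro sum.cong refl) (auto simp: representation_scale[OF bs(2)] lin_onD)

text \<open>Both traces are the double sum of products of matrix entries.\<close>

lemma trace_cyclic: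
 assumes f: "lin_on E f" and g: "lin_on E g"
 shows "trace_on E (%x. f (g x)) = trace_on E (%x. g (f x))"
proof -
 have 1: "representation bs (f (g v)) v = (\<Sum>w\<in>bs. representation bs (g v) w * representation bs (f w) v)"
  if f: "lin_on E f" and g: "lin_on E g" and v: "v : bs" for f g v
 proof -
  have "f (g v) = f (\<Sum>w\<in>bs. representation bs (g v) w *R w)"
   using rep_expand[of "g v"] lin_onD(1)[OF g] v bs(1) by auto
  also have "\<dots> = (\<Sum>w\<in>bs. representation bs (g v) w *R f w)" by (rule lin_on_sum[OF f E]) (use bs in auto)
  finally show ?thesis using rep_sum[of bs f] lin_onD(1)[OF f] bs(1) by auto
 qed
 have "trace_on E (%x. f (g x)) = (\<Sum>v\<in>bs. \<Sum>w\<in>bs. representation bs (g v) w * representation bs (f w) v)"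
  unfolding trace_bs by (rule sum.cong[OF refl 1[OF f g]])
 also have "\<dots> = (\<Sum>w\<in>bs. \<Sum>v\<in>bs. representation bs (f w) v * representation bs (g v) w)"
  by (subst sum.swap) (simp add: mult.commute)
 also have "\<dots> = trace_on E (%x. g (f x))"
  unfolding trace_bs by (rule sum.cong[OF refl 1[OF g f, symmetric]])
 finally show ?thesis .
qed

end

section \<open>Commuting symmetric operators\<close>

context form_space
begin

lemma form_space_subspace: "subspace U ==> U \<subseteq> S ==> form_space U B"
 by unfold_locales (auto intro: B_add B_scale B_sym B_pos)

lemma lin_sub: assumes "lin_on S T" "x : S" "y : S" shows "T (x + c *R y) = T x + c *R T y"
 using assms by (simp add: lin_onD)

text \<open>The Rayleigh quotient is maximised over the compact Euclidean unit sphere of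
  \<open>S\<close>. With the maximum as \<open>l\<close>, the form \<open>F\<close> is positive
  semidefinite and null at the maximiser \<open>w\<close>, so \<open>F w\<close> vanishes and
  \<open>w\<close> is an eigenvector.\<close>

lemma eigenvector:
 assumes T: "lin_on S T" and sym: "\<And>x y. x : S ==> y : S ==> B (T x) y = B x (T y)" and ne: "S \<noteq> {0}"
 shows "\<exists>w\<in>S. \<exists>l. w \<noteq> 0 \<and> T w = l *R w"
proof -
 let ?K = "S \<inter> sphere 0 1"
 have K: "compact ?K" using closed_subspace[OF subS] by (simp add: closed_Int_compact)
 obtain x where x: "x : S" "x \<noteq> 0" using ne S_simps(1) by blast
 then have "(1 / norm x) *R x : ?K" by simp
 then have Kne: "?K \<noteq> {}" by blast
 have exp: "B x y = (\<Sum>v\<in>fr. B v x * B v y)" if "x : S" "y : S" for x y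
 proof -
  have "B x y = B x (\<Sum>v\<in>fr. B y v *R v)" using fr(3)[OF that(2)] by simp
  also have "\<dots> = (\<Sum>v\<in>fr. B y v * B x v)" using fr that by (intro B_sum2) auto
  also have "\<dots> = (\<Sum>v\<in>fr. B v x * B v y)"
   by (rule sum.cong[OF refl]) (simp add: B_sym[OF that(1) fr(2)] B_sym[OF that(2) fr(2)])
  finally show ?thesis .
 qed
 have cl: "continuous_on ?K (B v)" if "v : S" for v
 proof -
  have "continuous_on ?K (%y. B v (prj S y))" using linear_continuous_on[OF B_bounded_linear[OF that]] .
  then show ?thesis by (rule continuous_on_eq) (simp add: prj_id[OF subS])
 qed
 have c1: "continuous_on ?K (%x. B x x)"
 proof (rule continuous_on_eq[of _ "%x. \<Sum>v\<in>fr. B v x * B v x"])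
  show "continuous_on ?K (%x. \<Sum>v\<in>fr. B v x * B v x)" by (intro continuous_intros cl fr(2))
 qed (rule exp[symmetric]; blast)
 have c2: "continuous_on ?K (%x. B (T x) x)"
 proof (rule continuous_on_eq[of _ "%x. \<Sum>v\<in>fr. B (T v) x * B v x"])
  show "continuous_on ?K (%x. \<Sum>v\<in>fr. B (T v) x * B v x)"
   by (intro continuous_intros cl lin_onD(1)[OF T] fr(2))
  fix x assume "x : ?K"
  then have x: "x : S" by simp
  show "(\<Sum>v\<in>fr. B (T v) x * B v x) = B (T x) x"
   unfolding exp[OF lin_onD(1)[OF T x] x] by (rule sum.cong[OF refl]) (simp add: sym[OF fr(2) x])
 qed
 have pos: "B x x > 0" if "x : ?K" for x
 proof -
  have "x \<noteq> 0" using that by auto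
  then show ?thesis using that B_pos by blast
 qed
 have "continuous_on ?K (%x. B (T x) x / B x x)"
 proof (rule continuous_on_divide[OF c2 c1])
  show "\<forall>x\<in>?K. B x x \<noteq> 0"
  proof
   fix x assume "x : ?K"
   from pos[OF this] show "B x x \<noteq> 0" by simp
  qed
 qed
 from continuous_attains_sup[OF K Kne this]
 obtain w where w: "w : ?K" "\<forall>x\<in>?K. B (T x) x / B x x \<le> B (T w) w / B w w" by blast
 define l where "l = B (T w) w / B w w"
 have wS: "w : S" "w \<noteq> 0" using w(1) by auto
 define F where "F x y = l * B x y - B (T x) y" for x y
 have F0: "F w w = 0" using pos[OF w(1)] by (simp add: F_def l_def)
 have Fpos: "F x x \<ge> 0" if x: "x : S" for x
 proof (cases "x = 0")
  case True
  then show ?thesis using lin_onD(3)[OF T S_simps(1), of 0] by (simp add: F_def B_zero)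
 next
  case False
  let ?y = "(1 / norm x) *R x"
  have y: "?y : ?K" using False x by simp
  have "B (T ?y) ?y / B ?y ?y = B (T x) x / B x x"
   using x False by (simp add: lin_onD[OF T] B_scale B_scale2)
  then have "B (T x) x / B x x \<le> l" using w(2) y unfolding l_def by metis
  then show ?thesis using B_pos[OF x False] by (simp add: F_def field_simps)
 qed
 have Fz: "F w y = 0" if y: "y : S" for y
 proof (rule ccontr)
  assume ne: "F w y \<noteq> 0"
  have q: "2 * t * F w y + t\<^sup>2 * F y y \<ge> 0" for t
  proof -
   have "F (w + t *R y) (w + t *R y) = F w w + 2 * t * F w y + t\<^sup>2 * F y y"
    using wS(1) y lin_onD(1)[OF T] sym[OF y wS(1)]
    by (simp add: F_def lin_sub[OF T] B_add B_add2 B_scale B_scale2 B_sym[of w "T y"] B_sym[of y "T w"] B_sym[of y w] power2_eq_square algebra_simps)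
   then show ?thesis using Fpos[of "w + t *R y"] wS(1) y F0 by simp
  qed
  \<comment> \<open>Near the minimiser of the quadratic polynomial in \<open>q\<close>; the summand
    1 keeps the denominator positive, and the value becomes minus
    \<open>t^2 * (F y y + 2)\<close>.\<close>
  define t where "t = - F w y / (F y y + 1)"
  have fy: "F y y + 1 > 0" using Fpos[OF y] by simp
  have a: "F w y = - t * (F y y + 1)" using fy by (simp add: t_def)
  then have "t \<noteq> 0" using ne by auto
  have "2 * t * F w y + t\<^sup>2 * F y y = - (t\<^sup>2 * (F y y + 2))"
   unfolding a by (simp add: power2_eq_square algebra_simps)
  moreover have "t\<^sup>2 * (F y y + 2) > 0" using \<open>t \<noteq> 0\<close> fy by (intro mult_pos_pos) auto
  ultimately show False using q[of t] by simp
 qed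
 let ?d = "l *R w - T w"
 have d: "?d : S" using wS(1) lin_onD(1)[OF T] by simp
 have "B ?d ?d = F w ?d" unfolding F_def using wS(1) lin_onD(1)[OF T] d by (simp add: B_diff(1)[of _ _ ?d] B_scale)
 then have "?d = 0" using Fz[OF d] B_pos[OF d] by fastforce
 then show ?thesis using wS by (intro bexI[of _ w] exI[of _ l]) auto
qed

text \<open>If the common eigenvectors spanned less, the orthogonal complement of their span would
  contain a nonzero invariant subspace of least dimension. Each operator has an eigenspace in it,
  which is invariant by commutation and hence everything, so all its vectors are common
  eigenvectors.\<close>

lemma simultaneous_eigenvectors:
 assumes lin: "\<And>T. T : \<A> ==> lin_on S T"
  and sym: "\<And>T x y. T : \<A> ==> x : S ==> y : S ==> B (T x) y = B x (T y)"
  and com: "\<And>T T' x. T : \<A> ==> T' : \<A> ==> x : S ==> T (T' x) = T' (T x)"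
 shows "S = span {x : S. \<forall>T\<in>\<A>. \<exists>l. T x = l *R x}" (is "S = span ?V")
proof (rule ccontr)
 assume "S \<noteq> span ?V"
 define U where "U = span ?V"
 have U: "subspace U" "U \<subseteq> S" unfolding U_def using span_minimal[OF _ subS, of ?V] by auto
 have "U \<noteq> S" using \<open>S \<noteq> span ?V\<close> by (auto simp: U_def)
 interpret u: form_space U B by (rule form_space_subspace[OF U])
 define W0 where "W0 = {x : S. \<forall>u\<in>U. B x u = 0}"
 have "T x : span ?V \<and> x : S" if T: "T : \<A>" and x: "x : span ?V" for T x
  using x
 proof (induction rule: span_induct_alt)
  case base
  show ?case using lin_onD(3)[OF lin[OF T] S_simps(1), of 0] by (simp add: span_0)
 next
  case (step c x y)
  obtain l where "T x = l *R x" using step(1) T by blast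
  then have "T (c *R x + y) = (c * l) *R x + T y"
   using step by (simp add: lin_onD[OF lin[OF T]])
  moreover have "x : span ?V" using step(1) by (rule span_base)
  ultimately show ?case using step by (simp add: span_add span_scale)
 qed
 then have TU: "T x : U" if "T : \<A>" "x : U" for T x using that by (auto simp: U_def)
 have W0: "subspace W0" unfolding W0_def subspace_def using U(2)
  by (auto simp: B_zero B_add B_scale subset_eq)
 have TW0: "T x : W0" if "T : \<A>" "x : W0" for T x
  using that sym lin_onD(1)[OF lin] TU U(2) by (auto simp: W0_def subset_eq)
 have "\<exists>x\<in>W0. x \<noteq> 0"
 proof -
  obtain x where x: "x : S" "x \<notin> U" using \<open>U \<noteq> S\<close> U(2) by blast
  let ?p = "\<Sum>v\<in>u.fr. B x v *R v"
  have p: "?p : U" by (rule u.S_sum) (simp add: u.fr)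
  have "B (x - ?p) u = 0" if uu: "u : U" for u
  proof -
   have "B ?p u = (\<Sum>v\<in>u.fr. B x v * B v u)" using u.fr uu by (intro u.B_sum) auto
   also have "\<dots> = (\<Sum>v\<in>u.fr. B u v * B x v)" using u.fr uu by (intro sum.cong) (auto simp: u.B_sym)
   also have "\<dots> = B x (\<Sum>v\<in>u.fr. B u v *R v)"
    by (rule B_sum2[symmetric]) (use u.fr U(2) x in auto)
   also have "\<dots> = B x u" using u.fr(3)[OF uu] by simp
   finally show ?thesis using x p uu U(2) by (simp add: B_diff subset_eq)
  qed
  then have "x - ?p : W0" using x p U(2) by (auto simp: W0_def)
  moreover have "x - ?p \<noteq> 0" using x p by auto
  ultimately show ?thesis by blast
 qed
 define P where "P W \<longleftrightarrow> subspace W \<and> W \<subseteq> W0 \<and> W \<noteq> {0} \<and> (\<forall>T\<in>\<A>. \<forall>x\<in>W. T x : W)" for W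
 have "P W0" using W0 TW0 \<open>\<exists>x\<in>W0. x \<noteq> 0\<close> by (auto simp: P_def)
 then obtain W where W: "P W" "\<And>W'. P W' ==> dim W \<le> dim W'"
  using arg_min_nat_lemma[of P W0 dim] by blast
 have Ws: "subspace W" "W \<subseteq> S" "W \<subseteq> W0" "W \<noteq> {0}" using W(1) by (auto simp: P_def W0_def)
 interpret w: form_space W B by (rule form_space_subspace[OF Ws(1,2)])
 obtain x where x: "x : W" "x \<noteq> 0" using Ws(4) w.S_simps(1) by blast
 have "\<exists>l. T x = l *R x" if T: "T : \<A>" for T
 proof -
  have inv: "T y : W" if "y : W" for y using W(1) T that by (auto simp: P_def)
  have "lin_on W T" using lin[OF T] inv Ws(2) by (auto simp: lin_on_def subset_eq)
  from w.eigenvector[OF this sym[OF T] Ws(4)] Ws(2)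
  obtain v l where v: "v : W" "v \<noteq> 0" "T v = l *R v" by blast
  define W' where "W' = {y : W. T y = l *R y}"
  have "subspace W'" unfolding W'_def subspace_def
   using Ws lin_onD[OF lin[OF T]] lin_onD(3)[OF lin[OF T] S_simps(1), of 0] by (auto simp: subset_eq algebra_simps)
  moreover have "W' \<noteq> {0}" using v by (auto simp: W'_def)
  moreover have "T' y : W'" if T': "T' : \<A>" and y: "y : W'" for T' y
  proof -
   have yS: "y : S" "y : W" "T y = l *R y" using y Ws(2) by (auto simp: W'_def)
   have "T (T' y) = l *R T' y" using com[OF T T' yS(1)] yS(3) lin_onD(3)[OF lin[OF T'] yS(1)] by simp
   moreover have "T' y : W" using W(1) T' yS(2) by (auto simp: P_def)
   ultimately show ?thesis by (simp add: W'_def)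
  qed
  ultimately have "P W'" using Ws(3) by (auto simp: P_def W'_def)
  then have "W' = W" using W(2)[of W'] \<open>subspace W'\<close> Ws(1) subspace_dim_equal[of W' W] by (auto simp: W'_def)
  then show ?thesis using x(1) by (auto simp: W'_def)
 qed
 then have "x : U" using x Ws(2) unfolding U_def by (intro span_base) auto
 then show False using x Ws(3) B_pos[of x] by (fastforce simp: W0_def)
qed

end

section \<open>The Killing form and restricted roots\<close>

locale iwa =
 fixes G :: "('a::{t2_space,second_countable_topology}, 'v::euclidean_space, 'z) iwasawa_group_scheme"
 assumes lie_group: "is_lie_group G" and iwasawa: "iwasawa G"
begin

sublocale lie_grp G by unfold_locales (rule lie_group)

abbreviation br where "br \<equiv> bracket G"
abbreviation K where "K \<equiv> killing G"
abbreviation th where "th \<equiv> theta G"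
abbreviation a where "a \<equiv> aa G"
abbreviation s where "s \<equiv> ss G"
abbreviation k where "k \<equiv> kk G"
abbreviation rs where "rs \<equiv> root_space G"

lemma E_simps [simp]: "0 : E" "x : E ==> y : E ==> x + y : E" "x : E ==> y : E ==> x - y : E"
 "x : E ==> c *R x : E" "x : E ==> - x : E" "x : E ==> y : E ==> br x y : E"
 using E_sub by (auto simp: subspace_0 subspace_add subspace_diff subspace_scale subspace_neg bracket_in)

lemma br_add2: "X : E ==> Y : E ==> Z : E ==> br X (Y + Z) = br X Y + br X Z"
 by (rule bracket_add_right)

lemma br_scale2: "X : E ==> Y : E ==> br X (c *R Y) = c *R br X Y"
 by (rule bracket_scale_right)

lemma br_add1: "X : E ==> Y : E ==> Z : E ==> br (X + Y) Z = br X Z + br Y Z"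
 using bracket_antisym[of "X + Y" Z] bracket_antisym[of Z X] bracket_antisym[of Z Y] bracket_add_right[of Z X Y] by simp

lemma br_scale1: "X : E ==> Y : E ==> br (c *R X) Y = c *R br X Y"
 using bracket_antisym[of "c *R X" Y] bracket_antisym[of Y X] bracket_scale_right[of Y X c] by simp

lemma br_minus: "X : E ==> Y : E ==> br (- X) Y = - br X Y" "X : E ==> Y : E ==> br X (- Y) = - br X Y"
 using br_scale1[of X Y "-1"] br_scale2[of X Y "-1"] by simp_all

lemma br_diff: "X : E ==> Y : E ==> Z : E ==> br (X - Y) Z = br X Z - br Y Z"
 "X : E ==> Y : E ==> Z : E ==> br X (Y - Z) = br X Y - br X Z"
 using br_add1[of X "- Y" Z] br_add2[of X Y "- Z"] by (simp_all add: br_minus)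

lemma br_zero: "X : E ==> br X 0 = 0" "X : E ==> br 0 X = 0"
 using br_scale2[of X X 0] br_scale1[of X X 0] by simp_all

lemma ad_lin: "X : E ==> lin_on E (br X)"
 by (simp add: lin_on_def br_add2 br_scale2)

lemma ad2_lin: "X : E ==> Y : E ==> lin_on E (%Z. br X (br Y Z))"
 by (simp add: lin_on_def br_add2 br_scale2)

lemma K_def': "K X Y = trace_on E (%Z. br X (br Y Z))"
 by (simp add: killing_def)

lemma K_sym: "X : E ==> Y : E ==> K X Y = K Y X"
 unfolding K_def' by (rule trace_cyclic[OF E_sub]) (simp_all add: ad_lin)

lemma K_add: "X : E ==> Y : E ==> Z : E ==> K (X + Y) Z = K X Z + K Y Z"
 unfolding K_def' by (subst trace_add[OF E_sub, symmetric]) (auto simp: ad2_lin br_add1 intro!: trace_cong[OF E_sub])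

lemma K_scale: "X : E ==> Y : E ==> K (c *R X) Y = c * K X Y"
 unfolding K_def' by (subst trace_scale[OF E_sub, symmetric]) (auto simp: ad2_lin br_scale1 intro!: trace_cong[OF E_sub])

lemma K_scale2: "X : E ==> Y : E ==> K X (c *R Y) = c * K X Y"
 using K_scale[of Y X c] by (simp add: K_sym)

lemma K_minus: "X : E ==> Y : E ==> K (- X) Y = - K X Y" "X : E ==> Y : E ==> K X (- Y) = - K X Y"
 using K_scale[of X Y "-1"] K_scale2[of X Y "-1"] by simp_all

lemma K_invariant:
 assumes X: "X : E" and Y: "Y : E" and Z: "Z : E"
 shows "K (br X Y) Z = K X (br Y Z)"
proof -
 let ?t = "%A B C. trace_on E (%W. br A (br B (br C W)))"
 have l: "lin_on E (%W. br A (br B (br C W)))" if "A : E" "B : E" "C : E" for A B C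
  using that by (simp add: lin_on_def br_add2 br_scale2)
 have sub: "trace_on E (%W. br A (br B (br C W)) + (-1) *R br A' (br B' (br C' W))) = ?t A B C - ?t A' B' C'"
  if "A : E" "B : E" "C : E" "A' : E" "B' : E" "C' : E" for A B C A' B' C'
  using trace_add[OF E_sub l[OF that(1-3)], of "%W. (-1) *R br A' (br B' (br C' W))"]
   trace_scale[OF E_sub l[OF that(4-6)], of "-1"] l[OF that(4-6)] by (simp add: lin_on_def algebra_simps)
 have "K (br X Y) Z = trace_on E (%W. br X (br Y (br Z W)) + (-1) *R br Y (br X (br Z W)))"
  unfolding K_def' by (rule trace_cong[OF E_sub]) (simp add: jacobi[OF X Y] Z)
 also have "\<dots> = ?t X Y Z - ?t Y X Z" by (rule sub) (use assms in auto)
 also have "?t Y X Z = ?t X Z Y"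
  by (rule trace_cyclic[OF E_sub ad_lin[OF Y] ad2_lin[OF X Z]])
 also have "?t X Y Z - ?t X Z Y = trace_on E (%W. br X (br Y (br Z W)) + (-1) *R br X (br Z (br Y W)))"
  by (rule sub[symmetric]) (use assms in auto)
 also have "\<dots> = K X (br Y Z)"
  unfolding K_def' by (rule trace_cong[OF E_sub]) (simp add: jacobi[OF Y Z] br_add2 X Y Z br_minus)
 finally show ?thesis .
qed

text \<open>Conjugation by an automorphism turns ad X into ad (f X), and the trace is cyclic. The
  instances are theta and \<open>Ad\<close>.\<close>

lemma K_aut:
 assumes f: "lin_on E f" and g: "lin_on E g" and fg: "\<And>x. x : E ==> f (g x) = x" "\<And>x. x : E ==> g (f x) = x"
  and aut: "\<And>x y. x : E ==> y : E ==> f (br x y) = br (f x) (f y)" and X: "X : E" and Y: "Y : E"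
 shows "K (f X) (f Y) = K X Y"
proof -
 note l = lin_onD[OF f] lin_onD[OF g]
 have h: "lin_on E (%Z. br X (br Y (g Z)))" using X Y by (simp add: lin_on_def l br_add2 br_scale2)
 have "K (f X) (f Y) = trace_on E (%Z. f (br X (br Y (g Z))))"
  unfolding K_def'
  by (rule trace_cong[OF E_sub]) (simp add: aut X Y l fg(1))
 also have "\<dots> = trace_on E (%Z. br X (br Y (g (f Z))))" by (rule trace_cyclic[OF E_sub f h])
 also have "\<dots> = K X Y" unfolding K_def' by (rule trace_cong[OF E_sub]) (simp add: fg(2))
 finally show ?thesis .
qed

lemma th_props: "X : E ==> th X : E" "X : E ==> th (th X) = X" "X : E ==> Y : E ==> th (X + Y) = th X + th Y"
 "X : E ==> th (c *R X) = c *R th X" "X : E ==> Y : E ==> th (br X Y) = br (th X) (th Y)"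
 "X : E ==> X \<noteq> 0 ==> - K X (th X) > 0"
 using iwasawa by (auto simp: iwasawa_def cartan_involution_def)

lemma th_minus: "X : E ==> th (- X) = - th X"
 using th_props(4)[of X "-1"] by simp

lemma th_diff: "X : E ==> Y : E ==> th (X - Y) = th X - th Y"
 using th_props(3)[of X "- Y"] by (simp add: th_minus)

lemma K_th: "X : E ==> Y : E ==> K (th X) (th Y) = K X Y"
 by (rule K_aut[of th th]) (auto simp: lin_on_def th_props)

text \<open>The inner product attached to the Cartan involution, used for orthogonality in the Lie
  algebra; on \<open>ss\<close> it coincides with the Killing form.\<close>

definition ip where "ip X Y = - K X (th Y)"

sublocale ip: form_space E ip
proof unfold_locales
 show "ip x y = ip y x" if "x : E" "y : E" for x y
  using K_th[of x "th y"] that K_sym[of "th x" y] by (simp add: ip_def th_props)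
 show "ip x x > 0" if "x : E" "x \<noteq> 0" for x using th_props(6)[OF that] by (simp add: ip_def)
qed (auto simp: ip_def E_sub K_add K_scale th_props(1-5))

lemma s_E: "X : s ==> X : E" and k_E: "X : k ==> X : E" and a_s: "X : a ==> X : s" and a_E: "X : a ==> X : E"
 using iwasawa by (auto simp: ss_def kk_def iwasawa_def)

lemma th_s: "X : s ==> th X = - X" and th_k: "X : k ==> th X = X"
 by (auto simp: ss_def kk_def)

lemma s_sub: "subspace s" and k_sub: "subspace k" and a_sub: "subspace a"
proof -
 have "th 0 = 0" using th_props(4)[of 0 0] by simp
 then show "subspace s" "subspace k" by (auto simp: subspace_def ss_def kk_def th_props)
 show "subspace a" using iwasawa by (auto simp: iwasawa_def abelian_subspace_def)
qed

lemma ip_s: "Y : s ==> X : E ==> ip X Y = K X Y"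
 by (simp add: ip_def th_s K_minus s_E)

sublocale fs: form_space s K
proof unfold_locales
 show "K x x > 0" if "x : s" "x \<noteq> 0" for x using ip.B_pos[of x] ip_s[of x x] that s_E by simp
 show "K x y = K y x" if "x : s" "y : s" for x y using that by (simp add: K_sym s_E)
qed (use s_sub in \<open>auto simp: K_add K_scale s_E\<close>)

sublocale fa: form_space a K
 by (rule fs.form_space_subspace) (use a_sub a_s in auto)

lemma a_abelian: "X : a ==> Y : a ==> br X Y = 0"
 using iwasawa by (auto simp: iwasawa_def abelian_subspace_def)

lemma K_ks: "X : k ==> Y : s ==> K X Y = 0"
 using K_th[of X Y] by (simp add: th_k th_s k_E s_E K_minus)

lemma br_ks: "X : k ==> Y : s ==> br X Y : s"
 by (simp add: ss_def kk_def th_props br_minus)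

lemma br_kk: "X : k ==> Y : k ==> br X Y : k"
 by (simp add: ss_def kk_def th_props)

lemma s_proj: "X : E ==> X - th X : s" and k_proj: "X : E ==> X + th X : k"
 by (auto simp: ss_def kk_def th_diff th_props)

text \<open>Invariance of the Killing form. As a consequence ad is symmetric on \<open>ss\<close>
  and skew on \<open>kk\<close>.\<close>

lemma adjoint_ad: "Z : E ==> X : E ==> Y : E ==> ip (br Z X) Y = - ip X (br (th Z) Y)"
proof -
 assume z: "Z : E" "X : E" "Y : E"
 have "ip (br Z X) Y = - K (br Z X) (th Y)" by (simp add: ip_def)
 also have "K (br Z X) (th Y) = - K (br X Z) (th Y)" using z bracket_antisym[of Z X] by (simp add: K_minus th_props)
 also have "K (br X Z) (th Y) = K X (br Z (th Y))" using z by (simp add: K_invariant th_props)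
 also have "br Z (th Y) = th (br (th Z) Y)" using z by (simp add: th_props)
 finally show ?thesis by (simp add: ip_def)
qed

lemma ad_symmetric: "H : s ==> X : E ==> Y : E ==> ip (br H X) Y = ip X (br H Y)"
 using adjoint_ad[of H X Y] by (simp add: s_E th_s br_minus ip.B_minus)

lemma ad_skew: "T : k ==> X : E ==> ip (br T X) X = 0"
 using adjoint_ad[of T X X] ip.B_sym[of X "br T X"] by (simp add: k_E th_k)

text \<open>Adjoining \<open>W\<close> to \<open>aa\<close> gives an abelian subspace of
  \<open>ss\<close>, which maximality forces to be \<open>aa\<close>.\<close>

lemma centralizer_s:
 assumes W: "W : s" "\<And>H. H : a ==> br H W = 0"
 shows "W : a"
proof -
 let ?b = "{H + c *R W |H c. H : a}"
 have sub: "subspace ?b"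
  unfolding subspace_def
 proof (intro conjI ballI allI)
  have "0 = 0 + 0 *R W" by simp
  then show "0 : ?b" using subspace_0[OF a_sub] by blast
 next
  fix x y assume "x : ?b" "y : ?b"
  then obtain H c H' c' where "x = H + c *R W" "y = H' + c' *R W" "H : a" "H' : a" by blast
  then have "x + y = (H + H') + (c + c') *R W" "H + H' : a"
   using subspace_add[OF a_sub] by (auto simp: algebra_simps)
  then show "x + y : ?b" by blast
 next
  fix d x assume "x : ?b"
  then obtain H c where "x = H + c *R W" "H : a" by blast
  then have "d *R x = d *R H + (d * c) *R W" "d *R H : a"
   using subspace_scale[OF a_sub] by (auto simp: algebra_simps)
  then show "d *R x : ?b" by blast
 qed
 have bs: "?b \<subseteq> s" using W(1) a_s s_sub by (auto intro!: subspace_add subspace_scale)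
 have "br X Y = 0" if X: "X : ?b" and Y: "Y : ?b" for X Y
 proof -
  obtain H c H' c' where e: "X = H + c *R W" "Y = H' + c' *R W" and H: "H : a" "H' : a" using X Y by blast
  have "br W H' = 0" using W(2)[OF H(2)] bracket_antisym[of W H'] s_E[OF W(1)] a_E[OF H(2)] by simp
  then show ?thesis unfolding e
   using H W s_E[OF W(1)] a_E by (simp add: br_add1 br_add2 br_scale1 br_scale2 a_abelian bracket_self)
 qed
 moreover have "?b \<subseteq> E" using bs s_E by blast
 ultimately have ab: "abelian_subspace G ?b" unfolding abelian_subspace_def using sub by blast
 have max: "\<forall>b. abelian_subspace G b \<and> a \<subseteq> b \<and> b \<subseteq> s \<longrightarrow> b = a" using iwasawa by (simp add: iwasawa_def)
 have "H = H + 0 *R W" for H by simp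
 then have "a \<subseteq> ?b" by blast
 then have "?b = a" using max ab bs by blast
 moreover have "W = 0 + 1 *R W" by simp
 then have "W : ?b" using subspace_0[OF a_sub] by blast
 ultimately show ?thesis by simp
qed

section \<open>Restricted roots and root spaces\<close>

abbreviation R where "R \<equiv> roots G"
abbreviation g0 where "g0 \<equiv> rs (%_. 0)"

lemma rsD: "X : rs \<alpha> ==> X : E" "X : rs \<alpha> ==> H : a ==> br H X = \<alpha> H *R X"
 by (auto simp: root_space_def)

lemma rsI: "X : E ==> (\<And>H. H : a ==> br H X = \<alpha> H *R X) ==> X : rs \<alpha>"
 by (auto simp: root_space_def)

lemma rs_sub: "subspace (rs \<alpha>)"
 by (auto simp: subspace_def root_space_def br_zero br_add2 br_scale2 a_E algebra_simps)

lemma rs_form_space: "form_space (rs \<alpha>) ip"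
 by (rule ip.form_space_subspace[OF rs_sub]) (use rsD in blast)

lemma rs_orth:
 assumes X: "X : rs \<alpha>" and Y: "Y : rs \<beta>" and H: "H : a" "\<alpha> H \<noteq> \<beta> H"
 shows "ip X Y = 0"
proof -
 have "ip (br H X) Y = ip X (br H Y)" by (rule ad_symmetric) (use X Y H a_s rsD in auto)
 then have "\<alpha> H * ip X Y = \<beta> H * ip X Y"
  using X Y H rsD by (simp add: ip.B_scale ip.B_scale2)
 then show ?thesis using H(2) by simp
qed

lemma dual_aa: "\<alpha> : dual_aa G ==> H : a ==> H' : a ==> \<alpha> (H + H') = \<alpha> H + \<alpha> H'"
 "\<alpha> : dual_aa G ==> H : a ==> \<alpha> (c *R H) = c * \<alpha> H" "\<alpha> : dual_aa G ==> x \<notin> a ==> \<alpha> x = 0"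
 using a_sub by (auto simp: dual_aa_def ext0_def linear_add linear_cmul subspace_add subspace_scale)

lemma dual_aaI:
 assumes "\<And>H H'. H : a ==> H' : a ==> f (H + H') = f H + f H'" "\<And>c H. H : a ==> f (c *R H) = c * f H"
 shows "ext0 a f : dual_aa G"
proof -
 have "linear (%x. f (prj a x))"
  by (rule linearI) (simp_all add: assms prj_in[OF a_sub] linear_add[OF prj_linear] linear_cmul[OF prj_linear])
 moreover have "ext0 a f = ext0 a (%x. f (prj a x))" by (auto simp: ext0_def prj_id[OF a_sub])
 ultimately show ?thesis by (auto simp: dual_aa_def)
qed

lemma dual_aa_neq: "\<alpha> : dual_aa G ==> \<beta> : dual_aa G ==> \<alpha> \<noteq> \<beta> ==> \<exists>H\<in>a. \<alpha> H \<noteq> \<beta> H"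
proof (rule ccontr)
 assume d: "\<alpha> : dual_aa G" "\<beta> : dual_aa G" "\<alpha> \<noteq> \<beta>" and n: "\<not> (\<exists>H\<in>a. \<alpha> H \<noteq> \<beta> H)"
 have "\<alpha> x = \<beta> x" for x using n dual_aa(3)[OF d(1)] dual_aa(3)[OF d(2)] by (cases "x : a") auto
 then show False using d(3) by blast
qed

lemma rootsD: "\<alpha> : R ==> \<alpha> : dual_aa G" "\<alpha> : R ==> \<alpha> \<noteq> (%_. 0)" "\<alpha> : R ==> rs \<alpha> \<noteq> {0}"
 by (auto simp: roots_def)

text \<open>The operators ad H for H in \<open>aa\<close> commute and are symmetric for
  \<open>ip\<close>. The eigenvalues of a nonzero common eigenvector depend linearly on H, so it
  lies in \<open>g0\<close> or in a root space.\<close>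

lemma root_decomposition: "E = span (g0 \<union> (\<Union>\<alpha>\<in>R. rs \<alpha>))"
proof -
 have "E = span {x : E. \<forall>T\<in>br ` a. \<exists>l. T x = l *R x}"
 proof (rule ip.simultaneous_eigenvectors)
  show "lin_on E T" if "T : br ` a" for T using that ad_lin a_E by auto
  show "ip (T x) y = ip x (T y)" if "T : br ` a" "x : E" "y : E" for T x y
   using that ad_symmetric a_s by auto
  show "T (T' x) = T' (T x)" if "T : br ` a" "T' : br ` a" "x : E" for T T' x
   using that jacobi[OF a_E a_E] by (auto simp: a_abelian br_zero)
 qed
 also have "\<dots> \<subseteq> span (g0 \<union> (\<Union>\<alpha>\<in>R. rs \<alpha>))"
 proof (rule span_mono, rule subsetI)
  fix x assume x: "x : {x : E. \<forall>T\<in>br ` a. \<exists>l. T x = l *R x}"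
  then have "\<forall>H. \<exists>l. H : a \<longrightarrow> br H x = l *R x" by auto
  then obtain l where l: "\<And>H. H : a ==> br H x = l H *R x" by metis
  have xE: "x : E" using x by simp
  show "x : g0 \<union> (\<Union>\<alpha>\<in>R. rs \<alpha>)"
  proof (cases "x = 0")
   case True
   then show ?thesis using subspace_0[OF rs_sub] by blast
  next
   case False
   have "ext0 a l : dual_aa G"
   proof (rule dual_aaI)
    fix H H' assume H: "H : a" "H' : a"
    have "l (H + H') *R x = (l H + l H') *R x"
     using l[OF H(1)] l[OF H(2)] l[OF subspace_add[OF a_sub H]] H xE by (simp add: br_add1 a_E algebra_simps)
    then show "l (H + H') = l H + l H'" using False by simp
   next
    fix c H assume H: "H : a"
    have "l (c *R H) *R x = (c * l H) *R x"
     using l[OF subspace_scale[OF a_sub H, of c]] xE unfolding br_scale1[OF a_E[OF H] xE] l[OF H] by auto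
    then show "l (c *R H) = c * l H" using False by simp
   qed
   moreover have xr: "x : rs (ext0 a l)" by (rule rsI[OF xE]) (simp add: l ext0_def)
   ultimately show ?thesis using False by (cases "ext0 a l = (%_. 0)") (auto simp: roots_def)
  qed
 qed
 finally have "E \<subseteq> span (g0 \<union> (\<Union>\<alpha>\<in>R. rs \<alpha>))" .
 moreover have "span (g0 \<union> (\<Union>\<alpha>\<in>R. rs \<alpha>)) \<subseteq> E" by (rule span_minimal[OF _ E_sub]) (use rsD in blast)
 ultimately show ?thesis by blast
qed

text \<open>Vectors from different root spaces are \<open>ip\<close>-orthogonal, hence
  independent.\<close>

lemma roots_finite: "finite R"
proof -
 have "\<exists>x. x : rs \<alpha> \<and> x \<noteq> 0" if "\<alpha> : R" for \<alpha>
  using rootsD(3)[OF that] subspace_0[OF rs_sub] by blast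
 then have "\<forall>\<alpha>\<in>R. \<exists>x. x : rs \<alpha> \<and> x \<noteq> 0" by blast
 then obtain x where "\<forall>\<alpha>\<in>R. x \<alpha> : rs \<alpha> \<and> x \<alpha> \<noteq> 0" by (elim bchoice[THEN exE])
 then have x: "\<And>\<alpha>. \<alpha> : R ==> x \<alpha> : rs \<alpha> \<and> x \<alpha> \<noteq> 0" by blast
 have orth: "ip (x \<alpha>) (x \<beta>) = 0" if "\<alpha> : R" "\<beta> : R" "\<alpha> \<noteq> \<beta>" for \<alpha> \<beta>
 proof -
  have "\<exists>H\<in>a. \<alpha> H \<noteq> \<beta> H" using dual_aa_neq[OF rootsD(1)[OF that(1)] rootsD(1)[OF that(2)] that(3)] .
  then obtain H where "H : a" "\<alpha> H \<noteq> \<beta> H" by blast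
  then show ?thesis using rs_orth[of "x \<alpha>" \<alpha> "x \<beta>" \<beta> H] x[OF that(1)] x[OF that(2)] by blast
 qed
 have pos: "ip (x \<alpha>) (x \<alpha>) > 0" if "\<alpha> : R" for \<alpha> using x[OF that] rsD ip.B_pos by blast
 have inj: "inj_on x R" 
 proof (rule inj_onI, rule ccontr)
  fix \<alpha> \<beta> assume "\<alpha> : R" "\<beta> : R" "x \<alpha> = x \<beta>" "\<alpha> \<noteq> \<beta>"
  then show False using orth[of \<alpha> \<beta>] pos[of \<alpha>] by simp
 qed
 have "independent (x ` R)"
 proof
  assume "dependent (x ` R)"
  then obtain t u where t: "finite t" "t \<subseteq> x ` R" "(\<Sum>v\<in>t. u v *R v) = 0" and ne: "\<exists>v\<in>t. u v \<noteq> 0"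
   unfolding dependent_explicit by blast
  obtain v where v: "v : t" "u v \<noteq> 0" using ne by blast
  then obtain \<alpha> where \<alpha>: "\<alpha> : R" "v = x \<alpha>" using t by blast
  have tE: "w : E" if "w : t" for w using that t(2) x rsD by blast
  have "0 = ip (\<Sum>w\<in>t. u w *R w) v" using t(3) tE[OF v(1)] ip.B_zero by simp
  also have "\<dots> = (\<Sum>w\<in>t. u w * ip w v)" by (rule ip.B_sum) (use tE v in auto)
  also have "\<dots> = (\<Sum>w\<in>{v}. u w * ip w v)"
  proof (rule sum.mono_neutral_right[OF t(1)])
   show "\<forall>w\<in>t - {v}. u w * ip w v = 0"
   proof
    fix w assume w: "w : t - {v}"
    then obtain \<beta> where "\<beta> : R" "w = x \<beta>" using t(2) by blast
    then show "u w * ip w v = 0" using orth[of \<beta> \<alpha>] \<alpha> w by auto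
   qed
  qed (use v in auto)
  finally show False using v pos[OF \<alpha>(1)] \<alpha>(2) by simp
 qed
 then have "finite (x ` R)" by (rule independent_imp_finite)
 then show ?thesis using finite_imageD inj by blast
qed

definition neg :: "('v => real) => 'v => real" where "neg \<alpha> = (%H. - \<alpha> H)"

lemma neg_dual: "\<alpha> : dual_aa G ==> neg \<alpha> : dual_aa G"
proof -
 assume "\<alpha> : dual_aa G"
 then have "ext0 a (neg \<alpha>) : dual_aa G" by (intro dual_aaI) (auto simp: neg_def dual_aa)
 moreover have "ext0 a (neg \<alpha>) = neg \<alpha>" using \<open>\<alpha> : dual_aa G\<close> by (auto simp: ext0_def neg_def dual_aa(3))
 ultimately show ?thesis by simp
qed

lemma th_rs: "X : rs \<alpha> ==> th X : rs (neg \<alpha>)"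
proof (rule rsI)
 fix H assume X: "X : rs \<alpha>" and H: "H : a"
 have "br H (th X) = - th (br H X)"
  using th_props(5)[OF a_E[OF H] rsD(1)[OF X]] th_s[OF a_s[OF H]] rsD(1)[OF X] H by (simp add: br_minus a_E th_props)
 then show "br H (th X) = neg \<alpha> H *R th X"
  using rsD[OF X] H by (simp add: th_props neg_def)
qed (simp add: rsD th_props)

lemma neg_roots: "\<alpha> : R ==> neg \<alpha> : R"
proof -
 assume r: "\<alpha> : R"
 obtain X where X: "X : rs \<alpha>" "X \<noteq> 0" using rootsD(3)[OF r] subspace_0[OF rs_sub] by blast
 have "th X \<noteq> 0" using X th_props(2)[of X] th_props(4)[of 0 0] rsD(1)[OF X(1)] by fastforce
 then have "rs (neg \<alpha>) \<noteq> {0}" using th_rs[OF X(1)] by blast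
 moreover have "neg \<alpha> \<noteq> (%_. 0)" using rootsD(2)[OF r] unfolding neg_def fun_eq_iff by simp
 ultimately show ?thesis using neg_dual rootsD(1)[OF r] by (auto simp: roots_def)
qed

abbreviation Hv where "Hv \<equiv> Hvec G"

lemma Hv: assumes "\<mu> : dual_aa G" shows "Hv \<mu> : a" "H : a ==> \<mu> H = K (Hv \<mu>) H"
proof -
 obtain X where X: "X : a" "\<forall>H\<in>a. K X H = \<mu> H" by (rule fa.riesz[of \<mu>]) (use dual_aa assms in auto)
 have "Hv \<mu> = X" unfolding Hvec_def
 proof (rule the_equality)
  fix Y assume Y: "Y : a \<and> (\<forall>H\<in>a. \<mu> H = K Y H)"
  then have "K (Y - X) (Y - X) = 0" using X by (simp add: fa.B_diff)
  then show "Y = X" using fa.B_pos[of "Y - X"] X Y by fastforce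
 qed (use X in auto)
 then show "Hv \<mu> : a" "H : a ==> \<mu> H = K (Hv \<mu>) H" using X by auto
qed

lemma Hv_pos: "\<alpha> : R ==> K (Hv \<alpha>) (Hv \<alpha>) > 0" "\<alpha> : R ==> \<alpha> (Hv \<alpha>) = K (Hv \<alpha>) (Hv \<alpha>)"
proof -
 assume r: "\<alpha> : R"
 have "Hv \<alpha> \<noteq> 0"
 proof
  assume "Hv \<alpha> = 0"
  then have "\<alpha> H = 0" for H using Hv(2)[OF rootsD(1)[OF r]] dual_aa(3)[OF rootsD(1)[OF r]] fa.B_zero
   by (cases "H : a") simp_all
  then show False using rootsD(2)[OF r] by auto
 qed
 then show "K (Hv \<alpha>) (Hv \<alpha>) > 0" using fa.B_pos Hv(1)[OF rootsD(1)[OF r]] by blast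
 show "\<alpha> (Hv \<alpha>) = K (Hv \<alpha>) (Hv \<alpha>)" using Hv[OF rootsD(1)[OF r]] by blast
qed

text \<open>The bracket lies in \<open>ss\<close> and commutes with \<open>aa\<close>, so it lies in
  \<open>aa\<close> by maximality; the pairing with \<open>aa\<close> then identifies it.\<close>

lemma br_X_thX:
 assumes r: "\<alpha> : dual_aa G" and X: "X : rs \<alpha>"
 shows "br X (th X) = - ip X X *R Hv \<alpha>"
proof -
 let ?W = "br X (th X)"
 have XE: "X : E" "th X : E" using rsD[OF X] th_props by auto
 have tX: "br H (th X) = - \<alpha> H *R th X" if "H : a" for H using rsD(2)[OF th_rs[OF X] that] by (simp add: neg_def)
 have "th ?W = br (th X) X" using XE th_props(5)[OF XE] th_props(2)[OF XE(1)] by simp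
 then have "th ?W = - ?W" using bracket_antisym[OF XE(2,1)] by simp
 then have Ws: "?W : s" using XE by (simp add: ss_def)
 have Wa: "?W : a"
 proof (rule centralizer_s[OF Ws])
  fix H assume H: "H : a"
  show "br H ?W = 0" using jacobi[OF a_E[OF H] XE] rsD(2)[OF X H] tX[OF H] XE by (simp add: br_scale1 br_scale2 br_minus)
 qed
 have "K (?W + ip X X *R Hv \<alpha>) H = 0" if H: "H : a" for H
 proof -
  have "K ?W H = K X (br (th X) H)" using K_invariant[OF XE a_E[OF H]] .
  also have "br (th X) H = \<alpha> H *R th X" using bracket_antisym[OF XE(2) a_E[OF H]] tX[OF H] by simp
  also have "K X (\<alpha> H *R th X) = - ip X X * \<alpha> H" using XE by (simp add: K_scale2 ip_def)
  finally show ?thesis using Wa Hv[OF r] H by (simp add: fa.B_add fa.B_scale)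
 qed
 moreover have "?W + ip X X *R Hv \<alpha> : a" using Wa Hv[OF r] by simp
 ultimately have "?W + ip X X *R Hv \<alpha> = 0" using fa.B_pos by fastforce
 then show ?thesis by (simp add: eq_neg_iff_add_eq_0)
qed

text \<open>The map \<open>Y \<mapsto> [X, [theta X, Y]]\<close> is injective, hence surjective on the root space of \<open>X\<close>.\<close>

lemma m_tangent:
 assumes r: "\<alpha> : R" and X: "X : rs \<alpha>" "X \<noteq> 0" and Y: "Y : rs \<alpha>" "ip X Y = 0"
 shows "\<exists>T\<in>k. (\<forall>H\<in>a. br T H = 0) \<and> br T X = Y"
proof -
 have XE: "X : E" "th X : E" using rsD[OF X(1)] th_props by auto
 define A where "A Z = br X (br (th X) Z)" for Z
 have u0: "br (th X) Z : g0" if Z: "Z : rs \<alpha>" for Z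
 proof (rule rsI)
  fix H assume H: "H : a"
  have "br H (th X) = - \<alpha> H *R th X" using rsD(2)[OF th_rs[OF X(1)] H] by (simp add: neg_def)
  then show "br H (br (th X) Z) = 0 *R br (th X) Z"
   using jacobi[OF a_E[OF H] XE(2) rsD(1)[OF Z]] rsD(1)[OF Z] rsD(2)[OF Z H] XE by (simp add: br_scale1 br_scale2 br_minus)
 qed (use XE rsD[OF Z] in simp)
 have A_in: "A Z : rs \<alpha>" if Z: "Z : rs \<alpha>" for Z
 proof (rule rsI)
  fix H assume H: "H : a"
  have "br H (br (th X) Z) = 0" using rsD(2)[OF u0[OF Z] H] by simp
  then show "br H (A Z) = \<alpha> H *R A Z" unfolding A_def
   using jacobi[OF a_E[OF H] XE(1) rsD(1)[OF u0[OF Z]]] rsD(2)[OF X(1) H] XE rsD(1)[OF u0[OF Z]]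
   by (simp add: br_scale1 br_zero)
 qed (use XE rsD[OF Z] in \<open>simp add: A_def\<close>)
 \<comment> \<open>For \<open>A Z = 0\<close> the squared norm of \<open>br X Z\<close> would be
   minus the product of the three squared norms of \<open>X\<close>, \<open>Hv \<alpha>\<close> and
   \<open>Z\<close>.\<close>
 have A_inj: "Z = 0" if Z: "Z : rs \<alpha>" "A Z = 0" for Z
 proof (rule ccontr)
  assume ne: "Z \<noteq> 0"
  have ZE: "Z : E" using rsD[OF Z(1)] by blast
  have "ip (br X Z) (br X Z) = - ip Z (br (th X) (br X Z))" using adjoint_ad XE ZE by simp
  also have "br (th X) (br X Z) = br (br (th X) X) Z + A Z" unfolding A_def by (rule jacobi[OF XE(2,1) ZE])
  also have "br (th X) X = ip X X *R Hv \<alpha>"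
   using br_X_thX[OF rootsD(1)[OF r] X(1)] bracket_antisym[OF XE(2,1)] by simp
  also have "br (ip X X *R Hv \<alpha>) Z = (ip X X * K (Hv \<alpha>) (Hv \<alpha>)) *R Z"
   unfolding br_scale1[OF a_E[OF Hv(1)[OF rootsD(1)[OF r]]] ZE] rsD(2)[OF Z(1) Hv(1)[OF rootsD(1)[OF r]]] Hv_pos(2)[OF r] by simp
  finally have "ip (br X Z) (br X Z) = - (ip X X * K (Hv \<alpha>) (Hv \<alpha>)) * ip Z Z"
   using Z(2) ZE by (simp add: ip.B_minus ip.B_scale2)
  moreover have "ip X X * K (Hv \<alpha>) (Hv \<alpha>) * ip Z Z > 0"
   using ip.B_pos XE X(2) ZE ne Hv_pos(1)[OF r] by simp
  moreover have "ip (br X Z) (br X Z) \<ge> 0"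
   using ip.B_pos[of "br X Z"] ip.B_zero[of 0] XE ZE by (cases "br X Z = 0") auto
  ultimately show False by (simp only: mult_minus_left)
 qed
 have "A ` rs \<alpha> = rs \<alpha>"
 proof -
  let ?A = "%z. A (prj (rs \<alpha>) z)"
  have lin: "linear ?A"
   by (rule linearI) (simp_all add: A_def linear_add[OF prj_linear] linear_cmul[OF prj_linear] rsD(1)[OF prj_in[OF rs_sub]]
     br_add2 br_scale2 XE)
  have eq: "?A z = A z" if "z : rs \<alpha>" for z using prj_id[OF rs_sub that] by simp
  have "inj_on ?A (rs \<alpha>)"
  proof (rule inj_onI)
   fix z w assume zw: "z : rs \<alpha>" "w : rs \<alpha>" "?A z = ?A w"
   have "z - w : rs \<alpha>" using zw rs_sub by (simp add: subspace_diff)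
   moreover have "A (z - w) = 0" using linear_diff[OF lin, of z w] zw eq calculation by simp
   ultimately have "z - w = 0" by (rule A_inj)
   then show "z = w" by simp
  qed
  then have "dim (?A ` rs \<alpha>) = dim (rs \<alpha>)"
   using dim_image_eq[OF lin, of "rs \<alpha>"] by (simp only: span_eq_iff[THEN iffD2, OF rs_sub])
  moreover have "?A ` rs \<alpha> \<subseteq> rs \<alpha>" using A_in eq by auto
  ultimately have "?A ` rs \<alpha> = rs \<alpha>"
   using subspace_dim_equal[OF linear_subspace_image[OF lin rs_sub] rs_sub] by simp
  then show ?thesis using eq by simp
 qed
 then have "Y : A ` rs \<alpha>" using Y(1) by simp
 then obtain Z where Z: "Z : rs \<alpha>" "A Z = Y" by (elim imageE) simp
 let ?U = "br (th X) Z"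
 have U: "?U : E" "th ?U : E" "\<And>H. H : a ==> br H ?U = 0"
  using rsD(1)[OF u0[OF Z(1)]] rsD(2)[OF u0[OF Z(1)]] by (simp_all add: th_props(1))
 have thU: "br H (th ?U) = 0" if "H : a" for H
 proof -
  have "th (br H ?U) = br (- H) (th ?U)" using th_props(5)[OF a_E[OF that] U(1)] th_s[OF a_s[OF that]] by simp
  moreover have "th 0 = 0" using th_props(4)[of 0 0] by simp
  ultimately show ?thesis using U(3)[OF that] a_E[OF that] U(2) by (simp add: br_minus)
 qed
 \<comment> \<open>Splitting along theta: \<open>T\<close> centralizes \<open>aa\<close> in
   \<open>kk\<close>, while \<open>W\<close> lies in \<open>aa\<close> and acts on \<open>X\<close>
   by the scalar \<open>\<alpha> W\<close>. Orthogonality of \<open>Y\<close> to \<open>X\<close>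
   forces this scalar to be 0.\<close>
 define T where "T = (1/2) *R (?U + th ?U)"
 define W where "W = (1/2) *R (?U - th ?U)"
 have T: "T : k" unfolding T_def by (intro subspace_scale[OF k_sub] k_proj U)
 have "W : s" unfolding W_def by (intro subspace_scale[OF s_sub] s_proj U)
 then have W: "W : a"
  by (rule centralizer_s) (simp add: W_def br_scale2 br_diff a_E U thU)
 have Ta: "br T H = 0" if "H : a" for H
 proof -
  have "br H T = 0" using that by (simp add: T_def br_scale2 br_add2 a_E U thU)
  then show ?thesis using bracket_antisym[OF k_E[OF T] a_E[OF that]] by simp
 qed
 have "?U = T + W" by (simp add: T_def W_def scaleR_add_right[symmetric] scaleR_2[symmetric])
 then have "Y = br X (T + W)" using Z(2) by (simp add: A_def)
 also have "\<dots> = - br T X - \<alpha> W *R X"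
  using bracket_antisym[OF XE(1) k_E[OF T]] bracket_antisym[OF XE(1) a_E[OF W]] rsD(2)[OF X(1) W] XE T W
  by (simp add: br_add2 k_E a_E)
 finally have Ye: "Y = - br T X - \<alpha> W *R X" .
 have "ip Y X = - \<alpha> W * ip X X"
  unfolding Ye using XE T k_E ad_skew[OF T XE(1)] by (simp add: ip.B_diff ip.B_minus ip.B_scale)
 then have "\<alpha> W = 0" using Y(2) ip.B_sym[of X Y] rsD(1)[OF Y(1)] XE ip.B_pos[OF XE(1) X(2)] by simp
 then have "br (- T) X = Y" using Ye XE T k_E by (simp add: br_minus)
 moreover have "- T : k" "\<forall>H\<in>a. br (- T) H = 0" using T Ta subspace_neg[OF k_sub] k_E a_E by (auto simp: br_minus)
 ultimately show ?thesis by blast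
qed

end

section \<open>The groups K and M, and the normalizer of \<open>aa\<close>\<close>

context iwa begin

lemma Ad_zero: "Ad G g 0 = 0"
 using Ad_scale[of 0 g 0] by simp

lemma Ad_minus: "X : E ==> Ad G g (- X) = - Ad G g X"
 using Ad_scale[of X g "-1"] by simp

lemma Ad_diff: "X : E ==> Y : E ==> Ad G g (X - Y) = Ad G g X - Ad G g Y"
 using Ad_add[of X "- Y" g] by (simp add: Ad_minus)

lemma K_Ad: "X : E ==> Y : E ==> K (Ad G g X) (Ad G g Y) = K X Y"
 by (rule K_aut[where g="Ad G (iv g)"]) (auto simp: lin_on_def Ad_in Ad_add Ad_scale Ad_inv Ad_bracket)

lemma ad_bounded_linear: "Z : E ==> bounded_linear (%y. br Z (prj E y))"
proof -
 assume "Z : E"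
 then have "linear (%y. br Z (prj E y))"
  by (intro linearI) (simp_all add: linear_add[OF prj_linear] linear_cmul[OF prj_linear] br_add2 br_scale2 prj_in E_sub)
 then show ?thesis by (simp add: linear_conv_bounded_linear)
qed

text \<open>The part of the curve outside \<open>V\<close> satisfies a homogeneous linear equation
  and starts at 0.\<close>

lemma Ad_one_param_invariant:
 assumes o: "one_param G Z ga" and Z: "Z : E" and V: "subspace V" "V \<subseteq> E" "\<And>Y. Y : V ==> br Z Y : V" and Y: "Y : V"
 shows "Ad G (ga t) Y : V"
proof -
 have YE: "Y : E" using Y V by blast
 let ?c = "%t. Ad G (ga t) Y"
 let ?D = "%y. br Z (prj E y) - prj V (br Z (prj E y))"
 have bl: "bounded_linear ?D"
  by (intro bounded_linear_sub ad_bounded_linear[OF Z] bounded_linear_compose[OF prj_bounded_linear ad_bounded_linear[OF Z]])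
 obtain L where L: "\<And>y. norm (?D y) \<le> norm y * L" using bounded_linear.bounded[OF bl] by blast
 have PV: "prj V y : V" "prj V y : E" for y using prj_in[OF V(1)] V(2) by auto
 define q where "q t = ?c t - prj V (?c t)" for t
 have "q t = 0"
 proof (rule linear_ode_zero)
  fix t
  have cE: "?c t : E" using Ad_in[OF YE] .
  have "br Z (?c t) - prj V (br Z (?c t)) = ?D (q t)"
  proof -
   have "br Z (?c t) = br Z (q t) + br Z (prj V (?c t))"
    using br_add2[OF Z, of "q t" "prj V (?c t)"] cE PV by (simp add: q_def)
   moreover have "prj V (br Z (prj V (?c t))) = br Z (prj V (?c t))" by (rule prj_id[OF V(1) V(3)[OF PV(1)]])
   moreover have "prj E (q t) = q t" using cE PV by (intro prj_id E_sub) (simp add: q_def)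
   ultimately show ?thesis by (simp add: linear_add[OF prj_linear])
  qed
  moreover have "(q hvd br Z (?c t) - prj V (br Z (?c t))) (at t)"
   unfolding q_def
   by (intro has_vector_derivative_diff Ad_one_param_deriv'[OF o Z YE]
     bounded_linear.has_vector_derivative[OF prj_bounded_linear Ad_one_param_deriv'[OF o Z YE]])
  ultimately show "(q hvd ?D (q t)) (at t)" by simp
  show "norm (?D (q t)) \<le> L * norm (q t)" using L[of "q t"] by (simp add: mult.commute)
 next
  show "q 0 = 0" using one_param_zero[OF o] Ad_one[OF YE] prj_id[OF V(1) Y] by (simp add: q_def)
 qed
 then have "?c t = prj V (?c t)" by (simp add: q_def)
 then show ?thesis using PV(1)[of "?c t"] by simp
qed

lemma Ad_one_param_eqI:
 assumes o: "one_param G Z ga" and Z: "Z : E" and c: "\<And>t. c t : E" "\<And>t. (c hvd br Z (c t)) (at t)"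
 shows "Ad G (ga t) (c 0) = c t"
proof -
 obtain L where L: "\<And>y. norm (br Z (prj E y)) \<le> norm y * L" using bounded_linear.bounded[OF ad_bounded_linear[OF Z]] by blast
 have "(%t. Ad G (ga t) (c 0) - c t) t = 0"
 proof (rule linear_ode_zero[where L=L])
  fix t
  show "((%t. Ad G (ga t) (c 0) - c t) hvd br Z (Ad G (ga t) (c 0) - c t)) (at t)"
   unfolding br_diff(2)[OF Z Ad_in[OF c(1)] c(1)] by (intro has_vector_derivative_diff Ad_one_param_deriv'[OF o Z c(1)] c(2))
  have "prj E (Ad G (ga t) (c 0) - c t) = Ad G (ga t) (c 0) - c t" by (rule prj_id[OF E_sub]) (simp add: Ad_in c(1))
  then show "norm (br Z (Ad G (ga t) (c 0) - c t)) \<le> L * norm (Ad G (ga t) (c 0) - c t)"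
   using L[of "Ad G (ga t) (c 0) - c t"] by (simp add: mult.commute)
 qed (simp add: one_param_zero[OF o] Ad_one[OF c(1)])
 then show ?thesis by simp
qed

lemma KgD: assumes "g : Kgrp G" and "Y : k" shows "Ad G g Y : k" "Ad G (iv g) Y : k"
proof -
 have e: "Ad G g ` k = k" using assms(1) by (simp add: Kgrp_def)
 then show "Ad G g Y : k" using assms(2) by blast
 obtain Y' where "Y' : k" "Y = Ad G g Y'" using e assms(2) by blast
 then show "Ad G (iv g) Y : k" by (simp add: Ad_inv k_E)
qed

lemma KgI: assumes "\<And>Y. Y : k ==> Ad G g Y : k" "\<And>Y. Y : k ==> Ad G (iv g) Y : k" shows "g : Kgrp G"
proof -
 have "Y : Ad G g ` k" if "Y : k" for Y
  using assms(2)[OF that] Ad_inv(2)[OF k_E[OF that], of g] by (metis imageI)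
 then show ?thesis using assms(1) by (auto simp: Kgrp_def)
qed

lemma Kg_one: "\<e> : Kgrp G"
 by (rule KgI) (simp_all add: Ad_one k_E)

lemma Kg_mult: "g : Kgrp G ==> h : Kgrp G ==> g \<cdot> h : Kgrp G"
 by (rule KgI) (simp_all add: Ad_mult k_E KgD inv_mult_group)

lemma Kg_inv: "g : Kgrp G ==> iv g : Kgrp G"
 by (rule KgI) (simp_all add: KgD)

lemma s_perp: assumes X: "X : E" "\<And>Y. Y : k ==> K X Y = 0" shows "X : s"
proof -
 let ?T = "X + th X"
 have T: "?T : k" "?T : E" using k_proj[OF X(1)] k_E by auto
 have "K ?T ?T = K X ?T + K (th X) (th ?T)" using K_add[OF X(1) th_props(1)[OF X(1)] T(2)] th_k[OF T(1)] by simp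
 then have "ip ?T ?T = 0" using X(2)[OF T(1)] K_th[OF X(1) T(2)] th_k[OF T(1)] by (simp add: ip_def)
 then have "?T = 0" using ip.B_pos[OF T(2)] by fastforce
 then show ?thesis using X(1) by (simp add: ss_def eq_neg_iff_add_eq_0 add.commute)
qed

text \<open>\<open>ss\<close> is the Killing-orthogonal complement of \<open>kk\<close>, which K
  preserves.\<close>

lemma Ad_s: assumes g: "g : Kgrp G" and X: "X : s" shows "Ad G g X : s"
proof (rule s_perp)
 show "Ad G g X : E" by (rule Ad_in[OF s_E[OF X]])
 fix Y assume Y: "Y : k"
 have "K (Ad G g X) (Ad G g (Ad G (iv g) Y)) = K X (Ad G (iv g) Y)" by (intro K_Ad s_E[OF X] Ad_in k_E[OF Y])
 then have "K (Ad G g X) Y = K (Ad G (iv g) Y) X" using Ad_inv(2)[OF k_E[OF Y]] K_sym X Y by (simp add: s_E k_E Ad_in)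
 then show "K (Ad G g X) Y = 0" using K_ks[OF KgD(2)[OF g Y] X] by simp
qed

text \<open>K preserves both eigenspaces of theta.\<close>

lemma Ad_th: assumes g: "g : Kgrp G" and X: "X : E" shows "Ad G g (th X) = th (Ad G g X)"
proof -
 have t: "X - th X : s" "X + th X : k" "th X : E" using s_proj[OF X] k_proj[OF X] th_props X by auto
 have "th (Ad G g (X - th X)) = - Ad G g (X - th X)" by (rule th_s[OF Ad_s[OF g t(1)]])
 then have 1: "th (Ad G g X) - th (Ad G g (th X)) = - (Ad G g X - Ad G g (th X))"
  using X t by (simp add: Ad_diff th_diff Ad_in)
 have "th (Ad G g (X + th X)) = Ad G g (X + th X)" by (rule th_k[OF KgD(1)[OF g t(2)]])
 then have 2: "th (Ad G g X) + th (Ad G g (th X)) = Ad G g X + Ad G g (th X)"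
  using X t by (simp add: Ad_add th_props Ad_in)
 have "2 *R th (Ad G g X) = (th (Ad G g X) - th (Ad G g (th X))) + (th (Ad G g X) + th (Ad G g (th X)))" by (simp add: scaleR_2)
 also have "\<dots> = 2 *R Ad G g (th X)" unfolding 1 2 by (simp add: scaleR_2)
 finally show ?thesis by simp
qed

lemma ip_Ad: "g : Kgrp G ==> X : E ==> Y : E ==> ip (Ad G g X) (Ad G g Y) = ip X Y"
 by (simp add: ip_def Ad_th[symmetric] K_Ad th_props)

lemma one_param_K: assumes o: "one_param G Z ga" and Z: "Z : k" shows "ga t : Kgrp G"
proof (rule KgI)
 fix Y assume "Y : k"
 then have "Ad G (ga t) Y : k" for t
  by (intro Ad_one_param_invariant[OF o k_E[OF Z] k_sub]) (use k_E br_kk[OF Z] in auto)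
 then show "Ad G (ga t) Y : k" "Ad G (iv (ga t)) Y : k" using one_param_minus[OF o, of t] by metis+
qed

lemma one_param_eq_D: assumes o: "one_param G X ga" "one_param G Y ga" and X: "X : E" "Y : E" shows "X = Y"
proof (rule tangent_ext[OF X])
 fix f assume f: "f : CG"
 show "tangent G X f = tangent G Y f"
  using DERIV_unique[OF one_param_has_deriv[OF o(1) f] one_param_has_deriv[OF o(2) f]] .
qed

lemma commutes_one_param_iff:
 assumes o: "one_param G X ga" and X: "X : E"
 shows "(\<forall>t. g \<cdot> ga t = ga t \<cdot> g) \<longleftrightarrow> Ad G g X = X"
proof
 assume c: "\<forall>t. g \<cdot> ga t = ga t \<cdot> g"
 have "g \<cdot> ga t \<cdot> iv g = ga t" for t by (simp only: c[rule_format] m_assoc carrier_UNIV UNIV_I r_inv r_one inv_closed)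
 then have "one_param G (Ad G g X) ga" using one_param_conj[OF o X, of g] by simp
 then show "Ad G g X = X" by (rule one_param_eq_D[OF _ o Ad_in[OF X] X])
next
 assume "Ad G g X = X"
 then have e: "g \<cdot> ga t \<cdot> iv g = ga t" for t using one_param_unique[OF one_param_conj[OF o X, of g, unfolded \<open>Ad G g X = X\<close>] o X] by simp
 have "g \<cdot> ga t = g \<cdot> ga t \<cdot> iv g \<cdot> g" for t by (simp add: m_assoc)
 then show "\<forall>t. g \<cdot> ga t = ga t \<cdot> g" using e by simp
qed

text \<open>Passes from the group A to its Lie algebra: A is generated by values of one-parameter
  groups, and a group element commutes with such a group exactly if \<open>Ad\<close> fixes its
  generator.\<close>

lemma Mgrp_iff: "g : Mgrp G \<longleftrightarrow> g : Kgrp G \<and> (\<forall>H\<in>a. Ad G g H = H)"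
proof (intro iffI conjI ballI)
 fix H assume g: "g : Mgrp G" and H: "H : a"
 obtain ga where o: "one_param G H ga" using one_param_exists[OF a_E[OF H]] by blast
 have "g \<cdot> ga t = ga t \<cdot> g" for t
 proof -
  have "t *R H : a" using subspace_scale[OF a_sub H] .
  then have "lie_exp G (t *R H) : Agrp G" unfolding Agrp_def by (intro generate.incl imageI)
  then show ?thesis using g lie_exp_scale[OF o a_E[OF H], of t] by (simp add: Mgrp_def)
 qed
 then show "Ad G g H = H" using commutes_one_param_iff[OF o a_E[OF H]] by blast
next
 assume g: "g : Kgrp G \<and> (\<forall>H\<in>a. Ad G g H = H)"
 have e: "g \<cdot> lie_exp G H = lie_exp G H \<cdot> g" if H: "H : a" for H
 proof -
  obtain ga where o: "one_param G H ga" using one_param_exists[OF a_E[OF H]] by blast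
  show ?thesis using commutes_one_param_iff[OF o a_E[OF H], of g] g H lie_exp_eq[OF o a_E[OF H]] by simp
 qed
 have "g \<cdot> x = x \<cdot> g" if "x : Agrp G" for x
  using that unfolding Agrp_def
 proof (induction rule: generate.induct)
  case (inv h)
  then have "g \<cdot> h = h \<cdot> g" using e by blast
  then have "iv h \<cdot> (g \<cdot> h \<cdot> iv h) = iv h \<cdot> (h \<cdot> g \<cdot> iv h)" by simp
  moreover have "g \<cdot> h \<cdot> iv h = g" by (simp add: m_assoc)
  moreover have "iv h \<cdot> (h \<cdot> g \<cdot> iv h) = g \<cdot> iv h" by (simp add: m_assoc[symmetric])
  ultimately show ?case by simp
 next
  case (eng h1 h2)
  have "g \<cdot> (h1 \<cdot> h2) = (g \<cdot> h1) \<cdot> h2" by (simp add: m_assoc)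
  also have "\<dots> = h1 \<cdot> (g \<cdot> h2)" by (simp add: eng m_assoc)
  also have "\<dots> = h1 \<cdot> h2 \<cdot> g" by (simp add: eng m_assoc)
  finally show ?case .
 qed (use e in auto)
 then show "g : Mgrp G" using g by (simp add: Mgrp_def)
qed (auto simp: Mgrp_def)

definition NA where "NA = {g : Kgrp G. Ad G g ` a = a}"

lemma NAD: assumes "g : NA" shows "g : Kgrp G" "H : a ==> Ad G g H : a" "H : a ==> Ad G (iv g) H : a"
proof -
 have e: "Ad G g ` a = a" and "g : Kgrp G" using assms by (auto simp: NA_def)
 then show "g : Kgrp G" "H : a ==> Ad G g H : a" by auto
 assume "H : a"
 then obtain H' where "H' : a" "H = Ad G g H'" using e by blast
 then show "Ad G (iv g) H : a" by (simp add: Ad_inv a_E)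
qed

lemma NAI: assumes "g : Kgrp G" "\<And>H. H : a ==> Ad G g H : a" "\<And>H. H : a ==> Ad G (iv g) H : a" shows "g : NA"
proof -
 have "H : Ad G g ` a" if "H : a" for H
  using assms(3)[OF that] Ad_inv(2)[OF a_E[OF that], of g] by (metis imageI)
 then show ?thesis using assms(1,2) by (auto simp: NA_def)
qed

lemma NA_inv: "g : NA ==> iv g : NA"
 by (rule NAI) (simp_all add: Kg_inv NAD)

lemma M_NA: "g : Mgrp G ==> g : NA"
proof (rule NAI)
 fix H assume "g : Mgrp G" "H : a"
 then show "Ad G g H : a" "Ad G (iv g) H : a" using Ad_inv(1)[of H g] by (auto simp: Mgrp_iff a_E)
qed (simp add: Mgrp_iff)

lemma NA_M: assumes g: "g : NA" and m: "x : Mgrp G" shows "iv g \<cdot> x \<cdot> g : Mgrp G"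
 unfolding Mgrp_iff
proof (intro conjI ballI)
 show "iv g \<cdot> x \<cdot> g : Kgrp G" using NAD(1)[OF g] m by (intro Kg_mult Kg_inv) (auto simp: Mgrp_iff)
 fix H assume H: "H : a"
 have "Ad G x (Ad G g H) = Ad G g H" using m NAD(2)[OF g H] by (simp add: Mgrp_iff)
 then show "Ad G (iv g \<cdot> x \<cdot> g) H = H" using H by (simp add: Ad_mult Ad_in a_E Ad_inv)
qed

lemma weyl_NA: assumes "w : carrier (weyl G)" "g : w" shows "g : NA"
proof -
 obtain h where h: "h : NA" "w = Mgrp G #>\<^bsub>G\<lparr>carrier := NA\<rparr>\<^esub> h"
  using assms(1) by (auto simp: weyl_def FactGroup_def RCOSETS_def NA_def)
 then obtain x where x: "x : Mgrp G" "g = x \<cdot> h" using assms(2) by (auto simp: r_coset_def)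
 have "iv g = iv h \<cdot> iv x" using x by (simp add: inv_mult_group)
 moreover note M_NA[OF x(1)]
 ultimately show ?thesis using x h
  by (intro NAI) (simp_all add: Kg_mult NAD Ad_mult a_E)
qed

lemma rs_Ad: assumes g: "g : NA" and X: "X : rs \<alpha>" shows "Ad G g X : rs (ext0 a (%H. \<alpha> (Ad G (iv g) H)))"
proof (rule rsI)
 fix H assume H: "H : a"
 have "br H (Ad G g X) = Ad G g (br (Ad G (iv g) H) X)"
  using H rsD(1)[OF X] by (simp add: Ad_bracket Ad_in a_E Ad_inv)
 also have "\<dots> = \<alpha> (Ad G (iv g) H) *R Ad G g X"
  using rsD[OF X] NAD(3)[OF g H] by (simp add: Ad_scale)
 finally show "br H (Ad G g X) = ext0 a (%H. \<alpha> (Ad G (iv g) H)) H *R Ad G g X" using H by (simp add: ext0_def)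
qed (rule Ad_in[OF rsD(1)[OF X]])

end

section \<open>Positive roots and reflections\<close>

context iwa begin

lemma H0_ex: "\<exists>H. H : a \<and> (\<forall>\<alpha>\<in>R. \<alpha> H \<noteq> 0) \<and> nn G = span (\<Union>\<alpha>\<in>{\<alpha> : R. \<alpha> H > 0}. rs \<alpha>)"
 using iwasawa unfolding iwasawa_def by blast

definition H0 where "H0 = (SOME H. H : a \<and> (\<forall>\<alpha>\<in>R. \<alpha> H \<noteq> 0) \<and> nn G = span (\<Union>\<alpha>\<in>{\<alpha> : R. \<alpha> H > 0}. rs \<alpha>))"

lemma H0: "H0 : a" "\<alpha> : R ==> \<alpha> H0 \<noteq> 0" "nn G = span (\<Union>\<alpha>\<in>{\<alpha> : R. \<alpha> H0 > 0}. rs \<alpha>)"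
 using someI_ex[OF H0_ex] unfolding H0_def by blast+

definition P where "P = {\<alpha> : R. \<alpha> H0 > 0}"

lemma PD: "\<alpha> : P ==> \<alpha> : R" "\<alpha> : P ==> \<alpha> H0 > 0"
 by (auto simp: P_def)

lemma ip_perp_sub: "X : E ==> subspace {Y : E. ip Y X = 0}"
 by (rule subspaceI) (simp_all add: ip.B_add ip.B_scale ip.B_zero)

text \<open>\<open>pos_roots\<close> is defined through \<open>nn\<close>. The space of a root that
  is negative on \<open>H0\<close> is orthogonal to \<open>nn\<close>, so it cannot be contained in
  it.\<close>

lemma pos_roots_eq: "pos_roots G = P"
proof
 show "P \<subseteq> pos_roots G"
  unfolding pos_roots_def H0(3) P_def by (auto intro!: span_base)
 show "pos_roots G \<subseteq> P"
 proof
  fix \<alpha> assume "\<alpha> : pos_roots G"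
  then have r: "\<alpha> : R" and sub: "rs \<alpha> \<subseteq> nn G" by (auto simp: pos_roots_def)
  obtain X where X: "X : rs \<alpha>" "X \<noteq> 0" using rootsD(3)[OF r] subspace_0[OF rs_sub] by blast
  show "\<alpha> : P"
  proof (rule ccontr)
   assume n: "\<alpha> \<notin> P"
   have "nn G \<subseteq> {Y : E. ip Y X = 0}"
    unfolding H0(3)
   proof (rule span_minimal[OF _ ip_perp_sub[OF rsD(1)[OF X(1)]]], rule subsetI)
    fix Y assume "Y : (\<Union>\<alpha>\<in>{\<alpha> : R. \<alpha> H0 > 0}. rs \<alpha>)"
    then obtain \<beta> where b: "\<beta> : R" "\<beta> H0 > 0" "Y : rs \<beta>" by auto
    then have "\<beta> H0 \<noteq> \<alpha> H0" using n r by (auto simp: P_def)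
    then show "Y : {Y : E. ip Y X = 0}" using rs_orth[OF b(3) X(1) H0(1)] rsD(1)[OF b(3)] by simp
   qed
   then have "ip X X = 0" using sub X(1) by blast
   then show False using ip.B_pos[OF rsD(1)[OF X(1)] X(2)] by simp
  qed
 qed
qed

section \<open>The rotation attached to a root vector\<close>

definition Zv where "Zv X = X + th X"
definition Wv where "Wv X = X - th X"

lemma Zv_k: "X : E ==> Zv X : k" and Wv_s: "X : E ==> Wv X : s"
 by (auto simp: Zv_def Wv_def k_proj s_proj)

lemma ZW:
 assumes r: "\<alpha> : dual_aa G" and X: "X : rs \<alpha>"
 shows "H : a ==> br (Zv X) H = - \<alpha> H *R Wv X" "br (Zv X) (Wv X) = (2 * ip X X) *R Hv \<alpha>"
  "H : a ==> br H (Wv X) = \<alpha> H *R Zv X"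
proof -
 have XE: "X : E" "th X : E" using rsD[OF X] th_props by auto
 have h: "br H X = \<alpha> H *R X" "br H (th X) = - \<alpha> H *R th X" if "H : a" for H
  using rsD(2)[OF X that] rsD(2)[OF th_rs[OF X] that] by (auto simp: neg_def)
 show "br (Zv X) H = - \<alpha> H *R Wv X" if "H : a"
  using XE that bracket_antisym[of X H] bracket_antisym[of "th X" H] h[OF that]
  by (simp add: Zv_def Wv_def br_add1 a_E algebra_simps)
 have "br (th X) X = - br X (th X)" using bracket_antisym[OF XE(2,1)] .
 then show "br (Zv X) (Wv X) = (2 * ip X X) *R Hv \<alpha>"
  using XE br_X_thX[OF r X] by (simp add: Zv_def Wv_def br_add1 br_diff bracket_self scaleR_add_left[symmetric])
 show "br H (Wv X) = \<alpha> H *R Zv X" if "H : a"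
  using XE that h[OF that] by (simp add: Zv_def Wv_def br_diff a_E algebra_simps)
qed

text \<open>The normalisation imposed on \<open>rvec\<close>, for an arbitrary vector of the root
  space. It makes the one-parameter group of \<open>Zv X\<close> rotate the plane of
  \<open>Hv \<alpha>\<close> and \<open>Wv X\<close> with angular speed 2.\<close>

definition unit_root where "unit_root \<alpha> X \<longleftrightarrow> \<alpha> : R \<and> X : rs \<alpha> \<and> ip X X = 2 / K (Hv \<alpha>) (Hv \<alpha>)"

lemma unit_rootD: assumes "unit_root \<alpha> X" shows "\<alpha> : R" "\<alpha> : dual_aa G" "X : rs \<alpha>" "X : E" "K (Hv \<alpha>) (Hv \<alpha>) > 0"
  "ip X X = 2 / K (Hv \<alpha>) (Hv \<alpha>)" "Hv \<alpha> : a" "Zv X : E" "Wv X : E" "X \<noteq> 0"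
proof -
 show r: "\<alpha> : R" and X: "X : rs \<alpha>" and n: "ip X X = 2 / K (Hv \<alpha>) (Hv \<alpha>)" using assms by (simp_all add: unit_root_def)
 show p: "K (Hv \<alpha>) (Hv \<alpha>) > 0" by (rule Hv_pos(1)[OF r])
 show d: "\<alpha> : dual_aa G" by (rule rootsD(1)[OF r])
 show XE: "X : E" by (rule rsD(1)[OF X])
 show "Hv \<alpha> : a" by (rule Hv(1)[OF d])
 show "Zv X : E" "Wv X : E" by (rule k_E[OF Zv_k[OF XE]], rule s_E[OF Wv_s[OF XE]])
 show "X \<noteq> 0" using n p ip.B_zero[of 0] by auto
qed

text \<open>The explicit solution of the equation for \<open>Ad\<close> with initial value
  \<open>H\<close>: the component along \<open>Hv \<alpha>\<close> is rotated and the kernel of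
  \<alpha> stays fixed. At pi/2 the sine vanishes and the reflection remains.\<close>

definition rot where "rot \<alpha> X H t = H + (\<alpha> H / K (Hv \<alpha>) (Hv \<alpha>)) *R ((cos (2 * t) - 1) *R Hv \<alpha> - (K (Hv \<alpha>) (Hv \<alpha>) / 2 * sin (2 * t)) *R Wv X)"

lemma rot_deriv:
 assumes u: "unit_root \<alpha> X" and H: "H : a"
 shows "(rot \<alpha> X H hvd br (Zv X) (rot \<alpha> X H t)) (at t)"
proof -
 note D = unit_rootD[OF u]
 let ?n = "K (Hv \<alpha>) (Hv \<alpha>)"
 have "br (Zv X) (rot \<alpha> X H t) = (\<alpha> H / ?n) *R ((- 2 * sin (2 * t)) *R Hv \<alpha> - (?n * cos (2 * t)) *R Wv X)"
 proof -
  define p u q where "p = \<alpha> H / ?n" and "u = cos (2 * t) - 1" and "q = ?n / 2 * sin (2 * t)"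
  have E: "H : E" "Hv \<alpha> : E" using H D(7) a_E by auto
  have pn: "\<alpha> H = p * ?n" using D(5) by (simp add: p_def)
  have "br (Zv X) (rot \<alpha> X H t) = br (Zv X) H + p *R (u *R br (Zv X) (Hv \<alpha>) - q *R br (Zv X) (Wv X))"
   unfolding rot_def p_def[symmetric] u_def[symmetric] q_def[symmetric]
   by (simp only: br_add2 br_scale2 br_diff E D(8,9) E_simps)
  also have "\<dots> = (- \<alpha> H) *R Wv X + p *R (u *R ((- ?n) *R Wv X) - q *R ((2 * (2 / ?n)) *R Hv \<alpha>))"
   by (simp only: ZW(1)[OF D(2,3) H] ZW(1)[OF D(2,3) D(7)] ZW(2)[OF D(2,3)] D(6) Hv_pos(2)[OF D(1)])
  also have "\<dots> = (p * - (q * (4 / ?n))) *R Hv \<alpha> - (p * (?n + u * ?n)) *R Wv X"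
   unfolding pn by (simp add: algebra_simps)
  also have "q * (4 / ?n) = 2 * sin (2 * t)" using D(5) by (simp add: q_def)
  also have "?n + u * ?n = ?n * cos (2 * t)" by (simp add: u_def algebra_simps)
  finally show ?thesis by (simp add: p_def scaleR_right_diff_distrib)
 qed
 moreover have "(rot \<alpha> X H hvd (\<alpha> H / ?n) *R ((- 2 * sin (2 * t)) *R Hv \<alpha> - (?n * cos (2 * t)) *R Wv X)) (at t)"
  unfolding rot_def by (auto intro!: derivative_eq_intros simp: algebra_simps)
 ultimately show ?thesis by simp
qed

lemma Ad_rot:
 assumes u: "unit_root \<alpha> X" and H: "H : a" and o: "one_param G (Zv X) ga"
 shows "Ad G (ga t) H = rot \<alpha> X H t"
proof -
 note D = unit_rootD[OF u]
 have "Ad G (ga t) (rot \<alpha> X H 0) = rot \<alpha> X H t"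
  by (rule Ad_one_param_eqI[OF o D(8) _ rot_deriv[OF u H]]) (use D H in \<open>simp add: rot_def a_E\<close>)
 then show ?thesis by (simp add: rot_def)
qed

lemma rot_pi: "rot \<alpha> X H (pi/2) = root_refl G \<alpha> H" "rot \<alpha> X H (-(pi/2)) = root_refl G \<alpha> H"
 by (simp_all add: rot_def root_refl_def)

lemma root_refl_a: "\<alpha> : R ==> H : a ==> root_refl G \<alpha> H : a"
 by (simp add: root_refl_def Hv(1)[OF rootsD(1)])

lemma root_refl_neg: "\<alpha> : R ==> H : a ==> \<alpha> (root_refl G \<alpha> H) = - \<alpha> H"
proof -
 assume r: "\<alpha> : R" and H: "H : a"
 note d = rootsD(1)[OF r]
 have h: "Hv \<alpha> : a" by (rule Hv(1)[OF d])
 have "\<alpha> (root_refl G \<alpha> H) = K (Hv \<alpha>) (H - (2 * \<alpha> H / K (Hv \<alpha>) (Hv \<alpha>)) *R Hv \<alpha>)"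
  using Hv(2)[OF d root_refl_a[OF r H]] by (simp add: root_refl_def)
 also have "\<dots> = K (Hv \<alpha>) H - 2 * \<alpha> H" using Hv_pos(1)[OF r] h H by (simp add: fa.B_diff fa.B_scale2)
 finally show ?thesis using Hv(2)[OF d H] by simp
qed

lemma refl_NA:
 assumes u: "unit_root \<alpha> X" and o: "one_param G (Zv X) ga"
 shows "ga (pi/2) : NA" "H : a ==> Ad G (ga (pi/2)) H = root_refl G \<alpha> H"
  "H : a ==> Ad G (iv (ga (pi/2))) H = root_refl G \<alpha> H"
proof -
 note D = unit_rootD[OF u]
 show 1: "Ad G (ga (pi/2)) H = root_refl G \<alpha> H" if "H : a" for H using Ad_rot[OF u that o] rot_pi by simp
 show 2: "Ad G (iv (ga (pi/2))) H = root_refl G \<alpha> H" if "H : a" for H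
  using Ad_rot[OF u that o, of "- (pi/2)"] one_param_minus[OF o, of "pi/2"] rot_pi(2)[of \<alpha> X H] by simp
 show "ga (pi/2) : NA" by (rule NAI) (simp_all add: one_param_K[OF o Zv_k[OF D(4)]] 1 2 root_refl_a D(1))
qed

lemma unit_root_ex: assumes r: "\<alpha> : R" shows "\<exists>X. unit_root \<alpha> X"
proof -
 obtain X where X: "X : rs \<alpha>" "X \<noteq> 0" using rootsD(3)[OF r] subspace_0[OF rs_sub] by blast
 have XE: "X : E" by (rule rsD(1)[OF X(1)])
 let ?c = "sqrt (2 / K (Hv \<alpha>) (Hv \<alpha>) / ip X X)"
 have "?c * ?c = 2 / K (Hv \<alpha>) (Hv \<alpha>) / ip X X" using Hv_pos(1)[OF r] ip.B_pos[OF XE X(2)] by simp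
 moreover have "ip (?c *R X) (?c *R X) = (?c * ?c) * ip X X" using XE by (simp only: ip.B_scale ip.B_scale2 E_simps mult.assoc)
 ultimately have "unit_root \<alpha> (?c *R X)"
  using r X ip.B_pos[OF XE X(2)] subspace_scale[OF rs_sub X(1)] unfolding unit_root_def by simp
 then show ?thesis by blast
qed

section \<open>Multiples of roots and the multiplicity function\<close>

definition hf :: "real => ('v => real) => 'v => real" where "hf c \<alpha> = (%H. c * \<alpha> H)"

lemma hf_hf [simp]: "hf c (hf d \<alpha>) = hf (c * d) \<alpha>" "hf 1 \<alpha> = \<alpha>"
 by (simp_all add: hf_def mult.assoc)

lemma hf_dual: assumes "\<alpha> : dual_aa G" shows "hf c \<alpha> : dual_aa G"
proof -
 have "ext0 a (hf c \<alpha>) : dual_aa G" using assms by (intro dual_aaI) (auto simp: hf_def dual_aa algebra_simps)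
 moreover have "ext0 a (hf c \<alpha>) = hf c \<alpha>" using assms by (auto simp: ext0_def hf_def dual_aa(3))
 ultimately show ?thesis by simp
qed

lemma br_rs: assumes X: "X : rs \<alpha>" and Y: "Y : rs \<beta>" and e: "\<And>H. H : a ==> de H = \<alpha> H + \<beta> H" shows "br X Y : rs de"
proof (rule rsI)
 fix H assume H: "H : a"
 show "br H (br X Y) = de H *R br X Y"
  using jacobi[OF a_E[OF H] rsD(1)[OF X] rsD(1)[OF Y]] rsD(2)[OF X H] rsD(2)[OF Y H] rsD(1)[OF X] rsD(1)[OF Y]
  by (simp add: e H br_scale1 br_scale2 scaleR_add_left)
qed (simp add: rsD(1)[OF X] rsD(1)[OF Y])

text \<open>The reflection of \<open>aa\<close> maps the string of \<open>c \<alpha>\<close> through itself and sends \<open>c \<alpha>\<close> to \<open>- c \<alpha>\<close>.\<close>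

lemma root_integrality:
 assumes r: "\<alpha> : R" and ne: "rs (hf c \<alpha>) \<noteq> {0}"
 shows "2 * c : \<int>"
proof (rule ccontr)
 assume c: "2 * c \<notin> \<int>"
 obtain X where u: "unit_root \<alpha> X" using unit_root_ex[OF r] by blast
 note D = unit_rootD[OF u]
 obtain ga where o: "one_param G (Zv X) ga" using one_param_exists[OF D(8)] by blast
 obtain Y where Y: "Y : rs (hf c \<alpha>)" "Y \<noteq> 0" using ne subspace_0[OF rs_sub] by blast
 have YE: "Y : E" by (rule rsD(1)[OF Y(1)])
 let ?g = "ga (pi/2)"
 \<comment> \<open>The string of all integral shifts is stable under the bracket with
   \<open>Zv X\<close>, hence its span is stable under \<open>Ad\<close> of the one-parameter
   group.\<close>
 let ?U = "\<Union>j::int. rs (hf (c + of_int j) \<alpha>)"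
 let ?V = "span ?U"
 have VE: "?V \<subseteq> E" by (rule span_minimal[OF _ E_sub]) (use rsD in blast)
 have inv: "br (Zv X) y : ?V" if "y : ?V" for y
 proof -
  have "subspace {y : E. br (Zv X) y : ?V}"
   using D(8) by (auto simp: subspace_def br_zero br_add2 br_scale2 span_zero span_add span_scale)
  moreover have "?U \<subseteq> {y : E. br (Zv X) y : ?V}"
  proof
   fix y assume "y : ?U"
   then obtain j where j: "y : rs (hf (c + of_int j) \<alpha>)" by blast
   have "br X y : rs (hf (c + of_int (j + 1)) \<alpha>)" by (rule br_rs[OF D(3) j]) (simp add: hf_def algebra_simps)
   moreover have "br (th X) y : rs (hf (c + of_int (j - 1)) \<alpha>)"
    by (rule br_rs[OF th_rs[OF D(3)] j]) (simp add: hf_def neg_def algebra_simps)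
   ultimately have "br X y + br (th X) y : ?V" by (intro span_add span_base) blast+
   then show "y : {y : E. br (Zv X) y : ?V}" using rsD(1)[OF j] D(4) by (simp add: Zv_def br_add1 th_props)
  qed
  ultimately show ?thesis using span_minimal that by blast
 qed
 have "Y : ?U" using Y(1) by (intro UN_I[of 0]) auto
 then have in_V: "Ad G ?g Y : ?V"
  by (intro Ad_one_param_invariant[OF o D(8) subspace_span VE inv]) (simp_all add: span_base)
 have gE: "Ad G ?g Y : E" by (rule Ad_in[OF YE])
 have gY: "Ad G ?g Y : rs (hf (- c) \<alpha>)"
 proof (rule rsI[OF gE])
  fix H assume H: "H : a"
  show "br H (Ad G ?g Y) = hf (- c) \<alpha> H *R Ad G ?g Y"
   using rsD(2)[OF rs_Ad[OF refl_NA(1)[OF u o] Y(1)] H] refl_NA(3)[OF u o H] root_refl_neg[OF r H] H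
   by (simp add: ext0_def hf_def)
 qed
 \<comment> \<open>If 2c is not an integer, then -c is not an integral shift of c, so the image of
   \<open>Y\<close> is orthogonal to the very space in which it lies.\<close>
 have "?V \<subseteq> {y : E. ip y (Ad G ?g Y) = 0}"
 proof (rule span_minimal[OF _ ip_perp_sub[OF gE]], rule subsetI)
  fix y assume "y : ?U"
  then obtain j where j: "y : rs (hf (c + of_int j) \<alpha>)" by blast
  have "c + of_int j \<noteq> - c"
  proof
   assume "c + of_int j = - c"
   then have "2 * c = of_int (- j)" by simp
   then show False using c by (metis Ints_of_int)
  qed
  then have "hf (c + of_int j) \<alpha> (Hv \<alpha>) \<noteq> hf (- c) \<alpha> (Hv \<alpha>)"
   using Hv_pos(1)[OF r] unfolding hf_def Hv_pos(2)[OF r] by (subst mult_right_cancel) auto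
  then show "y : {y : E. ip y (Ad G ?g Y) = 0}" using rs_orth[OF j gY D(7)] rsD(1)[OF j] by simp
 qed
 then have "ip (Ad G ?g Y) (Ad G ?g Y) = 0" using in_V by blast
 then have "Ad G ?g Y = 0" using ip.B_pos[OF gE] by fastforce
 then show False using Ad_inv(1)[OF YE, of ?g] Ad_zero Y(2) by simp
qed

lemma hf_root_iff: "\<alpha> : dual_aa G ==> c \<noteq> 0 ==> \<alpha> \<noteq> (%_. 0) ==> hf c \<alpha> : R \<longleftrightarrow> rs (hf c \<alpha>) \<noteq> {0}"
 using hf_dual[of \<alpha> c] by (auto simp: roots_def hf_def fun_eq_iff)

text \<open>The indivisible positive roots; their doubles form \<open>R1_pos\<close>.\<close>

definition Pm where "Pm = {\<alpha> : P. hf (1/2) \<alpha> \<notin> R}"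

lemma hf_inj: "hf 2 \<alpha> = hf 2 \<beta> ==> \<alpha> = \<beta>"
 by (auto simp: hf_def fun_eq_iff)

lemma RR_iff: "hf 2 \<alpha> : RR G \<longleftrightarrow> \<alpha> : R"
 using hf_inj[of \<alpha>] unfolding RR_def hf_def[symmetric] by blast

lemma R1_pos_eq: "R1_pos G = hf 2 ` Pm"
proof -
 have 1: "hf 2 \<alpha> : hf 2 ` RR G \<longleftrightarrow> hf (1/2) \<alpha> : R" for \<alpha>
 proof -
  have "hf 2 \<alpha> : hf 2 ` RR G \<longleftrightarrow> \<alpha> : RR G" using hf_inj[of \<alpha>] by blast
  also have "\<dots> \<longleftrightarrow> hf 2 (hf (1/2) \<alpha>) : RR G" by simp
  finally show ?thesis unfolding RR_iff .
 qed
 have "R1_pos G = (RR G - hf 2 ` RR G) \<inter> hf 2 ` P"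
  by (simp add: R1_pos_def R1_def pos_roots_eq hf_def[abs_def])
 then show ?thesis using 1 RR_iff PD by (auto simp: Pm_def)
qed

lemma PmD: "\<alpha> : Pm ==> \<alpha> : P" "\<alpha> : Pm ==> \<alpha> : R" "\<alpha> : Pm ==> \<alpha> : dual_aa G" "\<alpha> : Pm ==> \<alpha> \<noteq> (%_. 0)"
 using PD rootsD by (auto simp: Pm_def)

lemma P_finite: "finite P"
 using roots_finite by (simp add: P_def)

text \<open>If the double is not a root, its root space is zero, so both cases of \<open>m0\<close>
  have the same shape.\<close>

lemma m0_eq: assumes a: "\<alpha> : Pm" shows "2 * m0 G (hf 2 \<alpha>) = real (dim (rs \<alpha>)) + real (dim (rs (hf 2 \<alpha>)))"
proof -
 note [simp] = PmD[OF a]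
 have 1: "(%H. 2 * hf 2 \<alpha> H) : RR G \<longleftrightarrow> hf 2 \<alpha> : R" using RR_iff[of "hf 2 \<alpha>"] by (simp add: hf_def)
 have 2: "(%H. hf 2 \<alpha> H / 2) = \<alpha>" by (simp add: hf_def)
 show ?thesis
 proof (cases "hf 2 \<alpha> : R")
  case False
  then have "rs (hf 2 \<alpha>) = {0}" using hf_root_iff[of \<alpha> 2] by simp
  then show ?thesis using False by (simp add: m0_def 1 2)
 qed (simp add: m0_def 1 2)
qed

lemma P_decomp: "P - Pm = hf 2 ` {\<alpha> : Pm. hf 2 \<alpha> : R}"
proof
 show "P - Pm \<subseteq> hf 2 ` {\<alpha> : Pm. hf 2 \<alpha> : R}"
 proof
  fix \<alpha> assume "\<alpha> : P - Pm"
  then have a: "\<alpha> : R" "\<alpha> H0 > 0" "hf (1/2) \<alpha> : R" by (auto simp: P_def Pm_def)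
  \<comment> \<open>Integrality excludes a quarter of a root, so half of a divisible root is
    indivisible.\<close>
  have "hf (1/4) \<alpha> \<notin> R"
  proof
   assume "hf (1/4) \<alpha> : R"
   then have "2 * (1/4) : (\<int> :: real set)" using root_integrality[OF a(1), of "1/4"] rootsD(3) by blast
   then obtain n :: int where "2 * (1/4) = (of_int n :: real)" by (auto elim: Ints_cases)
   then have "of_int (2 * n) = (of_int 1 :: real)" by simp
   then have "2 * n = 1" by (simp only: of_int_eq_iff)
   then show False by presburger
  qed
  then have "hf (1/2) \<alpha> : Pm" using a by (simp add: Pm_def P_def) (simp add: hf_def)
  then show "\<alpha> : hf 2 ` {\<alpha> : Pm. hf 2 \<alpha> : R}" using a by (intro image_eqI[of _ _ "hf (1/2) \<alpha>"]) auto
 qed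
qed (auto simp: Pm_def P_def hf_def)

text \<open>\<open>T\<close> does not distinguish a root from its double, so a divisible root may be
  merged with its half; \<open>2 * m0\<close> is the sum of the two multiplicities.\<close>

lemma dunkl_sum:
 fixes T :: "('v => real) => complex"
 assumes T: "\<And>\<alpha>. \<alpha> : P ==> T (hf 2 \<alpha>) = T \<alpha>"
 shows "(\<Sum>\<beta>\<in>R1_pos G. of_real (2 * m0 G \<beta>) * T \<beta>) = (\<Sum>\<alpha>\<in>P. of_real (dim (rs \<alpha>)) * T \<alpha>)"
proof -
 let ?Q = "{\<alpha> : Pm. hf 2 \<alpha> : R}" and ?d = "%\<alpha>. of_real (dim (rs \<alpha>)) :: complex"
 have fin: "finite Pm" using P_finite by (simp add: Pm_def)
 have inj: "inj_on (hf 2) X" for X using hf_inj by (blast intro: inj_onI)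
 have "(\<Sum>\<beta>\<in>R1_pos G. of_real (2 * m0 G \<beta>) * T \<beta>) = (\<Sum>\<alpha>\<in>Pm. of_real (2 * m0 G (hf 2 \<alpha>)) * T (hf 2 \<alpha>))"
  unfolding R1_pos_eq by (simp add: sum.reindex[OF inj])
 also have "\<dots> = (\<Sum>\<alpha>\<in>Pm. ?d \<alpha> * T \<alpha> + ?d (hf 2 \<alpha>) * T (hf 2 \<alpha>))"
 proof (rule sum.cong[OF refl])
  fix \<alpha> assume a: "\<alpha> : Pm"
  show "of_real (2 * m0 G (hf 2 \<alpha>)) * T (hf 2 \<alpha>) = ?d \<alpha> * T \<alpha> + ?d (hf 2 \<alpha>) * T (hf 2 \<alpha>)"
   unfolding m0_eq[OF a] T[OF PmD(1)[OF a]] by (simp add: distrib_right)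
 qed
 also have "\<dots> = (\<Sum>\<alpha>\<in>Pm. ?d \<alpha> * T \<alpha>) + (\<Sum>\<alpha>\<in>?Q. ?d (hf 2 \<alpha>) * T (hf 2 \<alpha>))"
 proof -
  have "(\<Sum>\<alpha>\<in>Pm. ?d (hf 2 \<alpha>) * T (hf 2 \<alpha>)) = (\<Sum>\<alpha>\<in>?Q. ?d (hf 2 \<alpha>) * T (hf 2 \<alpha>))"
  proof (rule sum.mono_neutral_right[OF fin])
   show "\<forall>\<alpha>\<in>Pm - ?Q. ?d (hf 2 \<alpha>) * T (hf 2 \<alpha>) = 0"
   proof
    fix \<alpha> assume "\<alpha> : Pm - ?Q"
    then have "\<alpha> : Pm" "hf 2 \<alpha> \<notin> R" by auto
    then have "rs (hf 2 \<alpha>) = {0}" using hf_root_iff[OF PmD(3), of \<alpha> 2] PmD(4) by simp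
    then show "?d (hf 2 \<alpha>) * T (hf 2 \<alpha>) = 0" by simp
   qed
  qed auto
  then show ?thesis by (simp add: sum.distrib)
 qed
 also have "(\<Sum>\<alpha>\<in>?Q. ?d (hf 2 \<alpha>) * T (hf 2 \<alpha>)) = (\<Sum>\<alpha>\<in>P - Pm. ?d \<alpha> * T \<alpha>)"
  unfolding P_decomp by (simp add: sum.reindex[OF inj])
 also have "(\<Sum>\<alpha>\<in>Pm. ?d \<alpha> * T \<alpha>) + (\<Sum>\<alpha>\<in>P - Pm. ?d \<alpha> * T \<alpha>) = (\<Sum>\<alpha>\<in>P. ?d \<alpha> * T \<alpha>)"
  using sum.subset_diff[of Pm P "%\<alpha>. ?d \<alpha> * T \<alpha>"] P_finite by (simp add: Pm_def add.commute)
 finally show ?thesis .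
qed

lemma R1_iff: "\<beta> : R1_pos G \<longleftrightarrow> hf (1/2) \<beta> : R \<and> hf (1/4) \<beta> \<notin> R \<and> \<beta> H0 > 0"
proof
 assume "\<beta> : R1_pos G"
 then obtain \<alpha> where "\<alpha> : Pm" "\<beta> = hf 2 \<alpha>" unfolding R1_pos_eq by blast
 then show "hf (1/2) \<beta> : R \<and> hf (1/4) \<beta> \<notin> R \<and> \<beta> H0 > 0" by (auto simp: Pm_def P_def) (simp add: hf_def)
next
 assume b: "hf (1/2) \<beta> : R \<and> hf (1/4) \<beta> \<notin> R \<and> \<beta> H0 > 0"
 then have "hf (1/2) \<beta> : Pm" by (simp add: Pm_def P_def) (simp add: hf_def)
 then show "\<beta> : R1_pos G" unfolding R1_pos_eq by (intro image_eqI[of _ _ "hf (1/2) \<beta>"]) auto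
qed

lemma R1_dual: "\<beta> : R1_pos G ==> \<beta> : dual_aa G"
 using hf_dual PmD(3) unfolding R1_pos_eq by blast

lemma m0_eq': "\<beta> : R1_pos G ==> 2 * m0 G \<beta> = real (dim (rs (hf (1/2) \<beta>))) + real (dim (rs \<beta>))"
 using m0_eq unfolding R1_pos_eq by auto

section \<open>The normalizer of \<open>aa\<close> acting on roots and on Dunkl operators\<close>

definition act where "act g \<alpha> = ext0 a (%H. \<alpha> (Ad G (iv g) H))"

lemma act_dual: "g : NA ==> \<alpha> : dual_aa G ==> act g \<alpha> : dual_aa G"
 unfolding act_def by (rule dual_aaI) (simp_all add: Ad_add Ad_scale a_E dual_aa NAD)

lemma act_inv: "g : NA ==> \<alpha> : dual_aa G ==> act (iv g) (act g \<alpha>) = \<alpha>"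
 by (auto simp: act_def ext0_def Ad_inv a_E NAD dual_aa(3))

lemma act_hf: "act g (hf c \<alpha>) = hf c (act g \<alpha>)" and act_neg: "act g (neg \<alpha>) = neg (act g \<alpha>)"
 by (auto simp: act_def ext0_def hf_def neg_def)

lemma act_apply: "g : NA ==> x : a ==> act g \<alpha> (Ad G g x) = \<alpha> x"
 by (simp add: act_def ext0_def NAD Ad_inv a_E)

lemma dim_le_image:
 assumes "subspace V" "V \<subseteq> E" "lin_on E f" "f ` V \<subseteq> W" "\<And>x. x : V ==> f x = 0 ==> x = 0"
 shows "dim V \<le> dim W"
proof -
 let ?f = "%z. f (prj V z)"
 note f = lin_onD[OF assms(3)]
 have PE: "prj V z : E" for z using prj_in[OF assms(1)] assms(2) by blast
 have lin: "linear ?f" by (rule linearI) (simp_all add: linear_add[OF prj_linear] linear_cmul[OF prj_linear] f PE)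
 have eq: "?f z = f z" if "z : V" for z using prj_id[OF assms(1) that] by simp
 have inj: "inj_on ?f V"
 proof (rule inj_onI)
  fix x y assume xy: "x : V" "y : V" "?f x = ?f y"
  have d: "x - y : V" using xy assms(1) by (simp add: subspace_diff)
  have "f (x - y) = 0" using linear_diff[OF lin, of x y] xy eq[OF d] by simp
  then show "x = y" using assms(5)[OF d] by simp
 qed
 have sp: "span V = V" using assms(1) by (simp add: span_eq_iff)
 have "dim (?f ` V) = dim V" using dim_image_eq[OF lin, of V] inj unfolding sp by blast
 moreover have "?f ` V \<subseteq> W" using eq assms(4) by auto
 ultimately show ?thesis using dim_subset by metis
qed

lemma dim_act: assumes g: "g : NA" and al: "\<alpha> : dual_aa G" shows "dim (rs (act g \<alpha>)) = dim (rs \<alpha>)"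
proof -
 have le: "dim (rs \<alpha>) \<le> dim (rs (act g \<alpha>))" if g: "g : NA" for g \<alpha>
 proof (rule dim_le_image[OF rs_sub, where f="Ad G g"])
  show "Ad G g ` rs \<alpha> \<subseteq> rs (act g \<alpha>)" using rs_Ad[OF g] by (auto simp: act_def)
  show "x = 0" if "x : rs \<alpha>" "Ad G g x = 0" for x using Ad_inv(1)[OF rsD(1)[OF that(1)], of g] that(2) Ad_zero by simp
 qed (auto simp: rsD lin_on_def Ad_in Ad_add Ad_scale)
 show ?thesis using le[OF g, of \<alpha>] le[OF NA_inv[OF g], of "act g \<alpha>"] act_inv[OF g al] by simp
qed

lemma dim_neg: "dim (rs (neg \<alpha>)) = dim (rs \<alpha>)"
proof -
 have le: "dim (rs \<alpha>) \<le> dim (rs (neg \<alpha>))" for \<alpha>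
 proof (rule dim_le_image[OF rs_sub, where f=th])
  show "x = 0" if "x : rs \<alpha>" "th x = 0" for x using th_props(2)[OF rsD(1)[OF that(1)]] th_props(4)[of 0 0] that(2) by simp
 qed (auto simp: rsD lin_on_def th_props th_rs)
 have "neg (neg \<alpha>) = \<alpha>" by (simp add: neg_def)
 then show ?thesis using le[of \<alpha>] le[of "neg \<alpha>"] by simp
qed

lemma roots_dim: "\<alpha> : R \<longleftrightarrow> \<alpha> : dual_aa G \<and> \<alpha> \<noteq> (%_. 0) \<and> dim (rs \<alpha>) \<noteq> 0"
proof -
 have "rs \<alpha> \<noteq> {0} \<longleftrightarrow> \<not> rs \<alpha> \<subseteq> {0}" using subspace_0[OF rs_sub, of \<alpha>] by blast
 then show ?thesis by (auto simp: roots_def)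
qed

lemma act_roots: assumes g: "g : NA" and al: "\<alpha> : dual_aa G" shows "act g \<alpha> : R \<longleftrightarrow> \<alpha> : R"
proof -
 have "act g (%_. 0) = (%_. 0)" for g by (auto simp: act_def ext0_def)
 then have "act g \<alpha> = (%_. 0) \<longleftrightarrow> \<alpha> = (%_. 0)" using act_inv[OF g al] by metis
 then show ?thesis using act_dual[OF g al] al dim_act[OF g al] by (simp add: roots_dim)
qed

lemma neg_roots_iff: "neg \<alpha> : R \<longleftrightarrow> \<alpha> : R"
 using neg_roots[of \<alpha>] neg_roots[of "neg \<alpha>"] by (auto simp: neg_def)

sublocale du0: dunkl_data a K "R1_pos G" "m0 G" Hv
proof unfold_locales
 show "finite (R1_pos G)" using P_finite by (simp add: R1_pos_eq Pm_def)
 fix \<alpha> assume r: "\<alpha> : R1_pos G"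
 show "Hv \<alpha> : a" by (rule Hv(1)[OF R1_dual[OF r]])
 show eq: "\<alpha> x = K (Hv \<alpha>) x" if "x : a" for x by (rule Hv(2)[OF R1_dual[OF r] that])
 show "Hv \<alpha> \<noteq> 0" using eq[OF H0(1)] r R1_iff[of \<alpha>] fa.B_zero[OF H0(1)] by auto
qed

text \<open>The normalizer permutes the restricted roots and preserves multiplicities, but it may
  send positive roots to negative ones; \<open>up\<close> corrects the sign.\<close>

lemma Ad_isoA: assumes g: "g : NA" shows "du0.isoA (Ad G g)"
proof -
 define up where "up \<beta> = (if \<beta> H0 > 0 then \<beta> else neg \<beta>)" for \<beta> :: "'v => real"
 define \<sigma> where "\<sigma> \<beta> = up (act g \<beta>)" for \<beta>
 have cases: "\<sigma> \<beta> = act g \<beta> \<or> \<sigma> \<beta> = neg (act g \<beta>)" for \<beta> by (simp add: \<sigma>_def up_def)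
 have R: "hf c (\<sigma> \<beta>) : R \<longleftrightarrow> hf c \<beta> : R" if "\<beta> : R1_pos G" for \<beta> c
 proof -
  have "hf c (neg \<beta>) = neg (hf c \<beta>)" for \<beta> by (simp add: hf_def neg_def)
  then show ?thesis using cases[of \<beta>] act_roots[OF g hf_dual[OF R1_dual[OF that]], of c] by (auto simp: act_hf neg_roots_iff)
 qed
 have in_A: "\<sigma> \<beta> : R1_pos G" if b: "\<beta> : R1_pos G" for \<beta>
 proof -
  have h: "hf (1/2) (act g \<beta>) : R" using act_roots[OF g hf_dual[OF R1_dual[OF b]], of "1/2"] b by (simp add: act_hf R1_iff)
  have "act g \<beta> H0 \<noteq> 0" using H0(2)[OF h] by (simp add: hf_def)
  then have "\<sigma> \<beta> H0 > 0" by (simp add: \<sigma>_def up_def neg_def)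
  then show ?thesis using b R[OF b] by (simp add: R1_iff)
 qed
 have m: "m0 G (\<sigma> \<beta>) = m0 G \<beta>" if b: "\<beta> : R1_pos G" for \<beta>
 proof -
  have "dim (rs (hf c (\<sigma> \<beta>))) = dim (rs (hf c \<beta>))" for c
  proof -
   have "hf c (neg \<beta>) = neg (hf c \<beta>)" for \<beta> by (simp add: hf_def neg_def)
   then show ?thesis using cases[of \<beta>] dim_act[OF g hf_dual[OF R1_dual[OF b]], of c] by (auto simp: act_hf dim_neg)
  qed
  from this[of "1/2"] this[of 1] show ?thesis using m0_eq'[OF b] m0_eq'[OF in_A[OF b]] by simp
 qed
 have inj: "inj_on \<sigma> (R1_pos G)"
 proof (rule inj_onI, rule ccontr)
  fix \<beta> \<beta>' assume b: "\<beta> : R1_pos G" "\<beta>' : R1_pos G" "\<sigma> \<beta> = \<sigma> \<beta>'" and ne: "\<beta> \<noteq> \<beta>'"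
  have nn: "neg (neg \<alpha>) = \<alpha>" for \<alpha> by (simp add: neg_def)
  have "act g \<beta> = act g \<beta>' \<or> act g \<beta> = neg (act g \<beta>')" using cases[of \<beta>] cases[of \<beta>'] b(3) nn by metis
  then have "\<beta> = \<beta>' \<or> \<beta> = neg \<beta>'"
   using act_inv[OF g R1_dual[OF b(1)]] act_inv[OF g R1_dual[OF b(2)]] by (metis act_neg)
  then have "\<beta> H0 = - \<beta>' H0" using ne by (simp add: neg_def)
  then show False using b(1,2) by (auto simp: R1_iff)
 qed
 have "\<sigma> ` R1_pos G = R1_pos G" by (rule endo_inj_surj[OF du0.A_fin _ inj]) (use in_A in blast)
 then have "bij_betw \<sigma> (R1_pos G) (R1_pos G)" using inj by (simp add: bij_betw_def)
 moreover have "(\<forall>x\<in>a. \<sigma> \<beta> (Ad G g x) = \<beta> x) \<or> (\<forall>x\<in>a. \<sigma> \<beta> (Ad G g x) = - \<beta> x)" for \<beta>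
  using cases[of \<beta>]
 proof
  assume "\<sigma> \<beta> = neg (act g \<beta>)"
  then have "\<forall>x\<in>a. \<sigma> \<beta> (Ad G g x) = - \<beta> x" by (intro ballI) (simp add: neg_def act_apply[OF g])
  then show ?thesis by blast
 qed (simp add: act_apply[OF g])
 ultimately show ?thesis unfolding du0.isoA_def
  using g m by (auto simp: Ad_add Ad_scale K_Ad a_E NA_def)
qed

lemma Hv_hf: assumes "\<alpha> : dual_aa G" shows "Hv (hf c \<alpha>) = c *R Hv \<alpha>"
proof -
 note h = Hv[OF assms] Hv[OF hf_dual[OF assms, of c]]
 let ?d = "Hv (hf c \<alpha>) - c *R Hv \<alpha>"
 have d: "?d : a" using h by simp
 have "K ?d ?d = K (Hv (hf c \<alpha>)) ?d - c * K (Hv \<alpha>) ?d" using fa.B_diff(1)[OF h(3) _ d, of "c *R Hv \<alpha>"] h(1) d by (simp add: fa.B_scale)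
 also have "\<dots> = hf c \<alpha> ?d - c * \<alpha> ?d" by (simp only: h(2)[OF d] h(4)[OF d])
 finally have "?d = 0" using fa.B_pos[OF d] by (fastforce simp: hf_def)
 then show ?thesis by simp
qed

lemma root_refl_hf: "\<alpha> : dual_aa G ==> c \<noteq> 0 ==> root_refl G (hf c \<alpha>) H = root_refl G \<alpha> H"
 unfolding root_refl_def Hv_hf using Hv(1)[of \<alpha>] by (simp add: hf_def fa.B_scale fa.B_scale2)

lemma s_eq: "du0.s \<beta> x = root_refl G \<beta> x"
 by (simp add: du0.s_def root_refl_def)

text \<open>The reflections are induced by elements of the normalizer, namely values at pi/2 of
  one-parameter groups, so they are admissible symmetries.\<close>

sublocale du: dunkl_comm a K "R1_pos G" "m0 G" Hv
proof unfold_locales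
 fix \<beta> assume "\<beta> : R1_pos G"
 then obtain \<alpha> where al: "\<alpha> : Pm" "\<beta> = hf 2 \<alpha>" unfolding R1_pos_eq by blast
 obtain X where u: "unit_root \<alpha> X" using unit_root_ex[OF PmD(2)[OF al(1)]] by blast
 obtain ga where o: "one_param G (Zv X) ga" using one_param_exists[OF unit_rootD(8)[OF u]] by blast
 have "du0.s \<beta> x = Ad G (ga (pi/2)) x" if "x : a" for x
  using refl_NA(2)[OF u o that] al root_refl_hf[OF PmD(3)[OF al(1)]] by (simp add: s_eq)
 then show "du0.isoA (du0.s \<beta>)" using Ad_isoA[OF refl_NA(1)[OF u o]]
  unfolding du0.isoA_def by (simp cong: image_cong)
qed

lemma dunkl_vec_eq: "dunkl_vec G = du0.DU"
 by (intro ext) (simp add: dunkl_vec_def du0.DU_def dunkl_quot_def du0.quot_def s_eq)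

end

section \<open>Restriction of the Laplacian\<close>

context iwa begin

text \<open>An \<open>ip\<close>-frame of the root space, chosen such that its squared norms add up
  to the multiplicity.\<close>

definition fb where "fb \<alpha> = form_space.fr (rs \<alpha>) ip"

lemma fb: "finite (fb \<alpha>)" "X : fb \<alpha> ==> X : rs \<alpha>" "Y : rs \<alpha> ==> (\<Sum>X\<in>fb \<alpha>. ip Y X *R X) = Y"
 "(\<Sum>X\<in>fb \<alpha>. ip X X) = real (dim (rs \<alpha>))"
 using form_space.fr[OF rs_form_space[of \<alpha>]] form_space.fr_trace[OF rs_form_space[of \<alpha>]] by (simp_all add: fb_def)

lemma a_g0: "v : a ==> v : g0"
 by (rule rsI) (simp_all add: a_E a_abelian)

lemma K_a_Wv: assumes "\<alpha> : P" "X : rs \<alpha>" "v : a" shows "K v (Wv X) = 0" "K (Wv X) v = 0"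
proof -
 have e: "X : E" "th X : E" "v : E" using assms rsD(1) a_E th_props by auto
 have "ip X v = 0" "ip (th X) v = 0"
  using rs_orth[OF assms(2) a_g0[OF assms(3)] H0(1)] rs_orth[OF th_rs[OF assms(2)] a_g0[OF assms(3)] H0(1)] PD[OF assms(1)]
  by (simp_all add: neg_def)
 then have "ip (Wv X) v = 0" using e by (simp add: Wv_def ip.B_diff)
 then show "K (Wv X) v = 0" using ip_s[OF a_s[OF assms(3)], of "Wv X"] e by (simp add: Wv_def)
 then show "K v (Wv X) = 0" using K_sym[of v "Wv X"] e by (simp add: Wv_def)
qed

lemma K_Wv_Wv: assumes "\<alpha> : P" "X : rs \<alpha>" "\<beta> : P" "Y : rs \<beta>"
 shows "K (Wv X) (Wv Y) = (if \<alpha> = \<beta> then 2 * ip X Y else 0)"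
proof -
 have e: "X : E" "th X : E" "Y : E" "th Y : E" using assms rsD(1) th_props by auto
 have 0: "ip X (th Y) = 0" "ip (th X) Y = 0"
  using rs_orth[OF assms(2) th_rs[OF assms(4)] H0(1)] rs_orth[OF th_rs[OF assms(2)] assms(4) H0(1)] PD(2)[OF assms(1)] PD(2)[OF assms(3)]
  by (simp_all add: neg_def)
 have "ip (th X) (th Y) = ip X Y" using K_th[of X "th Y"] e by (simp add: ip_def)
 then have "ip (Wv X) (Wv Y) = 2 * ip X Y" unfolding Wv_def using e 0 by (simp add: ip.B_diff)
 moreover have "ip X Y = 0" if ne: "\<alpha> \<noteq> \<beta>"
 proof -
  have "\<exists>H\<in>a. \<alpha> H \<noteq> \<beta> H" using dual_aa_neq[OF _ _ ne] rootsD(1) PD(1) assms by blast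
  then obtain H where "H : a" "\<alpha> H \<noteq> \<beta> H" by blast
  then show ?thesis by (rule rs_orth[OF assms(2,4)])
 qed
 ultimately show ?thesis using ip_s[OF Wv_s[OF e(3)], of "Wv X"] e by (cases "\<alpha> = \<beta>") (simp_all add: Wv_def)
qed

text \<open>The candidate for the orthogonal expansion on \<open>ss\<close>. The squared norm of
  \<open>Wv X\<close> is \<open>2 * ip X X\<close>, whence the halves.\<close>

definition QW where "QW x = (\<Sum>v\<in>fa.fr. K x v *R v) + (\<Sum>\<alpha>\<in>P. \<Sum>X\<in>fb \<alpha>. (K x (Wv X) / 2) *R Wv X)"

lemma fb_E: "X : fb \<alpha> ==> X : E" "X : fb \<alpha> ==> Wv X : E" "X : fb \<alpha> ==> Wv X : s" and fr_E: "v : fa.fr ==> v : E"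
 using fb(2) rsD(1) Wv_s s_E fa.fr(2) a_E by blast+

lemma QW_add: "x : E ==> y : E ==> QW (x + y) = QW x + QW y"
 by (simp add: QW_def K_add fb_E fr_E scaleR_add_left sum.distrib add_divide_distrib cong: sum.cong)

lemma QW_scale: "x : E ==> QW (c *R x) = c *R QW x"
 by (simp add: QW_def K_scale fb_E fr_E scaleR_add_right scaleR_sum_right cong: sum.cong)

lemma QW_a: assumes "x : a" shows "QW x = x"
 using assms by (simp add: QW_def fa.fr(3) K_a_Wv fb cong: sum.cong)

lemma QW_rs: assumes y: "\<beta> : P" "y : rs \<beta>" shows "QW (Wv y) = Wv y"
proof -
 have yE: "y : E" by (rule rsD(1)[OF y(2)])
 have "(\<Sum>\<alpha>\<in>P. \<Sum>X\<in>fb \<alpha>. (K (Wv y) (Wv X) / 2) *R Wv X) = (\<Sum>\<alpha>\<in>P. if \<beta> = \<alpha> then \<Sum>X\<in>fb \<alpha>. ip y X *R Wv X else 0)"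
  using K_Wv_Wv[OF y _ fb(2)] by (intro sum.cong) auto
 also have "\<dots> = (\<Sum>X\<in>fb \<beta>. ip y X *R Wv X)" using y(1) P_finite by (simp add: sum.delta')
 also have "\<dots> = (\<Sum>X\<in>fb \<beta>. ip y X *R X) - (\<Sum>X\<in>fb \<beta>. ip y X *R th X)"
  by (simp add: Wv_def sum_subtractf algebra_simps)
 also have "(\<Sum>X\<in>fb \<beta>. ip y X *R th X) = th (\<Sum>X\<in>fb \<beta>. ip y X *R X)"
 proof -
  have "th (\<Sum>X\<in>J. c X *R X) = (\<Sum>X\<in>J. c X *R th X) \<and> (\<Sum>X\<in>J. c X *R X) : E" if "J \<subseteq> fb \<beta>" for J and c :: "'v => real"
   using finite_subset[OF that fb(1)] that th_props(4)[of 0 0]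
   by (induction J rule: finite_induct) (auto simp: th_props fb_E)
  then show ?thesis by simp
 qed
 finally have "(\<Sum>\<alpha>\<in>P. \<Sum>X\<in>fb \<alpha>. (K (Wv y) (Wv X) / 2) *R Wv X) = Wv y" by (simp add: fb(3)[OF y(2)] Wv_def)
 then show ?thesis using K_a_Wv(2)[OF y fa.fr(2)] by (simp add: QW_def)
qed

text \<open>An element of \<open>ss\<close> is \<open>Wv\<close> of half of itself, so the expansion
  can be checked after \<open>Wv\<close> on \<open>g0\<close> and on the root spaces; negative roots
  reduce to positive ones because \<open>Wv\<close> changes sign under theta.\<close>

lemma QW_s: assumes x: "x : s" shows "QW x = x"
proof -
 let ?V = "{y : E. QW (Wv y) = Wv y}"
 have th0: "th 0 = 0" using th_props(4)[of 0 0] by simp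
 have WE: "Wv y : E" if "y : E" for y using that by (simp add: Wv_def th_props)
 have Wadd: "Wv (y + z) = Wv y + Wv z" if "y : E" "z : E" for y z using that by (simp add: Wv_def th_props)
 have Wsc: "Wv (c *R y) = c *R Wv y" if "y : E" for c y using that by (simp add: Wv_def th_props scaleR_right_diff_distrib)
 have sub: "subspace ?V"
  using QW_scale[of 0 0] by (intro subspaceI) (simp_all add: Wadd Wsc QW_add QW_scale WE, simp add: Wv_def th0)
 have "g0 \<union> (\<Union>\<alpha>\<in>R. rs \<alpha>) \<subseteq> ?V"
 proof
  fix y assume "y : g0 \<union> (\<Union>\<alpha>\<in>R. rs \<alpha>)"
  then consider "y : g0" | \<beta> where "\<beta> : P" "y : rs \<beta>" | \<beta> where "\<beta> : R" "\<beta> \<notin> P" "y : rs \<beta>" by blast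
  then show "y : ?V"
  proof cases
   case 1
   have yE: "y : E" by (rule rsD(1)[OF 1])
   have "Wv y : a"
   proof (rule centralizer_s[OF Wv_s[OF yE]])
    fix H assume H: "H : a"
    show "br H (Wv y) = 0" using rsD(2)[OF 1 H] rsD(2)[OF th_rs[OF 1] H] H yE by (simp add: Wv_def br_diff a_E th_props neg_def)
   qed
   then show ?thesis using QW_a yE by simp
  next
   case 2
   then show ?thesis using QW_rs rsD(1) by simp
  next
   case 3
   have yE: "y : E" by (rule rsD(1)[OF 3(3)])
   have "neg \<beta> : P" using 3 H0(2)[OF 3(1)] neg_roots[OF 3(1)] by (auto simp: P_def neg_def)
   then have "QW (Wv (th y)) = Wv (th y)" using th_rs[OF 3(3)] by (rule QW_rs)
   moreover have "Wv (th y) = (-1) *R Wv y" using yE by (simp add: Wv_def th_props)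
   ultimately show ?thesis using QW_scale[OF WE[OF yE], of "-1"] yE by simp
  qed
 qed
 then have "span (g0 \<union> (\<Union>\<alpha>\<in>R. rs \<alpha>)) \<subseteq> ?V" by (rule span_minimal[OF _ sub])
 then have "E \<subseteq> ?V" unfolding root_decomposition[symmetric] .
 moreover have "(1/2) *R x : E" using s_E[OF x] by simp
 ultimately have "QW (Wv ((1/2) *R x)) = Wv ((1/2) *R x)" by blast
 moreover have "Wv ((1/2) *R x) = x" using s_E[OF x] th_s[OF x] by (simp add: Wv_def th_props scaleR_add_right[symmetric] scaleR_2[symmetric])
 ultimately show ?thesis by simp
qed

lemma frame_s: "fs.frame (fa.fr <+> Sigma P fb) (case_sum (%v. v) (%(\<alpha>, X). (1 / sqrt 2) *R Wv X))"
 unfolding fs.frame_def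
proof (intro conjI ballI)
 show "finite (fa.fr <+> Sigma P fb)" using fa.fr(1) P_finite fb(1) by (intro finite_Plus finite_SigmaI)
 show "case_sum (%v. v) (%(\<alpha>, X). (1 / sqrt 2) *R Wv X) i : s" if "i : fa.fr <+> Sigma P fb" for i
  using that fa.fr(2) a_s fb_E(3) by auto
 fix x assume x: "x : s"
 have [simp]: "(1 / sqrt 2 * c / sqrt 2) = c / 2" for c by (simp add: real_sqrt_mult_self power2_eq_square[symmetric] field_simps)
 have "x = (\<Sum>v\<in>fa.fr. K x v *R v) + (\<Sum>\<alpha>\<in>P. \<Sum>X\<in>fb \<alpha>. (K x (Wv X) / 2) *R Wv X)"
  using QW_s[OF x] by (simp add: QW_def)
 also have "(\<Sum>\<alpha>\<in>P. \<Sum>X\<in>fb \<alpha>. (K x (Wv X) / 2) *R Wv X) = (\<Sum>\<alpha>\<in>P. \<Sum>X\<in>fb \<alpha>. K x ((1 / sqrt 2) *R Wv X) *R (1 / sqrt 2) *R Wv X)"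
  using s_E[OF x] by (intro sum.cong refl) (simp add: K_scale2 fb_E)
 finally show "x = (\<Sum>i\<in>fa.fr <+> Sigma P fb. K x (case_sum (%v. v) (%(\<alpha>, X). (1 / sqrt 2) *R Wv X) i) *R
   case_sum (%v. v) (%(\<alpha>, X). (1 / sqrt 2) *R Wv X) i)"
  using P_finite fb(1) fa.fr(1) by (simp add: sum.Plus sum.Sigma split_def)
qed

lemma gamma0_C: "F : C_inf s ==> gamma0 G F : C_inf a"
 using C_inf_pullback[OF s_sub a_sub bounded_linear_ident _, of F] a_s by (auto simp: gamma0_def)

lemma gamma0_apply: "x : a ==> gamma0 G F x = F x"
 by (simp add: gamma0_def ext0_def)

lemma gamma0_outside: "x \<notin> a ==> gamma0 G F x = 0"
 by (simp add: gamma0_def ext0_def)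

lemma gamma0_dd: assumes F: "F : C_inf s" and v: "v : a" shows "dir_deriv a v (gamma0 G F) = gamma0 G (dir_deriv s v F)"
proof
 fix x show "dir_deriv a v (gamma0 G F) x = gamma0 G (dir_deriv s v F) x"
 proof (cases "x : a")
  case True
  have "gamma0 G F (x + t *R v) = F (x + t *R v)" for t
   using subspace_add[OF a_sub True subspace_scale[OF a_sub v]] by (rule gamma0_apply)
  then show ?thesis using C_inf_deriv[OF s_sub F a_s[OF v] a_s[OF True]] True
   by (intro dir_deriv_eqI) (simp_all add: gamma0_apply)
 qed (simp add: gamma0_outside dir_deriv_outside)
qed

lemma Lap_split:
 assumes F: "F : C_inf s" and H: "H : a"
 shows "fs.Lap F H = fa.Lap (gamma0 G F) H +
  (\<Sum>\<alpha>\<in>P. \<Sum>X\<in>fb \<alpha>. dir_deriv s (Wv X) (dir_deriv s (Wv X) F) H / 2)"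
proof -
 have h: "dir_deriv s ((1 / sqrt 2) *R Y) (dir_deriv s ((1 / sqrt 2) *R Y) F) H = dir_deriv s Y (dir_deriv s Y F) H / 2"
  if Y: "Y : s" for Y
 proof -
  have c: "dir_deriv s (c *R Y) (dir_deriv s (c *R Y) F) H = of_real (c * c) * dir_deriv s Y (dir_deriv s Y F) H" for c
  proof -
   have "dir_deriv s (c *R Y) F = (%x. of_real c * dir_deriv s Y F x)"
    by (rule ext) (rule dir_deriv_vec(2)[OF s_sub F Y])
   then show ?thesis
    using dir_deriv_vec(2)[OF s_sub fs.dd_C[OF Y F] Y, of c H] dir_deriv_scale[OF s_sub _ fs.dd_C[OF Y F], of "c *R Y"]
     subspace_scale[OF s_sub Y] by simp
  qed
  have "1 / sqrt 2 * (1 / sqrt 2) = (1 / 2 :: real)" by simp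
  then show ?thesis using c[of "1 / sqrt 2"] by simp
 qed
 have "fs.Lap F H = (\<Sum>i\<in>fa.fr <+> Sigma P fb. dir_deriv s (case_sum (%v. v) (%(\<alpha>, X). (1 / sqrt 2) *R Wv X) i)
   (dir_deriv s (case_sum (%v. v) (%(\<alpha>, X). (1 / sqrt 2) *R Wv X) i) F) H)"
  by (rule fs.Lap_frame[OF frame_s F a_s[OF H]])
 also have "\<dots> = (\<Sum>v\<in>fa.fr. dir_deriv s v (dir_deriv s v F) H) +
   (\<Sum>\<alpha>\<in>P. \<Sum>X\<in>fb \<alpha>. dir_deriv s ((1 / sqrt 2) *R Wv X) (dir_deriv s ((1 / sqrt 2) *R Wv X) F) H)"
  using P_finite fb(1) fa.fr(1) by (simp add: sum.Plus sum.Sigma split_def)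
 also have "(\<Sum>v\<in>fa.fr. dir_deriv s v (dir_deriv s v F) H) = fa.Lap (gamma0 G F) H"
  unfolding fa.Lap_def
  by (intro sum.cong refl) (simp add: gamma0_dd[OF F fa.fr(2)] gamma0_dd[OF fs.dd_C[OF a_s[OF fa.fr(2)] F] fa.fr(2)] gamma0_apply[OF H])
 finally show ?thesis by (simp add: h fb_E)
qed

end

section \<open>K-types\<close>

lemma scaleR_vec_complex: "r *R (v :: complex ^ 'n) = of_real r *s v"
 unfolding vec_eq_iff by (simp add: scaleR_conv_of_real[where 'a=complex])

lemma has_vector_derivative_shift0:
 assumes "((%u. f (t + u)) hvd d) (at 0)"
 shows "(f hvd d) (at (t::real))"
proof -
 have "((%x. x - t) hvd 1) (at t)" by (auto intro!: derivative_eq_intros)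
 from vector_diff_chain_at[OF this, of "%u. f (t + u)" d] assms show ?thesis by (simp add: o_def)
qed

locale kirr = iwa G for G :: "('a::{t2_space,second_countable_topology}, 'v::euclidean_space, 'z) iwasawa_group_scheme" +
 fixes \<pi> :: "'a => complex ^ 'n::finite => complex ^ 'n"
 assumes irr: "unitary_irrep G \<pi>"
begin

abbreviation HK where "HK \<equiv> Hom_K G \<pi> (C_inf s)"
abbreviation D where "D \<equiv> dpi G \<pi>"

lemma pi_add: "g : Kgrp G ==> \<pi> g (u + v) = \<pi> g u + \<pi> g v" and pi_scale: "g : Kgrp G ==> \<pi> g (c *s v) = c *s \<pi> g v"
 using irr by (auto simp: unitary_irrep_def Vector_Spaces.linear_iff)

lemma pi_one: "\<pi> \<e> v = v" and pi_mult: "g : Kgrp G ==> h : Kgrp G ==> \<pi> (g \<cdot> h) v = \<pi> g (\<pi> h v)"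
 using irr by (auto simp: unitary_irrep_def)

lemma pi_scaleR: "g : Kgrp G ==> \<pi> g (r *R v) = r *R \<pi> g v"
 by (simp add: scaleR_vec_complex pi_scale)

lemma pi_linear: "g : Kgrp G ==> linear (\<pi> g)"
 by (rule linearI) (simp_all add: pi_add pi_scaleR)

lemma pi_inv: "g : Kgrp G ==> \<pi> (iv g) (\<pi> g v) = v" "g : Kgrp G ==> \<pi> g (\<pi> (iv g) v) = v"
 by (simp_all add: pi_mult[symmetric] Kg_inv pi_one)

lemma pi_inner: assumes "g : Kgrp G" shows "\<pi> g v \<bullet> \<pi> g w = v \<bullet> w"
proof -
 have "Re (\<Sum>i\<in>UNIV. \<pi> g v $ i * cnj (\<pi> g w $ i)) = Re (\<Sum>i\<in>UNIV. v $ i * cnj (w $ i))"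
  using irr assms by (simp add: unitary_irrep_def)
 then show ?thesis by (simp add: inner_vec_def inner_complex_def)
qed

lemma pi_inner': "g : Kgrp G ==> \<pi> g v \<bullet> w = v \<bullet> \<pi> (iv g) w"
 using pi_inner[of g v "\<pi> (iv g) w"] by (simp add: pi_inv)

lemma pi_norm: "g : Kgrp G ==> norm (\<pi> g v) = norm v"
 by (simp add: norm_eq_sqrt_inner pi_inner)

lemma HomD: assumes "\<Phi> : HK"
 shows "\<Phi> v : C_inf s" "\<Phi> (u + v) x = \<Phi> u x + \<Phi> v x" "\<Phi> (c *s v) x = c * \<Phi> v x"
  "g : Kgrp G ==> x : s ==> \<Phi> (\<pi> g v) x = \<Phi> v (Ad G (iv g) x)"
 using assms by (auto simp: Hom_K_def)

lemma Hom_bl: assumes "\<Phi> : HK" shows "bounded_linear (%v. \<Phi> v x)"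
proof -
 have "linear (%v. \<Phi> v x)"
  by (rule linearI) (simp_all add: HomD[OF assms] scaleR_vec_complex scaleR_conv_of_real)
 then show ?thesis by (simp add: linear_conv_bounded_linear)
qed

end

text \<open>The assumption \<open>nz\<close> provides an equivariant embedding of the representation
  space into smooth functions, through which \<pi> inherits differentiability.\<close>

locale ktype = kirr G \<pi> for G :: "('a::{t2_space,second_countable_topology}, 'v::euclidean_space, 'z) iwasawa_group_scheme" and \<pi> :: "'a => complex ^ 'n::finite => complex ^ 'n" +
 assumes rvecs: "root_vectors G" and nz: "\<exists>\<Phi>\<in>Hom_K G \<pi> (C_inf (ss G)). \<exists>v x. \<Phi> v x \<noteq> 0"
begin

definition \<Phi>0 where "\<Phi>0 = (SOME \<Phi>. \<Phi> : HK \<and> (\<exists>v x. \<Phi> v x \<noteq> 0))"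

lemma Phi0: "\<Phi>0 : HK" "\<exists>v x. \<Phi>0 v x \<noteq> 0"
proof -
 have "\<exists>\<Phi>. \<Phi> : HK \<and> (\<exists>v x. \<Phi> v x \<noteq> 0)" using nz by blast
 from someI_ex[OF this] show "\<Phi>0 : HK" "\<exists>v x. \<Phi>0 v x \<noteq> 0" unfolding \<Phi>0_def by blast+
qed

text \<open>The kernel of \<open>\<Phi>0\<close> is an invariant subspace, and irreducibility leaves
  only 0.\<close>

lemma Phi0_inj: assumes z: "\<And>x. x : s ==> \<Phi>0 v x = 0" shows "v = 0"
proof -
 note h = HomD[OF Phi0(1)]
 define U where "U = {v. \<forall>x\<in>s. \<Phi>0 v x = 0}"
 have sub: "vec.subspace U"
  unfolding vec.subspace_def U_def using h(3)[of 0 0] by (auto simp: h(2,3))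
 have inv: "\<forall>g\<in>Kgrp G. \<pi> g ` U \<subseteq> U" by (auto simp: U_def h(4) Ad_s Kg_inv)
 have "\<forall>U. vec.subspace U \<and> (\<forall>g\<in>Kgrp G. \<pi> g ` U \<subseteq> U) \<longrightarrow> U = {0} \<or> U = UNIV"
  using irr unfolding unitary_irrep_def by blast
 then have "U = {0} \<or> U = UNIV" using sub inv by blast
 moreover have "U \<noteq> UNIV"
 proof
  assume e: "U = UNIV"
  obtain w y where w: "\<Phi>0 w y \<noteq> 0" using Phi0(2) by blast
  then have "y : s" using C_inf_outside[OF h(1)] by blast
  then show False using w e unfolding U_def by blast
 qed
 ultimately show ?thesis using z by (auto simp: U_def)
qed

lemma Phi0_eqI: assumes "\<And>x. x : s ==> \<Phi>0 v x = \<Phi>0 w x" shows "v = w"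
proof -
 have "\<Phi>0 (v + (-1) *s w) x = 0" if "x : s" for x unfolding HomD(2,3)[OF Phi0(1)] using assms[OF that] by simp
 then have "v + (-1) *s w = 0" by (rule Phi0_inj)
 then show ?thesis by (simp add: vec_eq_iff)
qed

text \<open>Equivariance moves the group element into the argument of a smooth function, where
  \<open>Ad\<close> is differentiable.\<close>

lemma Hom_curve:
 assumes P: "\<Phi> : HK" and o: "one_param G Z ga" and Z: "Z : k" and x: "x : s"
 shows "((%t. \<Phi> (\<pi> (ga t) v) x) hvd - dir_deriv s (br Z x) (\<Phi> v) x) (at 0)"
proof -
 note ZE = k_E[OF Z] and xE = s_E[OF x]
 have o': "one_param G (- Z) (%t. ga (- t))" using one_param_scale[OF o ZE, of "-1"] by simp
 have "((%t. Ad G (ga (- t)) x) hvd br (- Z) x) (at 0)"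
  by (rule Ad_one_param_deriv0[OF o' _ xE]) (simp add: ZE)
 then have c: "((%t. Ad G (ga (- t)) x) hvd - br Z x) (at 0)" by (simp add: br_minus ZE xE)
 have c0: "Ad G (ga (- 0)) x = x" using one_param_zero[OF o] Ad_one[OF xE] by simp
 have "((%t. \<Phi> v (Ad G (ga (- t)) x)) hvd dirder (\<Phi> v) (- br Z x) (Ad G (ga (- 0)) x)) (at 0)"
 proof (rule chain_curve[OF relopen_self[OF s_sub] smooth_on_Ck[OF C_inf_smooth[OF HomD(1)[OF P]]] _ c])
  show "Ad G (ga (- 0)) x : s" using c0 x by simp
  show "- br Z x : s" by (rule subspace_neg[OF s_sub br_ks[OF Z x]])
  show "\<forall>\<^sub>F t in at 0. Ad G (ga (- t)) x : s" by (intro always_eventually allI Ad_s one_param_K[OF o Z] x)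
 qed
 moreover have "dirder (\<Phi> v) (- br Z x) x = - dir_deriv s (br Z x) (\<Phi> v) x"
  using dir_deriv_vec(3)[OF s_sub HomD(1)[OF P] br_ks[OF Z x]] by (simp add: dir_deriv_apply[OF x, symmetric])
 moreover have "\<Phi> (\<pi> (ga t) v) x = \<Phi> v (Ad G (ga (- t)) x)" for t
  using HomD(4)[OF P one_param_K[OF o Z] x] one_param_minus[OF o] by simp
 ultimately show ?thesis unfolding c0 by simp
qed

text \<open>The evaluations \<open>%v. \<Phi>0 v x\<close> separate points, hence span the dual of the representation space.\<close>

lemma pi_differentiable:
 assumes o: "one_param G Z ga" and Z: "Z : k"
 shows "\<exists>d. ((%t. \<pi> (ga t) v) hvd d) (at 0)"
proof -
 \<comment> \<open>The vectors against which the orbit of \<open>v\<close> is differentiable. They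
   contain the representatives of all evaluations, whose orthogonal complement is trivial by
   \<open>Phi0_inj\<close>.\<close>
 define W where "W = {w :: complex ^ 'n. \<exists>d. ((%t. \<pi> (ga t) v \<bullet> w) has_real_derivative d) (at 0)}"
 have sub: "subspace W"
  unfolding W_def
 proof (rule subspaceI)
  show "0 : {w. \<exists>d. ((%t. \<pi> (ga t) v \<bullet> w) has_real_derivative d) (at 0)}" by (auto intro!: exI[of _ 0])
 qed (auto simp: inner_add_right intro: DERIV_add DERIV_cmult)
 have in_W: "adjoint (%v. f (\<Phi>0 v x)) (1::real) : W" if f: "bounded_linear f" and x: "x : s" for f :: "complex => real" and x
 proof -
  have bl: "bounded_linear (%v. f (\<Phi>0 v x))" by (rule bounded_linear_compose[OF f Hom_bl[OF Phi0(1)]])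
  have "((%t. f (\<Phi>0 (\<pi> (ga t) v) x)) hvd f (- dir_deriv s (br Z x) (\<Phi>0 v) x)) (at 0)"
   by (rule bounded_linear.has_vector_derivative[OF f Hom_curve[OF Phi0(1) o Z x]])
  moreover have "u \<bullet> adjoint (%v. f (\<Phi>0 v x)) 1 = f (\<Phi>0 u x)" for u
   using adjoint_works[OF bounded_linear.linear[OF bl], of u 1] by simp
  ultimately show ?thesis unfolding W_def by (auto simp: has_real_derivative_iff_has_vector_derivative)
 qed
 have "W = UNIV"
 proof (rule ccontr)
  assume "W \<noteq> UNIV"
  then have "dim W < DIM(complex ^ 'n)" using sub dim_eq_full[of W] dim_subset_UNIV[of W] span_eq_iff[of W] by fastforce
  then obtain u where u: "u \<noteq> 0" "\<And>y. y : span W ==> orthogonal u y" by (rule orthogonal_to_subspace_exists) rule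
  have z: "f (\<Phi>0 u x) = 0" if f: "bounded_linear f" and x: "x : s" for f :: "complex => real" and x
  proof -
   have bl: "bounded_linear (%v. f (\<Phi>0 v x))" by (rule bounded_linear_compose[OF f Hom_bl[OF Phi0(1)]])
   show ?thesis using u(2)[OF span_base[OF in_W[OF f x]]] adjoint_works[OF bounded_linear.linear[OF bl], of u 1]
    by (simp add: orthogonal_def)
  qed
  have "u = 0" by (rule Phi0_inj) (simp add: complex_eq_iff z bounded_linear_Re bounded_linear_Im)
  then show False using u by simp
 qed
 then have "\<forall>w. \<exists>d. ((%t. \<pi> (ga t) v \<bullet> w) has_real_derivative d) (at 0)" unfolding W_def by blast
 then obtain d where d: "\<forall>w. ((%t. \<pi> (ga t) v \<bullet> w) has_real_derivative d w) (at 0)" by (rule choice[THEN exE])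
 have "((%t. \<pi> (ga t) v) hvd (\<Sum>i\<in>Basis. d i *R i)) (at 0)"
  by (rule has_vector_derivative_componentwise) (simp add: d)
 then show ?thesis by blast
qed

section \<open>The derived representation of \<open>kk\<close>\<close>

lemma pi_deriv:
 assumes o: "one_param G Z ga" and Z: "Z : k"
 shows "((%t. \<pi> (ga t) v) hvd D Z v) (at 0)"
proof -
 obtain d where d: "((%t. \<pi> (ga t) v) hvd d) (at 0)" using pi_differentiable[OF o Z] by blast
 then have "D Z v = d" unfolding dpi_def lie_exp_scale[OF o k_E[OF Z]] by (rule vector_derivative_at)
 then show ?thesis using d by simp
qed

lemma one_param_k: "Z : k ==> \<exists>ga. one_param G Z ga"
 by (rule one_param_exists[OF k_E])

lemma D_eqI: "one_param G Z ga ==> Z : k ==> ((%t. \<pi> (ga t) v) hvd d) (at 0) ==> D Z v = d"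
 using vector_derivative_unique_at[OF pi_deriv] by blast

lemma pi_deriv':
 assumes o: "one_param G Z ga" and Z: "Z : k"
 shows "((%t. \<pi> (ga t) v) hvd D Z (\<pi> (ga t) v)) (at t)"
proof (rule has_vector_derivative_shift0)
 have "\<pi> (ga (t + u)) v = \<pi> (ga u) (\<pi> (ga t) v)" for u
  using one_param_add[OF o, of u t] by (simp add: add.commute pi_mult one_param_K[OF o Z])
 then show "((%u. \<pi> (ga (t + u)) v) hvd D Z (\<pi> (ga t) v)) (at 0)"
  using pi_deriv[OF o Z] by simp
qed

lemma Hom_D: assumes P: "\<Phi> : HK" and Z: "Z : k" and x: "x : s"
 shows "\<Phi> (D Z v) x = - dir_deriv s (br Z x) (\<Phi> v) x"
proof -
 obtain ga where o: "one_param G Z ga" using one_param_k[OF Z] by blast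
 have "((%t. \<Phi> (\<pi> (ga t) v) x) hvd \<Phi> (D Z v) x) (at 0)"
  by (rule bounded_linear.has_vector_derivative[OF Hom_bl[OF P] pi_deriv[OF o Z]])
 from vector_derivative_unique_at[OF this Hom_curve[OF P o Z x]] show ?thesis .
qed

lemma D_add: assumes Z: "Z : k" shows "D Z (u + v) = D Z u + D Z v"
proof -
 obtain ga where o: "one_param G Z ga" using one_param_k[OF Z] by blast
 show ?thesis using has_vector_derivative_add[OF pi_deriv[OF o Z, of u] pi_deriv[OF o Z, of v]]
  by (intro D_eqI[OF o Z]) (simp add: pi_add one_param_K[OF o Z])
qed

lemma D_scale: assumes Z: "Z : k" shows "D Z (c *s v) = c *s D Z v"
proof -
 obtain ga where o: "one_param G Z ga" using one_param_k[OF Z] by blast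
 have "linear (%v :: complex ^ 'n. c *s v)" by (rule linearI) (simp_all add: vec_eq_iff algebra_simps)
 then have "bounded_linear (%v :: complex ^ 'n. c *s v)" by (simp add: linear_conv_bounded_linear)
 from bounded_linear.has_vector_derivative[OF this pi_deriv[OF o Z, of v]]
 show ?thesis by (intro D_eqI[OF o Z]) (simp add: pi_scale one_param_K[OF o Z])
qed

lemma D_scaleR: "Z : k ==> D Z (r *R v) = r *R D Z v"
 by (simp add: scaleR_vec_complex D_scale)

lemma D_zero: "Z : k ==> D Z 0 = 0"
 using D_scaleR[of Z 0 0] by simp

lemma D_linear: "Z : k ==> linear (D Z)"
 by (rule linearI) (simp_all add: D_add D_scaleR)

text \<open>Linearity in the Lie algebra element is read off on the side of functions, where the
  action is a directional derivative along \<open>br Z x\<close>.\<close>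

lemma D_add1: assumes Z: "Z : k" "Z' : k" shows "D (Z + Z') v = D Z v + D Z' v"
proof (rule Phi0_eqI)
 fix x assume x: "x : s"
 have "br (Z + Z') x = br Z x + br Z' x" using Z x by (simp add: br_add1 k_E s_E)
 then show "\<Phi>0 (D (Z + Z') v) x = \<Phi>0 (D Z v + D Z' v) x"
  using dir_deriv_vec(1)[OF s_sub HomD(1)[OF Phi0(1)] br_ks[OF Z(1) x] br_ks[OF Z(2) x]] subspace_add[OF k_sub Z]
  by (simp add: HomD[OF Phi0(1)] Hom_D[OF Phi0(1)] Z x)
qed

lemma D_scale1: assumes Z: "Z : k" shows "D (c *R Z) v = c *R D Z v"
proof -
 obtain ga where o: "one_param G Z ga" using one_param_k[OF Z] by blast
 have "((*) c hvd c) (at 0)" by (auto intro!: derivative_eq_intros)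
 moreover have "((%t. \<pi> (ga t) v) hvd D Z v) (at (c * 0))" using pi_deriv[OF o Z] by simp
 ultimately have "((%t. \<pi> (ga (c * t)) v) hvd c *R D Z v) (at 0)"
  using vector_diff_chain_at[of "(*) c" c 0 "%t. \<pi> (ga t) v"] by (simp add: o_def)
 then show ?thesis by (rule D_eqI[OF one_param_scale[OF o k_E[OF Z]] subspace_scale[OF k_sub Z]])
qed

lemma D_skew: assumes Z: "Z : k" shows "D Z v \<bullet> w = - (v \<bullet> D Z w)"
proof -
 obtain ga where o: "one_param G Z ga" using one_param_k[OF Z] by blast
 have "((%t. \<pi> (ga t) v \<bullet> \<pi> (ga t) w) hvd (\<pi> (ga 0) v \<bullet> D Z w + D Z v \<bullet> \<pi> (ga 0) w)) (at 0)"
  by (rule bounded_bilinear.has_vector_derivative[OF bounded_bilinear_inner pi_deriv[OF o Z] pi_deriv[OF o Z]])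
 then have "((%t. v \<bullet> w) hvd (v \<bullet> D Z w + D Z v \<bullet> w)) (at 0)"
  by (simp add: pi_inner one_param_K[OF o Z] one_param_zero[OF o] pi_one)
 from vector_derivative_unique_at[OF this has_vector_derivative_const] show ?thesis by simp
qed

lemma pi_D: assumes g: "g : Kgrp G" and Z: "Z : k" shows "\<pi> g (D Z v) = D (Ad G g Z) (\<pi> g v)"
proof -
 obtain ga where o: "one_param G Z ga" using one_param_k[OF Z] by blast
 have "bounded_linear (\<pi> g)" using pi_linear[OF g] by (simp add: linear_conv_bounded_linear)
 from bounded_linear.has_vector_derivative[OF this pi_deriv[OF o Z, of v]]
 have "((%t. \<pi> (g \<cdot> ga t \<cdot> iv g) (\<pi> g v)) hvd \<pi> g (D Z v)) (at 0)"
  by (simp add: pi_mult Kg_mult Kg_inv g one_param_K[OF o Z] pi_inv)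
 then show ?thesis by (intro D_eqI[OF one_param_conj[OF o k_E[OF Z]] KgD(1)[OF g Z], symmetric])
qed

end

section \<open>Single-petaled vectors and the radial part of the Laplacian\<close>

context ktype begin

text \<open>The operator Z (Z^2 + 4) for an arbitrary root vector \<open>X\<close> in place of the
  chosen one.\<close>

definition cub where "cub X v = D (Zv X) (D (Zv X) (D (Zv X) v) + 4 *s v)"

lemma rvec: assumes "\<alpha> : R" shows "unit_root \<alpha> (rvec G \<alpha>)"
 using rvecs assms unfolding root_vectors_def unit_root_def ip_def by simp

lemma Zcubic_cub: "Zcubic G \<pi> \<alpha> v = cub (rvec G \<alpha>) v"
 by (simp add: Zcubic_def cub_def Zvec_def Zv_def Let_def)

lemma pi_cub: assumes g: "g : Kgrp G" and X: "X : E" shows "\<pi> g (cub X v) = cub (Ad G g X) (\<pi> g v)"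
proof -
 have "Ad G g (Zv X) = Zv (Ad G g X)" using X by (simp add: Zv_def Ad_add Ad_th[OF g] th_props)
 then show ?thesis by (simp add: cub_def pi_D g Zv_k X pi_add pi_scale)
qed

text \<open>The order of the quantifiers is the point: the derivative depends only on position and
  velocity. This lets a curve on a sphere be exchanged for an orbit of M with the same
  velocity.\<close>

lemma cub_curve:
 assumes "c' : E"
 shows "\<exists>d. \<forall>c. (\<forall>t. c t : E) \<longrightarrow> c t0 = X \<longrightarrow> (c hvd c') (at t0) \<longrightarrow>
  ((%t. cub (c t) v) hvd d) (at t0)"
proof -
 define B where "B X = D (Zv (prj E X))" for X
 have PE: "prj E X : E" for X by (rule prj_in[OF E_sub])
 have "bilinear B"
  unfolding bilinear_def
 proof (intro conjI allI)
  show "linear (B X)" for X unfolding B_def by (rule D_linear[OF Zv_k[OF PE]])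
  have "Zv (X + Y) = Zv X + Zv Y" "Zv (r *R X) = r *R Zv X" if "X : E" "Y : E" for X Y r
   using that by (simp_all add: Zv_def th_props scaleR_add_right)
  note zl = this(1) this(2)[OF _ E_simps(1)]
  from zl show "linear (%X. B X w)" for w
   by (intro linearI) (simp_all add: B_def linear_add[OF prj_linear] linear_cmul[OF prj_linear] PE D_add1 D_scale1 Zv_k)
 qed
 then have bb: "bounded_bilinear B" by (simp add: bilinear_conv_bounded_bilinear)
 note d = bounded_bilinear.has_vector_derivative[OF bb]
 let ?d = "B X (B X (B X 0 + B c' v) + B c' (B X v) + 0) + B c' (B X (B X v) + 4 *s v)"
 show ?thesis
 proof (intro exI allI impI)
  fix c assume c: "\<forall>t. c t : E" "c t0 = X" "(c hvd c') (at t0)"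
  have "((%t. B (c t) (B (c t) (B (c t) v) + 4 *s v)) hvd ?d) (at t0)"
   unfolding c(2)[symmetric]
   by (rule d[OF c(3) has_vector_derivative_add[OF d[OF c(3) d[OF c(3) has_vector_derivative_const]] has_vector_derivative_const]])
  then show "((%t. cub (c t) v) hvd ?d) (at t0)"
   using c(1) by (simp add: cub_def B_def prj_id[OF E_sub])
 qed
qed

text \<open>Every infinitesimal motion within the sphere of \<open>rs \<alpha>\<close> comes from M, and M does not change
 the norm of \<open>cub X v\<close>.\<close>

lemma cub_sphere:
 assumes r: "\<alpha> : R" and c: "\<And>t. c t : rs \<alpha>" "\<And>t. c t \<noteq> 0" "\<And>t. c' t : rs \<alpha>" "\<And>t. ip (c t) (c' t) = 0"
  "\<And>t. (c hvd c' t) (at t)" and v: "v : VM G \<pi>"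
 shows "norm (cub (c t) v) = norm (cub (c 0) v)"
proof -
 let ?N = "%t. cub (c t) v \<bullet> cub (c t) v"
 have "(?N has_real_derivative 0) (at t)" for t
 proof -
  obtain T where T: "T : k" "\<forall>H\<in>a. br T H = 0" "br T (c t) = c' t" using m_tangent[OF r c(1,2,3,4)] by blast
  note TE = k_E[OF T(1)] and cE = rsD(1)[OF c(1)]
  obtain de where o: "one_param G T de" using one_param_exists[OF TE] by blast
  have M: "de u : Mgrp G" for u
   unfolding Mgrp_iff using one_param_K[OF o T(1)] Ad_one_param_self[OF o TE] T(2) a_E by blast
  obtain d where d: "\<forall>e. (\<forall>u. e u : E) \<longrightarrow> e t = c t \<longrightarrow> (e hvd c' t) (at t) \<longrightarrow>
    ((%u. cub (e u) v) hvd d) (at t)"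
   using cub_curve[OF rsD(1)[OF c(3)], of t "c t" t v]
   by (elim exE)
  note sq = bounded_bilinear.has_vector_derivative[OF bounded_bilinear_inner]
  have 1: "((%u. cub (c u) v) hvd d) (at t)" using d[rule_format, of c] cE c(5) by blast
  \<comment> \<open>An orbit of M with the position and velocity of \<open>c\<close> at time
    \<open>t\<close>; along it the norm of the cubic expression is constant.\<close>
  let ?e = "%u. Ad G (de (u - t)) (c t)"
  have "(?e hvd c' t) (at t)"
   by (rule has_vector_derivative_shift0) (use Ad_one_param_deriv0[OF o TE cE, of t] T(3) in simp)
  then have 2: "((%u. cub (?e u) v) hvd d) (at t)"
   using d[rule_format, of ?e] cE Ad_in one_param_zero[OF o] Ad_one[OF cE, of t] by simp
  have "cub (?e u) v = \<pi> (de (u - t)) (cub (c t) v)" for u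
   using pi_cub[OF one_param_K[OF o T(1)] cE, of "u - t" t v] v M by (simp add: VM_def)
  then have "cub (?e u) v \<bullet> cub (?e u) v = ?N t" for u by (simp add: pi_inner one_param_K[OF o T(1)])
  then have "((%u. ?N t) hvd (cub (?e t) v \<bullet> d + d \<bullet> cub (?e t) v)) (at t)" using sq[OF 2 2] by simp
  from vector_derivative_unique_at[OF this has_vector_derivative_const]
  have "cub (c t) v \<bullet> d + d \<bullet> cub (c t) v = 0" using one_param_zero[OF o] Ad_one[OF cE] by simp
  then show ?thesis using sq[OF 1 1] by (simp add: has_real_derivative_iff_has_vector_derivative)
 qed
 then have "?N t = ?N 0" by (intro DERIV_isconst_all) blast
 then show ?thesis by (simp add: norm_eq_sqrt_inner)
qed

text \<open>A great circle in the sphere of the root space leads from \<open>rvec G \<alpha>\<close>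
  to \<open>X\<close>; by \<open>cub_sphere\<close> the norm of the cubic expression is constant
  along it, and it starts at 0. If \<open>X\<close> is plus or minus \<open>rvec G \<alpha>\<close>,
  the expression changes at most by a sign.\<close>

lemma cub_all:
 assumes v: "v : V_single G \<pi>" and u: "unit_root \<alpha> X"
 shows "cub X v = 0"
proof -
 note u0 = unit_rootD[OF rvec[OF unit_rootD(1)[OF u]]] and uX = unit_rootD[OF u]
 let ?E = "rvec G \<alpha>"
 define n where "n = 2 / K (Hv \<alpha>) (Hv \<alpha>)"
 have n: "n > 0" using uX(5) by (simp add: n_def)
 note nX = uX(6)[folded n_def] and n0 = u0(6)[folded n_def]
 have E0: "cub ?E v = 0" and VM: "v : VM G \<pi>" using v uX(1) by (auto simp: V_single_def Zcubic_cub)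
 define p where "p = ip X ?E / n"
 define Y where "Y = X - p *R ?E"
 have Yr: "Y : rs \<alpha>" unfolding Y_def by (intro subspace_diff subspace_scale rs_sub uX u0)
 have YE: "Y : E" by (rule rsD(1)[OF Yr])
 have EY: "ip ?E Y = 0" "ip Y ?E = 0"
  using uX(4) u0(4) n0 n ip.B_sym[of X ?E] ip.B_sym[of Y ?E] YE by (simp_all add: Y_def ip.B_diff ip.B_scale2 p_def)
 have X: "X = p *R ?E + Y" by (simp add: Y_def)
 have "ip X X = p * p * n + ip Y Y"
  using arg_cong2[OF X X, of ip] YE u0(4) n0 EY by (simp add: ip.B_add ip.B_add2 ip.B_scale ip.B_scale2)
 then have nY: "ip Y Y = (1 - p\<^sup>2) * n" using nX by (simp add: algebra_simps power2_eq_square)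
 define q where "q = sqrt (1 - p\<^sup>2)"
 have p1: "p\<^sup>2 \<le> 1"
 proof -
  have "ip Y Y \<ge> 0" using ip.B_pos[OF YE] ip.B_zero[of 0] by (cases "Y = 0") auto
  then show ?thesis using n nY by (simp add: zero_le_mult_iff)
 qed
 then have pq: "p\<^sup>2 + q\<^sup>2 = 1" by (simp add: q_def)
 obtain U where U: "U : rs \<alpha>" "ip U U = n" "ip ?E U = 0" "Y = q *R U" if "q \<noteq> 0"
 proof (cases "q = 0")
  case False
  have q2: "(1 - p\<^sup>2) = q\<^sup>2" using p1 by (simp add: q_def)
  let ?U = "(1 / q) *R Y"
  have "ip ?U ?U = n" using YE nY False unfolding q2 by (simp add: ip.B_scale ip.B_scale2 power2_eq_square)
  moreover have "?U : rs \<alpha>" "Y = q *R ?U" "ip ?E ?U = 0"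
   using False Yr EY YE u0(4) by (simp_all add: subspace_scale rs_sub ip.B_scale2)
  ultimately show ?thesis using that by blast
 qed (use that in simp)
 show ?thesis
 proof (cases "q = 0")
  case True
  then have "p\<^sup>2 = 1" using pq by simp
  have "Y = 0" using nY \<open>p\<^sup>2 = 1\<close> ip.B_pos[OF YE] by fastforce
  then have X': "X = p *R ?E" using X by simp
  have Z: "Zv X = p *R Zv ?E" unfolding X' using u0(4) by (simp add: Zv_def th_props scaleR_add_right)
  have "cub X v = p *R D (Zv ?E) (p *R p *R D (Zv ?E) (D (Zv ?E) v) + 4 *s v)"
   unfolding cub_def Z using Zv_k[OF u0(4)] by (simp add: D_scale1 D_scaleR)
  also have "\<dots> = p *R cub ?E v" using \<open>p\<^sup>2 = 1\<close> by (simp add: cub_def power2_eq_square)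
  finally show ?thesis using E0 by simp
 next
  case False
  note U = U[OF False]
  have UE: "U : E" by (rule rsD(1)[OF U(1)])
  obtain t where t: "p = cos t" "q = sin t" using sincos_total_2pi[OF pq] by metis
  define c where "c t = cos t *R ?E + sin t *R U" for t
  define c' where "c' t = cos t *R U - sin t *R ?E" for t
  have UE0: "ip U ?E = 0" using U(3) ip.B_sym[of U ?E] UE u0(4) by simp
  have ipc: "ip (c t) (c t) = n" for t
  proof -
   have "ip (c t) (c t) = cos t * (cos t * n) + sin t * (sin t * n)" unfolding c_def
    using UE u0(4) n0 U UE0 by (simp add: ip.B_add ip.B_add2 ip.B_scale ip.B_scale2)
   also have "\<dots> = ((cos t)\<^sup>2 + (sin t)\<^sup>2) * n" by (simp only: power2_eq_square distrib_right mult.assoc)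
   finally show ?thesis by simp
  qed
  have "norm (cub (c t) v) = norm (cub (c 0) v)"
  proof (rule cub_sphere[OF uX(1) _ _ _ _ _ VM])
   show "c t : rs \<alpha>" "c' t : rs \<alpha>" for t
    unfolding c_def c'_def by (intro subspace_add subspace_diff subspace_scale rs_sub u0 U)+
   show "c t \<noteq> 0" for t using ipc[of t] n ip.B_zero[of 0] by auto
   show "ip (c t) (c' t) = 0" for t unfolding c_def c'_def
    using UE u0(4) n0 U UE0 by (simp add: ip.B_add ip.B_diff ip.B_scale ip.B_scale2)
   show "(c hvd c' t) (at t)" for t unfolding c_def c'_def
    by (auto intro!: derivative_eq_intros)
  qed
  moreover have "c t = X" using X U(4) t by (simp add: c_def)
  moreover have "c 0 = ?E" by (simp add: c_def)
  ultimately show ?thesis using E0 by simp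
 qed
qed

text \<open>The hypothesis says Z^3 v = -4 Z v, so the orbit of v stays in the span of v, Z v and
  Z^2 v and is given by \<open>r\<close>; at pi/2 its sine term vanishes.\<close>

lemma pi_rotation:
 assumes u: "unit_root \<alpha> X" and c: "cub X v = 0" and o: "one_param G (Zv X) ga"
 shows "\<pi> (ga (pi/2)) v = v + (1/2) *R D (Zv X) (D (Zv X) v)"
proof -
 note Z = Zv_k[OF unit_rootD(4)[OF u]]
 let ?D = "D (Zv X)"
 note lin = D_add[OF Z] D_scaleR[OF Z]
 have four: "4 *s w = 4 *R w" for w :: "complex ^ 'n" by (simp add: scaleR_vec_complex)
 have D3: "?D (?D (?D v)) = (-4) *R ?D v" using c unfolding cub_def four lin by (simp add: eq_neg_iff_add_eq_0)
 define r where "r t = v + (sin (2 * t) / 2) *R ?D v + ((1 - cos (2 * t)) / 4) *R ?D (?D v)" for t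
 have rd: "(r hvd ?D (r t)) (at t)" for t
 proof -
  have "?D (r t) = cos (2 * t) *R ?D v + (sin (2 * t) / 2) *R ?D (?D v)"
  proof -
   have "?D (r t) = ?D v + (sin (2 * t) / 2) *R ?D (?D v) + ((1 - cos (2 * t)) / 4 * -4) *R ?D v"
    unfolding r_def lin D3 by simp
   also have "(1 - cos (2 * t)) / 4 * -4 = cos (2 * t) - 1" by (simp add: field_simps)
   finally show ?thesis by (simp add: scaleR_left_diff_distrib)
  qed
  moreover have "(r hvd cos (2 * t) *R ?D v + (sin (2 * t) / 2) *R ?D (?D v)) (at t)"
   unfolding r_def by (auto intro!: derivative_eq_intros)
  ultimately show ?thesis by simp
 qed
 have "bounded_linear ?D" using D_linear[OF Z] by (simp add: linear_conv_bounded_linear)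
 then obtain L where L: "\<And>y. norm (?D y) \<le> norm y * L" using bounded_linear.bounded by blast
 have "(%t. \<pi> (ga t) v - r t) (pi/2) = 0"
 proof (rule linear_ode_zero)
  show "((%t. \<pi> (ga t) v - r t) hvd ?D (\<pi> (ga t) v - r t)) (at t)" for t
   unfolding linear_diff[OF D_linear[OF Z]] by (intro has_vector_derivative_diff pi_deriv'[OF o Z] rd)
  show "norm (?D (\<pi> (ga t) v - r t)) \<le> L * norm (\<pi> (ga t) v - r t)" for t using L by (simp add: mult.commute)
 qed (simp add: r_def one_param_zero[OF o] pi_one)
 then show ?thesis by (simp add: r_def)
qed

lemma unit_root_scale:
 assumes r: "\<alpha> : R" and X: "X : rs \<alpha>"
 shows "\<exists>U c. unit_root \<alpha> U \<and> X = c *R U"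
proof -
 let ?n = "K (Hv \<alpha>) (Hv \<alpha>)"
 have XE: "X : E" by (rule rsD(1)[OF X])
 show ?thesis
 proof (cases "X = 0")
  case True
  obtain U where "unit_root \<alpha> U" using unit_root_ex[OF r] by blast
  then show ?thesis using True by (intro exI[of _ U] exI[of _ 0]) simp
 next
  case False
  have p: "ip X X > 0" "?n > 0" "ip X X \<noteq> 0" "?n \<noteq> 0" using ip.B_pos[OF XE False] Hv_pos(1)[OF r] by auto
  let ?c = "sqrt (2 / (?n * ip X X))"
  have c: "?c * ?c = 2 / (?n * ip X X)" "?c > 0" using p by simp_all
  have "ip (?c *R X) (?c *R X) = (?c * ?c) * ip X X" using XE by (simp only: ip.B_scale ip.B_scale2 E_simps mult.assoc)
  also have "\<dots> = 2 / ?n" unfolding c(1) using p(3,4) by (simp add: field_simps)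
  finally have "unit_root \<alpha> (?c *R X)" using r subspace_scale[OF rs_sub X] unfolding unit_root_def by blast
  moreover have "d > 0 ==> X = (1 / d) *R (d *R X)" for d by simp
  note this[OF c(2)]
  ultimately show ?thesis by blast
 qed
qed

text \<open>For a unit root vector \<open>pi_rotation\<close> expresses Z^2 v by the rotated vector,
  and equivariance turns the rotation into the reflection of \<open>H\<close>. The general case
  follows by scaling.\<close>

lemma Hom_single:
 assumes P: "\<Phi> : HK" and v: "v : V_single G \<pi>" and r: "\<alpha> : R" and X: "X : rs \<alpha>" and H: "H : a"
 shows "\<Phi> (D (Zv X) (D (Zv X) v)) H = - of_real (ip X X * K (Hv \<alpha>) (Hv \<alpha>)) * (\<Phi> v H - \<Phi> v (root_refl G \<alpha> H))"
proof -
 let ?n = "K (Hv \<alpha>) (Hv \<alpha>)"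
 have unit: "\<Phi> (D (Zv X) (D (Zv X) v)) H = - 2 * (\<Phi> v H - \<Phi> v (root_refl G \<alpha> H))" if u: "unit_root \<alpha> X" for X
 proof -
  note Z = Zv_k[OF unit_rootD(4)[OF u]]
  obtain ga where o: "one_param G (Zv X) ga" using one_param_k[OF Z] by blast
  have "\<Phi> v (root_refl G \<alpha> H) = \<Phi> (\<pi> (ga (pi/2)) v) H"
   using HomD(4)[OF P one_param_K[OF o Z] a_s[OF H]] refl_NA(3)[OF u o H] by simp
  also have "\<dots> = \<Phi> v H + \<Phi> (D (Zv X) (D (Zv X) v)) H / 2"
   unfolding pi_rotation[OF u cub_all[OF v u] o] scaleR_vec_complex HomD(2,3)[OF P] by simp
  finally show ?thesis by simp
 qed
 obtain U c where u: "unit_root \<alpha> U" and X': "X = c *R U" using unit_root_scale[OF r X] by blast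
 note U = unit_rootD[OF u]
 have Z: "Zv X = c *R Zv U" unfolding X' using U(4) by (simp add: Zv_def th_props scaleR_add_right)
 have "D (Zv X) (D (Zv X) v) = of_real (c * c) *s D (Zv U) (D (Zv U) v)"
  unfolding Z scaleR_vec_complex[symmetric] using Zv_k[OF U(4)] by (simp add: D_scale1 D_scaleR)
 then have "\<Phi> (D (Zv X) (D (Zv X) v)) H = of_real (c * c) * (- 2 * (\<Phi> v H - \<Phi> v (root_refl G \<alpha> H)))"
  by (simp only: HomD(3)[OF P] unit[OF u])
 moreover have "ip X X * ?n = c * c * 2" unfolding X' using U(4,5,6) by (simp add: ip.B_scale ip.B_scale2)
 ultimately show ?thesis by (simp add: algebra_simps)
qed

text \<open>The identity \<open>Hom_D\<close>, differentiated along the line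
  \<open>H + t *R Wv X\<close>: the bracket of \<open>Zv X\<close> with this line has a constant
  part along \<open>Wv X\<close> and a part linear in \<open>t\<close> along
  \<open>Hv \<alpha>\<close>, and the latter yields the first order term.\<close>

lemma second_derivative:
 assumes P: "\<Phi> : HK" and al: "\<alpha> : R" and X: "X : rs \<alpha>" and H: "H : a" and ne: "\<alpha> H \<noteq> 0"
 shows "dir_deriv s (Wv X) (dir_deriv s (Wv X) (\<Phi> v)) H =
  of_real (1 / (\<alpha> H)\<^sup>2) * \<Phi> (D (Zv X) (D (Zv X) v)) H + of_real (2 * ip X X / \<alpha> H) * dir_deriv s (Hv \<alpha>) (\<Phi> v) H"
proof -
 note r = rootsD(1)[OF al] and XE = rsD(1)[OF X] and Hs = a_s[OF H]
 note Z = Zv_k[OF XE] and W = Wv_s[OF XE] and F = HomD(1)[OF P] and HvS = a_s[OF Hv(1)[OF r]]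
 let ?W = "Wv X" and ?F = "\<Phi> v" and ?G = "\<Phi> (D (Zv X) v)"
 have zH: "br (Zv X) H = (- \<alpha> H) *R ?W" using ZW(1)[OF r X H] by simp
 have G: "?G (H + t *R ?W) = of_real (\<alpha> H) * dir_deriv s ?W ?F (H + t *R ?W)
   - of_real t * (of_real (2 * ip X X) * dir_deriv s (Hv \<alpha>) ?F (H + t *R ?W))" for t
 proof -
  have x: "H + t *R ?W : s" by (intro subspace_add subspace_scale s_sub Hs W)
  have "br (Zv X) (H + t *R ?W) = (- \<alpha> H) *R ?W + (t * (2 * ip X X)) *R Hv \<alpha>"
   using ZW(2)[OF r X] zH k_E[OF Z] s_E[OF Hs] s_E[OF W] by (simp add: br_add2 br_scale2)
  moreover have "dir_deriv s ((- \<alpha> H) *R ?W + (t * (2 * ip X X)) *R Hv \<alpha>) ?F y =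
    of_real (- \<alpha> H) * dir_deriv s ?W ?F y + of_real (t * (2 * ip X X)) * dir_deriv s (Hv \<alpha>) ?F y" for y
   by (simp only: dir_deriv_vec(1)[OF s_sub F subspace_scale[OF s_sub W] subspace_scale[OF s_sub HvS]]
     dir_deriv_vec(2)[OF s_sub F W] dir_deriv_vec(2)[OF s_sub F HvS])
  ultimately show ?thesis unfolding Hom_D[OF P Z x] by (simp only:) (simp add: algebra_simps)
 qed
 have "dir_deriv s ?W ?G H = of_real (\<alpha> H) * dir_deriv s ?W (dir_deriv s ?W ?F) H - of_real (2 * ip X X) * dir_deriv s (Hv \<alpha>) ?F H"
 proof (rule dir_deriv_eqI[OF Hs])
  note d1 = C_inf_deriv[OF s_sub fs.dd_C[OF W F] W Hs] and d2 = C_inf_deriv[OF s_sub fs.dd_C[OF HvS F] W Hs]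
  have "(of_real hvd (1::complex)) (at (0::real))"
   by (rule has_vector_derivative_real_field) (auto intro!: derivative_eq_intros)
  from has_vector_derivative_diff[OF has_vector_derivative_mult_right[OF d1, of "of_real (\<alpha> H)"]
    has_vector_derivative_mult[OF this has_vector_derivative_mult_right[OF d2, of "of_real (2 * ip X X)"]]]
  show "((%t. ?G (H + t *R ?W)) hvd of_real (\<alpha> H) * dir_deriv s ?W (dir_deriv s ?W ?F) H
    - of_real (2 * ip X X) * dir_deriv s (Hv \<alpha>) ?F H) (at 0)"
   unfolding G by simp
 qed
 moreover have "\<Phi> (D (Zv X) (D (Zv X) v)) H = of_real (\<alpha> H) * dir_deriv s ?W ?G H"
  using Hom_D[OF P Z Hs, of "D (Zv X) v"] dir_deriv_vec(2)[OF s_sub HomD(1)[OF P] W, where c="- \<alpha> H"] unfolding zH by simp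
 ultimately show ?thesis using ne by (simp add: power2_eq_square field_simps)
qed

definition omega where "omega \<alpha> v = (\<Sum>X\<in>fb \<alpha>. D (Zv X) (D (Zv X) v))"

lemma Hom_sum: "\<Phi> : HK ==> \<Phi> (\<Sum>i\<in>I. v i) x = (\<Sum>i\<in>I. \<Phi> (v i) x)"
 using linear_sum[OF bounded_linear.linear[OF Hom_bl]] by blast

text \<open>Each vector of the frame contributes its squared norm to the first order term, and these
  add up to the multiplicity of the root.\<close>

theorem radial_part:
 assumes P: "\<Phi> : HK" and H: "H : a" and reg: "\<forall>\<alpha>\<in>P. \<alpha> H \<noteq> 0"
 shows "fs.Lap (\<Phi> v) H = fa.Lap (gamma0 G (\<Phi> v)) H +
  (\<Sum>\<alpha>\<in>P. of_real (dim (rs \<alpha>)) * (of_real (1 / \<alpha> H) * dir_deriv a (Hv \<alpha>) (gamma0 G (\<Phi> v)) H)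
    + of_real (1 / (2 * (\<alpha> H)\<^sup>2)) * \<Phi> (omega \<alpha> v) H)"
 unfolding Lap_split[OF HomD(1)[OF P] H]
proof (intro arg_cong2[where f="(+)"] refl sum.cong)
 fix \<alpha> assume al: "\<alpha> : P"
 note r = PD(1)[OF al]
 have ne: "\<alpha> H \<noteq> 0" using reg al by blast
 let ?c = "of_real (1 / (2 * (\<alpha> H)\<^sup>2)) :: complex" and ?d = "of_real (1 / \<alpha> H) * dir_deriv s (Hv \<alpha>) (\<Phi> v) H"
 have "(\<Sum>X\<in>fb \<alpha>. dir_deriv s (Wv X) (dir_deriv s (Wv X) (\<Phi> v)) H / 2) =
   (\<Sum>X\<in>fb \<alpha>. ?c * \<Phi> (D (Zv X) (D (Zv X) v)) H + of_real (ip X X) * ?d)"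
  by (intro sum.cong refl) (simp add: second_derivative[OF P r fb(2) H ne] field_simps)
 also have "\<dots> = ?c * \<Phi> (omega \<alpha> v) H + of_real (dim (rs \<alpha>)) * ?d"
  unfolding omega_def Hom_sum[OF P] sum.distrib sum_distrib_left[symmetric] sum_distrib_right[symmetric] of_real_sum[symmetric] fb(4) by simp
 also have "dir_deriv s (Hv \<alpha>) (\<Phi> v) H = dir_deriv a (Hv \<alpha>) (gamma0 G (\<Phi> v)) H"
  using gamma0_dd[OF HomD(1)[OF P] Hv(1)[OF rootsD(1)[OF r]]] gamma0_apply[OF H] by simp
 finally show "(\<Sum>X\<in>fb \<alpha>. dir_deriv s (Wv X) (dir_deriv s (Wv X) (\<Phi> v)) H / 2) =
   of_real (dim (rs \<alpha>)) * (of_real (1 / \<alpha> H) * dir_deriv a (Hv \<alpha>) (gamma0 G (\<Phi> v)) H) + ?c * \<Phi> (omega \<alpha> v) H"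
  by (simp only: add.commute)
qed

end

context iwa begin

lemma Hv_act: assumes g: "g : NA" and al: "\<alpha> : dual_aa G" shows "Hv (act g \<alpha>) = Ad G g (Hv \<alpha>)"
proof -
 note h = Hv[OF act_dual[OF g al]] and h0 = Hv[OF al]
 let ?d = "Hv (act g \<alpha>) - Ad G g (Hv \<alpha>)"
 have A: "Ad G g (Hv \<alpha>) : a" using NAD(2)[OF g h0(1)] .
 have d: "?d : a" using h(1) A by simp
 have "K (Ad G g (Hv \<alpha>)) ?d = K (Ad G g (Hv \<alpha>)) (Ad G g (Ad G (iv g) ?d))" using Ad_inv(2)[OF a_E[OF d]] by simp
 also have "\<dots> = act g \<alpha> ?d"
  using K_Ad[OF a_E[OF h0(1)] Ad_in[OF a_E[OF d]]] h0(2)[OF NAD(3)[OF g d]] d by (simp add: act_def ext0_def)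
 finally have "K ?d ?d = 0" using fa.B_diff(1)[OF h(1) A d] h(2)[OF d] by simp
 then show ?thesis using fa.B_pos[OF d] by fastforce
qed

lemma unit_root_Ad: assumes g: "g : NA" and u: "unit_root \<alpha> X" shows "unit_root (act g \<alpha>) (Ad G g X)"
proof -
 note U = unit_rootD[OF u]
 have "K (Hv (act g \<alpha>)) (Hv (act g \<alpha>)) = K (Hv \<alpha>) (Hv \<alpha>)"
  unfolding Hv_act[OF g U(2)] by (intro K_Ad a_E U)
 moreover have "Ad G g X : rs (act g \<alpha>)" using rs_Ad[OF g U(3)] by (simp add: act_def)
 ultimately show ?thesis
  unfolding unit_root_def using act_roots[OF g U(2)] U(1,6) ip_Ad[OF NAD(1)[OF g] U(4) U(4)] by simp
qed

end

section \<open>M-invariant vectors and their splitting into single and double vectors\<close>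

context kirr begin

lemma VMD: "v : VM G \<pi> ==> m : Mgrp G ==> \<pi> m v = v"
 by (simp add: VM_def)

lemma MK: "m : Mgrp G ==> m : Kgrp G"
 by (simp add: Mgrp_def)

lemma VM_sub: "vec.subspace (VM G \<pi>)"
 unfolding vec.subspace_def VM_def
 using pi_scale[OF MK, of _ 0 0] by (auto simp: MK pi_add pi_scale)

lemma VM_NA: assumes g: "g : NA" and v: "v : VM G \<pi>" shows "\<pi> g v : VM G \<pi>"
 unfolding VM_def
proof (rule CollectI, rule ballI)
 fix m assume m: "m : Mgrp G"
 note gK = NAD(1)[OF g]
 have "g \<cdot> (iv g \<cdot> m \<cdot> g) = m \<cdot> g" by (simp add: m_assoc[symmetric])
 then have "\<pi> m (\<pi> g v) = \<pi> g (\<pi> (iv g \<cdot> m \<cdot> g) v)"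
  using pi_mult[OF gK MK[OF NA_M[OF g m]]] pi_mult[OF MK[OF m] gK] by simp
 then show "\<pi> m (\<pi> g v) = \<pi> g v" using VMD[OF v NA_M[OF g m]] by simp
qed

end

context ktype begin

lemma M_one: "\<e> : Mgrp G" and M_mult: "m : Mgrp G ==> m' : Mgrp G ==> m \<cdot> m' : Mgrp G"
 and M_inv: "m : Mgrp G ==> iv m : Mgrp G"
proof -
 show "\<e> : Mgrp G" by (simp add: Mgrp_iff Kg_one Ad_one a_E)
 show "m \<cdot> m' : Mgrp G" if "m : Mgrp G" "m' : Mgrp G" using that by (simp add: Mgrp_iff Kg_mult Ad_mult a_E)
 show "iv m : Mgrp G" if "m : Mgrp G" using that Ad_inv(1)[OF a_E, of _ m] by (simp add: Mgrp_iff Kg_inv)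
qed

lemma cub_add: "X : E ==> cub X (u + v) = cub X u + cub X v"
 and cub_scale: "X : E ==> cub X (c *s v) = c *s cub X v"
 unfolding cub_def by (simp_all add: D_add D_scale Zv_k vec.scale_right_distrib mult.commute)

text \<open>An odd polynomial in a skew operator.\<close>

lemma cub_skew: assumes "X : E" shows "cub X v \<bullet> w = - (v \<bullet> cub X w)"
proof -
 note Z = Zv_k[OF assms]
 have four: "4 *s w = 4 *R w" for w :: "complex ^ 'n" by (simp add: scaleR_vec_complex)
 show ?thesis unfolding cub_def four by (simp add: D_skew Z D_add D_scaleR inner_add_left inner_add_right)
qed

lemma rvec_E: "\<alpha> : R ==> rvec G \<alpha> : E"
 using unit_rootD(4)[OF rvec] .

lemma V_singleD: "v : V_single G \<pi> ==> v : VM G \<pi>"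
 by (simp add: V_single_def)

lemma V_single_sub: "vec.subspace (V_single G \<pi>)"
proof -
 have "cub X 0 = 0" if "X : E" for X using cub_scale[OF that, of 0 0] by simp
 then show ?thesis
  using VM_sub unfolding vec.subspace_def V_single_def by (simp add: Zcubic_cub cub_add cub_scale rvec_E)
qed

text \<open>\<open>Ad\<close> carries the chosen root vectors to other unit root vectors, which is
  where \<open>cub_all\<close> enters.\<close>

lemma V_single_NA: assumes g: "g : NA" and v: "v : V_single G \<pi>" shows "\<pi> g v : V_single G \<pi>"
proof -
 note gK = NAD(1)[OF g]
 have "\<pi> g v : VM G \<pi>" by (rule VM_NA[OF g V_singleD[OF v]])
 moreover have "cub (rvec G \<alpha>) (\<pi> g v) = 0" if r: "\<alpha> : R" for \<alpha>
 proof -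
  let ?X = "Ad G (iv g) (rvec G \<alpha>)"
  have "cub ?X v = 0" by (rule cub_all[OF v unit_root_Ad[OF NA_inv[OF g] rvec[OF r]]])
  then have "\<pi> g (cub ?X v) = 0" using pi_scale[OF gK, of 0 0] by simp
  then show ?thesis using pi_cub[OF gK Ad_in[OF rvec_E[OF r]], of "iv g"] Ad_inv(2)[OF rvec_E[OF r]] by simp
 qed
 ultimately show ?thesis by (simp add: V_single_def Zcubic_cub)
qed

text \<open>By \<open>pi_rotation\<close>, Z^2 v is twice the difference of the image of v under an
  element of the normalizer and v itself, and \<open>V_single\<close> is stable under the
  normalizer.\<close>

lemma omega_single: assumes r: "\<alpha> : R" and v: "v : V_single G \<pi>" shows "omega \<alpha> v : V_single G \<pi>"
 unfolding omega_def
proof (rule vec.subspace_sum[OF V_single_sub])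
 fix X assume "X : fb \<alpha>"
 obtain U c where u: "unit_root \<alpha> U" and X: "X = c *R U" using unit_root_scale[OF r fb(2)[OF \<open>X : fb \<alpha>\<close>]] by blast
 note Z = Zv_k[OF unit_rootD(4)[OF u]]
 obtain ga where o: "one_param G (Zv U) ga" using one_param_k[OF Z] by blast
 have "D (Zv U) (D (Zv U) v) = 2 *s (\<pi> (ga (pi/2)) v - v)"
  unfolding pi_rotation[OF u cub_all[OF v u] o] vec_eq_iff by (simp add: scaleR_conv_of_real[where 'a=complex])
 then have "D (Zv U) (D (Zv U) v) : V_single G \<pi>"
  using V_single_NA[OF refl_NA(1)[OF u o] v] v V_single_sub by (simp add: vec.subspace_diff vec.subspace_scale)
 moreover have "Zv X = c *R Zv U" unfolding X using unit_rootD(4)[OF u] by (simp add: Zv_def th_props scaleR_add_right)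
 then have "D (Zv X) (D (Zv X) v) = of_real (c * c) *s D (Zv U) (D (Zv U) v)"
  unfolding scaleR_vec_complex[symmetric] using Z by (simp add: D_scale1 D_scaleR)
 ultimately show "D (Zv X) (D (Zv X) v) : V_single G \<pi>" using V_single_sub by (simp add: vec.subspace_scale)
qed

text \<open>The span in the definition of \<open>V_double\<close>, before it is intersected with the
  M-invariants.\<close>

definition NZ where "NZ = vec.span {\<pi> m (Zcubic G \<pi> \<alpha> v) |\<alpha> m v. \<alpha> : R \<and> m : Mgrp G}"

lemma V_double_NZ: "V_double G \<pi> = VM G \<pi> \<inter> NZ"
 by (simp add: V_double_def NZ_def)

lemma NZ_induct:
 assumes "vec.subspace U" "\<And>\<alpha> m v. \<alpha> : R ==> m : Mgrp G ==> \<pi> m (cub (rvec G \<alpha>) v) : U" and "n : NZ"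
 shows "n : U"
proof -
 have "NZ \<subseteq> U" unfolding NZ_def by (rule vec.span_minimal[OF _ assms(1)]) (use assms(2) in \<open>auto simp: Zcubic_cub\<close>)
 then show ?thesis using assms(3) by blast
qed

lemma NZ_base: "\<alpha> : R ==> m : Mgrp G ==> \<pi> m (cub (rvec G \<alpha>) v) : NZ"
 unfolding NZ_def Zcubic_cub[symmetric] by (rule vec.span_base) blast

lemma NZ_sub: "vec.subspace NZ"
 unfolding NZ_def by (rule vec.subspace_span)

lemma real_subspace: "vec.subspace U ==> subspace (U :: (complex ^ 'n) set)"
 by (auto simp: vec.subspace_def subspace_def scaleR_vec_complex)

text \<open>The cubic operators are skew and kill single vectors. The inner product is the real one,
  hence the conjugate when a complex factor is moved across.\<close>

lemma NZ_single: assumes n: "n : NZ" and u: "u : V_single G \<pi>" shows "n \<bullet> u = 0"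
proof -
 have cs: "(c *s n) \<bullet> u = n \<bullet> (cnj c *s u)" for c and n u :: "complex ^ 'n"
  by (simp add: inner_vec_def inner_complex_def algebra_simps)
 have "n : {n. \<forall>u\<in>V_single G \<pi>. n \<bullet> u = 0}"
 proof (rule NZ_induct[OF _ _ n])
  show "vec.subspace {n. \<forall>u\<in>V_single G \<pi>. n \<bullet> u = 0}"
   unfolding vec.subspace_def using vec.subspace_scale[OF V_single_sub] by (auto simp: inner_add_left cs)
  fix \<alpha> m v assume h: "\<alpha> : R" "m : Mgrp G"
  have "\<pi> m (cub (rvec G \<alpha>) v) \<bullet> u = 0" if u: "u : V_single G \<pi>" for u
  proof -
   have "\<pi> m (cub (rvec G \<alpha>) v) \<bullet> u = cub (rvec G \<alpha>) v \<bullet> u"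
    using pi_inner'[OF MK[OF h(2)]] VMD[OF V_singleD[OF u] M_inv[OF h(2)]] by simp
   also have "\<dots> = 0" using u h(1) by (simp add: cub_skew[OF rvec_E] V_single_def Zcubic_cub)
   finally show ?thesis .
  qed
  then show "\<pi> m (cub (rvec G \<alpha>) v) : {n. \<forall>u\<in>V_single G \<pi>. n \<bullet> u = 0}" by blast
 qed
 then show ?thesis using u by blast
qed

text \<open>Orthogonal projection to \<open>NZ\<close>, which is stable under M, so both parts of an
  M-invariant vector are M-invariant. For the part \<open>p\<close> orthogonal to \<open>NZ\<close>,
  the squared norm of its cubic expression is, by skewness, a product of \<open>p\<close> with an
  element of \<open>NZ\<close>, so \<open>p\<close> is single.\<close>

lemma VM_decomp: assumes v: "v : VM G \<pi>" shows "\<exists>p\<in>V_single G \<pi>. \<exists>n\<in>V_double G \<pi>. v = n + p"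
proof -
 have sp: "span NZ = NZ" using real_subspace[OF NZ_sub] by (simp add: span_eq_iff)
 obtain n p where np: "n : span NZ" "\<And>w. w : span NZ ==> orthogonal p w" "v = n + p"
  by (rule orthogonal_subspace_decomp_exists[of NZ v]) rule
 have inv: "\<pi> m w : NZ" if m: "m : Mgrp G" and w: "w : NZ" for m w
 proof -
  have "w : {w. \<pi> m w : NZ}"
  proof (rule NZ_induct[OF _ _ w])
   show "vec.subspace {w. \<pi> m w : NZ}"
    using NZ_sub pi_scale[OF MK[OF m], of 0 0] unfolding vec.subspace_def by (simp add: pi_add pi_scale MK[OF m])
   show "\<pi> m' (cub (rvec G \<alpha>) u) : {w. \<pi> m w : NZ}" if "\<alpha> : R" "m' : Mgrp G" for \<alpha> m' u
    using NZ_base[OF that(1) M_mult[OF m that(2)]] pi_mult[OF MK[OF m] MK[OF that(2)]] by simp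
  qed
  then show ?thesis by blast
 qed
 have fix_M: "\<pi> m n = n \<and> \<pi> m p = p" if m: "m : Mgrp G" for m
 proof (rule orthogonal_subspace_decomp_unique[where S=NZ and T="{x. \<forall>w\<in>NZ. orthogonal x w}", simplified sp])
  show "\<pi> m n + \<pi> m p = n + p" using VMD[OF v m] np(3) by (simp add: pi_add[OF MK[OF m], symmetric])
  have "subspace {x. \<forall>w\<in>NZ. orthogonal x w}" by (auto simp: subspace_def orthogonal_def inner_add_left)
  then have T: "span {x. \<forall>w\<in>NZ. orthogonal x w} = {x. \<forall>w\<in>NZ. orthogonal x w}" by (simp add: span_eq_iff)
  show "\<pi> m n : NZ" "n : NZ" using inv[OF m] np(1) unfolding sp by blast+
  show "p : span {x. \<forall>w\<in>NZ. orthogonal x w}" unfolding T using np(2) unfolding sp by blast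
  show "\<pi> m p : span {x. \<forall>w\<in>NZ. orthogonal x w}"
   unfolding T using np(2) inv[OF M_inv[OF m]] unfolding sp by (auto simp: orthogonal_def pi_inner'[OF MK[OF m]])
  show "orthogonal x w" if "x : NZ" "w : {x. \<forall>w\<in>NZ. orthogonal x w}" for x w
   using that by (auto simp: orthogonal_commute)
 qed
 have "cub (rvec G \<alpha>) p = 0" if r: "\<alpha> : R" for \<alpha>
 proof -
  let ?c = "cub (rvec G \<alpha>)"
  have "?c (?c p) : NZ" using NZ_base[OF r M_one] pi_one by simp
  then have "?c p \<bullet> ?c p = 0" using np(2) unfolding sp by (simp add: cub_skew[OF rvec_E[OF r]] orthogonal_def)
  then show ?thesis by simp
 qed
 then have "p : V_single G \<pi>" using fix_M by (simp add: V_single_def VM_def Zcubic_cub)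
 moreover have "n : V_double G \<pi>" using fix_M np(1) unfolding sp V_double_NZ by (simp add: VM_def)
 ultimately show ?thesis using np(3) by blast
qed

text \<open>Evaluation at a point of \<open>aa\<close> is represented by an M-invariant vector; it is single if the evaluation
 kills the double vectors.\<close>

lemma omega_double:
 assumes P: "\<Phi> : HK" and r: "\<alpha> : R" and H: "H : a" and z: "\<And>v. v : V_double G \<pi> ==> \<Phi> v H = 0" and v: "v : V_double G \<pi>"
 shows "\<Phi> (omega \<alpha> v) H = 0"
proof -
 have "f (\<Phi> (omega \<alpha> v) H) = 0" if f: "bounded_linear f" for f :: "complex => real"
 proof -
  define h where "h = adjoint (%v. f (\<Phi> v H)) 1"
  have "bounded_linear (%v. f (\<Phi> v H))" by (rule bounded_linear_compose[OF f Hom_bl[OF P]])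
  then have h: "u \<bullet> h = f (\<Phi> u H)" for u using adjoint_works[OF bounded_linear.linear, of "%v. f (\<Phi> v H)" u 1] by (simp add: h_def)
  have "\<pi> m h = h" if m: "m : Mgrp G" for m
  proof -
   have "u \<bullet> \<pi> m h = u \<bullet> h" for u
    using pi_inner'[OF MK[OF M_inv[OF m]], of u h] HomD(4)[OF P MK[OF M_inv[OF m]] a_s[OF H], of u] m H
    by (simp add: h Mgrp_iff)
   then show ?thesis using vector_eq_ldot by blast
  qed
  then have "h : VM G \<pi>" by (simp add: VM_def)
  from VM_decomp[OF this] obtain p n where d: "p : V_single G \<pi>" "n : V_double G \<pi>" "h = n + p" by blast
  \<comment> \<open>The evaluation represented by \<open>h\<close> kills double vectors, in
    particular the double part \<open>n\<close> of \<open>h\<close> itself; as \<open>n\<close> is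
    also orthogonal to \<open>p\<close>, it is 0.\<close>
  have "n \<bullet> h = 0" using h z[OF d(2)] linear_simps(3)[OF f] by simp
  then have "n \<bullet> n = 0" using NZ_single[OF _ d(1)] d(2,3) by (simp add: V_double_NZ inner_add_right)
  then have "h : V_single G \<pi>" using d by simp
  moreover have "omega \<alpha> v \<bullet> h = v \<bullet> omega \<alpha> h"
   unfolding omega_def inner_sum_left inner_sum_right by (intro sum.cong refl) (simp add: D_skew Zv_k fb_E)
  ultimately show ?thesis using NZ_single[OF _ omega_single[OF r], of v h] v h by (simp add: V_double_NZ)
 qed
 from this[OF bounded_linear_Re] this[OF bounded_linear_Im] show ?thesis by (simp add: complex_eq_iff)
qed

lemma regular_zero:
 assumes g: "g : C_inf a" and z: "\<And>H. H : a ==> \<forall>\<alpha>\<in>P. \<alpha> H \<noteq> 0 ==> g H = 0"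
 shows "g x = 0"
proof (rule fa.regular_dense[OF P_finite H0(1) _ _ g z])
 show "\<forall>\<alpha>\<in>P. \<alpha> H0 \<noteq> 0" using PD(2) by fastforce
 show "\<alpha> (x + t *R H0) = \<alpha> x + t * \<alpha> H0" if "\<alpha> : P" "x : a" for \<alpha> x t
  using dual_aa[OF rootsD(1)[OF PD(1)[OF that(1)]]] that(2) H0(1) subspace_scale[OF a_sub H0(1)] by simp
qed

text \<open>At regular points every term of the radial part vanishes, the root terms by
  \<open>omega_double\<close>; smoothness and density give the other points.\<close>

lemma Lap_double:
 assumes P: "\<Phi> : HK" and z: "\<And>v. v : V_double G \<pi> ==> gamma0 G (\<Phi> v) = (%_. 0)" and v: "v : V_double G \<pi>"
 shows "gamma0 G (fs.Lap (\<Phi> v)) = (%_. 0)"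
proof
 fix x
 have C: "gamma0 G (fs.Lap (\<Phi> v)) : C_inf a" by (rule gamma0_C[OF fs.Lap_C[OF HomD(1)[OF P]]])
 show "gamma0 G (fs.Lap (\<Phi> v)) x = 0"
 proof (rule regular_zero[OF C])
  fix H assume H: "H : a" "\<forall>\<alpha>\<in>P. \<alpha> H \<noteq> 0"
  have "\<Phi> (omega \<alpha> v) H = 0" if "\<alpha> : P" for \<alpha>
   by (rule omega_double[OF P PD(1)[OF that] H(1) _ v]) (use z gamma0_apply[OF H(1)] in metis)
  moreover have "dir_deriv a X (%_. 0) H = 0" for X by (rule dir_deriv_eqI[OF H(1)]) simp
  moreover have "fa.Lap (%_. 0) H = 0" using fa.Lap_scale[OF C_inf_zero, of 0] by simp
  ultimately show "gamma0 G (fs.Lap (\<Phi> v)) H = 0"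
   unfolding gamma0_apply[OF H(1)] radial_part[OF P H] z[OF v] by simp
 qed
qed

text \<open>At regular points both sides are explicit: \<open>Hom_single\<close> turns
  \<open>omega\<close> into the reflection differences of the Dunkl Laplacian, and
  \<open>dunkl_sum\<close> matches the weights.\<close>

lemma Lap_single:
 assumes P: "\<Phi> : HK" and v: "v : V_single G \<pi>"
 shows "gamma0 G (fs.Lap (\<Phi> v)) = du.LD (gamma0 G (\<Phi> v))"
proof
 fix x
 let ?g = "gamma0 G (\<Phi> v)"
 have g: "?g : C_inf a" by (rule gamma0_C[OF HomD(1)[OF P]])
 have C: "(%x. gamma0 G (fs.Lap (\<Phi> v)) x - du.LD ?g x) : C_inf a"
  by (intro C_inf_diff gamma0_C fs.Lap_C HomD(1)[OF P] du.LD_C g)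
 have "(%x. gamma0 G (fs.Lap (\<Phi> v)) x - du.LD ?g x) x = 0"
 proof (rule regular_zero[OF C])
  fix H assume H: "H : a" and reg: "\<forall>\<alpha>\<in>P. \<alpha> H \<noteq> 0"
  \<comment> \<open>Half of the root term in \<open>LD_formula\<close>, to be weighted by
    \<open>2 * m0\<close>; it is homogeneous of degree 0 in the root, as \<open>dunkl_sum\<close>
    requires.\<close>
  define T where "T \<alpha> = of_real (1 / \<alpha> H) * dir_deriv a (Hv \<alpha>) ?g H
   - of_real (K (Hv \<alpha>) (Hv \<alpha>) / (2 * (\<alpha> H)\<^sup>2)) * (?g H - ?g (root_refl G \<alpha> H))" for \<alpha>
  have om: "\<Phi> (omega \<alpha> v) H = - of_real (dim (rs \<alpha>) * K (Hv \<alpha>) (Hv \<alpha>)) * (?g H - ?g (root_refl G \<alpha> H))" if al: "\<alpha> : P" for \<alpha>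
  proof -
   have "\<Phi> (omega \<alpha> v) H = (\<Sum>X\<in>fb \<alpha>. of_real (ip X X) * (- of_real (K (Hv \<alpha>) (Hv \<alpha>)) * (?g H - ?g (root_refl G \<alpha> H))))"
    unfolding omega_def Hom_sum[OF P]
    by (intro sum.cong refl) (simp add: Hom_single[OF P v PD(1)[OF al] fb(2) H] gamma0_apply H root_refl_a PD(1)[OF al])
   then show ?thesis unfolding sum_distrib_right[symmetric] of_real_sum[symmetric] fb(4) by simp
  qed
  have T2: "T (hf 2 \<alpha>) = T \<alpha>" if al: "\<alpha> : P" for \<alpha>
  proof -
   note d = rootsD(1)[OF PD(1)[OF al]]
   have "Hv \<alpha> : a" by (rule Hv(1)[OF d])
   then show ?thesis unfolding T_def Hv_hf[OF d] root_refl_hf[OF d, of 2, simplified]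
    by (simp add: hf_def dir_deriv_vec(2)[OF a_sub g] fa.B_scale fa.B_scale2 power2_eq_square)
  qed
  have "fs.Lap (\<Phi> v) H = fa.Lap ?g H + (\<Sum>\<alpha>\<in>P. of_real (dim (rs \<alpha>)) * T \<alpha>)"
   unfolding radial_part[OF P H reg]
  proof (intro arg_cong2[where f="(+)"] refl sum.cong)
   fix \<alpha> assume al: "\<alpha> : P"
   show "of_real (dim (rs \<alpha>)) * (of_real (1 / \<alpha> H) * dir_deriv a (Hv \<alpha>) ?g H) + of_real (1 / (2 * (\<alpha> H)\<^sup>2)) * \<Phi> (omega \<alpha> v) H
     = of_real (dim (rs \<alpha>)) * T \<alpha>"
    unfolding om[OF al] T_def by (simp add: right_diff_distrib mult.assoc)
  qed
  also have "\<dots> = fa.Lap ?g H + (\<Sum>\<beta>\<in>R1_pos G. of_real (2 * m0 G \<beta>) * T \<beta>)"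
   using dunkl_sum[of T] T2 by simp
  also have "\<dots> = du.LD ?g H"
  proof -
   have "\<forall>\<beta>\<in>R1_pos G. \<beta> H \<noteq> 0" using reg PmD(1) unfolding R1_pos_eq by (auto simp: hf_def)
   moreover have "of_real (2 * m) * (of_real (1 / b) * X - of_real (c / (2 * b\<^sup>2)) * Y) =
     of_real m * (of_real (2 / b) * X - of_real (c / b\<^sup>2) * Y)" for m b c :: real and X Y :: complex
   proof -
    have "2 * m * (1 / b) = m * (2 / b)" "2 * m * (c / (2 * b\<^sup>2)) = m * (c / b\<^sup>2)" by simp_all
    then show ?thesis by (simp only: right_diff_distrib mult.assoc[symmetric] of_real_mult[symmetric])
   qed
   ultimately show ?thesis unfolding T_def by (simp only: du.LD_formula[OF g H] s_eq)
  qed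
  finally show "gamma0 G (fs.Lap (\<Phi> v)) H - du.LD ?g H = 0" using H by (simp add: gamma0_apply)
 qed
 then show "gamma0 G (fs.Lap (\<Phi> v)) x = du.LD ?g x" by simp
qed

end

section \<open>Equivariance\<close>

context dunkl_comm begin

lemma sp_LD: "isoA w ==> f : C_inf S ==> LD (sp w f) = sp w (LD f)"
 by (rule C_inf_eqI[OF LD_C[OF isoA_C] isoA_C[OF _ LD_C]]) (simp_all add: LD_equiv sp_apply)

lemma adp_equiv: "isoA w ==> p : C_inf S ==> f : C_inf S ==> dun.adp d (sp w p) (sp w f) = sp w (dun.adp d p f)"
proof (induction d arbitrary: f)
 case (Suc d)
 then show ?case
  by (simp add: sp_LD dun.adp_C LD_C) (auto simp: sp_def ext0_def)
qed (auto simp: sp_def ext0_def)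

text \<open>Pullback by a symmetry commutes with \<open>LD\<close> and with homogeneous components,
  hence with the iterated commutators.\<close>

lemma DD_equiv:
 assumes w: "isoA w" and p: "p : Pol S" and f: "f : C_inf S"
 shows "dun.DD (sp w p) (sp w f) = sp w (dun.DD p f)"
proof -
 obtain N where N: "dec p (cmp p) N" using cmp_dec[OF p] by metis
 have C: "cmp p d : C_inf S" for d using PH_C[OF cmp_PH[OF p]] .
 have "dec (sp w p) (%d. sp w (cmp p d)) N"
  unfolding sp_def by (rule dec_pullback[OF form_space_axioms form_space_axioms _ _ _ N]) (use isoA_simps[OF w] in auto)
 from dun.DD_dec[OF this isoA_C[OF w f]] show ?thesis
  unfolding dun.DD_dec[OF N f] dun.Dh_def adp_equiv[OF w C f] by (auto simp: sp_def ext0_def)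
qed

end

context iwa begin

text \<open>With the empty set of roots the Dunkl operators are the directional derivatives and
  \<open>LD\<close> is the Laplacian, so the general theory also covers \<open>diff_op\<close> and
  its equivariance under K.\<close>

sublocale tr: dunkl_comm s K "{}" "%_. 0" Hv
 by unfold_locales auto

lemma tr_LD: "tr.LD = fs.Lap"
 by (intro ext) (simp add: tr.LD_def fs.Lap_def tr.DU_def)

lemma tr_DU: "tr.DU = dir_deriv s"
 by (intro ext) (simp add: tr.DU_def)

lemma Ad_tr: assumes g: "g : Kgrp G" shows "tr.isoA (Ad G g)"
proof -
 have "x : Ad G g ` s" if "x : s" for x
  using Ad_s[OF Kg_inv[OF g] that] Ad_inv(2)[OF s_E[OF that], of g] by (metis imageI)
 then have "Ad G g ` s = s" using Ad_s[OF g] by blast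
 then show ?thesis unfolding tr.isoA_def by (simp add: Ad_add Ad_scale K_Ad s_E bij_betw_def)
qed

lemma diff_op_eq: "p : Pol s ==> f : C_inf s ==> diff_op G p f = tr.dun.DD p f"
 unfolding diff_op_def tr_DU[symmetric] by (rule tr.dun.sym_ext_eq)

lemma dunkl_eq: "p : Pol a ==> f : C_inf a ==> dunkl G p f = du.dun.DD p f"
 unfolding dunkl_def dunkl_vec_eq by (rule du.dun.sym_ext_eq)

lemma C_inf_KD: assumes "f : C_inf_K G" shows "f : C_inf s" "g : Kgrp G ==> x : s ==> f (Ad G g x) = f x"
  "g : Kgrp G ==> tr.sp (Ad G g) f = f"
 using assms C_inf_outside[of f s] by (auto simp: C_inf_K_def tr.sp_def ext0_def)

lemma Lap_C_inf_K: assumes f: "f : C_inf_K G" shows "fs.Lap f : C_inf_K G"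
 using tr.LD_equiv[OF Ad_tr C_inf_KD(1)[OF f]] C_inf_KD[OF f] fs.Lap_C by (simp add: C_inf_K_def tr_LD)

text \<open>An invariant function is an equivariant map from the trivial representation.\<close>

lemma Lap_invariant:
 assumes r: "root_vectors G" and f: "f : C_inf_K G"
 shows "gamma0 G (fs.Lap f) = du.LD (gamma0 G f)"
proof (cases "f = (%_. 0)")
 case True
 then show ?thesis
  using fs.Lap_scale[OF C_inf_zero, of 0] du.LD_scale[OF C_inf_zero, of 0] by (simp add: gamma0_def ext0_def)
next
 case False
 let ?\<pi> = "%_ v. v :: complex ^ 1" and ?\<Phi> = "%v x. (v :: complex ^ 1) $ 1 * f x"
 let ?v = "vec 1 :: complex ^ 1"
 have Phi: "?\<Phi> : Hom_K G ?\<pi> (C_inf s)"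
  unfolding Hom_K_def using C_inf_KD[OF f] by (auto intro!: C_inf_scale simp: distrib_right mult.assoc Kg_inv)
 have U: "U = {0} \<or> U = UNIV" if U: "vec.subspace U" for U :: "(complex ^ 1) set"
 proof (cases "U = {0}")
  case False
  then obtain u where u: "u : U" "u \<noteq> 0" using vec.subspace_0[OF U] by blast
  then have "u $ 1 \<noteq> 0" by (simp add: vec_eq_iff)
  then have "w = (w $ 1 / u $ 1) *s u" for w by (simp add: vec_eq_iff)
  then have "w : U" for w using vec.subspace_scale[OF U u(1), of "w $ 1 / u $ 1"] by simp
  then show ?thesis by blast
 qed simp
 have irr: "unitary_irrep G ?\<pi>"
  unfolding unitary_irrep_def
 proof (intro conjI ballI allI impI)
  show "U = {0} \<or> U = UNIV" if "vec.subspace U \<and> (\<forall>g\<in>Kgrp G. (%v. v) ` U \<subseteq> U)" for U :: "(complex ^ 1) set"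
   using U that by simp
 qed (simp_all add: Vector_Spaces.linear_iff vec.vector_space_axioms)
 obtain x where "f x \<noteq> 0" using False by blast
 then have "\<exists>v x. ?\<Phi> v x \<noteq> 0" by (intro exI[of _ ?v] exI[of _ x]) simp
 then have nz: "\<exists>\<Phi>\<in>Hom_K G ?\<pi> (C_inf s). \<exists>v x. \<Phi> v x \<noteq> 0" by (intro bexI[OF _ Phi])
 interpret kt: ktype G ?\<pi> by unfold_locales (rule irr r nz)+
 \<comment> \<open>The orbit maps of the trivial representation are constant, so every vector is
   single.\<close>
 have "dpi G ?\<pi> Z v = 0" for Z v by (simp add: dpi_def)
 then have "?v : V_single G ?\<pi>" by (simp add: V_single_def VM_def Zcubic_def Let_def)
 from kt.Lap_single[OF Phi this] show ?thesis by simp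
qed

lemma gamma0_Pol: "p : Pol s ==> gamma0 G p : Pol a"
 using cmp_pullback(2)[OF fs.form_space_axioms fa.form_space_axioms, of "%x. x" p] a_s by (auto simp: gamma0_def)

text \<open>An invariant \<open>f\<close> is its own pullback, so the equivariance of
  \<open>DD\<close> moves the group action from the polynomial to the result.\<close>

lemma diff_Hom_Hom_K:
 assumes P: "\<Phi> : Hom_K G \<pi> (Pol s)" and f: "f : C_inf_K G"
 shows "diff_Hom G \<Phi> f : Hom_K G \<pi> (C_inf s)"
proof -
 have pol: "\<Phi> v : Pol s" for v using P by (simp add: Hom_K_def)
 note fC = C_inf_KD(1)[OF f]
 have add: "\<Phi> (u + v) = (%x. \<Phi> u x + \<Phi> v x)" and sc: "\<Phi> (c *s v) = (%x. c * \<Phi> v x)" for u v c using P by (simp_all add: Hom_K_def)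
 have "tr.dun.DD (\<Phi> (\<pi> g v)) f x = tr.dun.DD (\<Phi> v) f (Ad G (iv g) x)" if g: "g : Kgrp G" and x: "x : s" for g v x
 proof -
  let ?w = "Ad G (iv g)"
  have "\<Phi> (\<pi> g v) = tr.sp ?w (\<Phi> v)"
  proof
   fix y show "\<Phi> (\<pi> g v) y = tr.sp ?w (\<Phi> v) y"
    using P g C_inf_outside[OF Pol_C_inf[OF s_sub pol]] by (cases "y : s") (simp_all add: Hom_K_def tr.sp_apply tr.sp_outside)
  qed
  then have "tr.dun.DD (\<Phi> (\<pi> g v)) f = tr.sp ?w (tr.dun.DD (\<Phi> v) f)"
   using tr.DD_equiv[OF Ad_tr[OF Kg_inv[OF g]] pol fC] C_inf_KD(3)[OF f Kg_inv[OF g]] by (simp add: tr_LD)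
  then show ?thesis by (simp add: tr.sp_apply x)
 qed
 then show ?thesis
  unfolding Hom_K_def diff_Hom_def
  using tr.dun.DD_add[OF pol pol fC, folded add] tr.dun.DD_scale[OF pol fC, folded sc]
  by (simp add: diff_op_eq pol fC tr.dun.DD_C)
qed

end

context kirr begin

text \<open>The restriction of \<open>f\<close> is invariant under the normalizer of
  \<open>aa\<close>, which acts by symmetries of the Dunkl operators.\<close>

lemma dunkl_Hom_Hom_W:
 assumes P: "\<Phi> : Hom_K G \<pi> (Pol s)" and f: "f : C_inf_K G"
 shows "dunkl_Hom G \<pi> (Gamma0 G \<pi> \<Phi>) (gamma0 G f) : Hom_W G \<pi> (C_inf a)"
proof -
 have pol: "gamma0 G (\<Phi> v) : Pol a" for v using P by (intro gamma0_Pol) (simp add: Hom_K_def)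
 have fC: "gamma0 G f : C_inf a" by (rule gamma0_C[OF C_inf_KD(1)[OF f]])
 have add: "gamma0 G (\<Phi> (u + v)) = (%x. gamma0 G (\<Phi> u) x + gamma0 G (\<Phi> v) x)" for u v
  using P by (auto simp: Hom_K_def gamma0_def ext0_def)
 have sc: "gamma0 G (\<Phi> (c *s v)) = (%x. c * gamma0 G (\<Phi> v) x)" for c v
  using P by (auto simp: Hom_K_def gamma0_def ext0_def)
 have eq: "du.dun.DD (gamma0 G (\<Phi> (\<pi> g v))) (gamma0 G f) x = du.dun.DD (gamma0 G (\<Phi> v)) (gamma0 G f) (Ad G (iv g) x)"
  if g: "g : NA" and x: "x : a" for g v x
 proof -
  let ?w = "Ad G (iv g)"
  note gi = NA_inv[OF g]
  have 1: "gamma0 G (\<Phi> (\<pi> g v)) = du0.sp ?w (gamma0 G (\<Phi> v))"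
   using P NAD(1)[OF g] NAD(2)[OF gi] a_s by (auto simp: Hom_K_def gamma0_def ext0_def du0.sp_def)
  have 2: "gamma0 G f = du0.sp ?w (gamma0 G f)"
   using C_inf_KD(2)[OF f NAD(1)[OF gi]] NAD(2)[OF gi] a_s by (auto simp: gamma0_def ext0_def du0.sp_def)
  have "du.dun.DD (gamma0 G (\<Phi> (\<pi> g v))) (gamma0 G f) = du0.sp ?w (du.dun.DD (gamma0 G (\<Phi> v)) (gamma0 G f))"
   unfolding 1 by (subst 2) (rule du.DD_equiv[OF Ad_isoA[OF gi] pol fC])
  then show ?thesis by (simp add: du0.sp_apply x)
 qed
 show ?thesis
  unfolding Hom_W_def dunkl_Hom_def Gamma0_def
  using vec.subspace_add[OF VM_sub] vec.subspace_scale[OF VM_sub] VM_NA weyl_NA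
   du.dun.DD_add[OF pol pol fC, folded add] du.dun.DD_scale[OF pol fC, folded sc]
  by (auto simp: dunkl_eq pol fC du.dun.DD_C eq)
qed

end

section \<open>Restriction of the iterated commutators and of the operators built from them\<close>

context ktype begin

lemma HK_Lap: assumes P: "\<Phi> : HK" shows "(%v. fs.Lap (\<Phi> v)) : HK"
proof -
 have "\<Phi> (u + v) = (%x. \<Phi> u x + \<Phi> v x)" "\<Phi> (c *s v) = (%x. c * \<Phi> v x)" for u v c
  using HomD(2,3)[OF P] by auto
 moreover have "fs.Lap (\<Phi> (\<pi> g v)) x = fs.Lap (\<Phi> v) (Ad G (iv g) x)" if g: "g : Kgrp G" and x: "x : s" for g v x
 proof -
  have "\<Phi> (\<pi> g v) = tr.sp (Ad G (iv g)) (\<Phi> v)"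
   by (rule C_inf_eqI[OF HomD(1)[OF P] tr.isoA_C[OF Ad_tr[OF Kg_inv[OF g]] HomD(1)[OF P]]])
    (simp add: HomD(4)[OF P g] tr.sp_apply)
  then show ?thesis using tr.LD_equiv[OF Ad_tr[OF Kg_inv[OF g]] HomD(1)[OF P] x] by (simp add: tr_LD)
 qed
 ultimately show ?thesis
  unfolding Hom_K_def by (simp add: fs.Lap_C fs.Lap_add fs.Lap_scale HomD(1)[OF P])
qed

text \<open>Multiplication by an invariant function and application of \<open>L\<close> preserve
  equivariance in \<open>v\<close>. So each commutator is again a map to which the statements about
  \<open>L\<close> apply.\<close>

lemma HK_adp: assumes P: "\<Phi> : HK" and f: "f : C_inf_K G" shows "(%v. tr.dun.adp d (\<Phi> v) f) : HK"
 using f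
proof (induction d arbitrary: f)
 case 0
 then show ?case using P unfolding Hom_K_def
  by (auto intro!: C_inf_mult C_inf_KD(1)[OF 0] simp: distrib_right mult.assoc C_inf_KD(2)[OF 0] Kg_inv)
next
 case (Suc d)
 from HK_Lap[OF Suc.IH[OF Suc.prems]] Suc.IH[OF Lap_C_inf_K[OF Suc.prems]]
 show ?case unfolding Hom_K_def tr.dun.adp.simps by (auto intro!: C_inf_diff simp: tr_LD algebra_simps)
qed

text \<open>Of the two Laplacians in a commutator, the outer one is restricted by
  \<open>Lap_single\<close> and the inner one, which acts on \<open>f\<close>, by
  \<open>Lap_invariant\<close>.\<close>

lemma gamma0_adp:
 assumes P: "\<Phi> : HK" and v: "v : V_single G \<pi>" and f: "f : C_inf_K G"
 shows "gamma0 G (tr.dun.adp d (\<Phi> v) f) = du.dun.adp d (gamma0 G (\<Phi> v)) (gamma0 G f)"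
 using f
proof (induction d arbitrary: f)
 case (Suc d)
 have "gamma0 G (fs.Lap (tr.dun.adp d (\<Phi> v) f)) = du.LD (du.dun.adp d (gamma0 G (\<Phi> v)) (gamma0 G f))"
  using Lap_single[OF HK_adp[OF P Suc.prems] v] Suc.IH[OF Suc.prems] by simp
 moreover have "gamma0 G (tr.dun.adp d (\<Phi> v) (fs.Lap f)) = du.dun.adp d (gamma0 G (\<Phi> v)) (du.LD (gamma0 G f))"
  using Suc.IH[OF Lap_C_inf_K[OF Suc.prems]] Lap_invariant[OF rvecs Suc.prems] by simp
 moreover have "gamma0 G (%x. p x - q x) = (%x. gamma0 G p x - gamma0 G q x)" for p q by (auto simp: gamma0_def ext0_def)
 ultimately show ?case by (simp only: tr.dun.adp.simps) (simp add: tr_LD)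
qed (auto simp: gamma0_def ext0_def)

lemma gamma0_adp_double:
 assumes P: "\<Phi> : HK" and z: "\<And>v. v : V_double G \<pi> ==> gamma0 G (\<Phi> v) = (%_. 0)"
  and f: "f : C_inf_K G" and v: "v : V_double G \<pi>"
 shows "gamma0 G (tr.dun.adp d (\<Phi> v) f) = (%_. 0)"
 using f v
proof (induction d arbitrary: f v)
 case 0
 have "gamma0 G (tr.dun.adp 0 (\<Phi> v) f) x = gamma0 G (\<Phi> v) x * f x" for x by (auto simp: gamma0_def ext0_def)
 then show ?case using z[OF 0(2)] by auto
next
 case (Suc d)
 have "gamma0 G (fs.Lap (tr.dun.adp d (\<Phi> v) f)) = (%_. 0)"
  by (rule Lap_double[OF HK_adp[OF P Suc.prems(1)] Suc.IH[OF Suc.prems(1)] Suc.prems(2)])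
 moreover have "gamma0 G (tr.dun.adp d (\<Phi> v) (fs.Lap f)) = (%_. 0)" by (rule Suc.IH[OF Lap_C_inf_K[OF Suc.prems(1)] Suc.prems(2)])
 moreover have "gamma0 G (%x. p x - q x) = (%x. gamma0 G p x - gamma0 G q x)" for p q by (auto simp: gamma0_def ext0_def)
 ultimately show ?case by (simp only: tr.dun.adp.simps) (simp add: tr_LD)
qed

context
 fixes \<Phi> f assumes P: "\<Phi> : Hom_K G \<pi> (Pol s)" and f: "f : C_inf_K G"
begin

lemma pol: "\<Phi> v : Pol s"
 using P by (simp add: Hom_K_def)

text \<open>Taking homogeneous components commutes with linear substitutions of the
  variable.\<close>

lemma HK_cmp: "(%v. fs.cmp (\<Phi> v) d) : HK"
proof -
 have C: "fs.cmp (\<Phi> v) d : C_inf s" for v by (rule fs.PH_C[OF fs.cmp_PH[OF pol]])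
 have "fs.cmp (\<Phi> (\<pi> g v)) d x = fs.cmp (\<Phi> v) d (Ad G (iv g) x)" if g: "g : Kgrp G" and x: "x : s" for g v x
 proof -
  let ?w = "Ad G (iv g)"
  have "\<Phi> (\<pi> g v) y = ext0 s (%x. \<Phi> v (?w x)) y" for y
   using P g C_inf_outside[OF Pol_C_inf[OF s_sub pol]] by (cases "y : s") (simp_all add: Hom_K_def ext0_def)
  then have e: "\<Phi> (\<pi> g v) = ext0 s (%x. \<Phi> v (?w x))" by blast
  have "fs.cmp (ext0 s (%x. \<Phi> v (?w x))) d = ext0 s (%x. fs.cmp (\<Phi> v) d (?w x))"
   by (rule cmp_pullback(1)[OF fs.form_space_axioms fs.form_space_axioms])
    (auto simp: Ad_s Kg_inv g Ad_add Ad_scale s_E pol)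
  then show ?thesis unfolding e using x by (simp add: ext0_def)
 qed
 moreover have "\<Phi> (u + v) = (%x. \<Phi> u x + \<Phi> v x)" "\<Phi> (c *s v) = (%x. c * \<Phi> v x)" for u v c
  using P by (simp_all add: Hom_K_def)
 ultimately show ?thesis unfolding Hom_K_def by (simp add: C fs.cmp_add fs.cmp_scale pol)
qed

lemma gamma0_dec: "fs.dec p q N ==> fa.dec (gamma0 G p) (%d. gamma0 G (q d)) N"
 using dec_pullback[OF fs.form_space_axioms fa.form_space_axioms, of "%x. x" p q N] a_s by (auto simp: gamma0_def)

lemma diff_op_dec: "\<exists>N. fs.dec (\<Phi> v) (fs.cmp (\<Phi> v)) N \<and>
  gamma0 G (diff_op G (\<Phi> v) f) = (%x. \<Sum>d\<le>N. gamma0 G (tr.dun.adp d (fs.cmp (\<Phi> v) d) f) x / (2 ^ d * fact d))"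
proof -
 obtain N where N: "fs.dec (\<Phi> v) (fs.cmp (\<Phi> v)) N" using fs.cmp_dec[OF pol] by metis
 then show ?thesis
  unfolding diff_op_eq[OF pol C_inf_KD(1)[OF f]] using tr.dun.DD_dec[OF N C_inf_KD(1)[OF f]]
  by (intro exI[of _ N]) (auto simp: tr.dun.Dh_def gamma0_def ext0_def)
qed

lemma diff_op_single:
 assumes v: "v : V_single G \<pi>"
 shows "gamma0 G (diff_op G (\<Phi> v) f) = dunkl G (gamma0 G (\<Phi> v)) (gamma0 G f)"
proof -
 obtain N where N: "fs.dec (\<Phi> v) (fs.cmp (\<Phi> v)) N" and
  e: "gamma0 G (diff_op G (\<Phi> v) f) = (%x. \<Sum>d\<le>N. gamma0 G (tr.dun.adp d (fs.cmp (\<Phi> v) d) f) x / (2 ^ d * fact d))"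
  using diff_op_dec by blast
 show ?thesis
  unfolding e gamma0_adp[OF HK_cmp v f] dunkl_eq[OF gamma0_Pol[OF pol] gamma0_C[OF C_inf_KD(1)[OF f]]]
   du.dun.DD_dec[OF gamma0_dec[OF N] gamma0_C[OF C_inf_KD(1)[OF f]]] du.dun.Dh_def ..
qed

lemma diff_op_double:
 assumes z: "\<And>v. v : V_double G \<pi> ==> gamma0 G (\<Phi> v) = (%_. 0)" and v: "v : V_double G \<pi>"
 shows "gamma0 G (diff_op G (\<Phi> v) f) = (%_. 0)"
proof -
 have c: "gamma0 G (fs.cmp (\<Phi> v) d) = (%_. 0)" if v: "v : V_double G \<pi>" for v d
 proof -
  have "fa.cmp (gamma0 G (\<Phi> v)) d = gamma0 G (fs.cmp (\<Phi> v) d)"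
   using cmp_pullback(1)[OF fs.form_space_axioms fa.form_space_axioms, of "%x. x" "\<Phi> v" d] a_s pol by (auto simp: gamma0_def)
  \<comment> \<open>The restriction of \<open>\<Phi> v\<close> is zero, and multiplication by 0
    shows that the zero polynomial has zero components.\<close>
  moreover have "fa.cmp (%x. 0 * gamma0 G (\<Phi> v) x) d = (%x. 0 * fa.cmp (gamma0 G (\<Phi> v)) d x)"
   by (rule fa.cmp_scale[OF gamma0_Pol[OF pol]])
  ultimately show ?thesis using z[OF v] by simp
 qed
 show ?thesis using diff_op_dec[of v] gamma0_adp_double[OF HK_cmp c f v] by (elim exE conjE) simp
qed

text \<open>Only the single part of \<open>v\<close> contributes: on the double part both the
  restriction of \<open>\<Phi>\<close> and that of the result vanish.\<close>

lemma diff_op_VM: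
 assumes z: "\<And>v. v : V_double G \<pi> ==> gamma0 G (\<Phi> v) = (%_. 0)" and v: "v : VM G \<pi>"
 shows "gamma0 G (diff_op G (\<Phi> v) f) = dunkl G (gamma0 G (\<Phi> v)) (gamma0 G f)"
proof -
 obtain p n where d: "p : V_single G \<pi>" "n : V_double G \<pi>" "v = n + p" using VM_decomp[OF v] by blast
 have add: "\<Phi> v = (%x. \<Phi> n x + \<Phi> p x)" using P d(3) by (simp add: Hom_K_def)
 have "diff_op G (\<Phi> v) f = (%x. diff_op G (\<Phi> n) f x + diff_op G (\<Phi> p) f x)"
  using diff_Hom_Hom_K[OF P f] d(3) by (simp add: Hom_K_def diff_Hom_def)
 then have "gamma0 G (diff_op G (\<Phi> v) f) = (%x. gamma0 G (diff_op G (\<Phi> n) f) x + gamma0 G (diff_op G (\<Phi> p) f) x)"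
  by (auto simp: gamma0_def ext0_def)
 also have "\<dots> = dunkl G (gamma0 G (\<Phi> p)) (gamma0 G f)"
  by (simp add: diff_op_double[OF z d(2)] diff_op_single[OF d(1)])
 also have "gamma0 G (\<Phi> p) = gamma0 G (\<Phi> v)"
 proof
  fix x show "gamma0 G (\<Phi> p) x = gamma0 G (\<Phi> v) x"
   using fun_cong[OF z[OF d(2)], of x] unfolding add by (cases "x : a") (simp_all add: gamma0_apply gamma0_outside)
 qed
 finally show ?thesis .
qed

end

end

theorem theorem3p5:
  fixes G :: "('a::{t2_space,second_countable_topology}, 'v::euclidean_space) iwasawa_group"
    and \<pi> :: "'a \<Rightarrow> complex ^ 'n::finite \<Rightarrow> complex ^ 'n"
    and \<Phi> :: "complex ^ 'n \<Rightarrow> 'v \<Rightarrow> complex"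
    and f :: "'v \<Rightarrow> complex"
  assumes "is_lie_group G"
    and "semisimple G"
    and "iwasawa G"
    and "root_vectors G"
    and "Ad_inner G"
    and "compact (Kgrp G)"
    and "K_M_type G \<pi>"
    and "\<Phi> \<in> Hom_K G \<pi> (Pol (ss G))"
    and "f \<in> C_inf_K G"
  shows "(diff_Hom G \<Phi> f \<in> Hom_K G \<pi> (C_inf (ss G)) \<and>
         dunkl_Hom G \<pi> (Gamma0 G \<pi> \<Phi>) (gamma0 G f) \<in> Hom_W G \<pi> (C_inf (aa G)) \<and>
         (\<forall>v\<in>V_single G \<pi>.
            Gamma0 G \<pi> (diff_Hom G \<Phi> f) v = dunkl_Hom G \<pi> (Gamma0 G \<pi> \<Phi>) (gamma0 G f) v)) \<and>
         (\<Phi> \<in> Hom_K_22 G \<pi> (Pol (ss G)) \<longrightarrow>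
         diff_Hom G \<Phi> f \<in> Hom_K_22 G \<pi> (C_inf (ss G)) \<and>
         Gamma0 G \<pi> (diff_Hom G \<Phi> f) = dunkl_Hom G \<pi> (Gamma0 G \<pi> \<Phi>) (gamma0 G f)) \<and>
         (single_petaled G \<pi> \<longrightarrow>
         Gamma0 G \<pi> (diff_Hom G \<Phi> f) = dunkl_Hom G \<pi> (Gamma0 G \<pi> \<Phi>) (gamma0 G f))"
proof -
 interpret kirr G \<pi> by unfold_locales (use assms in \<open>simp_all add: K_M_type_def\<close>)
 note P = assms(8) and f = assms(9)
 let ?D = "diff_Hom G \<Phi> f" and ?W = "dunkl_Hom G \<pi> (Gamma0 G \<pi> \<Phi>) (gamma0 G f)"
 have D: "?D : Hom_K G \<pi> (C_inf s)" by (rule diff_Hom_Hom_K[OF P f])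
 have W: "?W : Hom_W G \<pi> (C_inf a)" by (rule dunkl_Hom_Hom_W[OF P f])
 have Gd: "Gamma0 G \<pi> ?D v = gamma0 G (diff_op G (\<Phi> v) f)" "?W v = dunkl G (gamma0 G (\<Phi> v)) (gamma0 G f)"
  "Gamma0 G \<pi> \<Phi> v = gamma0 G (\<Phi> v)" if "v : VM G \<pi>" for v
  using that by (simp_all add: Gamma0_def diff_Hom_def dunkl_Hom_def)
 have eqI: "Gamma0 G \<pi> ?D = ?W"
  if "\<And>v. v : VM G \<pi> ==> gamma0 G (diff_op G (\<Phi> v) f) = dunkl G (gamma0 G (\<Phi> v)) (gamma0 G f)"
  using that by (auto simp: Gamma0_def diff_Hom_def dunkl_Hom_def)
 have VMD: "v : V_single G \<pi> ==> v : VM G \<pi>" "v : V_double G \<pi> ==> v : VM G \<pi>" for v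
  by (simp_all add: V_single_def V_double_def)
 show ?thesis
 \<comment> \<open>If \<Phi> vanishes, no equivariant embedding is at hand, but both sides are 0 by
   linearity. Otherwise \<Phi> itself provides the embedding that \<open>ktype\<close> asks
   for.\<close>
 proof (cases "\<forall>v. \<Phi> v = (%_. 0)")
  case True
  have z: "gamma0 G (diff_op G (\<Phi> v) f) = (%_. 0)" for v
  proof -
   have "?D (0 *s v) = (%x. 0 * ?D v x)" using D unfolding Hom_K_def by blast
   then show ?thesis using True by (simp add: diff_Hom_def gamma0_def ext0_def)
  qed
  have "dunkl G (gamma0 G (\<Phi> v)) (gamma0 G f) = (%_. 0)" if v: "v : VM G \<pi>" for v
  proof -
   have "?W (0 *s v) = (%x. 0 * ?W v x)" using W v unfolding Hom_W_def by blast
   moreover have "0 *s v : VM G \<pi>" by (rule vec.subspace_scale[OF VM_sub v])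
   ultimately show ?thesis using True Gd(2)[OF \<open>0 *s v : VM G \<pi>\<close>] by simp
  qed
  then have e: "Gamma0 G \<pi> ?D = ?W" using z by (intro eqI) simp
  moreover have "?D : Hom_K_22 G \<pi> (C_inf s)" using D Gd(1) VMD(2) z by (simp add: Hom_K_22_def)
  ultimately show ?thesis using D W by simp
 next
  case False
  then have "\<exists>v x. \<Phi> v x \<noteq> 0" by auto
  moreover have "\<Phi> : Hom_K G \<pi> (C_inf s)" using P Pol_C_inf[OF s_sub] by (auto simp: Hom_K_def)
  ultimately have nz: "\<exists>\<Phi>\<in>Hom_K G \<pi> (C_inf s). \<exists>v x. \<Phi> v x \<noteq> 0" by (intro bexI)
  interpret ktype G \<pi> by unfold_locales (rule assms(4) nz)+
  have "Gamma0 G \<pi> ?D v = ?W v" if "v : V_single G \<pi>" for v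
   using Gd[OF VMD(1)[OF that]] diff_op_single[OF P f that] by simp
  moreover have "?D : Hom_K_22 G \<pi> (C_inf s) \<and> Gamma0 G \<pi> ?D = ?W" if "\<Phi> : Hom_K_22 G \<pi> (Pol s)"
  proof -
   have z: "gamma0 G (\<Phi> v) = (%_. 0)" if "v : V_double G \<pi>" for v
    using \<open>\<Phi> : Hom_K_22 G \<pi> (Pol s)\<close> Gd(3)[OF VMD(2)[OF that]] that by (simp add: Hom_K_22_def)
   have "?D : Hom_K_22 G \<pi> (C_inf s)"
    using D Gd(1)[OF VMD(2)] diff_op_double[OF P f z] by (simp add: Hom_K_22_def)
   moreover have "Gamma0 G \<pi> ?D = ?W" by (rule eqI) (rule diff_op_VM[OF P f z])
   ultimately show ?thesis by blast
  qed
  moreover have "Gamma0 G \<pi> ?D = ?W" if "single_petaled G \<pi>"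
   using that by (intro eqI diff_op_single[OF P f]) (simp add: single_petaled_def)
  ultimately show ?thesis using D W by blast
 qed
qed

end
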